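(* Fix $R=1$, $Q=343$, $\alpha_1=0.32$, $\alpha_2=0.62$, $A=202$, $B=1.9$, $C=3.04$, $\rho=0.3$, $a=1.05$, $b=1.75$, $T_{cS}=T^+_{cN}=-10$, and let $\mathbf X_\pm$, $S_\pm$, $\Sigma$, $P^s_\pm$, $R_\pm$ and $W(P^s_\pm)$ be as defined in the context. Choose $T^-_{cN}>T^+_{cN}$ and $b_-<b<b_+$ (with $b_->0$) so that for every $\epsilon>0$: (i) $P^s_-\in W(P^s_+)$ and $P^s_+\in W(P^s_-)$; and (ii) $R_+,R_-\in W(P^s_-)\cap W(P^s_+)$. Then for all sufficiently small $\epsilon>0$ the differential inclusion $$\dot{\mathbf v}\in \mathbf X(\mathbf v)=\begin{cases}\{\mathbf X_-(\mathbf v)\}, & \mathbf v\in S_-,\\ \{(1-p)\mathbf X_-(\mathbf v)+p\,\mathbf X_+(\mathbf v): p\in[0,1]\}, & \mathbf v\in\Sigma,\\ \{\mathbf X_+(\mathbf v)\}, & \mathbf v\in S_+,\end{cases}$$ with solutions understood in the sense of Filippov, admits a unique attracting limit cycle.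
   Context: **State space.** $\mathcal B=\{(w,\eta_S,\eta_N,\xi_N): w\in\mathbb R,\ \eta_S,\eta_N,\xi_N\in[-1,1],\ \eta_S\le\eta_N\}$ and $\mathcal B'=\{(w,\eta_S,\eta_N): w\in\mathbb R,\ \eta_S,\eta_N\in[-1,1],\ \eta_S\le\eta_N\}$. Dynamics on the boundary of $\mathcal B$ are not considered: all statements pertain to an invariant subset of $\mathcal B$ in which $-1<\eta_S<\eta_N<1$. **Functions.** Put $\alpha_0=\tfrac12(\alpha_1+\alpha_2)$ and $L=Q/(B+C)$. Let $p_2(y)=\tfrac12(3y^2-1)$ and $s(y)=s_0+s_2\,p_2(y)$, where $s_0=1$ and $s_2=-\tfrac58\,p_2(\cos\beta)$ with $\beta=23.5^\circ$. Define $$F(\eta_S,\eta_N)=\frac1B\Big(Qs_0(1-\alpha_0)-A+\tfrac12 C L s_0(\alpha_1-\alpha_2)\Big(1-\int_{\eta_S}^{\eta_N}s(y)\,dy\Big)\Big),$$ $$G(\eta_S)=-L(1-\alpha_0)(s(\eta_S)-1)+T_{cS},\qquad H_\pm(\eta_N)=-L(1-\alpha_0)(s(\eta_N)-1)+T^{\pm}_{cN}.$$ **Vector fields.** For $\epsilon>0$, $\mathbf X_+$ and $\mathbf X_-$ are the vector fields, in the variables $\mathbf v=(w,\eta_S,\eta_N,\xi_N)$, of the systems (with the sign $+$, respectively $-$, chosen throughout) $$\dot w=-\tfrac BR\,(w-F(\eta_S,\eta_N)),\quad \dot\eta_S=-\rho\,(w-G(\eta_S)),\quad \dot\eta_N=\rho\,(w-H_\pm(\eta_N)),\quad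 \dot\xi_N=\epsilon\big(b_\pm(\eta_N-\xi_N)-a(1-\eta_N)\big).$$ Their flows (of the smooth fields, ignoring $\Sigma$) are $\phi_\pm(\mathbf v,t)$. The first three equations do not involve $\xi_N$; they define three-dimensional vector fields $\mathbf Y_\pm$ on $\mathcal B'$. **Switching manifold.** Let $h(w,\eta_S,\eta_N,\xi_N)=b(\eta_N-\xi_N)-a(1-\eta_N)$ on $\mathcal B$, and $$\Sigma=\{h=0\}=\{\xi_N=\gamma(\eta_N)\},\quad \gamma(\eta_N)=(1+\tfrac ab)\eta_N-\tfrac ab,\qquad S_+=\{h>0\},\qquad S_-=\{h<0\}.$$ **Equilibria.** $\mathbf Y_+$ has exactly two equilibria in $\mathcal B'$: a saddle and a stable node $Q^s_+=(w^s_+,(\eta_S)^s_+,(\eta_N)^s_+)\approx(5.188,-0.955,0.955)$. The value $T^-_{cN}>T^+_{cN}$ is taken close enough to $T^+_{cN}$ that $\mathbf Y_-$ likewise has in the interior of $\mathcal B'$ a saddle and a stable node $Q^s_-=(w^s_-,(\eta_S)^s_-,(\eta_N)^s_-)$, where $Q^s_-$ is the equilibrium of $\mathbf Y_-$ that continues $Q^s_+$ (i.e. $Q^s_-\to Q^s_+$ as $T^-_{cN}\searrow T^+_{cN}$). Set $$P^s_\pm=\Big(w^s_\pm,(\eta_S)^s_\pm,(\eta_N)^s_\pm,\big(1+\tfrac{a}{b_\pm}\big)(\eta_N)^s_\pm-\tfrac{a}{b_\pm}\Big),$$ $$R_\pm=\big(w^s_\pm,(\eta_S)^s_\pm,(\eta_N)^s_\pm,\gamma((\eta_N)^s_\pm)\big)\in\Sigma.$$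 $P^s_\pm$ is a stable node of $\mathbf X_\pm$ for every $\epsilon>0$. $W(P^s_+)$ denotes the stable set of $P^s_+$ under $\phi_+$, i.e. the set of $\mathbf v\in\mathcal B$ with $\phi_+(\mathbf v,t)\to P^s_+$ as $t\to\infty$; $W(P^s_-)$ denotes the stable set of $P^s_-$ under $\phi_-$, defined analogously. **Solutions and limit cycles.** A solution of the inclusion in the sense of Filippov is an absolutely continuous function $\mathbf v(t)$ with $\dot{\mathbf v}(t)\in\mathbf X(\mathbf v(t))$ for almost every $t$. An attracting limit cycle is the orbit of a nonconstant periodic Filippov solution (possibly nonsmooth where it meets $\Sigma$) to which solutions starting nearby converge as $t\to\infty$. *)

theory Defs
  imports "HOL-Analysis.Analysis"
begin

section \<open>Absolutely continuous curves and differential inclusions\<close>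

definition abs_cont_on :: "real set \<Rightarrow> (real \<Rightarrow> 'a::real_normed_vector) \<Rightarrow> bool" where
  "abs_cont_on J x \<longleftrightarrow>
     (\<forall>e>0. \<exists>d>0. \<forall>\<D> S. \<D> division_of S \<and> S \<subseteq> J \<and> (\<Sum>k\<in>\<D>. measure lborel k) < d
        \<longrightarrow> (\<Sum>k\<in>\<D>. norm (x (Sup k) - x (Inf k))) < e)"

text \<open>
  Only compact subintervals of \<open>J\<close> are required to carry absolute continuity, as usual for
  solutions on unbounded intervals. Almost every point of an interval \<open>J\<close> is an interior point,
  so the two-sided derivative is the right one.
\<close>

definition filippov_solution ::
  "('a::real_normed_vector \<Rightarrow> 'a set) \<Rightarrow> 'a set \<Rightarrow> real set \<Rightarrow> (real \<Rightarrow> 'a) \<Rightarrow> bool" where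
  "filippov_solution X D J x \<longleftrightarrow>
     (\<forall>t\<in>J. x t \<in> D) \<and>
     (\<forall>a b. {a..b} \<subseteq> J \<longrightarrow> abs_cont_on {a..b} x) \<and>
     (AE t in lebesgue. t \<in> J \<longrightarrow> (\<exists>y\<in>X (x t). (x has_vector_derivative y) (at t)))"

text \<open>
  Solutions of an inclusion need not be unique. Every solution starting near \<open>\<Gamma>\<close>, on whatever
  interval \<open>J\<close> it is given, has to extend within the phase space to all of \<open>[0, \<infinity>)\<close> and converge
  to \<open>\<Gamma>\<close>. The case \<open>J = {0}\<close> gives existence for every nearby initial point, and the case
  \<open>J = [0, \<infinity>)\<close> gives convergence of every global solution.
\<close>

definition attracts ::
  "('a::real_normed_vector \<Rightarrow> 'a set) \<Rightarrow> 'a set \<Rightarrow> 'a set \<Rightarrow> bool" where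
  "attracts X D \<Gamma> \<longleftrightarrow>
     (\<exists>U. open U \<and> \<Gamma> \<subseteq> U \<and>
       (\<forall>J x. is_interval J \<and> 0 \<in> J \<and> J \<subseteq> {0..} \<and> filippov_solution X D J x \<and> x 0 \<in> U \<longrightarrow>
          (\<exists>y. filippov_solution X D {0..} y \<and> (\<forall>t\<in>J. y t = x t) \<and>
               ((\<lambda>t. infdist (y t) \<Gamma>) \<longlongrightarrow> 0) at_top)))"

definition attracting_limit_cycle ::
  "('a::real_normed_vector \<Rightarrow> 'a set) \<Rightarrow> 'a set \<Rightarrow> 'a set \<Rightarrow> bool" where
  "attracting_limit_cycle X D \<Gamma> \<longleftrightarrow>
     (\<exists>x. filippov_solution X D UNIV x \<and> (\<exists>T>0. \<forall>t. x (t + T) = x t) \<and>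
          (\<exists>t. x t \<noteq> x 0) \<and> \<Gamma> = range x) \<and>
     attracts X D \<Gamma>"


section \<open>Stable sets and equilibria of vector fields\<close>

text \<open>
  The stable set of \<open>p\<close> under the flow of \<open>f\<close> on \<open>D\<close>. For the fields used below solutions are
  unique, so \<open>x\<close> is the forward orbit \<open>t \<mapsto> \<phi>(v, t)\<close>; it is required to stay in \<open>D\<close>.
\<close>

definition stable_set ::
  "('a::real_normed_vector \<Rightarrow> 'a) \<Rightarrow> 'a set \<Rightarrow> 'a \<Rightarrow> 'a set" where
  "stable_set f D p =
     {v. \<exists>x. x 0 = v \<and>
         (\<forall>t\<ge>0. x t \<in> D \<and> (x has_vector_derivative f (x t)) (at t within {0..})) \<and>
         (x \<longlongrightarrow> p) at_top}"

text \<open>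
  \<open>c\<close> is an eigenvalue of the complexification of the real linear map \<open>f\<close>: the equation
  \<open>f (u + \<i> v) = c (u + \<i> v)\<close> written in real and imaginary parts.
\<close>

definition complex_eigenvalue :: "('a::real_vector \<Rightarrow> 'a) \<Rightarrow> complex \<Rightarrow> bool" where
  "complex_eigenvalue f c \<longleftrightarrow>
     (\<exists>u v. (u \<noteq> 0 \<or> v \<noteq> 0) \<and>
        f u = Re c *\<^sub>R u - Im c *\<^sub>R v \<and> f v = Im c *\<^sub>R u + Re c *\<^sub>R v)"

definition stable_node :: "('a::euclidean_space \<Rightarrow> 'a) \<Rightarrow> 'a \<Rightarrow> bool" where
  "stable_node f q \<longleftrightarrow> f q = 0 \<and> f differentiable (at q) \<and>
     (\<forall>c. complex_eigenvalue (frechet_derivative f (at q)) c \<longrightarrow> c \<in> \<real> \<and> Re c < 0)"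

definition saddle :: "('a::euclidean_space \<Rightarrow> 'a) \<Rightarrow> 'a \<Rightarrow> bool" where
  "saddle f q \<longleftrightarrow> f q = 0 \<and> f differentiable (at q) \<and>
     (let E = {c. complex_eigenvalue (frechet_derivative f (at q)) c}
      in (\<forall>c\<in>E. Re c \<noteq> 0) \<and> (\<exists>c\<in>E. Re c < 0) \<and> (\<exists>c\<in>E. Re c > 0))"


section \<open>The model\<close>

definition par_R :: real where "par_R = 1"
definition par_Q :: real where "par_Q = 343"
definition par_A :: real where "par_A = 202"
definition par_B :: real where "par_B = 1.9"
definition par_C :: real where "par_C = 3.04"
definition par_rho :: real where "par_rho = 0.3"
definition par_a :: real where "par_a = 1.05"
definition par_b :: real where "par_b = 1.75"
definition alpha1 :: real where "alpha1 = 0.32"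
definition alpha2 :: real where "alpha2 = 0.62"
definition T_cS :: real where "T_cS = -10"
definition T_cN_plus :: real where "T_cN_plus = -10"

definition alpha0 :: real where "alpha0 = (alpha1 + alpha2) / 2"
definition par_L :: real where "par_L = par_Q / (par_B + par_C)"

text \<open>The obliquity \<open>\<beta>\<close> is 23.5 degrees, in radians.\<close>

definition obliquity :: real where "obliquity = 23.5 * pi / 180"

definition legendre2 :: "real \<Rightarrow> real" where "legendre2 y = (3 * y\<^sup>2 - 1) / 2"

definition par_s0 :: real where "par_s0 = 1"
definition par_s2 :: real where "par_s2 = - 5 / 8 * legendre2 (cos obliquity)"

definition insol :: "real \<Rightarrow> real" where "insol y = par_s0 + par_s2 * legendre2 y"

definition F_eq :: "real \<Rightarrow> real \<Rightarrow> real" where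
  "F_eq \<eta>S \<eta>N =
     1 / par_B * (par_Q * par_s0 * (1 - alpha0) - par_A
       + 1 / 2 * par_C * par_L * par_s0 * (alpha1 - alpha2) * (1 - integral {\<eta>S..\<eta>N} insol))"

definition G_eq :: "real \<Rightarrow> real" where
  "G_eq \<eta>S = - par_L * (1 - alpha0) * (insol \<eta>S - 1) + T_cS"

text \<open>
  \<open>H_eq Tc\<close> is \<open>H\<^sub>+\<close> for \<open>Tc = T\<^sub>c\<^sub>N\<^sup>+\<close> and \<open>H\<^sub>-\<close> for \<open>Tc = T\<^sub>c\<^sub>N\<^sup>-\<close>; likewise
  the fields \<open>Y_field Tc\<close> and \<open>X_field Tc bb \<epsilon>\<close>, with \<open>bb\<close> either \<open>b\<^sub>+\<close> or \<open>b\<^sub>-\<close>.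
\<close>

definition H_eq :: "real \<Rightarrow> real \<Rightarrow> real" where
  "H_eq Tc \<eta>N = - par_L * (1 - alpha0) * (insol \<eta>N - 1) + Tc"

type_synonym state3 = "real \<times> real \<times> real"
type_synonym state4 = "real \<times> real \<times> real \<times> real"

definition Y_field :: "real \<Rightarrow> state3 \<Rightarrow> state3" where
  "Y_field Tc = (\<lambda>(w, \<eta>S, \<eta>N).
     (- (par_B / par_R) * (w - F_eq \<eta>S \<eta>N),
      - par_rho * (w - G_eq \<eta>S),
      par_rho * (w - H_eq Tc \<eta>N)))"

definition X_field :: "real \<Rightarrow> real \<Rightarrow> real \<Rightarrow> state4 \<Rightarrow> state4" where
  "X_field Tc bb \<epsilon> = (\<lambda>(w, \<eta>S, \<eta>N, \<xi>N).
     (- (par_B / par_R) * (w - F_eq \<eta>S \<eta>N),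
      - par_rho * (w - G_eq \<eta>S),
      par_rho * (w - H_eq Tc \<eta>N),
      \<epsilon> * (bb * (\<eta>N - \<xi>N) - par_a * (1 - \<eta>N))))"

definition space3 :: "state3 set" where
  "space3 = {(w, \<eta>S, \<eta>N). \<eta>S \<in> {-1..1} \<and> \<eta>N \<in> {-1..1} \<and> \<eta>S \<le> \<eta>N}"

definition space4 :: "state4 set" where
  "space4 = {(w, \<eta>S, \<eta>N, \<xi>N).
     \<eta>S \<in> {-1..1} \<and> \<eta>N \<in> {-1..1} \<and> \<xi>N \<in> {-1..1} \<and> \<eta>S \<le> \<eta>N}"

text \<open>
  The dynamics on the boundary of the state space is not considered. Trajectories and solutions
  are curves in the set below; those defined for all forward time thus live in its largest
  forward invariant subset.
\<close>

definition phase_space :: "state4 set" where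
  "phase_space = {(w, \<eta>S, \<eta>N, \<xi>N) \<in> space4. -1 < \<eta>S \<and> \<eta>S < \<eta>N \<and> \<eta>N < 1}"

definition switch_h :: "state4 \<Rightarrow> real" where
  "switch_h = (\<lambda>(w, \<eta>S, \<eta>N, \<xi>N). par_b * (\<eta>N - \<xi>N) - par_a * (1 - \<eta>N))"

definition Sigma_sw :: "state4 set" where "Sigma_sw = {v \<in> space4. switch_h v = 0}"
definition S_plus :: "state4 set" where "S_plus = {v \<in> space4. switch_h v > 0}"
definition S_minus :: "state4 set" where "S_minus = {v \<in> space4. switch_h v < 0}"

definition gamma_sw :: "real \<Rightarrow> real" where
  "gamma_sw \<eta>N = (1 + par_a / par_b) * \<eta>N - par_a / par_b"

definition P_point :: "real \<Rightarrow> state3 \<Rightarrow> state4" where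
  "P_point bb = (\<lambda>(w, \<eta>S, \<eta>N). (w, \<eta>S, \<eta>N, (1 + par_a / bb) * \<eta>N - par_a / bb))"

definition R_point :: "state3 \<Rightarrow> state4" where
  "R_point = (\<lambda>(w, \<eta>S, \<eta>N). (w, \<eta>S, \<eta>N, gamma_sw \<eta>N))"

text \<open>
  \<open>Qm\<close> is the continuation of the equilibrium \<open>Qp\<close> as the critical temperature increases from
  \<open>Tp\<close> to \<open>Tm\<close>: both lie on one continuous branch \<open>q\<close> of equilibria, and in particular
  \<open>q T \<rightarrow> Qp\<close> as \<open>T\<close> decreases to \<open>Tp\<close>.
\<close>

definition continues_equilibrium :: "real \<Rightarrow> real \<Rightarrow> state3 \<Rightarrow> state3 \<Rightarrow> bool" where
  "continues_equilibrium Tp Tm Qp Qm \<longleftrightarrow>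
     (\<exists>q. continuous_on {Tp..Tm} q \<and> q Tp = Qp \<and> q Tm = Qm \<and>
          (\<forall>T\<in>{Tp..Tm}. q T \<in> interior space3 \<and> Y_field T (q T) = 0))"

definition X_incl :: "real \<Rightarrow> real \<Rightarrow> real \<Rightarrow> real \<Rightarrow> state4 \<Rightarrow> state4 set" where
  "X_incl Tm bm bp \<epsilon> v =
     (if v \<in> S_minus then {X_field Tm bm \<epsilon> v}
      else if v \<in> Sigma_sw then
        {(1 - p) *\<^sub>R X_field Tm bm \<epsilon> v + p *\<^sub>R X_field T_cN_plus bp \<epsilon> v | p. p \<in> {0..1}}
      else if v \<in> S_plus then {X_field T_cN_plus bp \<epsilon> v}
      else {})"

end

theory Submission
  imports Defs
begin

text \<open>
 The three fast equations are cooperative for the order in which the southern ice line is reversed,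
 and also gradient-like, so that orbits staying in the domain accumulate at equilibria. By concavity
 of the equilibrium equations in the squared ice lines, a stable node lies above all equilibria
 for larger critical temperatures. Hence the fast flow of each phase leads from the node of the
 other phase to its own node, exponentially fast, while the slow variable drifts towards the
 switching manifold. When it is reached, after a time of order \<open>1/\<epsilon>\<close>, the fast
 variables are so close to the node that the manifold is crossed transversally, and the return map
 contracts; its fixed point gives the cycle.

 For uniqueness, a corrected energy shows that for small \<open>\<epsilon>\<close> every periodic solution comes close
 to an equilibrium for some temperature between the two critical ones. By monotonicity, solutions
 starting near the periodic orbit then leave the state space or reach a neighbourhood of
 one of the two nodes that is attracted by the cycle already found.
\<close>

section \<open>Almost everywhere differentiable curves\<close>

text \<open>The delicate point of existence is a balance of powers of \<open>e\<close>. A phase ends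
  with speed of order \<open>e\<close> only, so a perturbation of the starting point can shift the
  exit time by its size divided by \<open>e\<close>. The return map contracts nevertheless: at the
  exit the fast variables are within order \<open>e * e\<close> of the node, hence move that slowly,
  and the shift costs only order \<open>e\<close>. Exponential attraction over a time of order
  \<open>1 / e\<close> provides this. For uniqueness nothing is known about a competing cycle: it
  may slide along the switching manifold, where solutions are not unique, and it may pass close to
  an unstable equilibrium. Attraction of the competitor covers all solutions from a neighbourhood,
  so its slow variable may be pushed slightly off the manifold, and a single solution that ends up
  at the first cycle is a contradiction. Near an unstable equilibrium no invariant manifold is used:
  either the velocity becomes ordered at some time, and monotonicity takes over, or it never does,
  and then the distance to the equilibrium grows at most by a fixed factor.\<close>

lemma abs_cont_increment_le:
 fixes f :: "real => real"
 assumes ac: "abs_cont_on {a..b} f" and ab: "a <= b" and Z: "negligible Z"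
  and der: "\<And>t. t \<in> {a<..<b} - Z ==> \<exists>d. (f has_real_derivative d) (at t) & d <= M"
 shows "f b - f a <= M * (b - a)"
proof (cases "a = b")
 case False
 with ab have ab': "a < b" by simp
 have main: "f b - f a <= M * (b - a) + e * (b - a) + 2 * e" if e: "e > 0" for e
 proof -
  obtain d where d: "d > 0" and dD: "\<And>\<D> S. \<D> division_of S ==> S \<subseteq> {a..b} ==>
    (\<Sum>k\<in>\<D>. measure lborel k) < d ==> (\<Sum>k\<in>\<D>. norm (f (Sup k) - f (Inf k))) < e"
   using ac e unfolding abs_cont_on_def by meson
  define d' where "d' = d / (1 + \<bar>M\<bar>)"
  \<comment> \<open>The intervals tagged in the exceptional set must be short for two reasons: below
    \<open>d\<close>, absolute continuity bounds their increments by \<open>e\<close>; below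
    \<open>e / (1 + |M|)\<close>, leaving their length out of \<open>M * (b - a)\<close> costs at
    most \<open>e\<close>.\<close>
  define dd where "dd = min d (e / (1 + \<bar>M\<bar>))"
  have dd: "dd > 0" using d e by (simp add: dd_def)
  define N where "N = Z \<union> {a, b}"
  have "negligible N" using Z by (simp add: N_def)
  hence "N \<in> null_sets lebesgue" by (simp add: negligible_iff_null_sets)
  hence "N \<in> sets lebesgue" by auto
  then obtain T where T: "open T" "N \<subseteq> T" "T - N \<in> lmeasurable" "emeasure lebesgue (T - N) < ennreal dd"
   using sets_lebesgue_outer_open[of N dd] dd by blast
  have NT: "T \<in> lmeasurable" "measure lebesgue T < dd"
  proof -
   have N0: "N \<in> lmeasurable" "measure lebesgue N = 0"
    using \<open>negligible N\<close> negligible_imp_measurable negligible_imp_measure0 by auto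
   have TU: "(T - N) \<union> N = T" using T(2) by auto
   have "(T - N) \<union> N \<in> lmeasurable" by (rule fmeasurable.Un[OF T(3) N0(1)])
   thus "T \<in> lmeasurable" using TU by simp
   have "emeasure lebesgue (T - N) = ennreal (measure lebesgue (T - N))"
    by (rule emeasure_eq_measure2[OF T(3)])
   hence "measure lebesgue (T - N) < dd" using T(4) dd by (simp add: ennreal_less_iff)
   moreover have "measure lebesgue ((T - N) \<union> N) <= measure lebesgue (T - N) + measure lebesgue N"
    by (rule measure_Un_le) (use T(3) N0 in auto)
   ultimately show "measure lebesgue T < dd" using N0(2) TU by simp
  qed
  have good: "\<exists>g>0. \<forall>u v. u <= t --> t <= v --> \<bar>u - t\<bar> < g --> \<bar>v - t\<bar> < g --> f v - f u <= (M + e) * (v - u)"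
   if "t \<in> {a..b} - N" for t
  proof -
   have "t \<in> {a<..<b} - Z" using that by (auto simp: N_def)
   then obtain D where D: "(f has_real_derivative D) (at t)" "D <= M" using der by blast
   have "((%y. (f y - f t) / (y - t)) \<longlongrightarrow> D) (at t)"
    using D(1) by (simp add: has_field_derivative_iff)
   hence "\<forall>\<^sub>F y in at t. \<bar>(f y - f t) / (y - t) - D\<bar> < e"
    using e by (auto simp: tendsto_iff dist_real_def)
   then obtain g where g: "g > 0" "\<And>y. y \<noteq> t ==> dist y t < g ==> \<bar>(f y - f t) / (y - t) - D\<bar> < e"
    by (auto simp: eventually_at)
   have up: "f y - f t <= (M + e) * (y - t)" if "y >= t" "\<bar>y - t\<bar> < g" for y
   proof (cases "y = t")
    case False
    hence "(f y - f t) / (y - t) < M + e" using g(2)[of y] that D(2) by (auto simp: dist_real_def)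
    thus ?thesis using that False by (simp add: field_simps)
   qed simp
   have dn: "f t - f y <= (M + e) * (t - y)" if "y <= t" "\<bar>y - t\<bar> < g" for y
   proof (cases "y = t")
    case False
    hence "(f t - f y) / (t - y) < M + e" using g(2)[of y] that D(2)
     by (auto simp: dist_real_def) (metis abs_less_iff add.commute add_le_cancel_left diff_less_eq less_le_trans minus_diff_eq minus_divide_divide)
    thus ?thesis using that False by (simp add: field_simps)
   qed simp
   show ?thesis
   proof (intro exI[of _ g] conjI allI impI)
    fix u v assume "u <= t" "t <= v" "\<bar>u - t\<bar> < g" "\<bar>v - t\<bar> < g"
    hence "f v - f t <= (M + e) * (v - t)" "f t - f u <= (M + e) * (t - u)" using up dn by auto
    thus "f v - f u <= (M + e) * (v - u)" by (simp add: algebra_simps)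
   qed (fact g(1))
  qed
  define g where "g t = (SOME g. g > 0 & (\<forall>u v. u <= t --> t <= v --> \<bar>u - t\<bar> < g --> \<bar>v - t\<bar> < g --> f v - f u <= (M + e) * (v - u)))" for t
  have g: "g t > 0 & (\<forall>u v. u <= t --> t <= v --> \<bar>u - t\<bar> < g t --> \<bar>v - t\<bar> < g t --> f v - f u <= (M + e) * (v - u))"
   if "t \<in> {a..b} - N" for t
   unfolding g_def using good[OF that] by (rule someI_ex)
  \<comment> \<open>Exceptional tags get the small open set \<open>T\<close>; a regular tag gets a
    ball on which the difference quotients around the tag are at most \<open>M + e\<close>.\<close>
  define G where "G t = (if t \<in> N then T else if t \<in> {a..b} then ball t (g t) else ball t 1)" for t
  have "gauge G" unfolding gauge_def G_def using T(1,2) g by auto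
  then obtain p where p: "p tagged_division_of {a..b}" "G fine p"
   using fine_division_exists_real by blast
  have pf: "finite p" using p(1) by blast
  have pk: "\<exists>u v. k = {u..v} & u <= v & u <= t & t <= v & a <= u & v <= b" if tk: "(t, k) \<in> p" for t k
  proof -
   obtain u v where "k = cbox u v" using tagged_division_ofD(4)[OF p(1) tk] by blast
   moreover have "t \<in> k" "k \<subseteq> {a..b}" using p(1) tk by (auto dest: tagged_division_ofD(2,3))
   ultimately show ?thesis by (auto simp: subset_iff)
  qed
  have sumf: "(\<Sum>(t,k)\<in>p. f (Sup k) - f (Inf k)) = f b - f a"
   using additive_tagged_division_1[OF ab p(1), of f] by simp
  define q where "q = {(t,k)\<in>p. t \<in> N}"
  have qp: "q \<subseteq> p" by (auto simp: q_def)
  define r where "r = p - q"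
  have fin: "finite q" "finite r" using pf qp finite_subset by (auto simp: r_def)
  have len: "(\<Sum>(t,k)\<in>p. Sup k - Inf k) = b - a"
   using additive_tagged_division_1[OF ab p(1), of "%x. x"] by simp
  have qtag: "q tagged_partial_division_of {a..b}"
   using p(1) qp tagged_partial_division_subset by (meson tagged_division_of_def)
  have qdiv: "snd ` q division_of \<Union>(snd ` q)"
   by (rule partial_division_of_tagged_division[OF qtag])
  have qT: "\<Union>(snd ` q) \<subseteq> T"
  proof clarsimp
   fix x t k assume "x \<in> k" "(t,k) \<in> q"
   thus "x \<in> T" using p(2) unfolding fine_def q_def G_def by fastforce
  qed
  have qsub: "\<Union>(snd ` q) \<subseteq> {a..b}"
   using tagged_partial_division_ofD(3)[OF qtag] by fastforce
  have qmeas: "(\<Sum>k\<in>snd ` q. measure lebesgue k) < dd"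
  proof -
   have "measure lebesgue (\<Union>(snd ` q)) = (\<Sum>k\<in>snd ` q. measure lebesgue k)"
    by (rule content_division[OF qdiv, symmetric])
   moreover have "\<Union>(snd ` q) \<in> lmeasurable" using qdiv by (rule lmeasurable_division)
   hence "measure lebesgue (\<Union>(snd ` q)) <= measure lebesgue T"
    using NT qT by (intro measure_mono_fmeasurable) (auto simp: fmeasurableD)
   ultimately show ?thesis using NT(2) by simp
  qed
  have lebl: "measure lebesgue k = measure lborel k" if "k \<in> snd ` q" for k
   using that qtag by (auto dest!: tagged_partial_division_ofD(4))
  have "(\<Sum>k\<in>snd ` q. measure lborel k) < dd"
   using qmeas lebl by simp
  hence s1: "(\<Sum>k\<in>snd ` q. norm (f (Sup k) - f (Inf k))) < e"
   using dD[OF qdiv qsub] by (simp add: dd_def)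
  have over: "(\<Sum>(t,k)\<in>q. F k) = (\<Sum>k\<in>snd ` q. F k)" if "\<And>u v. box u v = {} ==> F (cbox u v) = 0" for F :: "real set => real"
   by (rule sum.over_tagged_division_lemma[where d=F, OF tagged_partial_division_of_Union_self[OF qtag] that])
  \<comment> \<open>For the empty interval \<open>Sup\<close> and \<open>Inf\<close> mean nothing.
    The default 0 makes \<open>F\<close> vanish on all degenerate boxes, as the passage from tagged
    intervals to intervals requires.\<close>
  define F where "F k = (if k = {} then 0 else f (Sup k) - f (Inf k))" for k
  have degen: "F (cbox u v) = 0" if "box u v = {}" for u v :: real
   using that by (cases "u = v") (auto simp: F_def)
  have s2: "(\<Sum>(t,k)\<in>q. f (Sup k) - f (Inf k)) < e"
  proof -
   have "(\<Sum>(t,k)\<in>q. f (Sup k) - f (Inf k)) = (\<Sum>(t,k)\<in>q. F k)"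
    using pk qp by (intro sum.cong) (force simp: F_def)+
   also have "... = (\<Sum>k\<in>snd ` q. F k)"
    by (rule over) (rule degen)
   also have "... <= (\<Sum>k\<in>snd ` q. norm (f (Sup k) - f (Inf k)))"
    by (rule sum_mono) (use abs_ge_self in \<open>auto simp: F_def\<close>)
   finally show ?thesis using s1 by simp
  qed
  have lq: "(\<Sum>(t,k)\<in>q. Sup k - Inf k) = (\<Sum>k\<in>snd ` q. measure lborel k)"
  proof -
   have "(\<Sum>(t,k)\<in>q. Sup k - Inf k) = (\<Sum>(t,k)\<in>q. measure lborel k)"
    using pk qp by (intro sum.cong) force+
   also have "... = (\<Sum>k\<in>snd ` q. measure lborel k)" by (rule over) auto
   finally show ?thesis .
  qed
  have lq': "(\<Sum>(t,k)\<in>q. Sup k - Inf k) < e / (1 + \<bar>M\<bar>)"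
   using lq \<open>(\<Sum>k\<in>snd ` q. measure lborel k) < dd\<close> by (simp add: dd_def)
  have lq0: "0 <= (\<Sum>(t,k)\<in>q. Sup k - Inf k)"
   using lq by (simp add: sum_nonneg)
  have s3: "(\<Sum>(t,k)\<in>r. f (Sup k) - f (Inf k)) <= (\<Sum>(t,k)\<in>r. (M + e) * (Sup k - Inf k))"
  proof (rule sum_mono, clarify)
   fix t k assume tk: "(t, k) \<in> r"
   then obtain u v where k: "k = {u..v}" "u <= v" "u <= t" "t <= v" "a <= u" "v <= b" using pk by (force simp: r_def)
   have tN: "t \<in> {a..b} - N" using tk k by (auto simp: r_def q_def)
   have "k \<subseteq> ball t (g t)" using p(2) tk tN unfolding fine_def r_def G_def by fastforce
   hence "u \<in> ball t (g t)" "v \<in> ball t (g t)" using k by (meson atLeastAtMost_iff order_refl order_trans subsetD)+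
   thus "f (Sup k) - f (Inf k) <= (M + e) * (Sup k - Inf k)"
    using g[OF tN] k by (auto simp: dist_real_def abs_minus_commute)
  qed
  have split: "(\<Sum>x\<in>p. F x) = (\<Sum>x\<in>q. F x) + (\<Sum>x\<in>r. F x)" for F :: "real \<times> real set => real"
   unfolding r_def using sum.subset_diff[OF qp pf] by (simp add: add.commute)
  have lr: "(\<Sum>(t,k)\<in>r. Sup k - Inf k) = (b - a) - (\<Sum>(t,k)\<in>q. Sup k - Inf k)"
   using split[of "%(t,k). Sup k - Inf k"] len by simp
  have s3': "(\<Sum>(t,k)\<in>r. (M + e) * (Sup k - Inf k)) = (M + e) * (\<Sum>(t,k)\<in>r. Sup k - Inf k)"
   by (simp add: sum_distrib_left case_prod_unfold)
  define Lq where "Lq = (\<Sum>(t,k)\<in>q. Sup k - Inf k)"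
  have "f b - f a <= e + (M + e) * ((b - a) - Lq)"
   using split[of "%(t,k). f (Sup k) - f (Inf k)"] sumf s2 s3 s3' lr by (simp add: Lq_def)
  moreover have "\<bar>M * Lq\<bar> <= e"
  proof -
   have "\<bar>M * Lq\<bar> <= (1 + \<bar>M\<bar>) * Lq" using lq0 by (simp add: Lq_def abs_mult mult_right_mono)
   also have "... <= (1 + \<bar>M\<bar>) * (e / (1 + \<bar>M\<bar>))" using lq' by (intro mult_left_mono) (auto simp: Lq_def)
   finally show ?thesis by (simp add: add_nonneg_eq_0_iff)
  qed
  moreover have "e * Lq >= 0" using e lq0 by (simp add: Lq_def)
  ultimately have "f b - f a <= M * (b - a) + e * (b - a) + e + e" by (simp add: algebra_simps)
  thus ?thesis by simp
 qed
 show ?thesis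
 proof (rule field_le_epsilon)
  fix e :: real assume e: "e > 0"
  define e' where "e' = e / (b - a + 2)"
  have "e' > 0" "e' * (b - a + 2) = e" using e ab' by (auto simp: e'_def)
  thus "f b - f a <= M * (b - a) + e" using main[of e'] by (simp add: algebra_simps)
 qed
qed simp

lemma lipschitz_imp_abs_cont:
 fixes f :: "real => 'a::real_normed_vector"
 assumes L: "L-lipschitz_on J f"
 shows "abs_cont_on J f"
 unfolding abs_cont_on_def
proof (intro allI impI)
 fix e :: real assume e: "e > 0"
 have L0: "L >= 0" using L by (rule lipschitz_on_nonneg)
 show "\<exists>d>0. \<forall>\<D> S. \<D> division_of S & S \<subseteq> J & (\<Sum>k\<in>\<D>. measure lborel k) < d
    --> (\<Sum>k\<in>\<D>. norm (f (Sup k) - f (Inf k))) < e"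
 proof (intro exI[of _ "e / (L + 1)"] conjI allI impI)
  show "e / (L + 1) > 0" using e L0 by simp
  fix \<D> S assume D: "\<D> division_of S & S \<subseteq> J & (\<Sum>k\<in>\<D>. measure lborel k) < e / (L + 1)"
  have "norm (f (Sup k) - f (Inf k)) <= L * measure lborel k" if k: "k \<in> \<D>" for k
  proof -
   obtain u v where uv: "k = cbox u v" using D k by (meson division_ofD(4))
   have "k \<noteq> {}" "k \<subseteq> S" using D k by (meson division_ofD(3), meson division_ofD(2))
   hence le: "u <= v" "u \<in> J" "v \<in> J" using uv D by auto
   have "dist (f v) (f u) <= L * dist v u" by (rule lipschitz_onD[OF L]) (use le in auto)
   thus ?thesis using uv le by (simp add: dist_norm)
  qed
  hence "(\<Sum>k\<in>\<D>. norm (f (Sup k) - f (Inf k))) <= L * (\<Sum>k\<in>\<D>. measure lborel k)"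
   by (simp add: sum_distrib_left sum_mono)
  also have "... <= L * (e / (L + 1))" using D L0 by (intro mult_left_mono) auto
  also have "... < e" using e L0 by (simp add: field_simps)
  finally show "(\<Sum>k\<in>\<D>. norm (f (Sup k) - f (Inf k))) < e" .
 qed
qed

lemma abs_cont_on_mono:
 assumes "abs_cont_on J f" and le: "\<And>s t. norm (g s - g t) <= norm (f s - f t)"
 shows "abs_cont_on J g"
 unfolding abs_cont_on_def
proof (intro allI impI)
 fix e :: real assume "e > 0"
 then obtain d where d: "d > 0" "\<And>\<D> S. \<D> division_of S ==> S \<subseteq> J ==>
    (\<Sum>k\<in>\<D>. measure lborel k) < d ==> (\<Sum>k\<in>\<D>. norm (f (Sup k) - f (Inf k))) < e"
  using assms(1) unfolding abs_cont_on_def by meson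
 show "\<exists>d>0. \<forall>\<D> S. \<D> division_of S & S \<subseteq> J & (\<Sum>k\<in>\<D>. measure lborel k) < d
    --> (\<Sum>k\<in>\<D>. norm (g (Sup k) - g (Inf k))) < e"
 proof (intro exI[of _ d] conjI allI impI d(1))
  fix \<D> S assume D: "\<D> division_of S & S \<subseteq> J & (\<Sum>k\<in>\<D>. measure lborel k) < d"
  have "(\<Sum>k\<in>\<D>. norm (g (Sup k) - g (Inf k))) <= (\<Sum>k\<in>\<D>. norm (f (Sup k) - f (Inf k)))"
   by (rule sum_mono) (rule le)
  also have "... < e" using d(2) D by blast
  finally show "(\<Sum>k\<in>\<D>. norm (g (Sup k) - g (Inf k))) < e" .
 qed
qed

lemma abs_cont_continuous:
 fixes f :: "real => 'a::real_normed_vector"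
 assumes "abs_cont_on {a..b} f"
 shows "continuous_on {a..b} f"
 unfolding continuous_on_iff
proof (intro ballI allI impI)
 fix x e :: real assume x: "x \<in> {a..b}" and "e > 0"
 then obtain d where d: "d > 0" and dD: "\<And>\<D> S. \<D> division_of S ==> S \<subseteq> {a..b} ==>
    (\<Sum>k\<in>\<D>. measure lborel k) < d ==> (\<Sum>k\<in>\<D>. norm (f (Sup k) - f (Inf k))) < e"
  using assms unfolding abs_cont_on_def by meson
 have *: "norm (f v - f u) < e" if uv: "u <= v" "a <= u" "v <= b" "v - u < d" for u v
 proof -
  have "{cbox u v} division_of cbox u v" by (rule division_of_self) (use uv in auto)
  from dD[OF this] show ?thesis using uv by simp
 qed
 show "\<exists>d>0. \<forall>x'\<in>{a..b}. dist x' x < d --> dist (f x') (f x) < e"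
 proof (intro exI[of _ d] conjI ballI impI d)
  fix y assume y: "y \<in> {a..b}" "dist y x < d"
  show "dist (f y) (f x) < e"
  proof (cases "x <= y")
   case True thus ?thesis using *[of x y] x y by (auto simp: dist_norm)
  next
   case False thus ?thesis using *[of y x] x y by (auto simp: dist_norm norm_minus_commute)
  qed
 qed
qed

text \<open>The increment bound applies to \<open>f\<close> and to \<open>- f\<close> on every
  subinterval. Solutions of the inclusion become Lipschitz in this way, a class that is easier to
  compute with than absolute continuity.\<close>

lemma abs_cont_imp_lipschitz:
 fixes f :: "real => real"
 assumes ac: "abs_cont_on {a..b} f" and Z: "negligible Z" and M: "M >= 0"
  and der: "\<And>t. t \<in> {a<..<b} - Z ==> \<exists>d. (f has_real_derivative d) (at t) & \<bar>d\<bar> <= M"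
 shows "M-lipschitz_on {a..b} f"
proof (rule lipschitz_onI)
 have *: "\<bar>f v - f u\<bar> <= M * (v - u)" if uv: "u <= v" "a <= u" "v <= b" for u v
 proof -
  have sub: "abs_cont_on {u..v} f"
   using ac uv unfolding abs_cont_on_def by (meson atLeastatMost_subset_iff dual_order.trans)
  have 1: "f v - f u <= M * (v - u)"
   by (rule abs_cont_increment_le[OF sub uv(1) Z]) (use der uv in \<open>force simp: abs_le_iff\<close>)
  have "abs_cont_on {u..v} (%x. - f x)"
   using sub by (rule abs_cont_on_mono) (simp add: abs_minus_commute)
  hence "(- f v) - (- f u) <= M * (v - u)"
  proof (rule abs_cont_increment_le[OF _ uv(1) Z])
   fix t assume "t \<in> {u<..<v} - Z"
   then obtain d where "(f has_real_derivative d) (at t)" "\<bar>d\<bar> <= M" using der uv by force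
   thus "\<exists>d. ((%x. - f x) has_real_derivative d) (at t) & d <= M"
    by (intro exI[of _ "-d"]) (auto intro: derivative_eq_intros)
  qed
  with 1 show ?thesis by simp
 qed
 show "dist (f x) (f y) <= M * dist x y" if "x \<in> {a..b}" "y \<in> {a..b}" for x y
  using *[of x y] *[of y x] that by (cases "x <= y") (auto simp: dist_real_def abs_minus_commute)
qed (fact M)

text \<open>The constant is hidden: only its existence matters when a differential inequality valid
  almost everywhere is integrated.\<close>

definition lips :: "real set => (real => 'a::metric_space) => bool" where
 "lips I f \<longleftrightarrow> (\<exists>L. L-lipschitz_on I f)"

lemma lips_const [simp]: "lips I (%t. c)"
 unfolding lips_def using lipschitz_on_constant by blast

lemma lips_add: "lips I f ==> lips I g ==> lips I (%t. f t + g t)"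
 for f g :: "real => 'a::real_normed_vector"
 unfolding lips_def using lipschitz_on_add by blast

lemma lips_minus: "lips I f ==> lips I (%t. - f t)"
 for f :: "real => 'a::real_normed_vector"
 unfolding lips_def using lipschitz_on_minus by blast

lemma lips_diff: "lips I f ==> lips I g ==> lips I (%t. f t - g t)"
 for f g :: "real => 'a::real_normed_vector"
 unfolding lips_def using lipschitz_on_diff by blast

lemma lips_comp: "K-lipschitz_on UNIV F ==> lips I f ==> lips I (%t. F (f t))"
 unfolding lips_def
proof (elim exE)
 fix L assume F: "K-lipschitz_on UNIV F" and f: "L-lipschitz_on I f"
 have "K-lipschitz_on (f ` I) F" using F by (rule lipschitz_on_subset) simp
 from lipschitz_on_compose2[OF f this] show "\<exists>L. L-lipschitz_on I (%t. F (f t))" by blast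
qed

lemma lips_cong: "lips I f ==> (\<And>t. t \<in> I ==> f t = g t) ==> lips I g"
 unfolding lips_def lipschitz_on_def by auto

lemma lips_continuous: "lips I f ==> continuous_on I f"
 unfolding lips_def by (auto intro: lipschitz_on_continuous_on)

lemma lips_fst: "lips I f ==> lips I (%t. fst (f t))"
 unfolding lips_def by (meson dist_fst_le lipschitz_on_def order_trans)

lemma lips_snd: "lips I f ==> lips I (%t. snd (f t))"
 unfolding lips_def by (meson dist_snd_le lipschitz_on_def order_trans)

lemma lips_max: "lips I f ==> lips I (%t. max c (f t))" for f :: "real => real"
 by (rule lips_comp[of 1 "max c"]) (auto intro!: lipschitz_onI simp: dist_real_def)

lemma lips_min: "lips I f ==> lips I (%t. min c (f t))" for f :: "real => real"
 by (rule lips_comp[of 1 "min c"]) (auto intro!: lipschitz_onI simp: dist_real_def)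

lemma lips_Pair: "lips I f ==> lips I g ==> lips I (%t. (f t, g t))"
 unfolding lips_def using lipschitz_on_Pair by blast

lemma lips_mult:
 fixes f g :: "real => real"
 assumes "lips {a..b} f" "lips {a..b} g"
 shows "lips {a..b} (%t. f t * g t)"
proof -
 obtain K L where K: "K-lipschitz_on {a..b} f" and L: "L-lipschitz_on {a..b} g"
  using assms by (auto simp: lips_def)
 have "bounded (f ` {a..b})" "bounded (g ` {a..b})"
  using assms by (auto intro!: compact_imp_bounded compact_continuous_image lips_continuous)
 then obtain A B where A: "\<And>t. t \<in> {a..b} ==> \<bar>f t\<bar> <= A" and B: "\<And>t. t \<in> {a..b} ==> \<bar>g t\<bar> <= B"
  by (force simp: bounded_iff)
 have K0: "K >= 0" "L >= 0" using K L lipschitz_on_nonneg by auto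
 have "(K * \<bar>B\<bar> + \<bar>A\<bar> * L)-lipschitz_on {a..b} (%t. f t * g t)"
 proof (rule lipschitz_onI)
  fix x y assume xy: "x \<in> {a..b}" "y \<in> {a..b}"
  have "f x * g x - f y * g y = (f x - f y) * g x + f y * (g x - g y)" by (simp add: algebra_simps)
  hence "\<bar>f x * g x - f y * g y\<bar> <= \<bar>f x - f y\<bar> * \<bar>g x\<bar> + \<bar>f y\<bar> * \<bar>g x - g y\<bar>"
   by (metis abs_mult abs_triangle_ineq)
  also have "... <= (K * \<bar>x - y\<bar>) * \<bar>B\<bar> + \<bar>A\<bar> * (L * \<bar>x - y\<bar>)"
   using lipschitz_onD[OF K xy] lipschitz_onD[OF L xy] A[OF xy(2)] B[OF xy(1)] K0
   by (intro add_mono mult_mono) (auto simp: dist_real_def)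
  finally show "dist (f x * g x) (f y * g y) <= (K * \<bar>B\<bar> + \<bar>A\<bar> * L) * dist x y"
   by (simp add: dist_real_def algebra_simps)
 qed (use K0 in auto)
 thus ?thesis unfolding lips_def by blast
qed

lemma lips_power:
 fixes f :: "real => real"
 shows "lips {a..b} f ==> lips {a..b} (%t. f t ^ n)"
 by (induction n) (auto intro!: lips_mult)

lemma lips_C1:
 fixes f :: "real => real"
 assumes "\<And>t. t \<in> {a..b} ==> (f has_real_derivative f' t) (at t within {a..b})"
  and "continuous_on {a..b} f'"
 shows "lips {a..b} f"
proof -
 have "bounded (f' ` {a..b})" using assms(2) by (auto intro!: compact_imp_bounded compact_continuous_image)
 then obtain A where A: "\<And>t. t \<in> {a..b} ==> \<bar>f' t\<bar> <= A" by (force simp: bounded_iff)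
 have "\<bar>A\<bar>-lipschitz_on {a..b} f"
 proof (rule lipschitz_onI)
  fix x y assume xy: "x \<in> {a..b}" "y \<in> {a..b}"
  have "norm (f x - f y) <= \<bar>A\<bar> * norm (x - y)"
   by (rule field_differentiable_bound[of "{a..b}" f f'])
    (use assms(1) A xy in \<open>auto intro: order_trans[OF _ abs_ge_self]\<close>)
  thus "dist (f x) (f y) <= \<bar>A\<bar> * dist x y" by (simp add: dist_norm)
 qed simp
 thus ?thesis unfolding lips_def by blast
qed

lemma lips_exp: "lips {a..b} (%t. exp (c * t))"
 by (rule lips_C1[where f' = "%t. c * exp (c * t)"])
  (auto intro!: derivative_eq_intros continuous_intros)

lemma lips_increment_le:
 fixes f :: "real => real"
 assumes "lips {a..b} f" and "a <= b" and "negligible Z"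
  and "\<And>t. t \<in> {a<..<b} - Z ==> \<exists>d. (f has_real_derivative d) (at t) & d <= M"
 shows "f b - f a <= M * (b - a)"
proof -
 have "abs_cont_on {a..b} f" using assms(1) lipschitz_imp_abs_cont by (auto simp: lips_def)
 thus ?thesis by (rule abs_cont_increment_le[OF _ assms(2-4)])
qed

section \<open>Differential inequalities\<close>

lemma exp_weight_le:
 assumes "exp (- C * b) * x <= exp (- C * a) * (y :: real)"
 shows "x <= exp (C * (b - a)) * y"
proof -
 have "exp (C * b) * (exp (- C * b) * x) <= exp (C * b) * (exp (- C * a) * y)" using assms by simp
 moreover have "exp (C * b) * exp (- C * b) = 1" by (simp add: exp_minus)
 moreover have "exp (C * b) * exp (- C * a) = exp (C * (b - a))"
  by (simp add: exp_add[symmetric] right_diff_distrib)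
 ultimately show ?thesis by (simp only: mult.assoc[symmetric])
qed

text \<open>Integrating factor \<open>exp (- C * t)\<close>. Neither \<open>C\<close> nor
  \<open>f\<close> carries a sign: a negative \<open>C\<close> later gives decay over one
  period.\<close>

lemma gronwall_ae:
 fixes f :: "real => real"
 assumes f: "lips {a..b} f" and ab: "a <= b" and Z: "negligible Z"
  and der: "\<And>t. t \<in> {a<..<b} - Z ==> \<exists>d. (f has_real_derivative d) (at t) & d <= C * f t"
 shows "f b <= exp (C * (b - a)) * f a"
proof -
 define g where "g t = exp (- C * t) * f t" for t
 have "lips {a..b} g" unfolding g_def by (intro lips_mult lips_exp f)
 hence "g b - g a <= 0 * (b - a)"
 proof (rule lips_increment_le[OF _ ab Z])
  fix t assume "t \<in> {a<..<b} - Z"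
  then obtain d where d: "(f has_real_derivative d) (at t)" "d <= C * f t" using der by blast
  have "(g has_real_derivative exp (- C * t) * (d - C * f t)) (at t)"
  proof -
   have e: "((%t. exp (- C * t)) has_real_derivative - C * exp (- C * t)) (at t)"
    by (auto intro!: derivative_eq_intros)
   from DERIV_mult[OF e d(1)] show ?thesis unfolding g_def by (rule back_subst) (simp add: algebra_simps)
  qed
  moreover have "exp (- C * t) * (d - C * f t) <= 0" using d(2) by (simp add: mult_nonneg_nonpos)
  ultimately show "\<exists>d. (g has_real_derivative d) (at t) & d <= 0" by blast
 qed
 hence "exp (- C * b) * f b <= exp (- C * a) * f a" by (simp add: g_def)
 thus ?thesis by (rule exp_weight_le)
qed

text \<open>Squaring removes the kink of the positive part at 0, so the violation of an inequality
  can serve as a differentiable Lyapunov function.\<close>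

lemma has_derivative_pos_part_sq:
 assumes "(f has_real_derivative d) (at t)"
 shows "((%t. (max 0 (f t))\<^sup>2) has_real_derivative 2 * max 0 (f t) * d) (at t)"
proof -
 have "((%x::real. (max 0 x)\<^sup>2) has_real_derivative 2 * max 0 x) (at x)" for x
 proof (cases x "0::real" rule: linorder_cases)
  case less
  have "((%x::real. 0) has_real_derivative 0) (at x)" by simp
  hence "((%x::real. (max 0 x)\<^sup>2) has_real_derivative 0) (at x)"
   by (rule has_field_derivative_transform_within_open[where S="{..<0}"]) (use less in auto)
  thus ?thesis using less by simp
 next
  case equal
  have "((%y::real. ((max 0 y)\<^sup>2 - 0) / y) \<longlongrightarrow> 0) (at 0)"
  proof (rule tendsto_sandwich[of "%y. - \<bar>y\<bar>" _ _ "%y. \<bar>y\<bar>"])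
   have *: "- \<bar>y\<bar> <= ((max 0 y)\<^sup>2 - 0) / y & ((max 0 y)\<^sup>2 - 0) / y <= \<bar>y\<bar>" for y :: real
    by (cases "y >= 0") (simp_all add: power2_eq_square)
   show "\<forall>\<^sub>F y in at 0. - \<bar>y::real\<bar> <= ((max 0 y)\<^sup>2 - 0) / y"
    by (rule always_eventually, rule allI, rule conjunct1[OF *])
   show "\<forall>\<^sub>F y in at 0. ((max 0 y)\<^sup>2 - 0) / y <= \<bar>y::real\<bar>"
    by (rule always_eventually, rule allI, rule conjunct2[OF *])
  qed (auto intro!: tendsto_eq_intros)
  thus ?thesis using equal by (simp add: has_field_derivative_iff)
 next
  case greater
  have "((%x::real. x\<^sup>2) has_real_derivative 2 * x) (at x)" by (auto intro!: derivative_eq_intros)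
  hence "((%x::real. (max 0 x)\<^sup>2) has_real_derivative 2 * x) (at x)"
   by (rule has_field_derivative_transform_within_open[where S="{0<..}"]) (use greater in auto)
  thus ?thesis using greater by simp
 qed
 from DERIV_chain2[OF this assms] show ?thesis .
qed

text \<open>After the last time with a value \<open><= 0\<close> the function would be positive and
  hence nonincreasing, so it could not have become positive.\<close>

lemma barrier_nonpos:
 fixes f :: "real => real"
 assumes ab: "a <= b" and cont: "continuous_on {a..b} f" and fa: "f a <= 0"
  and der: "\<And>t. a < t ==> t < b ==> f t > 0 ==> \<exists>d. (f has_real_derivative d) (at t) & d <= 0"
 shows "f b <= 0"
proof (rule ccontr)
 assume "\<not> f b <= 0"
 hence fb: "f b > 0" by simp
 define S where "S = {t \<in> {a..b}. f t <= 0}"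
 have Sc: "S = {a..b} \<inter> f -` {..0}" by (auto simp: S_def)
 have "closed S" unfolding Sc by (rule continuous_closed_preimage[OF cont]) auto
 have "a \<in> S" using fa ab by (simp add: S_def)
 hence ne: "S \<noteq> {}" by blast
 have bdd: "bdd_above S" by (rule bdd_aboveI[of _ b]) (simp add: S_def)
 have sS: "Sup S \<in> S" by (rule closed_contains_Sup[OF ne bdd \<open>closed S\<close>])
 define s where "s = Sup S"
 have s: "a <= s" "s <= b" "f s <= 0" using sS by (simp_all add: S_def s_def)
 have "s \<noteq> b" using s fb by auto
 with s have s: "a <= s" "s < b" "f s <= 0" by simp_all
 have pos: "f t > 0" if "s < t" "t <= b" for t
 proof (rule ccontr)
  assume "\<not> f t > 0"
  hence "t \<in> S" using that s by (auto simp: S_def)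
  hence "t <= s" unfolding s_def using bdd by (rule cSup_upper)
  thus False using that by simp
 qed
 have "f b <= f s"
 proof (rule DERIV_nonpos_imp_decreasing_open[of s b f])
  show "\<exists>y. DERIV f x :> y & y <= 0" if "s < x" "x < b" for x
   using der[of x] pos[of x] that s by auto
  show "continuous_on {s..b} f" using cont by (rule continuous_on_subset) (use s in auto)
 qed (use s in auto)
 thus False using s fb by simp
qed

text \<open>A zero with nonzero derivative is isolated, so a pair of rationals around it determines
  it. Applied to the switching function, this makes the transversal crossing times a null
  set.\<close>

lemma countable_transversal_zeros:
 fixes f :: "real => real"
 shows "countable {t. f t = 0 & (\<exists>d. d \<noteq> 0 & (f has_real_derivative d) (at t))}" (is "countable ?S")
proof -
 have "\<exists>q. q \<in> \<rat> \<times> \<rat> & fst q < t & t < snd q & (\<forall>y. fst q < y & y < snd q & f y = 0 --> y = t)"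
  if t: "t \<in> ?S" for t
 proof -
  from t obtain d where d: "f t = 0" "d \<noteq> 0" "(f has_real_derivative d) (at t)"
   unfolding mem_Collect_eq by (elim conjE exE)
  have "((%y. (f y - f t) / (y - t)) \<longlongrightarrow> d) (at t)" using d(3) by (simp add: has_field_derivative_iff)
  hence "\<forall>\<^sub>F y in at t. (f y - f t) / (y - t) \<noteq> 0" using d(2) by (rule tendsto_imp_eventually_ne)
  then obtain e where e: "e > 0" "\<And>y. y \<noteq> t ==> dist y t < e ==> (f y - f t) / (y - t) \<noteq> 0"
   by (auto simp: eventually_at)
  obtain q1 where q1: "q1 \<in> \<rat>" "t - e < q1" "q1 < t" using Rats_dense_in_real[of "t - e" t] e by auto
  obtain q2 where q2: "q2 \<in> \<rat>" "t < q2" "q2 < t + e" using Rats_dense_in_real[of t "t + e"] e by auto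
  have "y = t" if "q1 < y" "y < q2" "f y = 0" for y
  proof (rule ccontr)
   assume "y \<noteq> t"
   moreover have "dist y t < e" using that q1 q2 by (auto simp: dist_real_def)
   ultimately show False using e(2)[of y] d(1) that by simp
  qed
  hence "\<forall>y. q1 < y & y < q2 & f y = 0 --> y = t" by blast
  thus ?thesis
   unfolding mem_Times_iff by (intro exI[of _ "(q1, q2)"]) (simp only: fst_conv snd_conv q1(1,3) q2(1,2) simp_thms)
 qed
 hence "\<forall>t\<in>?S. \<exists>q. q \<in> \<rat> \<times> \<rat> & fst q < t & t < snd q & (\<forall>y. fst q < y & y < snd q & f y = 0 --> y = t)"
  by (rule ballI)
 from bchoice[OF this] obtain r where r: "\<And>t. t \<in> ?S ==> r t \<in> \<rat> \<times> \<rat> & fst (r t) < t & t < snd (r t) &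
   (\<forall>y. fst (r t) < y & y < snd (r t) & f y = 0 --> y = t)"
  by (elim exE) (rule that, drule bspec)
 have "inj_on r ?S"
 proof (rule inj_onI)
  fix s t assume st: "s \<in> ?S" "t \<in> ?S" "r s = r t"
  have 1: "fst (r t) < s" "s < snd (r t)" using r[OF st(1)] st(3) by simp_all
  have "f s = 0" using st(1) by simp
  thus "s = t" using r[OF st(2)] 1 by simp
 qed
 moreover have "countable (r ` ?S)"
 proof (rule countable_subset)
  show "r ` ?S \<subseteq> \<rat> \<times> \<rat>" using r by blast
  show "countable (\<rat> \<times> \<rat> :: (real \<times> real) set)" by (simp add: countable_rat)
 qed
 ultimately show ?thesis by (rule countable_image_inj_on[rotated])
qed

section \<open>Ordinary differential equations with globally Lipschitz right hand side\<close>

definition ode :: "('a::real_normed_vector => 'a) => (real => 'a) => bool" where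
 "ode f x \<longleftrightarrow> (\<forall>t\<ge>0. (x has_vector_derivative f (x t)) (at t within {0..}))"

text \<open>Picard iteration on the whole half-line at once, in a supremum norm with an exponential
  weight, which avoids patching local solutions.\<close>

theorem ode_exists:
 fixes f :: "'a::banach => 'a"
 assumes f: "L-lipschitz_on UNIV f"
 shows "\<exists>x. x 0 = x0 & ode f x"
proof -
 define K where "K = L + 1"
 have L0: "L >= 0" using f by (rule lipschitz_on_nonneg)
 have K: "K > 0" "L <= K" using L0 by (auto simp: K_def)
 have fK: "norm (f x - f y) <= K * norm (x - y)" for x y
  using lipschitz_onD[OF f, of x y] mult_right_mono[OF K(2), of "dist x y"] by (simp add: dist_norm)
 have cf: "continuous_on S f" for S
  by (rule continuous_on_subset[OF lipschitz_on_continuous_on[OF f]]) auto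
 \<comment> \<open>The unknown \<open>g\<close> is the rescaled deviation from \<open>x0\<close>;
   \<open>u g\<close> is the curve itself. The weight \<open>2 * K\<close> against the Lipschitz
   constant \<open>K\<close> gives the contraction factor 1/2, and \<open>K = L + 1\<close> is
   positive even for \<open>L = 0\<close>.\<close>
 define u where "u g s = x0 + exp (2 * K * s) *\<^sub>R apply_bcontfun g s" for g :: "real \<Rightarrow>\<^sub>C 'a" and s
 have cu: "continuous_on S (%s. f (u g s))" for g S
  unfolding u_def by (intro continuous_on_compose2[OF cf[of UNIV]] continuous_intros) auto
 have int: "(%s. f (u g s)) integrable_on {a..b}" for g a b
  by (rule integrable_continuous_real[OF cu])
 \<comment> \<open>Bounded continuous functions live on the whole line; \<open>max 0 t\<close>
   extends the integral operator to negative times by its value at 0.\<close>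
 define T0 where "T0 g t = exp (- (2 * K * max 0 t)) *\<^sub>R integral {0..max 0 t} (%s. f (u g s))" for g t
 have expint: "integral {0..t} (%s. exp (2 * K * s)) = (exp (2 * K * t) - 1) / (2 * K)" if "t >= 0" for t
 proof -
  have "((%s. exp (2 * K * s)) has_integral exp (2 * K * t) / (2 * K) - exp (2 * K * 0) / (2 * K)) {0..t}"
   by (rule fundamental_theorem_of_calculus[OF that])
    (auto intro!: derivative_eq_intros simp: has_real_derivative_iff_has_vector_derivative[symmetric] K less_imp_neq[OF K(1), symmetric])
  thus ?thesis by (simp add: integral_unique diff_divide_distrib)
 qed
 have half: "exp (- (2 * K * t)) * (K * N * ((exp (2 * K * t) - 1) / (2 * K))) <= N / 2" if "N >= 0" for t N
 proof -
  have "exp (- (2 * K * t)) * (K * N * ((exp (2 * K * t) - 1) / (2 * K))) = N / 2 * (1 - exp (- (2 * K * t)))"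
   using K(1) by (simp add: field_simps exp_minus)
  also have "... <= N / 2 * 1" using that by (intro mult_left_mono) auto
  finally show ?thesis by simp
 qed
 have diffT: "norm (T0 g t - T0 g' t) <= dist g g' / 2" for g g' t
 proof -
  define t' where "t' = max 0 t"
  have t': "t' >= 0" by (simp add: t'_def)
  have "norm (integral {0..t'} (%s. f (u g s)) - integral {0..t'} (%s. f (u g' s)))
    = norm (integral {0..t'} (%s. f (u g s) - f (u g' s)))"
   using int by (simp add: Henstock_Kurzweil_Integration.integral_diff)
  also have "... <= integral {0..t'} (%s. K * dist g g' * exp (2 * K * s))"
  proof (rule integral_norm_bound_integral)
   show "(%s. f (u g s) - f (u g' s)) integrable_on {0..t'}"
    using int by (intro integrable_diff)
   show "(%s. K * dist g g' * exp (2 * K * s)) integrable_on {0..t'}"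
    by (intro integrable_continuous_real continuous_intros)
   fix s
   have "norm (f (u g s) - f (u g' s)) <= K * norm (u g s - u g' s)" by (rule fK)
   also have "u g s - u g' s = exp (2 * K * s) *\<^sub>R (apply_bcontfun g s - apply_bcontfun g' s)"
    by (simp add: u_def scaleR_diff_right)
   also have "K * norm ... <= K * (exp (2 * K * s) * dist g g')"
    using dist_bounded[of g s g'] K(1) by (simp add: dist_norm)
   finally show "norm (f (u g s) - f (u g' s)) <= K * dist g g' * exp (2 * K * s)" by (simp add: mult_ac)
  qed
  also have "... = K * dist g g' * ((exp (2 * K * t') - 1) / (2 * K))"
   using expint[OF t'] by simp
  finally have *: "norm (integral {0..t'} (%s. f (u g s)) - integral {0..t'} (%s. f (u g' s)))
   <= K * dist g g' * ((exp (2 * K * t') - 1) / (2 * K))" .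
  have "norm (T0 g t - T0 g' t) = exp (- (2 * K * t')) *
    norm (integral {0..t'} (%s. f (u g s)) - integral {0..t'} (%s. f (u g' s)))"
   by (simp add: T0_def t'_def scaleR_diff_right[symmetric])
  also have "... <= exp (- (2 * K * t')) * (K * dist g g' * ((exp (2 * K * t') - 1) / (2 * K)))"
   using * by (intro mult_left_mono) auto
  also have "... <= dist g g' / 2" by (rule half) simp
  finally show ?thesis .
 qed
 have T0b: "T0 g \<in> bcontfun" for g
 proof -
  have u0: "u 0 s = x0" for s by (simp add: u_def)
  have 0: "norm (T0 0 t) <= norm (f x0) / K" for t
  proof -
   define t' where "t' = max 0 t"
   have t': "t' >= 0" by (simp add: t'_def)
   have "2 * K * t' <= exp (2 * K * t')" using exp_ge_add_one_self[of "2 * K * t'"] by linarith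
   hence "t' * exp (- (2 * K * t')) <= 1 / (2 * K)"
    using K(1) by (simp add: field_simps exp_minus)
   also have "... <= 1 / K" using K(1) by (simp add: field_simps)
   finally have "(t' * exp (- (2 * K * t'))) * norm (f x0) <= (1 / K) * norm (f x0)"
    by (rule mult_right_mono) simp
   thus ?thesis using t' by (simp add: T0_def u0 t'_def[symmetric] mult_ac)
  qed
  show ?thesis
  proof (rule bcontfun_normI)
   fix t
   have "norm (T0 g t) <= norm (T0 0 t) + norm (T0 g t - T0 0 t)"
    by (metis add.commute diff_add_cancel norm_triangle_ineq)
   thus "norm (T0 g t) <= norm (f x0) / K + dist g 0 / 2"
    using 0[of t] diffT[of g t 0] by linarith
  next
   have "continuous_on {0..b} (%t. integral {0..t} (%s. f (u g s)))" for b
    by (rule indefinite_integral_continuous_1[OF int])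
   hence *: "continuous_on {..<b} (%t. integral {0..max 0 t} (%s. f (u g s)))" for b
    by (rule continuous_on_compose2[where f="%t. max 0 t" and t="{0..max 0 b}"]) (auto intro!: continuous_intros)
   have "isCont (%t. integral {0..max 0 t} (%s. f (u g s))) t" for t
    using *[of "t + 1"] by (simp add: continuous_on_eq_continuous_at)
   hence "continuous_on UNIV (%t. integral {0..max 0 t} (%s. f (u g s)))"
    by (simp add: continuous_at_imp_continuous_on)
   thus "continuous_on UNIV (T0 g)"
    unfolding T0_def by (intro continuous_intros)
  qed
 qed
 define TT where "TT g = Bcontfun (T0 g)" for g
 have TT: "apply_bcontfun (TT g) = T0 g" for g
  unfolding TT_def by (rule Bcontfun_inverse[OF T0b])
 have "\<exists>!g. TT g = g"
 proof (rule banach_fix_type[of "1/2"])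
  show "\<forall>g g'. dist (TT g) (TT g') <= 1/2 * dist g g'"
  proof (intro allI dist_bound)
   fix g g' t
   show "dist (apply_bcontfun (TT g) t) (apply_bcontfun (TT g') t) <= 1/2 * dist g g'"
    using diffT[of g t g'] unfolding TT dist_norm[of "T0 g t"] by linarith
  qed
 qed auto
 then obtain g where g: "TT g = g" by blast
 have ug: "u g t = x0 + integral {0..t} (%s. f (u g s))" if "t >= 0" for t
 proof -
  have "apply_bcontfun g t = T0 g t" using TT[of g] g by simp
  thus ?thesis using that by (simp add: u_def[of g t] T0_def exp_minus)
 qed
 have "(u g has_vector_derivative f (u g t)) (at t within {0..})" if t: "t >= 0" for t
 proof -
  have "((%t. integral {0..t} (%s. f (u g s))) has_vector_derivative f (u g t)) (at t within {0..t+1})"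
   by (rule integral_has_vector_derivative[OF cu]) (use t in auto)
  hence "((%t. x0 + integral {0..t} (%s. f (u g s))) has_vector_derivative f (u g t)) (at t within {0..t+1})"
   by (auto intro!: derivative_eq_intros)
  hence "(u g has_vector_derivative f (u g t)) (at t within {0..t+1})"
   by (rule has_vector_derivative_transform[rotated 2]) (use ug t in auto)
  moreover have "at t within {0..t+1} = at t within {0..}"
   by (rule at_within_nhd[where S="{..<t+1}"]) auto
  ultimately show ?thesis by simp
 qed
 moreover have "u g 0 = x0" using ug[of 0] by simp
 ultimately show ?thesis unfolding ode_def by blast
qed

lemma gronwall:
 fixes f :: "real => real"
 assumes ab: "a <= b" and cont: "continuous_on {a..b} f"
  and der: "\<And>t. a < t ==> t < b ==> \<exists>d. (f has_real_derivative d) (at t) & d <= C * f t"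
 shows "f b <= exp (C * (b - a)) * f a"
proof -
 define g where "g t = exp (- C * t) * f t" for t
 have "g b <= g a"
 proof (rule DERIV_nonpos_imp_decreasing_open[OF ab])
  fix t assume "a < t" "t < b"
  then obtain d where d: "(f has_real_derivative d) (at t)" "d <= C * f t" using der by blast
  have "(g has_real_derivative exp (- C * t) * (d - C * f t)) (at t)"
  proof -
   have e: "((%t. exp (- C * t)) has_real_derivative - C * exp (- C * t)) (at t)"
    by (auto intro!: derivative_eq_intros)
   from DERIV_mult[OF e d(1)] show ?thesis unfolding g_def by (rule back_subst) (simp add: algebra_simps)
  qed
  moreover have "exp (- C * t) * (d - C * f t) <= 0" using d(2) by (simp add: mult_nonneg_nonpos)
  ultimately show "\<exists>y. DERIV g t :> y & y <= 0" by blast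
 qed (auto simp: g_def intro!: continuous_intros cont)
 hence "exp (- C * b) * f b <= exp (- C * a) * f a" by (simp add: g_def)
 thus ?thesis by (rule exp_weight_le)
qed

lemma ode_at:
 assumes "ode f x" "t > 0"
 shows "(x has_vector_derivative f (x t)) (at t)"
proof -
 have "at t within {0..} = at t"
  by (rule at_within_open_subset[of t "{0<..}"]) (use assms(2) in auto)
 moreover have "(x has_vector_derivative f (x t)) (at t within {0..})"
  using assms unfolding ode_def by (metis less_imp_le)
 ultimately show ?thesis by simp
qed

lemma ode_continuous:
 assumes "ode f x"
 shows "continuous_on {0..} x"
 unfolding continuous_on_eq_continuous_within
proof
 fix t :: real assume "t \<in> {0..}"
 hence "(x has_vector_derivative f (x t)) (at t within {0..})" using assms by (simp add: ode_def)
 thus "continuous (at t within {0..}) x" by (rule has_vector_derivative_continuous)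
qed

lemma ode_shift:
 assumes x: "ode f x" and s: "s >= 0"
 shows "ode f (%t. x (s + t))"
 unfolding ode_def
proof (intro allI impI)
 fix t :: real assume t: "t >= 0"
 have "((%t. x (s + t)) has_vector_derivative 1 *\<^sub>R f (x (s + t))) (at t within {0..})"
 proof (rule vector_diff_chain_within[where g=x and f="%t. s + t", unfolded o_def])
  show "((%t. s + t) has_vector_derivative 1) (at t within {0..})"
   by (auto intro!: derivative_eq_intros)
  have "(x has_vector_derivative f (x (s + t))) (at (s + t) within {0..})"
   using x s t by (simp add: ode_def)
  thus "(x has_vector_derivative f (x (s + t))) (at (s + t) within (+) s ` {0..})"
   by (rule has_vector_derivative_within_subset) (use s in auto)
 qed
 thus "((%t. x (s + t)) has_vector_derivative f (x (s + t))) (at t within {0..})" by simp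
qed

lemma ode_dist_le:
 fixes f :: "'a::real_inner => 'a"
 assumes f: "L-lipschitz_on UNIV f" and x: "ode f x" and y: "ode f y" and t: "t >= 0"
 shows "norm (x t - y t) <= exp (L * t) * norm (x 0 - y 0)"
proof -
 define V where "V t = (x t - y t) \<bullet> (x t - y t)" for t
 have "V t <= exp (2 * L * (t - 0)) * V 0"
 proof (rule gronwall[OF t])
  have "continuous_on {0..t} x" "continuous_on {0..t} y"
   using ode_continuous[OF x] ode_continuous[OF y] by (auto elim: continuous_on_subset)
  thus "continuous_on {0..t} V" unfolding V_def by (intro continuous_intros)
  fix s assume s: "0 < s" "s < t"
  have "(V has_real_derivative 2 * ((x s - y s) \<bullet> (f (x s) - f (y s)))) (at s)"
  proof -
   have d: "((%s. x s - y s) has_vector_derivative f (x s) - f (y s)) (at s)"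
    using ode_at[OF x s(1)] ode_at[OF y s(1)] by (rule has_vector_derivative_diff)
   have "(V has_derivative (%h. (x s - y s) \<bullet> (h *\<^sub>R (f (x s) - f (y s))) + (h *\<^sub>R (f (x s) - f (y s))) \<bullet> (x s - y s))) (at s)"
    unfolding V_def using d unfolding has_vector_derivative_def by (intro has_derivative_inner)
   moreover have "(%h. (x s - y s) \<bullet> (h *\<^sub>R (f (x s) - f (y s))) + (h *\<^sub>R (f (x s) - f (y s))) \<bullet> (x s - y s))
     = (*) (2 * ((x s - y s) \<bullet> (f (x s) - f (y s))))"
    by (rule ext) (simp only: inner_scaleR_left inner_scaleR_right inner_commute[of "f (x s) - f (y s)"], simp)
   ultimately show ?thesis by (simp only: has_field_derivative_def)
  qed
  moreover have "2 * ((x s - y s) \<bullet> (f (x s) - f (y s))) <= 2 * L * V s"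
  proof -
   have "(x s - y s) \<bullet> (f (x s) - f (y s)) <= norm (x s - y s) * norm (f (x s) - f (y s))"
    by (rule norm_cauchy_schwarz)
   also have "... <= norm (x s - y s) * (L * norm (x s - y s))"
    using lipschitz_onD[OF f, of "x s" "y s"] by (intro mult_left_mono) (auto simp: dist_norm)
   finally show ?thesis by (simp add: V_def power2_norm_eq_inner[symmetric] power2_eq_square mult_ac)
  qed
  ultimately show "\<exists>d. (V has_real_derivative d) (at s) & d <= 2 * L * V s" by blast
 qed
 also have "exp (2 * L * (t - 0)) = exp (L * t) * exp (L * t)" by (simp add: exp_add[symmetric] algebra_simps)
 finally have "(norm (x t - y t))\<^sup>2 <= (exp (L * t) * norm (x 0 - y 0))\<^sup>2"
  by (simp add: V_def power2_norm_eq_inner[symmetric] power_mult_distrib power2_eq_square mult_ac)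
 thus ?thesis by (rule power2_le_imp_le) simp
qed

section \<open>The cooperative order and the comparison principle\<close>

abbreviation Wc :: "state3 => real" where "Wc z \<equiv> fst z"
abbreviation Pc :: "state3 => real" where "Pc z \<equiv> fst (snd z)"
abbreviation Nc :: "state3 => real" where "Nc z \<equiv> snd (snd z)"

section \<open>Coordinates: the three fast variables and the slow one\<close>

definition zp :: "state4 => state3" where "zp v = (fst v, fst (snd v), fst (snd (snd v)))"
definition Xc :: "state4 => real" where "Xc v = snd (snd (snd v))"
definition mk :: "state3 => real => state4" where "mk z x = (fst z, fst (snd z), snd (snd z), x)"

lemma zp_mk [simp]: "zp (mk z x) = z" and Xc_mk [simp]: "Xc (mk z x) = x"
 and mk_zp_Xc [simp]: "mk (zp v) (Xc v) = v"
 by (simp_all add: zp_def Xc_def mk_def)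

lemma mk_add: "mk z x + mk z' x' = mk (z + z') (x + x')"
 and mk_scaleR: "c *\<^sub>R mk z x = mk (c *\<^sub>R z) (c * x)"
 and mk_diff: "mk z x - mk z' x' = mk (z - z') (x - x')"
 by (simp_all add: mk_def)

lemma mk_eq_iff: "mk z x = mk z' x' \<longleftrightarrow> z = z' & x = x'"
 by (auto simp: mk_def prod_eq_iff)

lemma bounded_linear_zp: "bounded_linear zp"
 unfolding zp_def by (intro bounded_linear_Pair bounded_linear_fst bounded_linear_compose[OF bounded_linear_fst bounded_linear_snd]
  bounded_linear_compose[OF bounded_linear_fst] bounded_linear_compose[OF bounded_linear_snd] bounded_linear_snd)

lemma bounded_linear_Xc: "bounded_linear Xc"
 unfolding Xc_def by (intro bounded_linear_compose[OF bounded_linear_snd] bounded_linear_snd)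

lemma norm_zp_le: "norm (zp v) <= norm v"
proof (rule power2_le_imp_le)
 show "(norm (zp v))\<^sup>2 <= (norm v)\<^sup>2"
  by (cases v) (simp add: zp_def norm_Pair)
qed simp

lemma norm_Xc_le: "\<bar>Xc v\<bar> <= norm v"
proof -
 have "\<bar>Xc v\<bar> <= norm (snd (snd v))" using norm_snd_le[of "snd (snd (snd v))" "fst (snd (snd v))"] by (simp add: Xc_def)
 also have "... <= norm (snd v)" using norm_snd_le[of "snd (snd v)" "fst (snd v)"] by simp
 also have "... <= norm v" using norm_snd_le[of "snd v" "fst v"] by simp
 finally show ?thesis .
qed

lemma norm_mk_le: "norm (mk z x) <= norm z + \<bar>x\<bar>"
proof (rule power2_le_imp_le)
 have "0 <= norm z * \<bar>x\<bar>" by simp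
 thus "(norm (mk z x))\<^sup>2 <= (norm z + \<bar>x\<bar>)\<^sup>2"
  by (cases z) (simp add: mk_def norm_Pair power2_sum)
qed simp

lemma abs_Wc_le: "\<bar>Wc z\<bar> <= norm z" and abs_Pc_le: "\<bar>Pc z\<bar> <= norm z" and abs_Nc_le: "\<bar>Nc z\<bar> <= norm z"
proof -
 have 1: "norm (snd z) <= norm z" using norm_snd_le[of "snd z" "fst z"] by simp
 show "\<bar>Wc z\<bar> <= norm z" using norm_fst_le[of "fst z" "snd z"] by simp
 show "\<bar>Pc z\<bar> <= norm z" using norm_fst_le[of "fst (snd z)" "snd (snd z)"] 1 by simp
 show "\<bar>Nc z\<bar> <= norm z" using norm_snd_le[of "snd (snd z)" "fst (snd z)"] 1 by simp
qed

lemma norm3_le: "norm (z :: state3) <= \<bar>Wc z\<bar> + \<bar>Pc z\<bar> + \<bar>Nc z\<bar>"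
proof -
 have "norm (fst z, snd z) <= norm (fst z) + norm (snd z)" by (rule norm_Pair_le)
 moreover have "norm (fst (snd z), snd (snd z)) <= norm (fst (snd z)) + norm (snd (snd z))" by (rule norm_Pair_le)
 ultimately show ?thesis by simp
qed

lemma vd_fst: "(x has_vector_derivative d) F ==> ((%t. fst (x t)) has_vector_derivative fst d) F"
 and vd_snd: "(x has_vector_derivative d) F ==> ((%t. snd (x t)) has_vector_derivative snd d) F"
 by (rule bounded_linear.has_vector_derivative[OF bounded_linear_fst], assumption)
  (rule bounded_linear.has_vector_derivative[OF bounded_linear_snd], assumption)

lemma vd_comps:
 assumes "(x has_vector_derivative d) F"
 shows "((%t. Wc (x t)) has_real_derivative Wc d) F"
  "((%t. Pc (x t)) has_real_derivative Pc d) F"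
  "((%t. Nc (x t)) has_real_derivative Nc d) F"
 unfolding has_real_derivative_iff_has_vector_derivative
 by (rule vd_fst[OF assms], rule vd_fst[OF vd_snd[OF assms]], rule vd_snd[OF vd_snd[OF assms]])

lemma vd_zp: "(x has_vector_derivative d) F ==> ((%t. zp (x t)) has_vector_derivative zp d) F"
 by (rule bounded_linear.has_vector_derivative[OF bounded_linear_zp])

lemma vd_Xc: "(x has_vector_derivative d) F ==> ((%t. Xc (x t)) has_real_derivative Xc d) F"
 unfolding has_real_derivative_iff_has_vector_derivative
 by (rule bounded_linear.has_vector_derivative[OF bounded_linear_Xc])

lemma lips_zp: "lips I x ==> lips I (%t. zp (x t))"
proof (rule lips_comp[where F=zp])
 show "1-lipschitz_on UNIV zp"
 proof (rule lipschitz_onI)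
  fix v v' show "dist (zp v) (zp v') <= 1 * dist v v'"
   using norm_zp_le[of "v - v'"] by (simp add: dist_norm linear_diff[OF bounded_linear.linear[OF bounded_linear_zp]])
 qed simp
qed

lemma lips_Xc: "lips I x ==> lips I (%t. Xc (x t))"
proof (rule lips_comp[where F=Xc])
 show "1-lipschitz_on UNIV Xc"
 proof (rule lipschitz_onI)
  fix v v' show "dist (Xc v) (Xc v') <= 1 * dist v v'"
   using norm_Xc_le[of "v - v'"] by (simp add: dist_norm linear_diff[OF bounded_linear.linear[OF bounded_linear_Xc]])
 qed simp
qed

lemma lips_comps:
 assumes "lips I x"
 shows "lips I (%t. Wc (x t))" "lips I (%t. Pc (x t))" "lips I (%t. Nc (x t))"
 by (rule lips_fst[OF assms], rule lips_fst[OF lips_snd[OF assms]], rule lips_snd[OF lips_snd[OF assms]])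

text \<open>The system is cooperative for this order, in which the southern ice line is reversed.\<close>

definition le3 :: "state3 => state3 => bool" where
 "le3 x y \<longleftrightarrow> Wc x <= Wc y & Pc y <= Pc x & Nc x <= Nc y"

lemma le3_refl [simp]: "le3 x x" by (simp add: le3_def)
lemma le3_trans: "le3 x y ==> le3 y z ==> le3 x z" by (auto simp: le3_def)
lemma le3_antisym: "le3 x y ==> le3 y x ==> x = y" by (auto simp: le3_def prod_eq_iff)
lemma le3_add_iff [simp]: "le3 (x + z) (y + z) \<longleftrightarrow> le3 x y" by (auto simp: le3_def)
lemma closed_le3: "closed {x. le3 x c}" "closed {x. le3 c x}"
 unfolding le3_def by (intro closed_Collect_conj closed_Collect_le continuous_intros)+

text \<open>Clamping the ice lines makes the fields globally Lipschitz, so that flows exist for all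
  times; on the physical domain the fields are unchanged.\<close>

definition cl :: "real => real" where "cl y = max (-1) (min 1 y)"

lemma cl_bounds: "-1 <= cl y" "cl y <= 1" by (auto simp: cl_def)
lemma cl_id: "-1 <= y ==> y <= 1 ==> cl y = y" by (auto simp: cl_def)
lemma cl_mono: "x <= y ==> cl x <= cl y" by (auto simp: cl_def)
lemma cl_lip: "\<bar>cl x - cl y\<bar> <= \<bar>x - y\<bar>" unfolding cl_def max_def min_def by (simp split: if_splits)

text \<open>The model in reduced form: \<open>q\<close> is minus the insolation coefficient of
  degree two, \<open>k\<close> and \<open>G0\<close> describe the ice line equations, \<kappa> and
  \<open>F0\<close> the heat balance, and \<open>dl\<close> is the difference of the two critical
  temperatures. By \<open>disc\<close> a quadratic polynomial has no real root, which keeps the ice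
  lines of equilibria on opposite sides of the equator.\<close>

locale climate =
 fixes B r \<kappa> k q F0 G0 a b bm bp dl :: real
 assumes B: "B > 0" and r: "r > 0" and \<kappa>: "\<kappa> > 0" and k: "k > 0" and q: "0 < q" "q < 1"
  and disc: "(\<kappa> * (1 + q / 2))\<^sup>2 < 4 * k * (G0 - F0)"
  and ab: "0 < a" "a < b" and bs: "0 < bm" "bm < b" "b < bp" and dl: "dl > 0"
begin

text \<open>A primitive of the insolation \<open>sd\<close>, so that the integral in the heat
  balance becomes a difference of two values of \<open>Phi\<close>.\<close>

definition Phi :: "real => real" where "Phi y = y + q / 2 * (y - y ^ 3)"
definition sd :: "real => real" where "sd y = 1 + q / 2 - 3 * q / 2 * y\<^sup>2"
definition ph :: "real => real" where "ph y = Phi (cl y)"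
definition gg :: "real => real" where "gg y = G0 + k * (cl y)\<^sup>2"

definition fld :: "real => state3 => state3" where
 "fld \<tau> z = (B * (F0 + \<kappa> * (ph (Nc z) - ph (Pc z)) - Wc z), - r * (Wc z - gg (Pc z)), r * (Wc z - gg (Nc z) - \<tau>))"

definition Xi :: "real => real => real => real" where
 "Xi \<beta> n x = \<beta> * (n - x) - a * (1 - n)"

definition fld4 :: "real => real => real => state4 => state4" where
 "fld4 \<tau> \<beta> ep v = mk (fld \<tau> (zp v)) (ep * Xi \<beta> (Nc (zp v)) (Xc v))"

lemma sd_bounds: "-1 <= y ==> y <= 1 ==> 1 - q <= sd y" "sd y <= 1 + q / 2"
proof -
 show "sd y <= 1 + q / 2" using q by (simp add: sd_def)
 assume "-1 <= y" "y <= 1"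
 hence "y\<^sup>2 <= 1" by (simp add: abs_square_le_1 abs_le_iff)
 hence "q * y\<^sup>2 <= q * 1" using q by (intro mult_left_mono) auto
 thus "1 - q <= sd y" by (simp add: sd_def)
qed

lemma sd_pos: "-1 <= y ==> y <= 1 ==> sd y > 0" using sd_bounds(1)[of y] q by linarith

lemma Phi_deriv: "(Phi has_real_derivative sd y) (at y within S)"
 unfolding Phi_def sd_def by (auto intro!: derivative_eq_intros simp: field_simps power2_eq_square)

lemma Phi_diff: "Phi x - Phi y = (x - y) * (1 + q / 2 - q / 2 * (x\<^sup>2 + x * y + y\<^sup>2))"
 by (simp add: Phi_def power2_eq_square power3_eq_cube field_simps)

lemma Phi_mono_lip:
 assumes "-1 <= x" "x <= y" "y <= 1"
 shows "0 <= Phi y - Phi x" "Phi y - Phi x <= 2 * (y - x)"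
proof -
 have sq: "x\<^sup>2 <= 1" "y\<^sup>2 <= 1" using assms by (simp_all add: abs_square_le_1 abs_le_iff)
 have "2 * (y * x) <= y\<^sup>2 + x\<^sup>2" using sum_squares_bound[of y x] by simp
 hence u: "y\<^sup>2 + y * x + x\<^sup>2 <= 3" using sq by linarith
 have "0 <= (y + x)\<^sup>2" by simp
 hence l: "0 <= y\<^sup>2 + y * x + x\<^sup>2" unfolding power2_sum using sq zero_le_power2[of x] zero_le_power2[of y] by linarith
 define m where "m = 1 + q / 2 - q / 2 * (y\<^sup>2 + y * x + x\<^sup>2)"
 have "q / 2 * (y\<^sup>2 + y * x + x\<^sup>2) <= q / 2 * 3" "0 <= q / 2 * (y\<^sup>2 + y * x + x\<^sup>2)"
  using u l q by (auto intro!: mult_left_mono mult_nonneg_nonneg)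
 hence m: "0 <= m" "m <= 2" using q unfolding m_def by linarith+
 have e: "Phi y - Phi x = (y - x) * m" unfolding m_def by (rule Phi_diff)
 show "0 <= Phi y - Phi x" unfolding e using assms m by simp
 have "(y - x) * m <= (y - x) * 2" using assms m by (intro mult_left_mono) auto
 thus "Phi y - Phi x <= 2 * (y - x)" unfolding e by simp
qed

lemma ph_mono: "x <= y ==> ph x <= ph y"
 using Phi_mono_lip(1)[OF cl_bounds(1) cl_mono cl_bounds(2), of x y] by (simp add: ph_def)

lemma ph_lip: "\<bar>ph x - ph y\<bar> <= 2 * \<bar>x - y\<bar>"
proof -
 have *: "\<bar>ph x - ph y\<bar> <= 2 * \<bar>x - y\<bar>" if "x <= y" for x y
 proof -
  have "\<bar>ph x - ph y\<bar> = Phi (cl y) - Phi (cl x)" using ph_mono[OF that] by (simp add: ph_def)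
  also have "... <= 2 * (cl y - cl x)" by (rule Phi_mono_lip(2)[OF cl_bounds(1) cl_mono[OF that] cl_bounds(2)])
  also have "... <= 2 * \<bar>x - y\<bar>" using cl_lip[of x y] by (simp add: abs_le_iff)
  finally show ?thesis .
 qed
 show ?thesis using *[of x y] *[of y x] by (cases "x <= y") (simp_all add: abs_minus_commute)
qed

text \<open>Monotonicity together with the Lipschitz bound: only a violation of the order
  contributes, which is what the comparison principle needs.\<close>

lemma ph_pos_part: "ph x - ph y <= 2 * max 0 (x - y)"
proof (cases "x <= y")
 case True thus ?thesis using ph_mono[OF True] by simp
next
 case False thus ?thesis using ph_lip[of x y] by (simp add: abs_le_iff)
qed

lemma gg_lip: "\<bar>gg x - gg y\<bar> <= 2 * k * \<bar>x - y\<bar>"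
proof -
 have "gg x - gg y = k * ((cl x - cl y) * (cl x + cl y))"
  by (simp add: gg_def power2_eq_square algebra_simps)
 hence "\<bar>gg x - gg y\<bar> = k * (\<bar>cl x - cl y\<bar> * \<bar>cl x + cl y\<bar>)"
  using k by (simp add: abs_mult)
 also have "... <= k * (\<bar>x - y\<bar> * 2)"
  using cl_lip[of x y] cl_bounds[of x] cl_bounds[of y] k by (intro mult_left_mono mult_mono) (auto simp: abs_le_iff)
 finally show ?thesis by simp
qed

text \<open>\<open>V\<close> is the sum of the squared violations of the order. By cooperativity
  each violation is driven only by violations of the other components and by itself, so
  \<open>V' <= C * V\<close>, and \<open>V\<close> starts at 0. The exceptional null set admits
  solutions of the inclusion as well as classical orbits.\<close>

lemma compare:
 fixes x y :: "real => state3"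
 assumes st: "s <= t" and lx: "lips {s..t} x" and ly: "lips {s..t} y" and Z: "negligible Z"
  and der: "\<And>u. u \<in> {s<..<t} - Z ==> \<exists>d e. (x has_vector_derivative d) (at u) & (y has_vector_derivative e) (at u)
    & le3 d (fld \<tau> (x u)) & le3 (fld \<tau> (y u)) e"
  and init: "le3 (x s) (y s)"
 shows "le3 (x t) (y t)"
proof -
 define mw where "mw u = max 0 (Wc (x u) - Wc (y u))" for u
 define mp where "mp u = max 0 (Pc (y u) - Pc (x u))" for u
 define mn where "mn u = max 0 (Nc (x u) - Nc (y u))" for u
 have m0: "mw u >= 0" "mp u >= 0" "mn u >= 0" for u by (simp_all add: mw_def mp_def mn_def)
 define V where "V u = (mw u)\<^sup>2 + (mp u)\<^sup>2 + (mn u)\<^sup>2" for u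
 define C where "C = 4 * (B * \<kappa>) + 2 * r + 4 * (r * k)"
 have lV: "lips {s..t} V"
  unfolding V_def mw_def mp_def mn_def
  by (intro lips_add lips_power lips_max lips_diff lips_comps lx ly)
 have "V t <= exp (C * (t - s)) * V s"
 proof (rule gronwall_ae[OF lV st Z])
  fix u assume "u \<in> {s<..<t} - Z"
  then obtain d e where d: "(x has_vector_derivative d) (at u)" "(y has_vector_derivative e) (at u)"
    "le3 d (fld \<tau> (x u))" "le3 (fld \<tau> (y u)) e"
   using der by blast
  note dx = vd_comps[OF d(1)] and dy = vd_comps[OF d(2)]
  define D where "D = 2 * mw u * (Wc d - Wc e) + 2 * mp u * (Pc e - Pc d) + 2 * mn u * (Nc d - Nc e)"
  have "(V has_real_derivative D) (at u)"
   unfolding V_def D_def mw_def mp_def mn_def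
   by (intro DERIV_add has_derivative_pos_part_sq DERIV_diff dx dy)
  moreover have "D <= C * V u"
  proof -
   have 1: "mw u * (Wc d - Wc e) <= mw u * (2 * (B * \<kappa>) * (mn u + mp u))"
   proof (cases "mw u = 0")
    case False
    hence w: "Wc (x u) > Wc (y u)" by (auto simp: mw_def max_def split: if_splits)
    have "Wc d - Wc e <= Wc (fld \<tau> (x u)) - Wc (fld \<tau> (y u))" using d(3,4) by (simp add: le3_def)
    also have "... = B * (\<kappa> * ((ph (Nc (x u)) - ph (Nc (y u))) + (ph (Pc (y u)) - ph (Pc (x u)))) - (Wc (x u) - Wc (y u)))"
     by (simp add: fld_def algebra_simps)
    also have "... <= B * (\<kappa> * (2 * mn u + 2 * mp u))"
    proof (rule mult_left_mono)
     have "\<kappa> * ((ph (Nc (x u)) - ph (Nc (y u))) + (ph (Pc (y u)) - ph (Pc (x u)))) <= \<kappa> * (2 * mn u + 2 * mp u)"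
      unfolding mn_def mp_def using \<kappa> by (intro mult_left_mono add_mono ph_pos_part) auto
     thus "\<kappa> * ((ph (Nc (x u)) - ph (Nc (y u))) + (ph (Pc (y u)) - ph (Pc (x u)))) - (Wc (x u) - Wc (y u))
       <= \<kappa> * (2 * mn u + 2 * mp u)" using w by linarith
    qed (use B in simp)
    finally have "Wc d - Wc e <= 2 * (B * \<kappa>) * (mn u + mp u)" by (simp add: algebra_simps)
    thus ?thesis using m0 by (intro mult_left_mono)
   qed simp
   have 2: "mp u * (Pc e - Pc d) <= mp u * (r * mw u + 2 * (r * k) * mp u)"
   proof (cases "mp u = 0")
    case False
    hence w: "Pc (y u) > Pc (x u)" by (auto simp: mp_def max_def split: if_splits)
    have "Pc e - Pc d <= Pc (fld \<tau> (y u)) - Pc (fld \<tau> (x u))" using d(3,4) by (simp add: le3_def)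
    also have "... = r * ((Wc (x u) - Wc (y u)) + (gg (Pc (y u)) - gg (Pc (x u))))"
     by (simp add: fld_def algebra_simps)
    also have "... <= r * (mw u + 2 * k * mp u)"
     using gg_lip[of "Pc (y u)" "Pc (x u)"] w r
     by (intro mult_left_mono add_mono) (auto simp: mw_def mp_def)
    finally have "Pc e - Pc d <= r * mw u + 2 * (r * k) * mp u" by (simp add: algebra_simps)
    thus ?thesis using m0 by (intro mult_left_mono)
   qed simp
   have 3: "mn u * (Nc d - Nc e) <= mn u * (r * mw u + 2 * (r * k) * mn u)"
   proof (cases "mn u = 0")
    case False
    hence w: "Nc (x u) > Nc (y u)" by (auto simp: mn_def max_def split: if_splits)
    have "Nc d - Nc e <= Nc (fld \<tau> (x u)) - Nc (fld \<tau> (y u))" using d(3,4) by (simp add: le3_def)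
    also have "... = r * ((Wc (x u) - Wc (y u)) + (gg (Nc (y u)) - gg (Nc (x u))))"
     by (simp add: fld_def algebra_simps)
    also have "... <= r * (mw u + 2 * k * mn u)"
     using gg_lip[of "Nc (y u)" "Nc (x u)"] w r
     by (intro mult_left_mono add_mono) (auto simp: mw_def mn_def)
    finally have "Nc d - Nc e <= r * mw u + 2 * (r * k) * mn u" by (simp add: algebra_simps)
    thus ?thesis using m0 by (intro mult_left_mono)
   qed simp
   define A where "A = mw u" define P where "P = mp u" define N where "N = mn u"
   \<comment> \<open>Turns the cross products of violations into squares; \<open>C\<close> collects
     the resulting coefficients.\<close>
   have am: "2 * (A * P) <= A\<^sup>2 + P\<^sup>2" "2 * (A * N) <= A\<^sup>2 + N\<^sup>2"
    using sum_squares_bound[of A P] sum_squares_bound[of A N] by simp_all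
   define K1 where "K1 = B * \<kappa>" define K2 where "K2 = r * k"
   have K: "K1 > 0" "K2 > 0" using B \<kappa> r k by (simp_all add: K1_def K2_def)
   have "D <= 2 * (A * (2 * K1 * (N + P))) + 2 * (P * (r * A + 2 * K2 * P)) + 2 * (N * (r * A + 2 * K2 * N))"
    using 1 2 3 unfolding D_def A_def P_def N_def K1_def K2_def by linarith
   also have "... = 2 * K1 * (2 * (A * N)) + 2 * K1 * (2 * (A * P)) + r * (2 * (A * P)) + r * (2 * (A * N)) + 4 * K2 * (P\<^sup>2 + N\<^sup>2)"
    by (simp add: algebra_simps power2_eq_square)
   also have "... <= 2 * K1 * (A\<^sup>2 + N\<^sup>2) + 2 * K1 * (A\<^sup>2 + P\<^sup>2) + r * (A\<^sup>2 + P\<^sup>2) + r * (A\<^sup>2 + N\<^sup>2) + 4 * K2 * (P\<^sup>2 + N\<^sup>2)"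
    using am K r by (intro add_mono mult_left_mono) auto
   also have "... <= (4 * K1 + 2 * r + 4 * K2) * (A\<^sup>2 + P\<^sup>2 + N\<^sup>2)"
   proof -
    have "0 <= 4 * K2 * A\<^sup>2 + (2 * K1 + r) * (P\<^sup>2 + N\<^sup>2)" using K r by simp
    thus ?thesis by (simp add: algebra_simps)
   qed
   finally show ?thesis by (simp add: C_def V_def K1_def K2_def A_def P_def N_def)
  qed
  ultimately show "\<exists>d. (V has_real_derivative d) (at u) & d <= C * V u" by blast
 qed
 also have "V s = 0" using init by (simp add: V_def mw_def mp_def mn_def le3_def)
 finally have "V t <= 0" by simp
 moreover have "0 <= (mw t)\<^sup>2" "0 <= (mp t)\<^sup>2" "0 <= (mn t)\<^sup>2" by simp_all
 ultimately have "(mw t)\<^sup>2 = 0" "(mp t)\<^sup>2 = 0" "(mn t)\<^sup>2 = 0" unfolding V_def by linarith+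
 hence "mw t = 0" "mp t = 0" "mn t = 0" by simp_all
 thus ?thesis by (simp add: le3_def mw_def mp_def mn_def max_def split: if_splits)
qed

text \<open>The critical temperature enters additively, so one constant serves all \<tau>.\<close>

lemma fld_lipschitz: "\<exists>L>0. \<forall>\<tau>. L-lipschitz_on UNIV (fld \<tau>)"
proof -
 define L where "L = B * (4 * \<kappa> + 1) + 2 * (r * (1 + 2 * k))"
 have L: "L > 0" using B \<kappa> r k unfolding L_def by (intro add_pos_pos mult_pos_pos) auto
 have "L-lipschitz_on UNIV (fld \<tau>)" for \<tau>
 proof (rule lipschitz_onI)
  fix x y :: state3
  define D where "D = norm (x - y)"
  have c: "\<bar>Wc x - Wc y\<bar> <= D" "\<bar>Pc x - Pc y\<bar> <= D" "\<bar>Nc x - Nc y\<bar> <= D"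
   using abs_Wc_le[of "x - y"] abs_Pc_le[of "x - y"] abs_Nc_le[of "x - y"] by (simp_all add: D_def)
  have p: "\<bar>ph (Nc x) - ph (Nc y)\<bar> <= 2 * D" "\<bar>ph (Pc x) - ph (Pc y)\<bar> <= 2 * D"
   by (rule order_trans[OF ph_lip], use c in simp)+
  have g: "\<bar>gg (Nc x) - gg (Nc y)\<bar> <= 2 * k * D" "\<bar>gg (Pc x) - gg (Pc y)\<bar> <= 2 * k * D"
   by (rule order_trans[OF gg_lip], use c k in \<open>simp add: mult_left_mono\<close>)+
  have "Wc (fld \<tau> x) - Wc (fld \<tau> y) = B * (\<kappa> * ((ph (Nc x) - ph (Nc y)) - (ph (Pc x) - ph (Pc y))) - (Wc x - Wc y))"
   by (simp add: fld_def algebra_simps)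
  also have "\<bar>...\<bar> <= B * (\<kappa> * (2 * D + 2 * D) + D)"
  proof -
   have "\<bar>(ph (Nc x) - ph (Nc y)) - (ph (Pc x) - ph (Pc y))\<bar> <= 2 * D + 2 * D" using p by linarith
   hence "\<bar>\<kappa> * ((ph (Nc x) - ph (Nc y)) - (ph (Pc x) - ph (Pc y)))\<bar> <= \<kappa> * (2 * D + 2 * D)"
    using \<kappa> by (simp only: abs_mult abs_of_pos mult_left_mono less_imp_le)
   hence "\<bar>\<kappa> * ((ph (Nc x) - ph (Nc y)) - (ph (Pc x) - ph (Pc y))) - (Wc x - Wc y)\<bar> <= \<kappa> * (2 * D + 2 * D) + D"
    using c(1) by linarith
   thus ?thesis using B by (simp only: abs_mult abs_of_pos mult_left_mono less_imp_le)
  qed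
  finally have 1: "\<bar>Wc (fld \<tau> x) - Wc (fld \<tau> y)\<bar> <= B * (4 * \<kappa> + 1) * D" by (simp add: algebra_simps)
  have "Pc (fld \<tau> x) - Pc (fld \<tau> y) = r * ((gg (Pc x) - gg (Pc y)) - (Wc x - Wc y))"
   by (simp add: fld_def algebra_simps)
  also have "\<bar>...\<bar> <= r * (2 * k * D + D)"
  proof -
   have "\<bar>(gg (Pc x) - gg (Pc y)) - (Wc x - Wc y)\<bar> <= 2 * k * D + D" using g c by linarith
   thus ?thesis using r by (simp only: abs_mult abs_of_pos mult_left_mono less_imp_le)
  qed
  finally have 2: "\<bar>Pc (fld \<tau> x) - Pc (fld \<tau> y)\<bar> <= r * (1 + 2 * k) * D" by (simp add: algebra_simps)
  have "Nc (fld \<tau> x) - Nc (fld \<tau> y) = r * ((Wc x - Wc y) - (gg (Nc x) - gg (Nc y)))"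
   by (simp add: fld_def algebra_simps)
  also have "\<bar>...\<bar> <= r * (2 * k * D + D)"
  proof -
   have "\<bar>(Wc x - Wc y) - (gg (Nc x) - gg (Nc y))\<bar> <= 2 * k * D + D" using g c by linarith
   thus ?thesis using r by (simp only: abs_mult abs_of_pos mult_left_mono less_imp_le)
  qed
  finally have 3: "\<bar>Nc (fld \<tau> x) - Nc (fld \<tau> y)\<bar> <= r * (1 + 2 * k) * D" by (simp add: algebra_simps)
  have "norm (fld \<tau> x - fld \<tau> y) <= \<bar>Wc (fld \<tau> x) - Wc (fld \<tau> y)\<bar> + \<bar>Pc (fld \<tau> x) - Pc (fld \<tau> y)\<bar> + \<bar>Nc (fld \<tau> x) - Nc (fld \<tau> y)\<bar>"
   using norm3_le[of "fld \<tau> x - fld \<tau> y"] by simp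
  also have "... <= B * (4 * \<kappa> + 1) * D + r * (1 + 2 * k) * D + r * (1 + 2 * k) * D" using 1 2 3 by linarith
  also have "... = L * D" by (simp add: L_def algebra_simps)
  finally show "dist (fld \<tau> x) (fld \<tau> y) <= L * dist x y" by (simp add: dist_norm D_def)
 qed (use L in simp)
 thus ?thesis using L by blast
qed

definition Lf :: real where "Lf = (SOME L. L > 0 & (\<forall>\<tau>. L-lipschitz_on UNIV (fld \<tau>)))"

lemma Lf: "Lf > 0" "Lf-lipschitz_on UNIV (fld \<tau>)"
 using someI_ex[OF fld_lipschitz] by (simp_all add: Lf_def)

lemma fld_continuous: "continuous_on S (fld \<tau>)"
 using lipschitz_on_continuous_on[OF Lf(2)] by (rule continuous_on_subset) simp

lemma fld4_lipschitz: "\<exists>L>0. L-lipschitz_on UNIV (fld4 \<tau> \<beta> ep)"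
proof -
 define M where "M = \<bar>ep\<bar> * (2 * \<bar>\<beta>\<bar> + a)"
 have M: "M >= 0" using ab by (simp add: M_def)
 have "(Lf + M)-lipschitz_on UNIV (fld4 \<tau> \<beta> ep)"
 proof (rule lipschitz_onI)
  fix v v' :: state4
  have z: "zp v - zp v' = zp (v - v')" "Xc v - Xc v' = Xc (v - v')" by (simp_all add: zp_def Xc_def)
  define D where "D = norm (v - v')"
  have c: "norm (zp v - zp v') <= D" "\<bar>Xc v - Xc v'\<bar> <= D"
   unfolding z D_def by (rule norm_zp_le, rule norm_Xc_le)
  have "\<bar>Nc (zp v - zp v')\<bar> <= D" using abs_Nc_le c(1) by (rule order_trans)
  hence c: "norm (zp v - zp v') <= D" "\<bar>Xc v - Xc v'\<bar> <= D" "\<bar>Nc (zp v) - Nc (zp v')\<bar> <= D"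
   using c by simp_all
  have "norm (fld \<tau> (zp v) - fld \<tau> (zp v')) <= Lf * norm (zp v - zp v')"
   using lipschitz_onD[OF Lf(2), of "zp v" "zp v'"] by (simp add: dist_norm)
  also have "... <= Lf * D" using c Lf(1) by simp
  finally have 1: "norm (fld \<tau> (zp v) - fld \<tau> (zp v')) <= Lf * D" .
  have "ep * Xi \<beta> (Nc (zp v)) (Xc v) - ep * Xi \<beta> (Nc (zp v')) (Xc v')
   = ep * (\<beta> * ((Nc (zp v) - Nc (zp v')) - (Xc v - Xc v')) + a * (Nc (zp v) - Nc (zp v')))"
   by (simp add: Xi_def algebra_simps)
  also have "\<bar>...\<bar> <= \<bar>ep\<bar> * (\<bar>\<beta>\<bar> * (2 * D) + a * D)"
  proof -
   have "\<bar>\<beta> * ((Nc (zp v) - Nc (zp v')) - (Xc v - Xc v'))\<bar> <= \<bar>\<beta>\<bar> * (2 * D)"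
    unfolding abs_mult using c by (intro mult_left_mono) linarith+
   moreover have "\<bar>a * (Nc (zp v) - Nc (zp v'))\<bar> <= a * D" using ab c by (simp add: abs_mult)
   ultimately have "\<bar>\<beta> * ((Nc (zp v) - Nc (zp v')) - (Xc v - Xc v')) + a * (Nc (zp v) - Nc (zp v'))\<bar> <= \<bar>\<beta>\<bar> * (2 * D) + a * D"
    by linarith
   thus ?thesis unfolding abs_mult[of ep] by (intro mult_left_mono) auto
  qed
  also have "... = M * D" by (simp add: M_def algebra_simps)
  finally have 2: "\<bar>ep * Xi \<beta> (Nc (zp v)) (Xc v) - ep * Xi \<beta> (Nc (zp v')) (Xc v')\<bar> <= M * D" .
  have "norm (fld4 \<tau> \<beta> ep v - fld4 \<tau> \<beta> ep v') <= Lf * D + M * D"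
   unfolding fld4_def mk_diff by (rule order_trans[OF norm_mk_le]) (use 1 2 in linarith)
  thus "dist (fld4 \<tau> \<beta> ep v) (fld4 \<tau> \<beta> ep v') <= (Lf + M) * dist v v'"
   by (simp add: dist_norm D_def algebra_simps)
 qed (use Lf(1) M in simp)
 thus ?thesis using Lf(1) M by (intro exI[of _ "Lf + M"]) simp
qed

lemma fld4_continuous: "continuous_on S (fld4 \<tau> \<beta> ep)"
 using fld4_lipschitz[of \<tau> \<beta> ep] lipschitz_on_continuous_on continuous_on_subset[of UNIV] by blast

lemma flow3_exists: "\<exists>x. x 0 = z & ode (fld \<tau>) x" by (rule ode_exists[OF Lf(2)])

lemma flow4_exists: "\<exists>y. y 0 = v & ode (fld4 \<tau> \<beta> ep) y"
 using fld4_lipschitz[of \<tau> \<beta> ep] ode_exists by blast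

lemma flow4_zp: "ode (fld4 \<tau> \<beta> ep) y ==> ode (fld \<tau>) (%t. zp (y t))"
 unfolding ode_def using vd_zp by (fastforce simp: fld4_def)

end

lemma ode_lips:
 fixes x :: "real => 'a::real_normed_vector"
 assumes x: "ode f x" and f: "continuous_on UNIV f" and s: "s >= 0"
 shows "lips {s..t} x"
proof -
 have sub: "{s..t} \<subseteq> {0..}" using s by auto
 have cx: "continuous_on {s..t} x" using ode_continuous[OF x] sub by (rule continuous_on_subset)
 have "continuous_on {s..t} (%u. f (x u))"
  by (rule continuous_on_compose2[OF f cx]) simp
 hence "bounded ((%u. f (x u)) ` {s..t})" by (intro compact_imp_bounded compact_continuous_image) auto
 then obtain M where M: "M > 0" "\<And>u. u \<in> {s..t} ==> norm (f (x u)) <= M"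
  unfolding bounded_pos by blast
 have "M-lipschitz_on {s..t} x"
 proof (rule lipschitz_onI)
  fix u v assume uv: "u \<in> {s..t}" "v \<in> {s..t}"
  have "norm (x u - x v) <= M * norm (u - v)"
  proof (rule differentiable_bound[of "{s..t}" x "%u h. h *\<^sub>R f (x u)"])
   fix w assume w: "w \<in> {s..t}"
   hence "(x has_vector_derivative f (x w)) (at w within {0..})" using x sub by (auto simp: ode_def)
   hence "(x has_vector_derivative f (x w)) (at w within {s..t})" using sub by (rule has_vector_derivative_within_subset)
   thus "(x has_derivative (%h. h *\<^sub>R f (x w))) (at w within {s..t})" by (simp add: has_vector_derivative_def)
   show "onorm (%h. h *\<^sub>R f (x w)) <= M"
    using M(2)[OF w] by (simp add: onorm_scaleR_left[OF bounded_linear_ident] onorm_id)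
  qed (use uv in auto)
  thus "dist (x u) (x v) <= M * dist u v" by (simp add: dist_norm)
 qed (use M in simp)
 thus ?thesis by (auto simp: lips_def)
qed

context climate begin

lemma flow3_lips: "ode (fld \<tau>) x ==> s >= 0 ==> lips {s..t} x"
 by (rule ode_lips[OF _ fld_continuous])

lemma flow4_lips: "ode (fld4 \<tau> \<beta> ep) y ==> s >= 0 ==> lips {s..t} y"
 by (rule ode_lips[OF _ fld4_continuous])

section \<open>Monotonicity of the fast flow\<close>

lemma flow_le_flow:
 assumes x: "ode (fld \<tau>) x" and y: "ode (fld \<tau>) y" and t: "t >= 0" and i: "le3 (x 0) (y 0)"
 shows "le3 (x t) (y t)"
proof (rule compare[OF t flow3_lips[OF x] flow3_lips[OF y] negligible_empty _ i])
 fix u assume "u \<in> {0<..<t} - {}"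
 hence "u > 0" by simp
 thus "\<exists>d e. (x has_vector_derivative d) (at u) & (y has_vector_derivative e) (at u)
    & le3 d (fld \<tau> (x u)) & le3 (fld \<tau> (y u)) e"
  using ode_at[OF x] ode_at[OF y] le3_refl by blast
qed auto

lemma flow_le_const:
 assumes x: "ode (fld \<tau>) x" and t: "t >= 0" and c: "le3 (fld \<tau> c) 0" and i: "le3 (x 0) c"
 shows "le3 (x t) c"
proof (rule compare[OF t flow3_lips[OF x] lips_const negligible_empty _ i])
 fix u assume "u \<in> {0<..<t} - {}"
 hence "u > 0" by simp
 thus "\<exists>d e. (x has_vector_derivative d) (at u) & ((%u. c) has_vector_derivative e) (at u)
    & le3 d (fld \<tau> (x u)) & le3 (fld \<tau> c) e"
  using ode_at[OF x] c le3_refl has_vector_derivative_const by blast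
qed auto

lemma const_le_flow:
 assumes x: "ode (fld \<tau>) x" and t: "t >= 0" and c: "le3 0 (fld \<tau> c)" and i: "le3 c (x 0)"
 shows "le3 c (x t)"
proof (rule compare[OF t lips_const flow3_lips[OF x] negligible_empty _ i])
 fix u assume "u \<in> {0<..<t} - {}"
 hence "u > 0" by simp
 thus "\<exists>d e. ((%u. c) has_vector_derivative d) (at u) & (x has_vector_derivative e) (at u)
    & le3 d (fld \<tau> c) & le3 (fld \<tau> (x u)) e"
  using ode_at[OF x] c le3_refl has_vector_derivative_const by blast
qed auto

text \<open>The starting point is a supersolution, so \<open>x (t - s)\<close> lies below
  \<open>x 0\<close>; letting both flow for the time \<open>s\<close> compares \<open>x t\<close>
  with \<open>x s\<close>.\<close>

lemma flow_decreasing: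
 assumes x: "ode (fld \<tau>) x" and c: "le3 (fld \<tau> (x 0)) 0" and st: "0 <= s" "s <= t"
 shows "le3 (x t) (x s)"
proof -
 have "le3 (x (t - s)) (x 0)" by (rule flow_le_const[OF x _ c]) (use st in auto)
 hence "le3 (x ((t - s) + s)) (x (0 + s))"
  using flow_le_flow[OF ode_shift[OF x, of "t - s"] x, of s] st by (simp add: add.commute)
 thus ?thesis by simp
qed

lemma flow_increasing:
 assumes x: "ode (fld \<tau>) x" and c: "le3 0 (fld \<tau> (x 0))" and st: "0 <= s" "s <= t"
 shows "le3 (x s) (x t)"
proof -
 have "le3 (x 0) (x (t - s))" by (rule const_le_flow[OF x _ c]) (use st in auto)
 hence "le3 (x (0 + s)) (x ((t - s) + s))"
  using flow_le_flow[OF x ode_shift[OF x, of "t - s"], of s] st by (simp add: add.commute)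
 thus ?thesis by simp
qed

lemma flow3_dist: "ode (fld \<tau>) x ==> ode (fld \<tau>) y ==> t >= 0 ==> norm (x t - y t) <= exp (Lf * t) * norm (x 0 - y 0)"
 by (rule ode_dist_le[OF Lf(2)])

end

section \<open>Equilibria\<close>

declare split_paired_All [simp del] split_paired_Ex [simp del]

context climate begin

definition dom3 :: "state3 set" where "dom3 = {z. -1 <= Pc z & Pc z <= Nc z & Nc z <= 1}"
definition eqm :: "real => state3 => bool" where "eqm \<tau> z \<longleftrightarrow> z \<in> dom3 & fld \<tau> z = 0"
text \<open>Solving the two ice line equations for the ice lines as functions of \<open>w\<close>
  reduces the equilibrium problem to \<open>w = F(w)\<close>; \<open>lam\<close> is the slope of
  \<open>F\<close> there. Slope below 1 characterises the nodes, slope at least 1 the unstable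
  equilibria.\<close>

definition lam :: "state3 => real" where
 "lam z = \<kappa> * sd (Pc z) / (2 * k * - Pc z) + \<kappa> * sd (Nc z) / (2 * k * Nc z)"

lemma closed_dom3: "closed dom3"
 unfolding dom3_def by (intro closed_Collect_conj closed_Collect_le continuous_intros)

lemma fld_dom:
 assumes "z \<in> dom3"
 shows "fld \<tau> z = (B * (F0 + \<kappa> * (Phi (Nc z) - Phi (Pc z)) - Wc z),
  - r * (Wc z - (G0 + k * (Pc z)\<^sup>2)), r * (Wc z - (G0 + k * (Nc z)\<^sup>2) - \<tau>))"
 using assms by (simp add: fld_def ph_def gg_def cl_id dom3_def)

lemma eqm_iff:
 "eqm \<tau> z \<longleftrightarrow> z \<in> dom3 & Wc z = F0 + \<kappa> * (Phi (Nc z) - Phi (Pc z)) & Wc z = G0 + k * (Pc z)\<^sup>2 &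
   Wc z = G0 + k * (Nc z)\<^sup>2 + \<tau>"
proof (cases "z \<in> dom3")
 case True
 show ?thesis unfolding eqm_def fld_dom[OF True] zero_prod_def prod.inject
  using B r by auto
qed (simp add: eqm_def)

lemma Phi_odd: "Phi (- y) = - Phi y" by (simp add: Phi_def algebra_simps)
lemma sd_even: "sd (- y) = sd y" by (simp add: sd_def)

text \<open>Completing the square; the assumption \<open>disc\<close> is made for this
  inequality.\<close>

lemma quad_pos: "k * y\<^sup>2 + (G0 - F0) > \<kappa> * (1 + q / 2) * y"
proof -
 define c where "c = \<kappa> * (1 + q / 2)"
 have "4 * k * (k * y\<^sup>2 + (G0 - F0) - c * y) = (2 * k * y - c)\<^sup>2 + (4 * k * (G0 - F0) - c\<^sup>2)"
  by (simp add: power2_eq_square algebra_simps)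
 also have "... > 0" using disc zero_le_power2[of "2 * k * y - c"] unfolding c_def by linarith
 finally have "k * y\<^sup>2 + (G0 - F0) - c * y > 0" using k by (simp add: zero_less_mult_iff)
 thus ?thesis by (simp add: c_def)
qed

text \<open>From \<tau> \<open>>= 0\<close> the northern line is at most as far from the equator as
  the southern one. A southern line at \<open>>= 0\<close> would collapse both lines and give
  \<open>Wc z = F0\<close>, which is below \<open>G0\<close>. A northern line at \<open><= 0\<close>
  would leave too little absorbed heat, by \<open>quad_pos\<close>.\<close>

lemma eqm_signs:
 assumes e: "eqm \<tau> z" and \<tau>: "\<tau> >= 0"
 shows "Pc z < 0" "0 < Nc z"
proof -
 note E = e[unfolded eqm_iff]
 have d: "-1 <= Pc z" "Pc z <= Nc z" "Nc z <= 1" using E by (auto simp: dom3_def)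
 have "k * (Nc z)\<^sup>2 <= k * (Pc z)\<^sup>2" using E \<tau> by linarith
 hence sq: "(Nc z)\<^sup>2 <= (Pc z)\<^sup>2" using k by simp
 have G: "G0 - F0 > 0" using quad_pos[of 0] by simp
 show P: "Pc z < 0"
 proof (rule ccontr)
  assume "\<not> Pc z < 0"
  hence "0 <= Pc z" by simp
  hence "Nc z <= Pc z" using sq by (rule power2_le_imp_le[rotated])
  hence "Nc z = Pc z" using d by simp
  hence "Wc z = F0" using E by simp
  moreover have "0 <= k * (Pc z)\<^sup>2" using k by simp
  moreover have "Wc z = G0 + k * (Pc z)\<^sup>2" using E by blast
  ultimately show False using G by linarith
 qed
 show "0 < Nc z"
 proof (rule ccontr)
  assume "\<not> 0 < Nc z"
  hence "Phi (Nc z) <= Phi 0" using Phi_mono_lip(1)[of "Nc z" 0] d by simp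
  hence n: "Phi (Nc z) <= 0" by (simp add: Phi_def)
  have "Phi (- Pc z) = (1 + q / 2) * - Pc z - q / 2 * (- Pc z) ^ 3" by (simp add: Phi_def algebra_simps)
  also have "... <= (1 + q / 2) * - Pc z"
   using P q mult_nonneg_nonneg[of "q / 2" "(- Pc z) ^ 3"] by simp
  finally have p: "- Phi (Pc z) <= (1 + q / 2) * - Pc z" by (simp only: Phi_odd)
  have "Wc z <= F0 + \<kappa> * ((1 + q / 2) * - Pc z)"
  proof -
   have "\<kappa> * (Phi (Nc z) - Phi (Pc z)) <= \<kappa> * ((1 + q / 2) * - Pc z)"
    using n p \<kappa> by (intro mult_left_mono) auto
   thus ?thesis using E by linarith
  qed
  moreover have "Wc z = G0 + k * (- Pc z)\<^sup>2" using E by simp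
  moreover have "\<kappa> * (1 + q / 2) * - Pc z < k * (- Pc z)\<^sup>2 + (G0 - F0)" by (rule quad_pos)
  ultimately show False by (simp add: mult.assoc)
 qed
qed

text \<open>Concavity of \<open>Phi\<close> as a function of the square:
  \<open>sd y / (2 * y)\<close> is its derivative with respect to \<open>y\<close> squared, and the
  gap to the tangent is an explicit sum of nonnegative terms.\<close>

lemma Phi_concave_sq:
 assumes y: "0 < y" "y <= 1" and x: "0 < x"
 shows "Phi x - Phi y <= sd y / (2 * y) * (x\<^sup>2 - y\<^sup>2)"
  and "x \<noteq> y ==> Phi x - Phi y < sd y / (2 * y) * (x\<^sup>2 - y\<^sup>2)"
proof -
 have s: "sd y > 0" using y by (intro sd_pos) auto
 have "Phi x - Phi y = (x - y) * sd y - q / 2 * ((x - y)\<^sup>2 * (x + 2 * y))"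
  by (simp add: Phi_def sd_def power2_eq_square power3_eq_cube field_simps)
 moreover have "(x - y) * sd y = sd y / (2 * y) * (x\<^sup>2 - y\<^sup>2) - sd y / (2 * y) * (x - y)\<^sup>2"
  using y by (simp add: field_simps power2_eq_square)
 ultimately have e: "Phi x - Phi y = sd y / (2 * y) * (x\<^sup>2 - y\<^sup>2) - sd y / (2 * y) * (x - y)\<^sup>2 - q / 2 * ((x - y)\<^sup>2 * (x + 2 * y))"
  by simp
 have n: "0 <= q / 2 * ((x - y)\<^sup>2 * (x + 2 * y))" using q x y by (intro mult_nonneg_nonneg) auto
 have "0 <= sd y / (2 * y) * (x - y)\<^sup>2" using s y by simp
 thus "Phi x - Phi y <= sd y / (2 * y) * (x\<^sup>2 - y\<^sup>2)" using e n by linarith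
 assume "x \<noteq> y"
 hence "0 < sd y / (2 * y) * (x - y)\<^sup>2" using s y by simp
 thus "Phi x - Phi y < sd y / (2 * y) * (x\<^sup>2 - y\<^sup>2)" using e n by linarith
qed

text \<open>Covers equilibria as well as starting points from which the flow rises, so that one
  tangent comparison serves both.\<close>

definition subeq :: "real => state3 => bool" where
 "subeq \<tau> z \<longleftrightarrow> z \<in> dom3 & Pc z < 0 & 0 < Nc z & le3 0 (fld \<tau> z)"

lemma eqm_subeq: "eqm \<tau> z ==> \<tau> >= 0 ==> subeq \<tau> z"
 using eqm_signs[of \<tau> z] by (simp add: subeq_def eqm_def)

text \<open>All functions entering the equilibrium equations are concave in the squared ice lines, so a
 sub-equilibrium can be compared with the tangent at an equilibrium.\<close>

lemma subeq_compare:
 assumes s1: "subeq \<tau>1 z1" and e2: "eqm \<tau>2 z2" and \<tau>2: "\<tau>2 >= 0"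
 defines "d \<equiv> Wc z1 - Wc z2" and "C \<equiv> \<kappa> * sd (Nc z2) / (2 * k * Nc z2)"
 shows "(1 - lam z2) * d <= - C * (\<tau>1 - \<tau>2)"
  and "z1 \<noteq> z2 ==> (1 - lam z2) * d < - C * (\<tau>1 - \<tau>2)"
  and "C > 0" and "k * ((Pc z1)\<^sup>2 - (Pc z2)\<^sup>2) <= d" and "k * ((Nc z1)\<^sup>2 - (Nc z2)\<^sup>2) <= d - (\<tau>1 - \<tau>2)"
proof -
 have z1: "z1 \<in> dom3" "Pc z1 < 0" "0 < Nc z1" using s1 by (auto simp: subeq_def)
 have f1: "Wc z1 <= F0 + \<kappa> * (Phi (Nc z1) - Phi (Pc z1))" "G0 + k * (Pc z1)\<^sup>2 <= Wc z1" "G0 + k * (Nc z1)\<^sup>2 + \<tau>1 <= Wc z1"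
  using s1 B r unfolding subeq_def le3_def fld_dom[OF z1(1)]
  by (auto simp: zero_le_mult_iff mult_le_0_iff)
 note E2 = e2[unfolded eqm_iff] and sg = eqm_signs[OF e2 \<tau>2]
 have d2: "-1 <= Pc z2" "Nc z2 <= 1" using E2 by (auto simp: dom3_def)
 define A where "A = \<kappa> * sd (Pc z2) / (2 * k * - Pc z2)"
 have pos: "sd (Pc z2) > 0" "sd (Nc z2) > 0" using d2 sg by (auto intro!: sd_pos)
 have A: "A > 0" unfolding A_def using \<kappa> k pos sg by (intro divide_pos_pos mult_pos_pos) auto
 show C: "C > 0" unfolding C_def using \<kappa> k pos sg by (intro divide_pos_pos mult_pos_pos) auto
 have lam: "lam z2 = A + C" by (simp add: lam_def A_def C_def)
 show p: "k * ((Pc z1)\<^sup>2 - (Pc z2)\<^sup>2) <= d" using f1 E2 by (simp add: d_def algebra_simps)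
 show n: "k * ((Nc z1)\<^sup>2 - (Nc z2)\<^sup>2) <= d - (\<tau>1 - \<tau>2)" using f1 E2 by (simp add: d_def algebra_simps)
 \<comment> \<open>Increments of \<open>Phi\<close> along its tangents at \<open>z2\<close>, in the
   squared ice lines.\<close>
 define DP where "DP = sd (Pc z2) / (2 * - Pc z2) * ((Pc z1)\<^sup>2 - (Pc z2)\<^sup>2)"
 define DN where "DN = sd (Nc z2) / (2 * Nc z2) * ((Nc z1)\<^sup>2 - (Nc z2)\<^sup>2)"
 have P1: "Phi (- Pc z1) - Phi (- Pc z2) <= DP" "Pc z1 \<noteq> Pc z2 ==> Phi (- Pc z1) - Phi (- Pc z2) < DP"
  using Phi_concave_sq[of "- Pc z2" "- Pc z1"] z1 sg d2 by (simp_all add: sd_even DP_def)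
 have N1: "Phi (Nc z1) - Phi (Nc z2) <= DN" "Nc z1 \<noteq> Nc z2 ==> Phi (Nc z1) - Phi (Nc z2) < DN"
  using Phi_concave_sq[of "Nc z2" "Nc z1"] z1 sg d2 by (simp_all add: DN_def)
 have k1: "\<kappa> * DP = A * (k * ((Pc z1)\<^sup>2 - (Pc z2)\<^sup>2))" "\<kappa> * DN = C * (k * ((Nc z1)\<^sup>2 - (Nc z2)\<^sup>2))"
  using k by (simp_all add: DP_def DN_def A_def C_def)
 have k2: "\<kappa> * DP <= A * d" "\<kappa> * DN <= C * (d - (\<tau>1 - \<tau>2))"
  unfolding k1 using A C p n by (intro mult_left_mono; simp)+
 have dd: "d <= \<kappa> * ((Phi (- Pc z1) - Phi (- Pc z2)) + (Phi (Nc z1) - Phi (Nc z2)))"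
  using f1(1) E2 unfolding d_def Phi_odd by (simp add: algebra_simps)
 have "\<kappa> * ((Phi (- Pc z1) - Phi (- Pc z2)) + (Phi (Nc z1) - Phi (Nc z2))) <= \<kappa> * (DP + DN)"
  using P1(1) N1(1) \<kappa> by (intro mult_left_mono) auto
 hence le: "d <= A * d + C * (d - (\<tau>1 - \<tau>2))" using dd k2 by (simp add: distrib_left)
 thus "(1 - lam z2) * d <= - C * (\<tau>1 - \<tau>2)" unfolding lam by (simp add: algebra_simps)
 assume ne: "z1 \<noteq> z2"
 have "Pc z1 \<noteq> Pc z2 \<or> Nc z1 \<noteq> Nc z2"
 proof (rule ccontr)
  assume "\<not> ?thesis"
  hence eq: "Pc z1 = Pc z2" "Nc z1 = Nc z2" by auto
  hence "Wc z1 <= Wc z2" "Wc z2 <= Wc z1" using f1 E2 by auto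
  thus False using eq ne by (simp add: prod_eq_iff)
 qed
 hence "(Phi (- Pc z1) - Phi (- Pc z2)) + (Phi (Nc z1) - Phi (Nc z2)) < DP + DN"
  using P1 N1 by fastforce
 hence "\<kappa> * ((Phi (- Pc z1) - Phi (- Pc z2)) + (Phi (Nc z1) - Phi (Nc z2))) < \<kappa> * (DP + DN)"
  using \<kappa> by simp
 hence "d < A * d + C * (d - (\<tau>1 - \<tau>2))" using dd k2 by (simp add: distrib_left)
 thus "(1 - lam z2) * d < - C * (\<tau>1 - \<tau>2)" unfolding lam by (simp add: algebra_simps)
qed

text \<open>For slope \<open>lam z2 >= 1\<close> the factor \<open>1 - lam z2\<close> is
  nonpositive, so the strict tangent inequality forces a positive difference in
  \<open>w\<close>.\<close>

lemma subeq_above_saddle: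
 assumes s1: "subeq \<tau>1 z1" and e2: "eqm \<tau>2 z2" and \<tau>: "0 <= \<tau>2" "\<tau>2 <= \<tau>1" and l: "lam z2 >= 1" and ne: "z1 \<noteq> z2"
 shows "Wc z2 < Wc z1"
proof -
 note c = subeq_compare[OF s1 e2 \<tau>(1)]
 have "0 <= (\<kappa> * sd (Nc z2) / (2 * k * Nc z2)) * (\<tau>1 - \<tau>2)"
  by (rule mult_nonneg_nonneg[OF less_imp_le[OF c(3)]]) (use \<tau> in simp)
 hence "(1 - lam z2) * (Wc z1 - Wc z2) < 0" using c(2)[OF ne] by simp
 thus ?thesis using l by (auto simp: mult_less_0_iff)
qed

text \<open>Now the factor is positive and the difference in \<open>w\<close> negative. Lower
  \<open>w\<close> and a larger critical temperature then shrink both squared ice lines.\<close>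

lemma subeq_below_node:
 assumes s1: "subeq \<tau>1 z1" and e2: "eqm \<tau>2 z2" and \<tau>: "0 <= \<tau>2" "\<tau>2 <= \<tau>1" and l: "lam z2 < 1" and ne: "z1 \<noteq> z2"
 shows "Wc z1 < Wc z2" "Pc z2 < Pc z1" "Nc z1 < Nc z2"
proof -
 note c = subeq_compare[OF s1 e2 \<tau>(1)]
 have "0 <= (\<kappa> * sd (Nc z2) / (2 * k * Nc z2)) * (\<tau>1 - \<tau>2)"
  by (rule mult_nonneg_nonneg[OF less_imp_le[OF c(3)]]) (use \<tau> in simp)
 hence "(1 - lam z2) * (Wc z1 - Wc z2) < 0" using c(2)[OF ne] by simp
 thus w: "Wc z1 < Wc z2" using l by (auto simp: mult_less_0_iff)
 have "k * ((Pc z1)\<^sup>2 - (Pc z2)\<^sup>2) < 0" "k * ((Nc z1)\<^sup>2 - (Nc z2)\<^sup>2) < 0" using c(4,5) w \<tau> by linarith+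
 hence sq: "(- Pc z1)\<^sup>2 < (- Pc z2)\<^sup>2" "(Nc z1)\<^sup>2 < (Nc z2)\<^sup>2" using k by (auto simp: mult_less_0_iff)
 have "- Pc z1 < - Pc z2" by (rule power2_less_imp_less[OF sq(1)]) (use eqm_signs[OF e2 \<tau>(1)] in simp)
 thus "Pc z2 < Pc z1" by simp
 show "Nc z1 < Nc z2" by (rule power2_less_imp_less[OF sq(2)]) (use eqm_signs[OF e2 \<tau>(1)] in simp)
qed

lemma eqm_le_node:
 assumes "eqm \<tau>1 z1" "eqm \<tau>2 z2" "0 <= \<tau>2" "\<tau>2 <= \<tau>1" "lam z2 < 1"
 shows "le3 z1 z2"
proof (cases "z1 = z2")
 case False
 have "subeq \<tau>1 z1" using assms by (intro eqm_subeq) auto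
 from subeq_below_node[OF this assms(2-5) False] show ?thesis by (simp add: le3_def)
qed simp

text \<open>The weighted box around a node given by a positive vector on which the linearisation is negative.\<close>

lemma node_box:
 assumes e: "eqm \<tau> z" and \<tau>: "\<tau> >= 0" and l: "lam z < 1" and int: "-1 < Pc z" "Nc z < 1"
 obtains v R where "Wc v = 1" "Pc v < 0" "0 < Nc v" "R > 0"
  "\<And>x. \<bar>Pc x - Pc z\<bar> <= R ==> -1 < Pc x & Pc x < 0"
  "\<And>x. \<bar>Nc x - Nc z\<bar> <= R ==> 0 < Nc x & Nc x < 1"
  "\<And>x \<rho> \<tau>'. \<bar>Pc x - Pc z\<bar> <= R ==> \<bar>Nc x - Nc z\<bar> <= R ==>
    \<bar>Pc (x + \<rho> *\<^sub>R v) - Pc z\<bar> <= R ==> \<bar>Nc (x + \<rho> *\<^sub>R v) - Nc z\<bar> <= R ==> 0 <= \<rho> ==>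
    le3 (fld \<tau>' (x + \<rho> *\<^sub>R v)) (fld \<tau>' x - (R * \<rho>) *\<^sub>R v)"
proof -
 define s where "s = - Pc z" define n where "n = Nc z"
 have sn: "0 < s" "s < 1" "0 < n" "n < 1" using eqm_signs[OF e \<tau>] int by (auto simp: s_def n_def)
 have sdp: "sd s > 0" "sd n > 0" using sn by (auto intro!: sd_pos)
 \<comment> \<open>Half the gap to slope 1. Ice line components \<open>1 + \<theta>\<close> times
   the slopes in \<open>w\<close> make the ice line rows of the linearisation strictly negative, and
   \<open>(1 + \<theta>) * lam z < 1\<close> keeps the heat balance row negative.\<close>
 define \<theta> where "\<theta> = (1 - lam z) / 2"
 have \<theta>: "\<theta> > 0" using l by (simp add: \<theta>_def)
 define vp where "vp = (1 + \<theta>) / (2 * k * s)" define vn where "vn = (1 + \<theta>) / (2 * k * n)"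
 have v: "vp > 0" "vn > 0" using \<theta> k sn by (simp_all add: vp_def vn_def)
 have lamz: "lam z = \<kappa> * sd s / (2 * k * s) + \<kappa> * sd n / (2 * k * n)"
  by (simp add: lam_def s_def n_def sd_even)
 have "\<kappa> * (sd s * vp + sd n * vn) = (1 + \<theta>) * lam z"
  unfolding lamz vp_def vn_def using k sn by (simp add: field_simps)
 also have "... < 1"
 proof -
  have "\<theta> * lam z < \<theta> * 1" using \<theta> l by (intro mult_strict_left_mono) auto
  hence "(1 + \<theta>) * lam z < lam z + \<theta>" by (simp add: distrib_right)
  also have "lam z + \<theta> < 1" using l by (simp add: \<theta>_def field_simps)
  finally show ?thesis .
 qed
 finally have k0: "\<kappa> * (sd s * vp + sd n * vn) < 1" .
 have p0: "2 * k * s * vp > 1" "2 * k * n * vn > 1" using k sn \<theta> by (simp_all add: vp_def vn_def)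
 \<comment> \<open>All inequalities are strict at \<open>R = 0\<close>, so a small \<open>R\<close>
   can be at once the radius of the box and the contraction rate. The term \<open>3 * R\<close>
   bounds the variation of \<open>sd\<close> over the box.\<close>
 have ev: "\<forall>\<^sub>F R in at_right 0. \<kappa> * ((sd s + 3 * R) * vp + (sd n + 3 * R) * vn) + R / B < 1 &
   r * (2 * k * (s - R) * vp - 1) - R * vp > 0 & r * (2 * k * (n - R) * vn - 1) - R * vn > 0 &
   R < s & R < n & s + R < 1 & n + R < 1 & 0 < R"
 proof (intro eventually_conj)
  show "\<forall>\<^sub>F R in at_right 0. \<kappa> * ((sd s + 3 * R) * vp + (sd n + 3 * R) * vn) + R / B < 1"
  proof (rule order_tendstoD(2))
   show "((%R. \<kappa> * ((sd s + 3 * R) * vp + (sd n + 3 * R) * vn) + R / B) \<longlongrightarrow>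
    \<kappa> * ((sd s + 3 * 0) * vp + (sd n + 3 * 0) * vn) + 0 / B) (at_right 0)" using B by (intro tendsto_intros) auto
  qed (use k0 in simp)
  show "\<forall>\<^sub>F R in at_right 0. r * (2 * k * (s - R) * vp - 1) - R * vp > 0"
  proof (rule order_tendstoD(1))
   show "((%R. r * (2 * k * (s - R) * vp - 1) - R * vp) \<longlongrightarrow> r * (2 * k * (s - 0) * vp - 1) - 0 * vp) (at_right 0)"
    by (intro tendsto_intros)
  qed (use p0 r in simp)
  show "\<forall>\<^sub>F R in at_right 0. r * (2 * k * (n - R) * vn - 1) - R * vn > 0"
  proof (rule order_tendstoD(1))
   show "((%R. r * (2 * k * (n - R) * vn - 1) - R * vn) \<longlongrightarrow> r * (2 * k * (n - 0) * vn - 1) - 0 * vn) (at_right 0)"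
    by (intro tendsto_intros)
  qed (use p0 r in simp)
  have t: "((%R::real. c + R) \<longlongrightarrow> c + 0) (at_right 0)" for c by (intro tendsto_intros)
  show "\<forall>\<^sub>F R in at_right 0. R < s" using order_tendstoD(2)[OF t[of 0], of s] sn by simp
  show "\<forall>\<^sub>F R in at_right 0. R < n" using order_tendstoD(2)[OF t[of 0], of n] sn by simp
  show "\<forall>\<^sub>F R in at_right 0. s + R < 1" using order_tendstoD(2)[OF t[of s], of 1] sn by simp
  show "\<forall>\<^sub>F R in at_right 0. n + R < 1" using order_tendstoD(2)[OF t[of n], of 1] sn by simp
  show "\<forall>\<^sub>F R in at_right 0. (0::real) < R" by (rule eventually_at_right_less)
 qed
 then obtain R where R: "\<kappa> * ((sd s + 3 * R) * vp + (sd n + 3 * R) * vn) + R / B < 1"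
   "r * (2 * k * (s - R) * vp - 1) - R * vp > 0" "r * (2 * k * (n - R) * vn - 1) - R * vn > 0"
   "R < s" "R < n" "s + R < 1" "n + R < 1" "0 < R"
  using eventually_happens'[OF trivial_limit_at_right_real ev] by (elim exE conjE)
 define vv where "vv = (1::real, - vp, vn)"
 have bP: "-1 < Pc x & Pc x < 0" if "\<bar>Pc x - Pc z\<bar> <= R" for x :: state3
  using that R by (auto simp: s_def)
 have bN: "0 < Nc x & Nc x < 1" if "\<bar>Nc x - Nc z\<bar> <= R" for x :: state3
  using that R by (auto simp: n_def)
 have sdle: "sd y <= sd m + 3 * R" if "\<bar>y - m\<bar> <= R" "0 < y" "y < 1" "0 < m" "m < 1" for y m
 proof -
  have "m\<^sup>2 - y\<^sup>2 = (m - y) * (m + y)" by (simp add: power2_eq_square algebra_simps)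
  also have "... <= R * 2"
  proof -
   have "(m - y) * (m + y) <= \<bar>m - y\<bar> * (m + y)" using that by (intro mult_right_mono) auto
   also have "... <= R * 2" using that R(8) by (intro mult_mono) auto
   finally show ?thesis .
  qed
  finally have "3 * q / 2 * (m\<^sup>2 - y\<^sup>2) <= 3 * q / 2 * (R * 2)" using q by (intro mult_left_mono) auto
  also have "... <= 3 * R" using q R(8) by (simp add: mult_left_le_one_le)
  finally show ?thesis by (simp add: sd_def algebra_simps)
 qed
 have inc: "Phi (y + h) - Phi y <= sd y * h" if "0 < y" "0 <= h" for y h
 proof -
  have "Phi (y + h) - Phi y = sd y * h - q / 2 * (h\<^sup>2 * (h + 3 * y))"
   by (simp add: Phi_def sd_def power2_eq_square power3_eq_cube field_simps)
  moreover have "0 <= q / 2 * (h\<^sup>2 * (h + 3 * y))" using that q by (intro mult_nonneg_nonneg) auto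
  ultimately show ?thesis by linarith
 qed
 have main: "le3 (fld \<tau>' (x + \<rho> *\<^sub>R vv)) (fld \<tau>' x - (R * \<rho>) *\<^sub>R vv)"
  if x: "\<bar>Pc x - Pc z\<bar> <= R" "\<bar>Nc x - Nc z\<bar> <= R" "\<bar>Pc (x + \<rho> *\<^sub>R vv) - Pc z\<bar> <= R" "\<bar>Nc (x + \<rho> *\<^sub>R vv) - Nc z\<bar> <= R"
   and \<rho>: "0 <= \<rho>" for x \<rho> \<tau>'
 proof -
  define p where "p = - Pc x" define m where "m = Nc x"
  have pm: "0 < p" "p < 1" "0 < m" "m < 1" "\<bar>p - s\<bar> <= R" "\<bar>m - n\<bar> <= R"
   using bP[OF x(1)] bN[OF x(2)] x(1,2) by (auto simp: p_def m_def s_def n_def)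
  have d1: "x \<in> dom3" using pm by (simp add: dom3_def p_def m_def)
  have d2: "x + \<rho> *\<^sub>R vv \<in> dom3" using bP[OF x(3)] bN[OF x(4)] by (simp add: dom3_def)
  have cs: "Wc (x + \<rho> *\<^sub>R vv) = Wc x + \<rho>" "Pc (x + \<rho> *\<^sub>R vv) = - (p + \<rho> * vp)" "Nc (x + \<rho> *\<^sub>R vv) = m + \<rho> * vn"
   by (simp_all add: vv_def p_def m_def)
  have xp: "Pc x = - p" "Nc x = m" by (simp_all add: p_def m_def)
  have 1: "B * (\<kappa> * ((Phi (m + \<rho> * vn) - Phi m) + (Phi (p + \<rho> * vp) - Phi p)) - \<rho>) <= - (R * \<rho>)"
  proof -
   have "Phi (m + \<rho> * vn) - Phi m <= sd m * (\<rho> * vn)" by (rule inc[OF pm(3) mult_nonneg_nonneg[OF \<rho> less_imp_le[OF v(2)]]])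
   also have "... <= (sd n + 3 * R) * (\<rho> * vn)" by (rule mult_right_mono[OF sdle[OF pm(6) pm(3,4) sn(3,4)] mult_nonneg_nonneg[OF \<rho> less_imp_le[OF v(2)]]])
   finally have a: "Phi (m + \<rho> * vn) - Phi m <= (sd n + 3 * R) * (\<rho> * vn)" .
   have "Phi (p + \<rho> * vp) - Phi p <= sd p * (\<rho> * vp)" by (rule inc[OF pm(1) mult_nonneg_nonneg[OF \<rho> less_imp_le[OF v(1)]]])
   also have "... <= (sd s + 3 * R) * (\<rho> * vp)" by (rule mult_right_mono[OF sdle[OF pm(5) pm(1,2) sn(1,2)] mult_nonneg_nonneg[OF \<rho> less_imp_le[OF v(1)]]])
   finally have b: "Phi (p + \<rho> * vp) - Phi p <= (sd s + 3 * R) * (\<rho> * vp)" .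
   have "\<kappa> * ((Phi (m + \<rho> * vn) - Phi m) + (Phi (p + \<rho> * vp) - Phi p)) <= \<kappa> * ((sd n + 3 * R) * (\<rho> * vn) + (sd s + 3 * R) * (\<rho> * vp))"
    using a b \<kappa> by (intro mult_left_mono) auto
   also have "... = \<rho> * (\<kappa> * ((sd s + 3 * R) * vp + (sd n + 3 * R) * vn))" by (simp add: algebra_simps)
   also have "... <= \<rho> * (1 - R / B)" using R(1) \<rho> by (intro mult_left_mono) auto
   finally have "\<kappa> * ((Phi (m + \<rho> * vn) - Phi m) + (Phi (p + \<rho> * vp) - Phi p)) - \<rho> <= - (\<rho> * R / B)"
    by (simp add: algebra_simps)
   hence "B * (\<kappa> * ((Phi (m + \<rho> * vn) - Phi m) + (Phi (p + \<rho> * vp) - Phi p)) - \<rho>) <= B * - (\<rho> * R / B)"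
    using B by (intro mult_left_mono) auto
   thus ?thesis using B by (simp add: mult.commute)
  qed
  have sqge: "r * (\<rho> - k * ((y + \<rho> * u)\<^sup>2 - y\<^sup>2)) <= - (R * \<rho> * u)"
   if y: "\<bar>y - m\<bar> <= R" "0 < y" "u > 0" and c: "r * (2 * k * (m - R) * u - 1) - R * u > 0" for y m u
  proof -
   have "r * (\<rho> - k * ((y + \<rho> * u)\<^sup>2 - y\<^sup>2)) = \<rho> * (r * (1 - 2 * k * y * u)) - r * k * (\<rho> * u)\<^sup>2"
    by (simp add: power2_eq_square algebra_simps)
   also have "... <= \<rho> * (r * (1 - 2 * k * y * u))" using r k by simp
   also have "... <= \<rho> * (r * (1 - 2 * k * (m - R) * u))"
   proof -
    have "(2 * k * u) * (m - R) <= (2 * k * u) * y" using y k by (intro mult_left_mono) auto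
    thus ?thesis using r \<rho> by (intro mult_left_mono) (auto simp: mult_ac)
   qed
   also have "... <= \<rho> * (- (R * u))" using c \<rho> by (intro mult_left_mono) (auto simp: algebra_simps)
   finally show ?thesis by (simp add: mult_ac)
  qed
  have 2: "r * (\<rho> - k * ((p + \<rho> * vp)\<^sup>2 - p\<^sup>2)) <= - (R * \<rho> * vp)" by (rule sqge[OF pm(5) pm(1) v(1) R(2)])
  have 3: "r * (\<rho> - k * ((m + \<rho> * vn)\<^sup>2 - m\<^sup>2)) <= - (R * \<rho> * vn)" by (rule sqge[OF pm(6) pm(3) v(2) R(3)])
  have vc: "Wc vv = 1" "Pc vv = - vp" "Nc vv = vn" by (simp_all add: vv_def)
  show ?thesis
   unfolding le3_def fld_dom[OF d1] fld_dom[OF d2] cs xp fst_diff snd_diff fst_scaleR snd_scaleR fst_conv snd_conv vc Phi_odd power2_minus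
   using 1 2 3 by (simp add: algebra_simps)
 qed
 show ?thesis
  by (rule that[of vv R]) (use v R(8) bP bN main in \<open>auto simp: vv_def\<close>)
qed

section \<open>The gradient structure\<close>

definition Ip :: "real => real" where
 "Ip y = G0 * (1 + q / 2) * y + (k * (1 + q / 2) - 3 * q * G0 / 2) * y ^ 3 / 3 - 3 * q * k / 2 * y ^ 5 / 5"

text \<open>Potential of the fast field: its partial derivatives are \<open>w - F\<close> in the
  first variable and, up to sign, the ice line equations multiplied by \<open>\<kappa> * sd\<close>.
  With these positive weights the field is a negative gradient.\<close>

definition En :: "real => state3 => real" where
 "En \<tau> z = (Wc z)\<^sup>2 / 2 - Wc z * (F0 + \<kappa> * (Phi (Nc z) - Phi (Pc z))) + \<kappa> * (Ip (Nc z) - Ip (Pc z)) + \<kappa> * \<tau> * Phi (Nc z)"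

lemma Ip_deriv: "(Ip has_real_derivative (G0 + k * y\<^sup>2) * sd y) (at y within S)"
 unfolding Ip_def sd_def by (auto intro!: derivative_eq_intros simp: field_simps power2_eq_square) algebra

text \<open>The northern velocity is left free, so the formula also applies when the critical
  temperature of the motion differs from that of the energy.\<close>

lemma En_deriv:
 assumes x: "(x has_vector_derivative d) (at t within S)"
  and w: "Wc d = B * (F0 + \<kappa> * (Phi (Nc (x t)) - Phi (Pc (x t))) - Wc (x t))"
  and p: "Pc d = - r * (Wc (x t) - (G0 + k * (Pc (x t))\<^sup>2))"
 shows "((%t. En \<tau> (x t)) has_real_derivative
   - (Wc d)\<^sup>2 / B - \<kappa> * sd (Pc (x t)) * (Pc d)\<^sup>2 / r
   - \<kappa> * sd (Nc (x t)) * (Wc (x t) - (G0 + k * (Nc (x t))\<^sup>2) - \<tau>) * Nc d) (at t within S)"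
proof -
 note c = vd_comps[OF x]
 have P: "((%t. Phi (Pc (x t))) has_real_derivative sd (Pc (x t)) * Pc d) (at t within S)"
  "((%t. Phi (Nc (x t))) has_real_derivative sd (Nc (x t)) * Nc d) (at t within S)"
  by (rule DERIV_chain2[OF Phi_deriv c(2)], rule DERIV_chain2[OF Phi_deriv c(3)])
 have I: "((%t. Ip (Pc (x t))) has_real_derivative (G0 + k * (Pc (x t))\<^sup>2) * sd (Pc (x t)) * Pc d) (at t within S)"
  "((%t. Ip (Nc (x t))) has_real_derivative (G0 + k * (Nc (x t))\<^sup>2) * sd (Nc (x t)) * Nc d) (at t within S)"
  by (rule DERIV_chain2[OF Ip_deriv c(2)], rule DERIV_chain2[OF Ip_deriv c(3)])
 define FF where "FF = F0 + \<kappa> * (Phi (Nc (x t)) - Phi (Pc (x t)))"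
 define SP where "SP = sd (Pc (x t))" define SN where "SN = sd (Nc (x t))"
 define GP where "GP = G0 + k * (Pc (x t))\<^sup>2" define GN where "GN = G0 + k * (Nc (x t))\<^sup>2"
 have der: "((%t. En \<tau> (x t)) has_real_derivative
   Wc (x t) * Wc d - (Wc d * FF + Wc (x t) * (\<kappa> * (SN * Nc d - SP * Pc d)))
   + \<kappa> * (GN * SN * Nc d - GP * SP * Pc d) + \<kappa> * \<tau> * (SN * Nc d)) (at t within S)"
  unfolding En_def FF_def SP_def SN_def GP_def GN_def
  by (auto intro!: derivative_eq_intros c P I simp: power2_eq_square)
 have w': "FF - Wc (x t) = Wc d / B" using w B by (simp add: FF_def)
 have p': "Wc (x t) - GP = - Pc d / r" using p r by (simp add: GP_def)
 have "Wc (x t) * Wc d - (Wc d * FF + Wc (x t) * (\<kappa> * (SN * Nc d - SP * Pc d)))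
   + \<kappa> * (GN * SN * Nc d - GP * SP * Pc d) + \<kappa> * \<tau> * (SN * Nc d)
   = - (Wc d * (FF - Wc (x t))) + \<kappa> * SP * Pc d * (Wc (x t) - GP) - \<kappa> * SN * (Wc (x t) - GN - \<tau>) * Nc d"
  by (simp add: algebra_simps)
 also have "... = - (Wc d)\<^sup>2 / B - \<kappa> * SP * (Pc d)\<^sup>2 / r - \<kappa> * SN * (Wc (x t) - GN - \<tau>) * Nc d"
  unfolding w' p' by (simp add: power2_eq_square)
 finally show ?thesis using der by (simp add: SP_def SN_def GN_def)
qed

definition md :: real where "md = min (1 / B) (\<kappa> * (1 - q) / r)"

lemma md_pos: "md > 0" using B \<kappa> q r by (simp add: md_def)

lemma norm3_sq: "(norm (d :: state3))\<^sup>2 = (Wc d)\<^sup>2 + (Pc d)\<^sup>2 + (Nc d)\<^sup>2"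
 by (cases d) (simp add: norm_Pair)

lemma dissipation:
 assumes "z \<in> dom3"
 shows "(Wc d)\<^sup>2 / B + \<kappa> * sd (Pc z) * (Pc d)\<^sup>2 / r + \<kappa> * sd (Nc z) * (Nc d)\<^sup>2 / r >= md * (norm d)\<^sup>2"
proof -
 have "1 - q <= sd (Pc z)" "1 - q <= sd (Nc z)" using assms by (auto simp: dom3_def intro!: sd_bounds(1))
 hence "\<kappa> * (1 - q) / r <= \<kappa> * sd (Pc z) / r" "\<kappa> * (1 - q) / r <= \<kappa> * sd (Nc z) / r"
  using \<kappa> r by (auto intro!: divide_right_mono mult_left_mono)
 hence m: "md <= 1 / B" "md <= \<kappa> * sd (Pc z) / r" "md <= \<kappa> * sd (Nc z) / r" by (auto simp: md_def)
 have "md * (Wc d)\<^sup>2 <= 1 / B * (Wc d)\<^sup>2" "md * (Pc d)\<^sup>2 <= \<kappa> * sd (Pc z) / r * (Pc d)\<^sup>2" "md * (Nc d)\<^sup>2 <= \<kappa> * sd (Nc z) / r * (Nc d)\<^sup>2"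
  using m by (auto intro!: mult_right_mono simp del: times_divide_eq_left)
 thus ?thesis unfolding norm3_sq distrib_left by simp
qed

lemma En_continuous: "continuous_on S (En \<tau>)"
 unfolding En_def Phi_def Ip_def by (intro continuous_intros) auto

lemma compact_dom3_slab: "compact (dom3 \<inter> {z. \<bar>Wc z\<bar> <= M})"
proof -
 have "compact ({-M..M} \<times> {-1..1::real} \<times> {-1..1::real})" by (intro compact_Times compact_Icc)
 hence "compact (({-M..M} \<times> {-1..1} \<times> {-1..1}) \<inter> dom3)" using closed_dom3 by (rule compact_Int_closed)
 moreover have "dom3 \<inter> {z. \<bar>Wc z\<bar> <= M} = ({-M..M} \<times> {-1..1} \<times> {-1..1}) \<inter> dom3"
  by (auto simp: dom3_def)
 ultimately show ?thesis by simp
qed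

lemma ph_bound: "\<bar>ph x - ph y\<bar> <= 4"
proof -
 have "Phi (-1) <= ph x & ph x <= Phi 1" for x
  using Phi_mono_lip(1)[of "-1" "cl x"] Phi_mono_lip(1)[of "cl x" 1] cl_bounds[of x] by (simp add: ph_def)
 moreover have "Phi 1 = 1" "Phi (-1) = -1" by (simp_all add: Phi_def)
 ultimately have "-1 <= ph x" "ph x <= 1" "-1 <= ph y" "ph y <= 1" by metis+
 thus ?thesis by linarith
qed

definition Fb :: real where "Fb = \<bar>F0\<bar> + 4 * \<kappa>"

lemma F_bound: "\<bar>F0 + \<kappa> * (ph x - ph y)\<bar> <= Fb"
proof -
 have "\<bar>\<kappa> * (ph x - ph y)\<bar> <= \<kappa> * 4" unfolding abs_mult using \<kappa> ph_bound[of x y] by (simp add: mult_left_mono)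
 thus ?thesis unfolding Fb_def by linarith
qed

lemma flow_W_bound:
 assumes x: "ode (fld \<tau>) x" and t: "t >= 0" and M: "M >= Fb" "\<bar>Wc (x 0)\<bar> <= M"
 shows "\<bar>Wc (x t)\<bar> <= M"
proof -
 have cont: "continuous_on {0..t} (%t. Wc (x t))"
  by (intro continuous_on_fst continuous_on_subset[OF ode_continuous[OF x]]) auto
 have der: "((%t. Wc (x t)) has_real_derivative B * (F0 + \<kappa> * (ph (Nc (x u)) - ph (Pc (x u))) - Wc (x u))) (at u)" if "0 < u" for u
  using vd_comps(1)[OF ode_at[OF x that]] by (simp add: fld_def)
 have "Wc (x t) - M <= 0"
 proof (rule barrier_nonpos[OF t, where f="%t. Wc (x t) - M"])
  fix u assume u: "0 < u" "Wc (x u) - M > 0"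
  have "F0 + \<kappa> * (ph (Nc (x u)) - ph (Pc (x u))) - Wc (x u) <= 0" using F_bound[of "Nc (x u)" "Pc (x u)"] u M by linarith
  hence "B * (F0 + \<kappa> * (ph (Nc (x u)) - ph (Pc (x u))) - Wc (x u)) <= 0" using B by (simp add: mult_le_0_iff)
  thus "\<exists>d. ((%t. Wc (x t) - M) has_real_derivative d) (at u) & d <= 0"
   using DERIV_diff[OF der[OF u(1)] DERIV_const[of M]] by auto
 qed (use M in \<open>auto intro!: continuous_intros cont\<close>)
 moreover have "- Wc (x t) - M <= 0"
 proof (rule barrier_nonpos[OF t, where f="%t. - Wc (x t) - M"])
  fix u assume u: "0 < u" "- Wc (x u) - M > 0"
  have "F0 + \<kappa> * (ph (Nc (x u)) - ph (Pc (x u))) - Wc (x u) >= 0" using F_bound[of "Nc (x u)" "Pc (x u)"] u M by linarith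
  hence "B * (F0 + \<kappa> * (ph (Nc (x u)) - ph (Pc (x u))) - Wc (x u)) >= 0" using B by simp
  thus "\<exists>d. ((%t. - Wc (x t) - M) has_real_derivative d) (at u) & d <= 0"
   using DERIV_diff[OF DERIV_minus[OF der[OF u(1)]] DERIV_const[of M]] by auto
 qed (use M in \<open>auto intro!: continuous_intros cont\<close>)
 ultimately show ?thesis by linarith
qed

text \<open>LaSalle's argument: the energy is bounded on a compact set and falls at least at the
  rate \<open>md\<close> times the squared speed, so the speed cannot stay away from 0. A limit of
  points with vanishing speed is an equilibrium.\<close>

lemma flow_accumulates:
 assumes x: "ode (fld \<tau>) x" and dom: "\<And>t. t >= 0 ==> x t \<in> dom3"
 obtains z where "eqm \<tau> z" "\<And>e. e > 0 ==> \<exists>t\<ge>0. norm (x t - z) < e"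
proof -
 define M where "M = max Fb \<bar>Wc (x 0)\<bar>"
 define K where "K = dom3 \<inter> {z. \<bar>Wc z\<bar> <= M}"
 have K: "compact K" unfolding K_def by (rule compact_dom3_slab)
 have xK: "x t \<in> K" if "t >= 0" for t
  using dom[OF that] flow_W_bound[OF x that, of M] by (simp add: K_def M_def)
 have "bounded (En \<tau> ` K)" by (intro compact_imp_bounded compact_continuous_image En_continuous K)
 then obtain C where C: "\<And>z. z \<in> K ==> \<bar>En \<tau> z\<bar> <= C" by (force simp: bounded_iff)
 have small: "\<exists>t\<ge>0. norm (fld \<tau> (x t)) < e" if e: "e > 0" for e
 proof (rule ccontr)
  assume "\<not> ?thesis"
  hence ge: "norm (fld \<tau> (x t)) >= e" if "t >= 0" for t using that by force
  define c where "c = md * e\<^sup>2"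
  have c: "c > 0" using md_pos e by (simp add: c_def)
  \<comment> \<open>By this time the energy would have dropped by \<open>2 * C + 1\<close>, more
    than its total oscillation.\<close>
  define T where "T = (2 * C + 1) / c"
  have C0: "C >= 0" using C[OF xK[of 0]] by linarith
  have T: "T > 0" using c C0 by (simp add: T_def)
  have "En \<tau> (x T) + c * T <= En \<tau> (x 0) + c * 0"
  proof (rule DERIV_nonpos_imp_decreasing_open[OF less_imp_le[OF T]])
   have "continuous_on {0..T} x" by (rule continuous_on_subset[OF ode_continuous[OF x]]) auto
   hence "continuous_on {0..T} (%t. En \<tau> (x t))"
    by (rule continuous_on_compose2[OF En_continuous]) auto
   thus "continuous_on {0..T} (%t. En \<tau> (x t) + c * t)" by (intro continuous_intros)
   fix t assume t: "0 < t" "t < T"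
   define d where "d = fld \<tau> (x t)"
   have dm: "x t \<in> dom3" using dom t by simp
   have dd: "Wc d = B * (F0 + \<kappa> * (Phi (Nc (x t)) - Phi (Pc (x t))) - Wc (x t))"
    "Pc d = - r * (Wc (x t) - (G0 + k * (Pc (x t))\<^sup>2))"
    "Nc d = r * (Wc (x t) - (G0 + k * (Nc (x t))\<^sup>2) - \<tau>)"
    by (simp_all add: d_def fld_dom[OF dm])
   define E' where "E' = - (Wc d)\<^sup>2 / B - \<kappa> * sd (Pc (x t)) * (Pc d)\<^sup>2 / r
     - \<kappa> * sd (Nc (x t)) * (Wc (x t) - (G0 + k * (Nc (x t))\<^sup>2) - \<tau>) * Nc d"
   have der: "((%t. En \<tau> (x t)) has_real_derivative E') (at t)"
    unfolding E'_def by (rule En_deriv[OF ode_at[OF x t(1), folded d_def] dd(1,2)])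
   have "Wc (x t) - (G0 + k * (Nc (x t))\<^sup>2) - \<tau> = Nc d / r" using dd(3) r by simp
   hence "E' = - ((Wc d)\<^sup>2 / B + \<kappa> * sd (Pc (x t)) * (Pc d)\<^sup>2 / r + \<kappa> * sd (Nc (x t)) * (Nc d)\<^sup>2 / r)"
    by (simp add: E'_def power2_eq_square)
   also have "... <= - (md * (norm d)\<^sup>2)" using dissipation[OF dm, of d] by simp
   also have "... <= - c"
    unfolding c_def using ge[of t] t md_pos e by (simp add: d_def power_mono)
   finally have "E' <= - c" .
   moreover have "((%t. En \<tau> (x t) + c * t) has_real_derivative E' + c * 1) (at t)"
    by (intro DERIV_add der DERIV_cmult DERIV_ident)
   ultimately show "\<exists>y. ((%t. En \<tau> (x t) + c * t) has_real_derivative y) (at t) & y <= 0"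
    by (intro exI[of _ "E' + c * 1"]) simp
  qed
  moreover have "c * T = 2 * C + 1" using c by (simp add: T_def)
  moreover have "\<bar>En \<tau> (x T)\<bar> <= C" "\<bar>En \<tau> (x 0)\<bar> <= C" using C xK T by auto
  ultimately show False by linarith
 qed
 have "\<forall>n. \<exists>t\<ge>0. norm (fld \<tau> (x t)) < inverse (real (Suc n))" using small by simp
 then obtain tt where tt: "\<And>n. tt n >= 0" "\<And>n. norm (fld \<tau> (x (tt n))) < inverse (real (Suc n))" by metis
 have "\<forall>n. x (tt n) \<in> K" using xK tt by simp
 then obtain z \<sigma> where z: "z \<in> K" "strict_mono \<sigma>" "((%n. x (tt n)) \<circ> \<sigma>) \<longlonglongrightarrow> z"
  using K unfolding compact_def by meson
 have "(%n. fld \<tau> (x (tt n))) \<longlonglongrightarrow> 0"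
  by (rule Lim_null_comparison[OF _ LIMSEQ_inverse_real_of_nat]) (rule always_eventually[OF allI[OF less_imp_le[OF tt(2)]]])
 hence "((%n. fld \<tau> (x (tt n))) \<circ> \<sigma>) \<longlonglongrightarrow> 0" using z(2) by (rule LIMSEQ_subseq_LIMSEQ)
 moreover have "(%n. fld \<tau> (((%n. x (tt n)) \<circ> \<sigma>) n)) \<longlonglongrightarrow> fld \<tau> z"
 proof (rule isCont_tendsto_compose[OF _ z(3)])
  show "isCont (fld \<tau>) z" using fld_continuous[of UNIV \<tau>] by (simp add: continuous_on_eq_continuous_at)
 qed
 ultimately have "fld \<tau> z = 0" by (simp add: o_def LIMSEQ_unique)
 hence "eqm \<tau> z" using z(1) by (simp add: eqm_def K_def)
 moreover have "\<exists>t\<ge>0. norm (x t - z) < e" if e: "e > 0" for e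
 proof -
  obtain n where "dist (((%n. x (tt n)) \<circ> \<sigma>) n) z < e"
   using z(3) e unfolding lim_sequentially by (meson order_refl)
  thus ?thesis using tt(1) by (auto simp: dist_norm)
 qed
 ultimately show ?thesis by (rule that)
qed

end

section \<open>The switched system\<close>

lemma phase_iff: "v \<in> phase_space \<longleftrightarrow> -1 < Pc (zp v) & Pc (zp v) < Nc (zp v) & Nc (zp v) < 1 & -1 <= Xc v & Xc v <= 1"
 by (cases v) (auto simp: phase_space_def space4_def zp_def Xc_def)

context climate begin

definition hh :: "state4 => real" where "hh v = b * (Nc (zp v) - Xc v) - a * (1 - Nc (zp v))"

text \<open>The phase \<open>True\<close> is the glacial advance with field \<open>X\<^sub>+\<close> in the region \<open>h > 0\<close>,
 the phase \<open>False\<close> belongs to \<open>X\<^sub>-\<close>; \<open>HH u\<close> is positive inside the region of phase \<open>u\<close>.\<close>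

definition ta :: "bool => real" where "ta u = (if u then 0 else dl)"
definition be :: "bool => real" where "be u = (if u then bp else bm)"
definition HH :: "bool => state4 => real" where "HH u v = (if u then hh v else - hh v)"

text \<open>Both parameters are interpolated simultaneously; as the fields are affine in them, this
  is the convex combination of the two fields, see \<open>mix_affine\<close>.\<close>

definition mix :: "real => real => state4 => state4" where
 "mix s ep v = fld4 ((1 - s) * dl) ((1 - s) * bm + s * bp) ep v"

definition incl :: "real => state4 => state4 set" where
 "incl ep v = {mix s ep v | s. s \<in> {0..1} & (hh v > 0 --> s = 1) & (hh v < 0 --> s = 0)}"

text \<open>Solutions without the constraint to the phase space, and with the exceptional null set
  made explicit; this form is convenient for cutting and gluing.\<close>

definition gsol :: "real => real set => (real => state4) => bool" where
 "gsol ep J x \<longleftrightarrow> (\<forall>s t. {s..t} \<subseteq> J --> lips {s..t} x) &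
   (\<exists>Z. negligible Z & (\<forall>t\<in>J - Z. \<exists>y\<in>incl ep (x t). (x has_vector_derivative y) (at t)))"

lemma mix_ends: "mix 1 ep = fld4 (ta True) (be True) ep" "mix 0 ep = fld4 (ta False) (be False) ep"
 by (rule ext, simp add: mix_def ta_def be_def)+

lemma ta_bounds: "0 <= ta u" "ta u <= dl" using dl by (auto simp: ta_def)
lemma be_pos: "be u > 0" using bs ab by (auto simp: be_def)

lemma fld_tau: "fld \<tau> z = fld 0 z - (0, 0, r * \<tau>)"
 by (simp add: fld_def algebra_simps)

lemma incl_bound: "\<exists>C\<ge>0. \<forall>v. \<forall>y\<in>incl ep v. norm y <= C * (1 + norm v)"
proof -
 define C where "C = norm (fld 0 0) + Lf + r * dl + \<bar>ep\<bar> * (2 * bp + 2 * a)"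
 have C: "C >= 0" using Lf(1)[THEN less_imp_le] r dl bs ab by (simp add: C_def)
 have "norm y <= C * (1 + norm v)" if y: "y \<in> incl ep v" for v y
 proof -
  obtain s where s: "0 <= s" "s <= 1" "y = mix s ep v" using y by (auto simp: incl_def)
  define n where "n = norm v"
  have n: "n >= 0" by (simp add: n_def)
  have "norm (fld 0 (zp v) - fld 0 0) <= Lf * norm (zp v - 0)"
   using lipschitz_onD[OF Lf(2)[of 0], of "zp v" 0] by (simp add: dist_norm)
  also have "... <= Lf * n" using norm_zp_le[of v] Lf(1) by (simp add: n_def)
  finally have 1: "norm (fld 0 (zp v) - fld 0 0) <= Lf * n" .
  have "norm (fld 0 (zp v)) <= norm (fld 0 0) + norm (fld 0 (zp v) - fld 0 0)"
   using norm_triangle_ineq[of "fld 0 0" "fld 0 (zp v) - fld 0 0"] by simp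
  hence 2: "norm (fld 0 (zp v)) <= norm (fld 0 0) + Lf * n" using 1 by linarith
  have "norm (0 :: real, 0 :: real, r * ((1 - s) * dl)) = r * ((1 - s) * dl)"
   using s r dl by (simp add: norm_Pair)
  also have "... <= r * dl" using s r dl by (simp add: mult_left_le_one_le)
  finally have 3: "norm (0 :: real, 0 :: real, r * ((1 - s) * dl)) <= r * dl" .
  have "norm (fld ((1 - s) * dl) (zp v)) <= norm (fld 0 (zp v)) + norm (0 :: real, 0 :: real, r * ((1 - s) * dl))"
   unfolding fld_tau[of "(1 - s) * dl"] by (rule norm_triangle_ineq4)
  hence 4: "norm (fld ((1 - s) * dl) (zp v)) <= norm (fld 0 0) + Lf * n + r * dl" using 2 3 by linarith
  define \<beta> where "\<beta> = (1 - s) * bm + s * bp"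
  have "(1 - s) * bm <= (1 - s) * bp" using s bs by (intro mult_left_mono) auto
  moreover have "0 <= (1 - s) * bm + s * bp" using s bs by simp
  ultimately have \<beta>: "0 <= \<beta>" "\<beta> <= bp" by (simp_all add: \<beta>_def algebra_simps)
  have nx: "\<bar>Nc (zp v)\<bar> <= n" "\<bar>Xc v\<bar> <= n"
   using order_trans[OF abs_Nc_le norm_zp_le] norm_Xc_le by (simp_all add: n_def)
  have "\<bar>\<beta> * (Nc (zp v) - Xc v)\<bar> <= bp * (2 * n)"
   unfolding abs_mult using \<beta> nx by (intro mult_mono) auto
  moreover have "\<bar>a * (1 - Nc (zp v))\<bar> <= a * (1 + n)"
   unfolding abs_mult using nx ab by (intro mult_mono) auto
  ultimately have "\<bar>Xi \<beta> (Nc (zp v)) (Xc v)\<bar> <= bp * (2 * n) + a * (1 + n)"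
   unfolding Xi_def by linarith
  also have "... <= (2 * bp + 2 * a) * (1 + n)" using bs ab n by (simp add: algebra_simps)
  finally have "\<bar>ep * Xi \<beta> (Nc (zp v)) (Xc v)\<bar> <= \<bar>ep\<bar> * ((2 * bp + 2 * a) * (1 + n))"
   unfolding abs_mult by (intro mult_left_mono) auto
  moreover have "norm y <= norm (fld ((1 - s) * dl) (zp v)) + \<bar>ep * Xi \<beta> (Nc (zp v)) (Xc v)\<bar>"
   unfolding s(3) mix_def fld4_def \<beta>_def by (rule norm_mk_le)
  ultimately have "norm y <= norm (fld 0 0) + Lf * n + r * dl + \<bar>ep\<bar> * ((2 * bp + 2 * a) * (1 + n))" using 4 by linarith
  also have "... <= C * (1 + n)"
   using n Lf(1) r dl norm_ge_zero[of "fld 0 0"] by (simp add: C_def algebra_simps)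
  finally show ?thesis by (simp add: n_def)
 qed
 thus ?thesis using C by blast
qed

lemma lips_state4: "lips I (%t. Wc (zp (x t))) ==> lips I (%t. Pc (zp (x t))) ==> lips I (%t. Nc (zp (x t))) ==>
  lips I (%t. Xc (x t)) ==> lips I x"
proof -
 assume "lips I (%t. Wc (zp (x t)))" "lips I (%t. Pc (zp (x t)))" "lips I (%t. Nc (zp (x t)))" "lips I (%t. Xc (x t))"
 hence "lips I (%t. (Wc (zp (x t)), Pc (zp (x t)), Nc (zp (x t)), Xc (x t)))" by (intro lips_Pair)
 moreover have "(%t. (Wc (zp (x t)), Pc (zp (x t)), Nc (zp (x t)), Xc (x t))) = x" by (simp add: zp_def Xc_def)
 ultimately show ?thesis by simp
qed

text \<open>On compact time intervals solutions are Lipschitz, since the inclusion has linear growth.\<close>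

lemma filippov_gsol:
 "filippov_solution (incl ep) phase_space J x \<longleftrightarrow> gsol ep J x & (\<forall>t\<in>J. x t \<in> phase_space)"
proof
 assume f: "filippov_solution (incl ep) phase_space J x"
 hence ph: "\<forall>t\<in>J. x t \<in> phase_space" and ac: "\<And>s t. {s..t} \<subseteq> J ==> abs_cont_on {s..t} x"
  and AE: "AE t in lebesgue. t \<in> J --> (\<exists>y\<in>incl ep (x t). (x has_vector_derivative y) (at t))"
  by (auto simp: filippov_solution_def)
 from AE obtain Z where Z: "Z \<in> null_sets lebesgue"
   "{t \<in> space lebesgue. \<not> (t \<in> J --> (\<exists>y\<in>incl ep (x t). (x has_vector_derivative y) (at t)))} \<subseteq> Z"
  unfolding eventually_ae_filter by blast
 have nZ: "negligible Z" using Z(1) by (simp add: negligible_iff_null_sets)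
 have dZ: "\<exists>y\<in>incl ep (x t). (x has_vector_derivative y) (at t)" if "t \<in> J - Z" for t
  using that Z(2) by auto
 obtain C where C: "C >= 0" "\<And>v y. y \<in> incl ep v ==> norm y <= C * (1 + norm v)" using incl_bound by meson
 have "lips {s..t} x" if sub: "{s..t} \<subseteq> J" for s t
 proof -
  have "continuous_on {s..t} x" by (rule abs_cont_continuous[OF ac[OF sub]])
  hence "bounded (x ` {s..t})" by (intro compact_imp_bounded compact_continuous_image) auto
  then obtain M where M: "M > 0" "\<And>u. u \<in> {s..t} ==> norm (x u) <= M" unfolding bounded_pos by blast
  define M' where "M' = C * (1 + M)"
  have M': "M' >= 0" using C M by (simp add: M'_def)
  have d: "\<exists>y. (x has_vector_derivative y) (at u) & norm y <= M'" if u: "u \<in> {s<..<t} - Z" for u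
  proof -
   have uu: "u \<in> {s..t}" "u \<in> J - Z" using u sub by auto
   obtain y where y: "y \<in> incl ep (x u)" "(x has_vector_derivative y) (at u)" using dZ[OF uu(2)] by blast
   have "norm y <= C * (1 + norm (x u))" by (rule C(2)[OF y(1)])
   also have "... <= M'" unfolding M'_def using M(2)[OF uu(1)] C(1) by (intro mult_left_mono) auto
   finally show ?thesis using y(2) by blast
  qed
  have comp: "lips {s..t} (%u. f (x u))" if bl: "bounded_linear f" and le: "\<And>v. \<bar>f v\<bar> <= norm v" for f :: "state4 => real"
  proof -
   have "M'-lipschitz_on {s..t} (%u. f (x u))"
   proof (rule abs_cont_imp_lipschitz[OF abs_cont_on_mono[OF ac[OF sub]] nZ M'])
    show "norm (f (x s) - f (x t)) <= norm (x s - x t)" for s t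
     using le[of "x s - x t"] linear_diff[OF bounded_linear.linear[OF bl], of "x s" "x t"] by simp
    fix u assume "u \<in> {s<..<t} - Z"
    then obtain y where y: "(x has_vector_derivative y) (at u)" "norm y <= M'" using d by blast
    have "((%u. f (x u)) has_real_derivative f y) (at u)"
     unfolding has_real_derivative_iff_has_vector_derivative
     by (rule bounded_linear.has_vector_derivative[OF bl y(1)])
    moreover have "\<bar>f y\<bar> <= M'" using le[of y] y(2) by linarith
    ultimately show "\<exists>d. ((%u. f (x u)) has_real_derivative d) (at u) & \<bar>d\<bar> <= M'" by blast
   qed
   thus ?thesis by (auto simp: lips_def)
  qed
  have nz: "\<bar>Wc (zp v)\<bar> <= norm v" "\<bar>Pc (zp v)\<bar> <= norm v" "\<bar>Nc (zp v)\<bar> <= norm v" for v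
   by (rule order_trans[OF abs_Wc_le norm_zp_le], rule order_trans[OF abs_Pc_le norm_zp_le], rule order_trans[OF abs_Nc_le norm_zp_le])
  have bf: "bounded_linear (%v. fst (zp v))" by (rule bounded_linear_compose[OF bounded_linear_fst bounded_linear_zp])
  have bsn: "bounded_linear (%v. snd (zp v))" by (rule bounded_linear_compose[OF bounded_linear_snd bounded_linear_zp])
  show ?thesis
   by (rule lips_state4[OF comp[OF bf nz(1)] comp[OF bounded_linear_compose[OF bounded_linear_fst bsn] nz(2)]
    comp[OF bounded_linear_compose[OF bounded_linear_snd bsn] nz(3)] comp[OF bounded_linear_Xc norm_Xc_le]])
 qed
 thus "gsol ep J x & (\<forall>t\<in>J. x t \<in> phase_space)" using nZ dZ ph unfolding gsol_def by blast
next
 assume g: "gsol ep J x & (\<forall>t\<in>J. x t \<in> phase_space)"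
 then obtain Z where Z: "negligible Z" "\<forall>t\<in>J - Z. \<exists>y\<in>incl ep (x t). (x has_vector_derivative y) (at t)"
  unfolding gsol_def by blast
 have "Z \<in> null_sets lebesgue" using Z(1) by (simp add: negligible_iff_null_sets)
 hence "AE t in lebesgue. t \<in> J --> (\<exists>y\<in>incl ep (x t). (x has_vector_derivative y) (at t))"
  by (rule AE_I') (use Z(2) in auto)
 moreover have "abs_cont_on {s..t} x" if "{s..t} \<subseteq> J" for s t
  using g that lipschitz_imp_abs_cont unfolding gsol_def lips_def by blast
 ultimately show "filippov_solution (incl ep) phase_space J x"
  using g unfolding filippov_solution_def by blast
qed

section \<open>Cutting, shifting and gluing solutions\<close>

lemma gsol_lips: "gsol ep J x ==> {s..t} \<subseteq> J ==> lips {s..t} x"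
 by (simp add: gsol_def)

lemma gsol_continuous: "gsol ep J x ==> {s..t} \<subseteq> J ==> continuous_on {s..t} x"
 by (rule lips_continuous[OF gsol_lips])

lemma gsol_subset: "gsol ep J x ==> K \<subseteq> J ==> gsol ep K x"
 unfolding gsol_def by (meson DiffD1 DiffD2 DiffI subset_iff subset_trans)

text \<open>Values outside \<open>J\<close> affect the two-sided derivative only at the ends of the
  interval, and the frontier of an interval is negligible.\<close>

lemma gsol_cong:
 assumes g: "gsol ep J x" and J: "is_interval J" and eq: "\<And>t. t \<in> J ==> x t = y t"
 shows "gsol ep J y"
proof -
 obtain Z where Z: "negligible Z" "\<And>t. t \<in> J - Z ==> \<exists>d\<in>incl ep (x t). (x has_vector_derivative d) (at t)"
  using g unfolding gsol_def by blast
 have "negligible (frontier J)" by (rule negligible_convex_frontier[OF is_interval_convex[OF J]])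
 hence nZ: "negligible (Z \<union> frontier J)" using Z(1) by simp
 have "\<exists>d\<in>incl ep (y t). (y has_vector_derivative d) (at t)" if t: "t \<in> J - (Z \<union> frontier J)" for t
 proof -
  have ti: "t \<in> interior J" using t closure_subset[of J] by (auto simp: frontier_def)
  obtain d where d: "d \<in> incl ep (x t)" "(x has_vector_derivative d) (at t)" using Z(2)[of t] t by blast
  have "(y has_vector_derivative d) (at t)"
   by (rule has_vector_derivative_transform_within_open[OF d(2) open_interior ti])
    (use eq interior_subset in blast)
  moreover have "x t = y t" using eq t by blast
  ultimately show ?thesis using d(1) by auto
 qed
 moreover have "lips {s..t} y" if "{s..t} \<subseteq> J" for s t
  by (rule lips_cong[OF gsol_lips[OF g that]]) (use eq that in auto)
 ultimately show ?thesis unfolding gsol_def using nZ by blast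
qed

lemma lips_join:
 fixes f :: "real => 'a::metric_space"
 assumes "lips {s..c} f" "lips {c..t} f" "s <= c" "c <= t"
 shows "lips {s..t} f"
proof -
 obtain K L where K: "K-lipschitz_on {s..c} f" "L-lipschitz_on {c..t} f" using assms by (auto simp: lips_def)
 have "(max K L)-lipschitz_on {s..t} (%x. if x <= c then f x else f x)"
  by (rule lipschitz_on_concat_max[OF K]) simp
 thus ?thesis by (auto simp: lips_def)
qed

lemma gsol_Un:
 assumes g1: "gsol ep {s..c} x" and g2: "gsol ep J x" and J: "is_interval J" "c \<in> J" "J \<subseteq> {c..}" and sc: "s <= c"
 shows "gsol ep ({s..c} \<union> J) x"
proof -
 obtain Z1 where Z1: "negligible Z1" "\<forall>t\<in>{s..c} - Z1. \<exists>d\<in>incl ep (x t). (x has_vector_derivative d) (at t)"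
  using g1 unfolding gsol_def by blast
 obtain Z2 where Z2: "negligible Z2" "\<forall>t\<in>J - Z2. \<exists>d\<in>incl ep (x t). (x has_vector_derivative d) (at t)"
  using g2 unfolding gsol_def by blast
 have "negligible (Z1 \<union> Z2)" using Z1 Z2 by simp
 moreover have "\<forall>t\<in>({s..c} \<union> J) - (Z1 \<union> Z2). \<exists>d\<in>incl ep (x t). (x has_vector_derivative d) (at t)"
  using Z1(2) Z2(2) by blast
 moreover have "lips {u..t} x" if sub: "{u..t} \<subseteq> {s..c} \<union> J" for u t
 proof (cases "u <= t")
  case ut: True
  have su: "s <= u" using sub ut J sc by (force simp: subset_iff)
  consider "t <= c" | "c <= u" | "u < c" "c < t" by linarith
  thus ?thesis
  proof cases
   case 1 thus ?thesis using gsol_lips[OF g1, of u t] su by auto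
  next
   case 2
   have "v \<in> J" if v: "v \<in> {u..t}" for v
   proof (cases "v \<in> J")
    case False
    hence "v \<in> {s..c}" using v sub by blast
    hence "v = c" using v 2 by simp
    thus ?thesis using J(2) by simp
   qed
   hence "{u..t} \<subseteq> J" by blast
   thus ?thesis using gsol_lips[OF g2] by blast
  next
   case 3
   have "t \<in> {s..c} \<union> J" using sub ut by (meson atLeastAtMost_iff order_refl subsetD)
   hence "t \<in> J" using 3 by simp
   hence "{c..t} \<subseteq> J" using J(1,2) unfolding is_interval_1 by (meson atLeastAtMost_iff subsetI)
   hence 2: "lips {c..t} x" by (rule gsol_lips[OF g2])
   have 1: "lips {u..c} x" by (rule gsol_lips[OF g1]) (use su in simp)
   show ?thesis by (rule lips_join[OF 1 2]) (use 3 in simp_all)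
  qed
 qed (auto simp: lips_def intro: exI[of _ 0])
 ultimately show ?thesis unfolding gsol_def by blast
qed

lemma gsol_exhaust:
 assumes g: "\<And>n::nat. gsol ep (J n) x" and ex: "\<And>s t. {s..t} \<subseteq> K ==> s <= t ==> \<exists>n. {s..t} \<subseteq> J n"
 shows "gsol ep K x"
proof -
 have "\<forall>n. \<exists>Z. negligible Z & (\<forall>t\<in>J n - Z. \<exists>d\<in>incl ep (x t). (x has_vector_derivative d) (at t))"
  using g unfolding gsol_def by blast
 then obtain Z where Z: "\<And>n. negligible (Z n)"
   "\<And>n. \<forall>t\<in>J n - Z n. \<exists>d\<in>incl ep (x t). (x has_vector_derivative d) (at t)" by metis
 have "negligible (\<Union>n. Z n)" by (rule negligible_countable_Union) (use Z in auto)
 moreover have "\<exists>d\<in>incl ep (x t). (x has_vector_derivative d) (at t)" if t: "t \<in> K - (\<Union>n. Z n)" for t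
 proof -
  obtain n where "{t..t} \<subseteq> J n" using ex[of t t] t by auto
  thus ?thesis using Z(2)[of n] t by auto
 qed
 moreover have "lips {s..t} x" if sub: "{s..t} \<subseteq> K" for s t
 proof (cases "s <= t")
  case True
  then obtain n where "{s..t} \<subseteq> J n" using ex[OF sub True] by blast
  thus ?thesis by (rule gsol_lips[OF g])
 qed (auto simp: lips_def intro: exI[of _ 0])
 ultimately show ?thesis unfolding gsol_def by blast
qed

lemma gsol_shift:
 assumes g: "gsol ep J x" and sh: "\<And>t. t \<in> K ==> t + c \<in> J"
 shows "gsol ep K (%t. x (t + c))"
proof -
 obtain Z where Z: "negligible Z" "\<And>t. t \<in> J - Z ==> \<exists>d\<in>incl ep (x t). (x has_vector_derivative d) (at t)"
  using g unfolding gsol_def by blast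
 have "negligible ((+) (- c) ` Z)" by (rule negligible_translation[OF Z(1)])
 moreover have "\<exists>d\<in>incl ep (x (t + c)). ((%t. x (t + c)) has_vector_derivative d) (at t)" if t: "t \<in> K - (+) (- c) ` Z" for t
 proof -
  have "t = - c + (t + c)" by simp
  hence "t + c \<notin> Z" using t by (metis DiffD2 image_eqI)
  hence "t + c \<in> J - Z" using sh t by blast
  then obtain d where d: "d \<in> incl ep (x (t + c))" "(x has_vector_derivative d) (at (t + c))" using Z(2) by blast
  have "((%t. t + c) has_vector_derivative 1) (at t)" by (auto intro!: derivative_eq_intros)
  from vector_diff_chain_at[OF this, of x d] d show ?thesis by (auto simp: o_def)
 qed
 moreover have "lips {s..t} (%t. x (t + c))" if sub: "{s..t} \<subseteq> K" for s t
 proof -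
  have "{s + c..t + c} \<subseteq> J"
  proof
   fix u assume "u \<in> {s + c..t + c}"
   hence "u - c \<in> K" using sub by auto
   thus "u \<in> J" using sh by fastforce
  qed
  hence "lips {s + c..t + c} x" by (rule gsol_lips[OF g])
  then obtain L where L: "L-lipschitz_on {s + c..t + c} x" by (auto simp: lips_def)
  have "L-lipschitz_on {s..t} (%t. x (t + c))"
  proof (rule lipschitz_onI)
   fix u v assume "u \<in> {s..t}" "v \<in> {s..t}"
   thus "dist (x (u + c)) (x (v + c)) <= L * dist u v"
    using lipschitz_onD[OF L, of "u + c" "v + c"] by (simp add: dist_real_def)
  qed (rule lipschitz_on_nonneg[OF L])
  thus ?thesis by (auto simp: lips_def)
 qed
 ultimately show ?thesis unfolding gsol_def by blast
qed

text \<open>The common lower bound \<open>d0\<close> sends the junction times to infinity: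
  switchings cannot accumulate, and the pieces cover the half-line.\<close>

lemma gsol_concat:
 fixes seg :: "nat => real => state4"
 assumes g: "\<And>n. gsol ep {0..d n} (seg n)" and m: "\<And>n. seg n (d n) = seg (Suc n) 0"
  and d: "d0 > 0" "\<And>n. d n >= d0"
 obtains y where "gsol ep {0..} y" "\<And>n u. 0 <= u ==> u <= d n ==> y ((\<Sum>i<n. d i) + u) = seg n u"
  "\<And>t. t >= 0 ==> \<exists>n u. t = (\<Sum>i<n. d i) + u & 0 <= u & u <= d n"
proof -
 define tt where "tt n = (\<Sum>i<n. d i)" for n
 have tt0: "tt 0 = 0" and ttS: "tt (Suc n) = tt n + d n" for n by (simp_all add: tt_def)
 have dp: "d n > 0" for n using d(1) d(2)[of n] by linarith
 have smono: "strict_mono tt" by (rule strict_monoI_Suc) (use dp ttS in simp)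
 have ttge: "tt n >= d0 * n" for n
  by (induction n) (use d(2) tt0 ttS in \<open>auto simp: algebra_simps intro: add_mono\<close>)
 \<comment> \<open>A junction time is assigned to the later piece; by \<open>m\<close> the earlier
   piece has the same value there.\<close>
 define idx where "idx t = (LEAST n. t < tt (Suc n))" for t
 define y where "y t = seg (idx t) (t - tt (idx t))" for t
 have ex: "\<exists>n. t < tt (Suc n)" for t
 proof -
  obtain n :: nat where "t / d0 < n" using reals_Archimedean2 by blast
  hence "t < d0 * n" using d(1) by (simp add: field_simps)
  also have "... <= tt n" by (rule ttge)
  also have "... < tt (Suc n)" using dp ttS by simp
  finally show ?thesis by blast
 qed
 have idx: "idx t = n" if "tt n <= t" "t < tt (Suc n)" for t n
  unfolding idx_def
 proof (rule Least_equality)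
  fix k assume k: "t < tt (Suc k)"
  show "n <= k"
  proof (rule ccontr)
   assume "\<not> n <= k"
   hence "Suc k <= n" by simp
   hence "tt (Suc k) <= tt n" using smono by (simp add: strict_mono_less_eq)
   thus False using k that by simp
  qed
 qed (fact that(2))
 have yv: "y (tt n + u) = seg n u" if u: "0 <= u" "u <= d n" for n u
 proof (cases "u < d n")
  case True
  thus ?thesis using idx[of n "tt n + u"] u ttS by (simp add: y_def)
 next
  case False
  hence ud: "u = d n" using u by simp
  hence e: "tt n + u = tt (Suc n)" using ttS by simp
  have "idx (tt (Suc n)) = Suc n" by (rule idx) (use smono in \<open>auto simp: strict_mono_less\<close>)
  thus ?thesis using m[of n] ud unfolding e y_def by simp
 qed
 have piece: "gsol ep {tt n..tt (Suc n)} y" for n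
 proof -
  have "gsol ep {tt n..tt (Suc n)} (%t. seg n (t + - tt n))"
   by (rule gsol_shift[OF g]) (use ttS in auto)
  thus ?thesis
  proof (rule gsol_cong)
   fix t assume "t \<in> {tt n..tt (Suc n)}"
   thus "seg n (t + - tt n) = y t" using yv[of "t - tt n" n] ttS by simp
  qed (rule is_interval_cc)
 qed
 have init: "gsol ep {0..tt (Suc n)} y" for n
 proof (induction n)
  case 0 show ?case using piece[of 0] tt0 by simp
 next
  case (Suc n)
  have le: "0 <= tt (Suc n)" "tt (Suc n) <= tt (Suc (Suc n))"
   using ttge[of "Suc n"] d(1) dp[of "Suc n"] ttS[of "Suc n"] by (auto intro: order_trans[rotated])
  have "gsol ep ({0..tt (Suc n)} \<union> {tt (Suc n)..tt (Suc (Suc n))}) y"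
   by (rule gsol_Un[OF Suc piece is_interval_cc]) (use le in auto)
  thus ?case using le by (simp add: ivl_disj_un_two_touch)
 qed
 have "gsol ep {0..} y"
 proof (rule gsol_exhaust[OF init])
  fix s t :: real assume st: "{s..t} \<subseteq> {0..}" "s <= t"
  obtain n where "t < tt (Suc n)" using ex by blast
  thus "\<exists>n. {s..t} \<subseteq> {0..tt (Suc n)}" using st by (intro exI[of _ n]) auto
 qed
 moreover have "\<exists>n u. t = tt n + u & 0 <= u & u <= d n" if "t >= 0" for t
 proof -
  define n where "n = idx t"
  have lt: "t < tt (Suc n)" unfolding n_def idx_def using ex by (rule LeastI_ex)
  have "tt n <= t"
  proof (cases n)
   case 0 thus ?thesis using tt0 that by simp
  next
   case (Suc k)
   have "\<not> t < tt (Suc k)"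
    by (rule not_less_Least) (use Suc in \<open>simp add: n_def[symmetric] idx_def[symmetric]\<close>)
   thus ?thesis using Suc by simp
  qed
  thus ?thesis using lt ttS by (intro exI[of _ n] exI[of _ "t - tt n"]) auto
 qed
 ultimately show ?thesis using yv that unfolding tt_def by blast
qed

text \<open>Negative times are reduced modulo \<open>P\<close>. Each half-line starting at a
  negative multiple of \<open>P\<close> carries a shifted copy of \<open>y\<close>, and these
  half-lines exhaust the real line.\<close>

lemma gsol_periodic:
 assumes g: "gsol ep {0..} y" and P: "P > 0" and per: "\<And>t. t >= 0 ==> y (t + P) = y t"
 obtains x where "gsol ep UNIV x" "\<And>t. t >= 0 ==> x t = y t" "\<And>t. x (t + P) = x t" "range x = y ` {0..P}"
proof -
 define fl where "fl t = t - P * of_int \<lfloor>t / P\<rfloor>" for t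
 define x where "x t = y (fl t)" for t
 have pern: "y (t + P * real n) = y t" if "t >= 0" for t n
 proof (induction n)
  case (Suc n)
  have "y (t + P * real (Suc n)) = y ((t + P * real n) + P)" by (simp add: algebra_simps)
  also have "... = y (t + P * real n)" by (rule per) (use that P in simp)
  finally show ?case using Suc by simp
 qed simp
 have fl: "0 <= fl t" "fl t < P" for t
 proof -
  have "of_int \<lfloor>t / P\<rfloor> <= t / P" by (rule of_int_floor_le)
  moreover have "t / P < of_int \<lfloor>t / P\<rfloor> + 1" by linarith
  ultimately have "of_int \<lfloor>t / P\<rfloor> * P <= t" "t < (of_int \<lfloor>t / P\<rfloor> + 1) * P"
   by (simp_all only: pos_le_divide_eq[OF P] pos_divide_less_eq[OF P])
  thus "0 <= fl t" "fl t < P" by (simp_all add: fl_def algebra_simps)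
 qed
 have xs: "x t = y (t + P * real n)" if "t + P * real n >= 0" for t n
 proof -
  have "\<lfloor>t / P\<rfloor> + int n >= 0"
  proof -
   have "(t + P * real n) / P >= 0" using that P by simp
   hence "t / P + real n >= 0" using P by (simp add: add_divide_distrib)
   moreover have "\<lfloor>t / P\<rfloor> + int n = \<lfloor>t / P + real n\<rfloor>" using floor_add_int[of "t / P" "int n"] by simp
   ultimately show ?thesis by (simp only: zero_le_floor)
  qed
  then obtain j where j: "\<lfloor>t / P\<rfloor> + int n = int j" by (metis nonneg_int_cases)
  have "real_of_int (\<lfloor>t / P\<rfloor> + int n) = real_of_int (int j)" by (simp only: j)
  hence "real j = real_of_int \<lfloor>t / P\<rfloor> + real n" by simp
  hence "t + P * real n = fl t + P * real j" by (simp add: fl_def algebra_simps)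
  thus ?thesis unfolding x_def using pern[OF fl(1), of t j] by simp
 qed
 have x0: "x t = y t" if "t >= 0" for t using xs[of t 0] that by simp
 have xp: "x (t + P) = x t" for t
 proof -
  have "fl (t + P) = fl t" using P by (simp add: fl_def add_divide_distrib algebra_simps)
  thus ?thesis by (simp add: x_def)
 qed
 have gn: "gsol ep {- (P * real n)..} x" for n
 proof (rule gsol_cong)
  show "gsol ep {- (P * real n)..} (%t. y (t + P * real n))"
   by (rule gsol_shift[OF g]) auto
  fix t assume "t \<in> {- (P * real n)..}"
  hence "t + P * real n >= 0" by simp
  from xs[OF this] show "y (t + P * real n) = x t" ..
 qed (rule is_interval_ci)
 have "gsol ep UNIV x"
 proof (rule gsol_exhaust[OF gn])
  fix s t :: real
  obtain n :: nat where "- s / P < n" using reals_Archimedean2 by blast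
  hence "- s < P * n" using P by (simp add: field_simps)
  thus "\<exists>n. {s..t} \<subseteq> {- (P * real n)..}" by (intro exI[of _ n]) auto
 qed
 moreover have "range x = y ` {0..P}"
 proof
  show "range x \<subseteq> y ` {0..P}"     proof (rule image_subsetI)
   fix t show "x t \<in> y ` {0..P}" unfolding x_def by (rule imageI) (use fl[of t] in simp)
  qed
  show "y ` {0..P} \<subseteq> range x"
  proof (rule image_subsetI)
   fix t assume "t \<in> {0..P}"
   hence "y t = x t" using x0[of t] by simp
   thus "y t \<in> range x" by simp
  qed
 qed
 ultimately show ?thesis using x0 xp by (intro that)
qed

section \<open>Crossing the switching manifold, and uniqueness\<close>

lemma hh_alt: "hh v = (a + b) * Nc (zp v) - b * Xc v - a" by (simp add: hh_def algebra_simps)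

lemma vd_hh:
 assumes "(x has_vector_derivative d) (at t within S)"
 shows "((%t. hh (x t)) has_real_derivative (a + b) * Nc (zp d) - b * Xc d) (at t within S)"
 unfolding hh_alt
 by (intro DERIV_cong[OF DERIV_diff[OF DERIV_diff[OF DERIV_cmult[OF vd_comps(3)[OF vd_zp[OF assms]]]
  DERIV_cmult[OF vd_Xc[OF assms]]] DERIV_const]]) simp

lemma lips_hh: "lips I x ==> lips I (%t. hh (x t))"
proof -
 assume x: "lips I x"
 have m: "lips I (%t. c * f t)" if "lips I f" for c and f :: "real => real"
 proof (rule lips_comp[OF _ that])
  show "\<bar>c\<bar>-lipschitz_on UNIV ((*) c)"
   by (rule lipschitz_onI) (auto simp: dist_real_def abs_mult[symmetric] right_diff_distrib[symmetric])
 qed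
 show ?thesis unfolding hh_alt by (intro lips_diff m lips_comps lips_zp lips_Xc x lips_const)
qed

lemma hh_continuous: "continuous_on S hh"
 unfolding hh_alt zp_def Xc_def by (auto intro!: continuous_intros)

text \<open>The derivative of the switching function along the \<open>s\<close>-mixture of the two fields.\<close>

definition hd4 :: "real => real => state4 => real" where
 "hd4 ep s v = (a + b) * Nc (zp (mix s ep v)) - b * Xc (mix s ep v)"

lemma hd4_alt: "hd4 ep s v = (a + b) * Nc (fld ((1 - s) * dl) (zp v)) - b * (ep * Xi ((1 - s) * bm + s * bp) (Nc (zp v)) (Xc v))"
 by (simp add: hd4_def mix_def fld4_def)

lemma hd4_affine: "hd4 ep s v = (1 - s) * hd4 ep 0 v + s * hd4 ep 1 v"
 by (simp add: hd4_alt fld_def Xi_def algebra_simps)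

lemma hd4_continuous: "continuous_on S (hd4 ep s)"
 unfolding hd4_def mix_def
 by (intro continuous_intros continuous_on_compose2[OF linear_continuous_on[OF bounded_linear_zp] fld4_continuous]
  continuous_on_compose2[OF linear_continuous_on[OF bounded_linear_Xc] fld4_continuous] continuous_on_snd) auto

text \<open>On the switching manifold both fields point strictly to the same side, so there is no sliding.\<close>

definition strict :: "real => state4 => bool" where
 "strict ep v \<longleftrightarrow> (hh v = 0 --> (hd4 ep 0 v > 0 & hd4 ep 1 v > 0) \<or> (hd4 ep 0 v < 0 & hd4 ep 1 v < 0))"

text \<open>The region entered next. On the manifold one of the two normal speeds decides; under
  \<open>strict\<close> the other has the same sign.\<close>

definition side :: "real => state4 => bool" where
 "side ep v \<longleftrightarrow> hh v > 0 \<or> (hh v = 0 & hd4 ep 1 v > 0)"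

text \<open>On the manifold, strictness gives both fields, hence by affinity every mixture, a normal
  speed of one sign that is bounded away from 0 for a short time. Whatever mixture the solution
  selects, it enters the same region. Off the manifold continuity suffices.\<close>

lemma gsol_side:
 assumes g: "gsol ep {s..t} x" and st: "s < t" and str: "strict ep (x s)"
 obtains w where "s < w" "w <= t" "\<And>u. s < u ==> u <= w ==> HH (side ep (x s)) (x u) > 0"
proof (cases "hh (x s) = 0")
 case False
 have cx: "continuous_on {s..t} x" by (rule gsol_continuous[OF g]) simp
 hence c: "continuous_on {s..t} (%u. HH (side ep (x s)) (x u))"
  unfolding HH_def by (cases "side ep (x s)") (auto intro!: continuous_intros continuous_on_compose2[OF hh_continuous cx])
 have "HH (side ep (x s)) (x s) > 0" using False by (auto simp: HH_def side_def)
 then obtain e where e: "e > 0" "\<And>u. u \<in> {s..t} ==> dist u s < e ==> dist (HH (side ep (x s)) (x u)) (HH (side ep (x s)) (x s)) < HH (side ep (x s)) (x s)"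
  using c st unfolding continuous_on_iff by (meson atLeastAtMost_iff less_imp_le order_refl)
 show ?thesis
 proof (rule that[of "min t (s + e / 2)"])
  fix u assume "s < u" "u <= min t (s + e / 2)"
  hence "u \<in> {s..t}" "dist u s < e" using e(1) by (auto simp: dist_real_def)
  from e(2)[OF this] show "HH (side ep (x s)) (x u) > 0" by (auto simp: dist_real_def)
 qed (use st e in auto)
next
 case True
 define u0 where "u0 = side ep (x s)"
 define K where "K p v = (if u0 then hd4 ep p v else - hd4 ep p v)" for p v
 have K0: "K 0 (x s) > 0" "K 1 (x s) > 0" using str True by (auto simp: strict_def u0_def side_def K_def)
 define c where "c = min (K 0 (x s)) (K 1 (x s)) / 2"
 have c: "c > 0" "K 0 (x s) > c" "K 1 (x s) > c" using K0 by (auto simp: c_def min_def)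
 have cx: "continuous_on {s..t} x" by (rule gsol_continuous[OF g]) simp
 have cK: "continuous_on {s..t} (%u. K p (x u))" for p
  unfolding K_def by (cases u0) (auto intro!: continuous_intros continuous_on_compose2[OF hd4_continuous cx])
 have near: "\<exists>e>0. \<forall>u\<in>{s..t}. dist u s < e --> K p (x u) > c" if "K p (x s) > c" for p
 proof -
  have "K p (x s) - c > 0" "s \<in> {s..t}" using that st by auto
  then obtain e where "e > 0" "\<forall>u\<in>{s..t}. dist u s < e --> dist (K p (x u)) (K p (x s)) < K p (x s) - c"
   using cK[of p] unfolding continuous_on_iff by meson
  thus ?thesis by (intro exI[of _ e]) (auto simp: dist_real_def)
 qed
 obtain e0 e1 where e: "e0 > 0" "\<forall>u\<in>{s..t}. dist u s < e0 --> K 0 (x u) > c"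
   "e1 > 0" "\<forall>u\<in>{s..t}. dist u s < e1 --> K 1 (x u) > c"
  using near[of 0] near[of 1] c by meson
 define w where "w = min t (s + min e0 e1 / 2)"
 obtain Z where Z: "negligible Z" "\<forall>t\<in>{s..t} - Z. \<exists>d\<in>incl ep (x t). (x has_vector_derivative d) (at t)"
  using g unfolding gsol_def by blast
 show ?thesis
 proof (rule that[of w])
  show "s < w" "w <= t" using st e by (auto simp: w_def)
  fix u assume u: "s < u" "u <= w"
  have sub: "{s..u} \<subseteq> {s..t}" using u by (auto simp: w_def)
  define f where "f y = (if u0 then - hh (x y) else hh (x y))" for y
  have lf: "lips {s..u} f"
   unfolding f_def using lips_hh[OF gsol_lips[OF g sub]] lips_minus[OF lips_hh[OF gsol_lips[OF g sub]]] by (cases u0) auto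
  have "f u - f s <= - c * (u - s)"
  proof (rule lips_increment_le[OF lf _ Z(1)])
   fix y assume y: "y \<in> {s<..<u} - Z"
   hence yy: "y \<in> {s..t}" "dist y s < e0" "dist y s < e1" using u e by (auto simp: w_def dist_real_def)
   obtain d where d: "d \<in> incl ep (x y)" "(x has_vector_derivative d) (at y)" using Z(2) y yy by blast
   then obtain p where p: "0 <= p" "p <= 1" "d = mix p ep (x y)" by (auto simp: incl_def)
   have D: "((%y. hh (x y)) has_real_derivative hd4 ep p (x y)) (at y)"
    using vd_hh[OF d(2)] by (simp add: hd4_def p(3))
   have "K p (x y) = (1 - p) * K 0 (x y) + p * K 1 (x y)"
    unfolding K_def hd4_affine[of ep p] by (simp add: algebra_simps)
   also have "... >= (1 - p) * c + p * c" using e yy p by (intro add_mono mult_left_mono) (auto intro: less_imp_le)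
   finally have Kc: "K p (x y) >= c" by (simp add: algebra_simps)
   have "(f has_real_derivative - K p (x y)) (at y)"
    unfolding f_def K_def using D DERIV_minus[OF D] by (cases u0) auto
   thus "\<exists>d. (f has_real_derivative d) (at y) & d <= - c" using Kc by (intro exI[of _ "- K p (x y)"]) simp
  qed (use u in simp)
  moreover have "c * (u - s) > 0" using c u by simp
  moreover have "f s = 0" using True by (simp add: f_def)
  ultimately have "f u < 0" by (simp add: algebra_simps)
  thus "HH (side ep (x s)) (x u) > 0" unfolding u0_def[symmetric] by (auto simp: f_def HH_def split: if_splits)
 qed
qed

lemma incl_side: "HH u v > 0 ==> incl ep v = {fld4 (ta u) (be u) ep v}"
 using mix_ends by (cases u) (auto simp: incl_def HH_def)

text \<open>Inside one region the inclusion is a single Lipschitz field, so Gronwall applies to the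
  squared distance.\<close>

lemma gsol_unique_side:
 assumes x: "gsol ep {s..t} x" and y: "gsol ep {s..t} y" and st: "s <= t" and eq: "x s = y s"
  and side: "\<And>v. s < v ==> v < t ==> HH u (x v) > 0 & HH u (y v) > 0"
 shows "x t = y t"
proof -
 obtain L where L: "L > 0" "L-lipschitz_on UNIV (fld4 (ta u) (be u) ep)" using fld4_lipschitz by blast
 obtain Zx where Zx: "negligible Zx" "\<forall>t\<in>{s..t} - Zx. \<exists>d\<in>incl ep (x t). (x has_vector_derivative d) (at t)"
  using x unfolding gsol_def by blast
 obtain Zy where Zy: "negligible Zy" "\<forall>t\<in>{s..t} - Zy. \<exists>d\<in>incl ep (y t). (y has_vector_derivative d) (at t)"
  using y unfolding gsol_def by blast
 define V where "V v = (norm (x v - y v))\<^sup>2" for v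
 have "lips {s..t} (%v. norm (x v - y v))"
 proof (rule lips_comp[of 1 norm])
  show "1-lipschitz_on UNIV (norm :: state4 => real)"
  proof (rule lipschitz_onI)
   fix u v :: state4 show "dist (norm u) (norm v) <= 1 * dist u v"
    using norm_triangle_ineq3[of u v] by (simp only: dist_norm real_norm_def mult_1)
  qed simp
 qed (intro lips_diff gsol_lips[OF x] gsol_lips[OF y] order_refl)
 hence lV: "lips {s..t} V" unfolding V_def by (rule lips_power)
 have "V t <= exp (2 * L * (t - s)) * V s"
 proof (rule gronwall_ae[OF lV st])
  show "negligible (Zx \<union> Zy)" using Zx Zy by simp
  fix v assume v: "v \<in> {s<..<t} - (Zx \<union> Zy)"
  define f where "f = fld4 (ta u) (be u) ep"
  have dx: "(x has_vector_derivative f (x v)) (at v)" "(y has_vector_derivative f (y v)) (at v)"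
  proof -
   have vs: "v \<in> {s..t} - Zx" "v \<in> {s..t} - Zy" "HH u (x v) > 0" "HH u (y v) > 0" using v side[of v] by auto
   show "(x has_vector_derivative f (x v)) (at v)"
    using bspec[OF Zx(2) vs(1)] unfolding incl_side[OF vs(3)] f_def by simp
   show "(y has_vector_derivative f (y v)) (at v)"
    using bspec[OF Zy(2) vs(2)] unfolding incl_side[OF vs(4)] f_def by simp
  qed
  have V_inner: "V = (%v. (x v - y v) \<bullet> (x v - y v))" by (rule ext) (simp add: V_def power2_norm_eq_inner)
  have d: "((%s. x s - y s) has_vector_derivative f (x v) - f (y v)) (at v)"
   using dx by (rule has_vector_derivative_diff)
  have "(V has_derivative (%h. (x v - y v) \<bullet> (h *\<^sub>R (f (x v) - f (y v))) + (h *\<^sub>R (f (x v) - f (y v))) \<bullet> (x v - y v))) (at v)"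
   unfolding V_inner using d unfolding has_vector_derivative_def by (intro has_derivative_inner)
  moreover have "(%h. (x v - y v) \<bullet> (h *\<^sub>R (f (x v) - f (y v))) + (h *\<^sub>R (f (x v) - f (y v))) \<bullet> (x v - y v))
    = (*) (2 * ((x v - y v) \<bullet> (f (x v) - f (y v))))"
   by (rule ext) (simp only: inner_scaleR_left inner_scaleR_right inner_commute[of "f (x v) - f (y v)"], simp)
  ultimately have "(V has_real_derivative 2 * ((x v - y v) \<bullet> (f (x v) - f (y v)))) (at v)"
   by (simp only: has_field_derivative_def)
  moreover have "2 * ((x v - y v) \<bullet> (f (x v) - f (y v))) <= 2 * L * V v"
  proof -
   have "(x v - y v) \<bullet> (f (x v) - f (y v)) <= norm (x v - y v) * norm (f (x v) - f (y v))"
    by (rule norm_cauchy_schwarz)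
   also have "... <= norm (x v - y v) * (L * norm (x v - y v))"
    using lipschitz_onD[OF L(2), of "x v" "y v"] by (intro mult_left_mono) (auto simp: dist_norm f_def)
   finally show ?thesis by (simp add: V_def power2_eq_square mult_ac)
  qed
  ultimately show "\<exists>d. (V has_real_derivative d) (at v) & d <= 2 * L * V v" by blast
 qed
 hence "V t <= 0" by (simp add: V_def eq)
 thus ?thesis by (simp add: V_def)
qed

text \<open>At the last time \<open>m\<close> of agreement both solutions are in the same strict
  state, enter the same region and agree beyond \<open>m\<close>. Strictness is asked of
  \<open>y\<close> only, since the competitor inherits it from the common state.\<close>

lemma gsol_unique:
 assumes x: "gsol ep {0..T} x" and y: "gsol ep {0..T} y" and eq: "x 0 = y 0"
  and str: "\<And>t. 0 <= t ==> t < T ==> strict ep (y t)" and t: "0 <= t" "t <= T"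
 shows "x t = y t"
proof -
 define A where "A = {t \<in> {0..T}. \<forall>s\<in>{0..t}. x s = y s}"
 have A0: "0 \<in> A" using t eq by (auto simp: A_def)
 have bd: "bdd_above A" by (rule bdd_aboveI[of _ T]) (auto simp: A_def)
 define m where "m = Sup A"
 have m: "0 <= m" "m <= T"
 proof -
  show "0 <= m" unfolding m_def by (rule cSup_upper[OF A0 bd])
  show "m <= T" unfolding m_def
  proof (rule cSup_least)
   show "A \<noteq> {}" using A0 by blast
  qed (simp add: A_def)
 qed
 have less: "x s = y s" if "0 <= s" "s < m" for s
 proof -
  have "\<exists>u\<in>A. s < u" using that(2) A0 unfolding m_def by (metis empty_iff less_cSup_iff bd)
  then obtain u where "u \<in> A" "s < u" by blast
  thus ?thesis using that(1) by (simp add: A_def)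
 qed
 have mm: "x m = y m"
 proof (cases "m = 0")
  case False
  have "continuous_on {0..T} (%s. x s - y s)"
   by (intro continuous_intros gsol_continuous[OF x] gsol_continuous[OF y]) auto
  hence "continuous_on {0..m} (%s. x s - y s)" by (rule continuous_on_subset) (use m in auto)
  moreover have "x s - y s = 0" if "s \<in> {0..<m}" for s using less that by simp
  moreover have "closure {0..<m} = {0..m}" using False m(1) by simp
  ultimately have "x m - y m = 0"
   using continuous_constant_on_closure[of "{0..<m}" "%s. x s - y s" 0 m] m(1) by simp
  thus ?thesis by simp
 qed (use eq in simp)
 have all: "x s = y s" if "0 <= s" "s <= m" for s using less mm that by (cases "s = m") auto
 have "m = T"
 proof (rule ccontr)
  assume "m \<noteq> T"
  hence mT: "m < T" using m by simp
  have sub: "{m..T} \<subseteq> {0..T}" using m by auto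
  have gx: "gsol ep {m..T} x" and gy: "gsol ep {m..T} y" using gsol_subset[OF x sub] gsol_subset[OF y sub] by auto
  have sm: "strict ep (y m)" "strict ep (x m)" using str[of m] m mT mm by auto
  obtain w1 where w1: "m < w1" "w1 <= T" "\<And>u. m < u ==> u <= w1 ==> HH (side ep (x m)) (x u) > 0"
   using gsol_side[OF gx mT sm(2)] by blast
  obtain w2 where w2: "m < w2" "w2 <= T" "\<And>u. m < u ==> u <= w2 ==> HH (side ep (x m)) (y u) > 0"
   using gsol_side[OF gy mT sm(1)] mm by metis
  define w where "w = min w1 w2"
  have w: "m < w" "w <= T" using w1 w2 by (auto simp: w_def)
  have "x u = y u" if u: "m <= u" "u <= w" for u
  proof (rule gsol_unique_side[where u="side ep (x m)", of ep m])
   show "gsol ep {m..u} x" by (rule gsol_subset[OF gx]) (use u w in simp)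
   show "gsol ep {m..u} y" by (rule gsol_subset[OF gy]) (use u w in simp)
   fix v assume "m < v" "v < u"
   thus "HH (side ep (x m)) (x v) > 0 & HH (side ep (x m)) (y v) > 0" using w1(3)[of v] w2(3)[of v] u by (simp add: w_def)
  qed (use u mm in simp_all)
  hence "x s = y s" if "0 <= s" "s <= w" for s using all[of s] that by (cases "s <= m") simp_all
  hence "\<forall>s\<in>{0..w}. x s = y s" by (meson atLeastAtMost_iff)
  moreover have "w \<in> {0..T}" using w m by simp
  ultimately have "w \<in> A" unfolding A_def by blast
  hence "w <= m" unfolding m_def by (rule cSup_upper[OF _ bd])
  thus False using w by simp
 qed
 thus ?thesis using all t by simp
qed

lemma flow_gsol:
 assumes y: "ode (fld4 (ta u) (be u) ep) y" and J: "J \<subseteq> {0..}" and H: "\<And>t. t \<in> J ==> HH u (y t) >= 0"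
 shows "gsol ep J y"
proof -
 have "lips {s..t} y" if "{s..t} \<subseteq> J" for s t
 proof (cases "s <= t")
  case True
  hence "s >= 0" using that J by auto
  thus ?thesis by (rule flow4_lips[OF y])
 qed (auto simp: lips_def intro: exI[of _ 0])
 moreover have "\<exists>d\<in>incl ep (y t). (y has_vector_derivative d) (at t)" if t: "t \<in> J - {0}" for t
 proof -
  have "t > 0" using t J by force
  moreover have "fld4 (ta u) (be u) ep (y t) \<in> incl ep (y t)"
   using H[of t] t mix_ends unfolding incl_def HH_def by (cases u) (auto intro: exI[of _ 1] exI[of _ 0])
  ultimately show ?thesis using ode_at[OF y] by blast
 qed
 moreover have "negligible {0::real}" by simp
 ultimately show ?thesis unfolding gsol_def by blast
qed

end

section \<open>Following a phase of the switched system\<close>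

context climate begin

definition sg :: "bool => real" where "sg u = (if u then 1 else -1)"

lemma HH_sg: "HH u v = sg u * hh v" by (simp add: HH_def sg_def)
lemma sg_sq [simp]: "sg u * (sg u * c) = c" by (simp add: sg_def)
lemma abs_sg [simp]: "\<bar>sg u\<bar> = 1" by (simp add: sg_def)

lemma flow4_deriv:
 assumes y: "ode (fld4 \<tau> \<beta> ep) y" and t: "t > 0"
 shows "((%t. Xc (y t)) has_real_derivative ep * Xi \<beta> (Nc (zp (y t))) (Xc (y t))) (at t)"
  and "((%t. Nc (zp (y t))) has_real_derivative Nc (fld \<tau> (zp (y t)))) (at t)"
 using vd_Xc[OF ode_at[OF y t]] vd_comps(3)[OF vd_zp[OF ode_at[OF y t]]] by (simp_all add: fld4_def)

lemma flow4_cont: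
 assumes y: "ode (fld4 \<tau> \<beta> ep) y" and S: "S \<subseteq> {0..}"
 shows "continuous_on S (%t. zp (y t))" "continuous_on S (%t. Xc (y t))" "continuous_on S (%t. Nc (zp (y t)))" "continuous_on S (%t. hh (y t))"
proof -
 have c: "continuous_on S y" by (rule continuous_on_subset[OF ode_continuous[OF y] S])
 show z: "continuous_on S (%t. zp (y t))"
  by (rule continuous_on_compose2[OF linear_continuous_on[OF bounded_linear_zp, of UNIV] c]) simp
 show "continuous_on S (%t. Xc (y t))"
  by (rule continuous_on_compose2[OF linear_continuous_on[OF bounded_linear_Xc, of UNIV] c]) simp
 show "continuous_on S (%t. Nc (zp (y t)))" by (intro continuous_on_snd z)
 show "continuous_on S (%t. hh (y t))" by (rule continuous_on_compose2[OF hh_continuous[of UNIV] c]) simp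
qed

text \<open>Largest modulus at which the slow field \<open>Xi\<close> can vanish while the northern
  line stays within \<open>N\<close>; beyond it the slow variable is driven back.\<close>

definition XB :: "real => real => real" where "XB \<beta> N = N + a * (1 + N) / \<beta>"

lemma xi_bound:
 assumes y: "ode (fld4 \<tau> \<beta> ep) y" and \<beta>: "\<beta> > 0" and ep: "ep > 0" and t: "t >= 0"
  and n: "\<And>s. 0 <= s ==> s <= t ==> \<bar>Nc (zp (y s))\<bar> <= N" and i: "\<bar>Xc (y 0)\<bar> <= XB \<beta> N"
 shows "\<bar>Xc (y t)\<bar> <= XB \<beta> N"
proof -
 have M: "\<beta> * XB \<beta> N = \<beta> * N + a * (1 + N)" using \<beta> by (simp add: XB_def field_simps)
 have c: "continuous_on {0..t} (%t. Xc (y t))" by (rule flow4_cont[OF y]) auto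
 have up: "Xc (y t) - XB \<beta> N <= 0"
 proof (rule barrier_nonpos[OF t, where f="%t. Xc (y t) - XB \<beta> N"])
  fix s assume s: "0 < s" "s < t" "Xc (y s) - XB \<beta> N > 0"
  have nn: "Nc (zp (y s)) <= N" "- N <= Nc (zp (y s))" using n[of s] s by auto
  have "\<beta> * XB \<beta> N < \<beta> * Xc (y s)" using s(3) \<beta> by simp
  moreover have "(\<beta> + a) * Nc (zp (y s)) <= (\<beta> + a) * N" using nn \<beta> ab by (intro mult_left_mono) auto
  moreover have "a >= 0" using ab by simp
  ultimately have "Xi \<beta> (Nc (zp (y s))) (Xc (y s)) <= 0" unfolding Xi_def using M by (simp add: algebra_simps)
  hence "ep * Xi \<beta> (Nc (zp (y s))) (Xc (y s)) <= 0" using ep by (simp add: mult_le_0_iff)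
  thus "\<exists>d. ((%t. Xc (y t) - XB \<beta> N) has_real_derivative d) (at s) & d <= 0"
   using DERIV_diff[OF flow4_deriv(1)[OF y s(1)] DERIV_const[of "XB \<beta> N"]] by auto
 qed (use i in \<open>auto intro!: continuous_intros c\<close>)
 have dn: "- Xc (y t) - XB \<beta> N <= 0"
 proof (rule barrier_nonpos[OF t, where f="%t. - Xc (y t) - XB \<beta> N"])
  fix s assume s: "0 < s" "s < t" "- Xc (y s) - XB \<beta> N > 0"
  have nn: "Nc (zp (y s)) <= N" "- N <= Nc (zp (y s))" using n[of s] s by auto
  have "\<beta> * XB \<beta> N < \<beta> * - Xc (y s)" using s(3) \<beta> by (intro mult_strict_left_mono) auto
  moreover have "(\<beta> + a) * - N <= (\<beta> + a) * Nc (zp (y s))" using nn \<beta> ab by (intro mult_left_mono) auto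
  ultimately have "Xi \<beta> (Nc (zp (y s))) (Xc (y s)) >= 0" unfolding Xi_def using M by (simp add: algebra_simps)
  hence "- (ep * Xi \<beta> (Nc (zp (y s))) (Xc (y s))) <= 0" using ep by simp
  thus "\<exists>d. ((%t. - Xc (y t) - XB \<beta> N) has_real_derivative d) (at s) & d <= 0"
   using DERIV_diff[OF DERIV_minus[OF flow4_deriv(1)[OF y s(1)]] DERIV_const[of "XB \<beta> N"]] by auto
 qed (use i in \<open>auto intro!: continuous_intros c\<close>)
 show ?thesis using up dn by linarith
qed

definition CX :: "real => real => real" where "CX \<beta> N = \<beta> * (N + XB \<beta> N) + a * (1 + N)"

lemma xi_move:
 assumes y: "ode (fld4 \<tau> \<beta> ep) y" and \<beta>: "\<beta> > 0" and ep: "ep > 0" and st: "0 <= s" "s <= t"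
  and n: "\<And>s. 0 <= s ==> s <= t ==> \<bar>Nc (zp (y s))\<bar> <= N" and i: "\<bar>Xc (y 0)\<bar> <= XB \<beta> N"
 shows "\<bar>Xc (y t) - Xc (y s)\<bar> <= ep * CX \<beta> N * (t - s)"
proof -
 have Xib: "\<bar>ep * Xi \<beta> (Nc (zp (y u))) (Xc (y u))\<bar> <= ep * CX \<beta> N" if u: "0 <= u" "u <= t" for u
 proof -
  have x: "\<bar>Xc (y u)\<bar> <= XB \<beta> N" by (rule xi_bound[OF y \<beta> ep u(1) _ i]) (use n u in auto)
  have "\<bar>\<beta> * (Nc (zp (y u)) - Xc (y u))\<bar> <= \<beta> * (N + XB \<beta> N)"
   unfolding abs_mult using \<beta> x n[OF u] by (intro mult_mono) auto
  moreover have "\<bar>a * (1 - Nc (zp (y u)))\<bar> <= a * (1 + N)"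
   unfolding abs_mult using ab n[OF u] by (intro mult_mono) auto
  ultimately have "\<bar>Xi \<beta> (Nc (zp (y u))) (Xc (y u))\<bar> <= CX \<beta> N" unfolding Xi_def CX_def by linarith
  thus ?thesis unfolding abs_mult using ep by simp
 qed
 have c: "continuous_on {s..t} (%t. Xc (y t))" by (rule flow4_cont[OF y]) (use st in auto)
 have "Xc (y t) - ep * CX \<beta> N * t <= Xc (y s) - ep * CX \<beta> N * s"
 proof (rule DERIV_nonpos_imp_decreasing_open[OF st(2)])
  fix u assume u: "s < u" "u < t"
  have "((%t. Xc (y t) - ep * CX \<beta> N * t) has_real_derivative ep * Xi \<beta> (Nc (zp (y u))) (Xc (y u)) - ep * CX \<beta> N * 1) (at u)"
   by (intro DERIV_diff DERIV_cmult DERIV_ident flow4_deriv(1)[OF y]) (use u st in auto)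
  thus "\<exists>d. ((%t. Xc (y t) - ep * CX \<beta> N * t) has_real_derivative d) (at u) & d <= 0"
   using Xib[of u] u st by (intro exI conjI) auto
 qed (intro continuous_intros c)
 moreover have "- Xc (y t) - ep * CX \<beta> N * t <= - Xc (y s) - ep * CX \<beta> N * s"
 proof (rule DERIV_nonpos_imp_decreasing_open[OF st(2)])
  fix u assume u: "s < u" "u < t"
  have "((%t. - Xc (y t) - ep * CX \<beta> N * t) has_real_derivative - (ep * Xi \<beta> (Nc (zp (y u))) (Xc (y u))) - ep * CX \<beta> N * 1) (at u)"
   by (intro DERIV_diff DERIV_minus DERIV_cmult DERIV_ident flow4_deriv(1)[OF y]) (use u st in auto)
  thus "\<exists>d. ((%t. - Xc (y t) - ep * CX \<beta> N * t) has_real_derivative d) (at u) & d <= 0"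
   using Xib[of u] u st by (intro exI conjI) auto
 qed (intro continuous_intros c)
 ultimately show ?thesis by (simp add: algebra_simps abs_le_iff)
qed

lemma HH_diff: "HH u v - HH u v' = sg u * (a + b) * (Nc (zp v) - Nc (zp v')) - sg u * b * (Xc v - Xc v')"
 by (simp add: HH_sg hh_alt algebra_simps)

text \<open>Progress of the northern line in the direction of the phase moves the state away from
  the manifold; the slow drift can take back at most \<open>b * e\<close>.\<close>

lemma HH_lower:
 assumes "\<bar>Xc v - Xc v'\<bar> <= e"
 shows "HH u v >= HH u v' + (a + b) * (sg u * (Nc (zp v) - Nc (zp v'))) - b * e"
proof -
 have "\<bar>sg u * b * (Xc v - Xc v')\<bar> <= b * e"
  using assms ab by (simp add: abs_mult)
 thus ?thesis using HH_diff[of u v v'] by (simp add: mult_ac abs_le_iff)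
qed

text \<open>An equilibrium for such \<tau> is a sub-equilibrium of the flow of phase
  \<open>True\<close>, respectively a super-equilibrium for phase \<open>False\<close>.\<close>

definition toward :: "bool => real => bool" where
 "toward u \<tau> \<longleftrightarrow> (if u then \<tau> > ta u else \<tau> < ta u)"

lemma fld_at_eqm: "eqm \<tau> z ==> fld (ta u) z = (0, 0, r * (\<tau> - ta u))"
 using fld_tau[of "ta u" z] fld_tau[of \<tau> z] by (simp add: eqm_def prod_eq_iff algebra_simps)

text \<open>Leaving an equilibrium of another critical temperature: the exact orbit is monotone by
 cooperativity, so nearby solutions do not return to the switching manifold.\<close>

lemma escape_monotone:
 assumes z0: "ode (fld (ta u)) z0" and e: "eqm \<tau> (z0 0)" and d: "toward u \<tau>" and st: "0 <= s" "s <= t"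
 shows "if u then le3 (z0 s) (z0 t) else le3 (z0 t) (z0 s)"
proof (cases u)
 case True
 have "le3 0 (fld (ta u) (z0 0))" using d r True by (simp add: fld_at_eqm[OF e] le3_def toward_def)
 thus ?thesis using flow_increasing[OF z0 _ st] True by simp
next
 case False
 have "le3 (fld (ta u) (z0 0)) 0" using d r False by (simp add: fld_at_eqm[OF e] le3_def toward_def mult_le_0_iff)
 thus ?thesis using flow_decreasing[OF z0 _ st] False by simp
qed

text \<open>Up to a short time \<open>t0\<close> the northern line moves with at least half its
  initial speed, and by monotonicity the exact orbit keeps this gain afterwards. Nearby orbits lose
  only part of it, and the slow drift up to the time \<open>T\<close> is of order
  \<open>ep\<close>.\<close>

lemma escape:
 assumes z0: "ode (fld (ta u)) z0" and e: "eqm \<tau> (z0 0)" and d: "toward u \<tau>" and T: "T > 0" and \<rho>: "\<rho> > 0"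
 obtains \<delta> ep0 where "\<delta> > 0" "ep0 > 0"
  "\<And>ep y t. 0 < ep ==> ep < ep0 ==> ode (fld4 (ta u) (be u) ep) y ==> norm (zp (y 0) - z0 0) <= \<delta> ==> \<bar>Xc (y 0)\<bar> <= 1 ==>
    HH u (y 0) >= 0 ==> 0 < t ==> t <= T ==> HH u (y t) > 0"
  "\<And>ep y t. ode (fld4 (ta u) (be u) ep) y ==> norm (zp (y 0) - z0 0) <= \<delta> ==> 0 <= t ==> t <= T ==>
    norm (zp (y t) - z0 t) < \<rho>"
proof -
 define D where "D = r * \<bar>\<tau> - ta u\<bar>"
 have ne: "\<tau> \<noteq> ta u" using d by (auto simp: toward_def split: if_splits)
 have D: "D > 0" using r ne by (simp add: D_def)
 have sgD: "sg u * Nc (fld (ta u) (z0 0)) = D"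
  using d by (auto simp: fld_at_eqm[OF e] D_def sg_def toward_def split: if_splits)
 \<comment> \<open>On a ball of this radius the Lipschitz bound leaves at least half of the initial
   speed \<open>D\<close>.\<close>
 define \<eta> where "\<eta> = D / (2 * Lf)"
 have \<eta>: "\<eta> > 0" using D Lf(1) by (simp add: \<eta>_def)
 have rate: "sg u * Nc (fld (ta u) z) >= D / 2" if z: "norm (z - z0 0) <= \<eta>" for z
 proof -
  have "\<bar>Nc (fld (ta u) z) - Nc (fld (ta u) (z0 0))\<bar> <= norm (fld (ta u) z - fld (ta u) (z0 0))"
   using abs_Nc_le[of "fld (ta u) z - fld (ta u) (z0 0)"] by simp
  also have "... <= Lf * norm (z - z0 0)" using lipschitz_onD[OF Lf(2)[of "ta u"], of z "z0 0"] by (simp add: dist_norm)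
  also have "... <= Lf * \<eta>" using z Lf(1) by simp
  also have "... = D / 2" using Lf(1) by (simp add: \<eta>_def)
  finally have "\<bar>sg u * Nc (fld (ta u) z) - sg u * Nc (fld (ta u) (z0 0))\<bar> <= D / 2"
   by (simp add: abs_mult flip: right_diff_distrib)
  thus ?thesis unfolding sgD by linarith
 qed
 have cz0: "continuous_on {0..} z0" by (rule ode_continuous[OF z0])
 obtain t1 where t1: "t1 > 0" "\<And>t. t \<in> {0..} ==> dist t 0 < t1 ==> dist (z0 t) (z0 0) < \<eta> / 2"
  using cz0 \<eta> unfolding continuous_on_iff by (meson atLeast_iff half_gt_zero order_refl)
 define t0 where "t0 = min T (t1 / 2)"
 have t0: "0 < t0" "t0 <= T" using T t1(1) by (auto simp: t0_def)
 have z0near: "norm (z0 t - z0 0) <= \<eta> / 2" if "0 <= t" "t <= t0" for t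
  using t1(2)[of t] that t1(1) by (simp add: t0_def dist_norm)
 have z0n: "((%t. Nc (z0 t)) has_real_derivative Nc (fld (ta u) (z0 t))) (at t)" if "t > 0" for t
  by (rule vd_comps(3)[OF ode_at[OF z0 that]])
 have drop0: "sg u * (Nc (z0 t0) - Nc (z0 0)) >= D / 2 * t0"
 proof -
  have "D / 2 * t0 - sg u * Nc (z0 t0) <= D / 2 * 0 - sg u * Nc (z0 0)"
  proof (rule DERIV_nonpos_imp_decreasing_open[of 0 t0 "%t. D / 2 * t - sg u * Nc (z0 t)"])
   fix t assume t: "0 < t" "t < t0"
   have "((%t. D / 2 * t - sg u * Nc (z0 t)) has_real_derivative D / 2 * 1 - sg u * Nc (fld (ta u) (z0 t))) (at t)"
    by (intro DERIV_diff DERIV_cmult DERIV_ident z0n t)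
   moreover have "sg u * Nc (fld (ta u) (z0 t)) >= D / 2" by (rule rate) (use z0near[of t] t \<eta> in auto)
   ultimately show "\<exists>d. ((%t. D / 2 * t - sg u * Nc (z0 t)) has_real_derivative d) (at t) & d <= 0" by fastforce
   next
    have "continuous_on {0..t0} z0" by (rule continuous_on_subset[OF cz0]) auto
    thus "continuous_on {0..t0} (%t. D / 2 * t - sg u * Nc (z0 t))" by (intro continuous_intros)
  qed (use t0 in auto)
  thus ?thesis by (simp add: algebra_simps)
 qed
 have drop: "sg u * (Nc (z0 t) - Nc (z0 0)) >= D / 2 * t0" if t: "t0 <= t" for t
 proof -
  have "sg u * Nc (z0 t0) <= sg u * Nc (z0 t)"
   using escape_monotone[OF z0 e d less_imp_le[OF t0(1)] t] by (cases u) (auto simp: sg_def le3_def)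
  thus ?thesis using drop0 by (simp add: algebra_simps)
 qed
 have "bounded (z0 ` {0..T})"
  by (intro compact_imp_bounded compact_continuous_image continuous_on_subset[OF cz0]) auto
 then obtain M where M: "M > 0" "\<And>t. t \<in> {0..T} ==> norm (z0 t) <= M" unfolding bounded_pos by blast
 define N where "N = M + 1"
 define E where "E = exp (Lf * T)"
 have E: "E >= 1" using Lf(1) T by (simp add: E_def)
 \<comment> \<open>The bounds ensure in turn the final closeness, the size bound \<open>N\<close>,
   that the orbit stays where the speed persists, and that at most half of the gain
   \<open>D / 2 * t0\<close> is lost.\<close>
 define m where "m = min (min (\<rho> / 2) 1) (min (\<eta> / 2) (D * t0 / 8))"
 have m: "m > 0" "m < \<rho>" "m <= 1" "m <= \<eta> / 2" "m <= D * t0 / 8" using \<rho> \<eta> D t0 by (auto simp: m_def)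
 define \<delta> where "\<delta> = m / E"
 have \<delta>: "\<delta> > 0" "E * \<delta> = m" using m E by (auto simp: \<delta>_def)
 define C where "C = CX (be u) N"
 have C: "C > 0"
 proof -
  have "XB (be u) N > 0" using M(1) ab be_pos[of u] by (simp add: XB_def N_def add_pos_pos)
  thus ?thesis unfolding C_def CX_def using M(1) ab be_pos[of u] by (simp add: N_def add_pos_pos)
 qed
 \<comment> \<open>The first bound keeps the drift below the speed of the northern line before
   \<open>t0\<close>, the second keeps the drift over the whole time \<open>T\<close> below the gain
   that remains.\<close>
 define ep0 where "ep0 = min ((a + b) * D / (2 * (b * C))) ((a + b) * (D * t0 / 4) / (b * C * T))"
 have ep0: "ep0 > 0" using ab D C t0 T by (simp add: ep0_def)
 have near: "norm (zp (y t) - z0 t) <= m"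
  if y: "ode (fld4 (ta u) (be u) ep) y" "norm (zp (y 0) - z0 0) <= \<delta>" and t: "0 <= t" "t <= T" for ep y t
 proof -
  have "norm (zp (y t) - z0 t) <= exp (Lf * t) * norm (zp (y 0) - z0 0)"
   by (rule flow3_dist[OF flow4_zp[OF y(1)] z0 t(1)])
  also have "... <= E * \<delta>" unfolding E_def using y(2) t Lf(1) by (intro mult_mono) auto
  finally show ?thesis using \<delta> by simp
 qed
 have main: "HH u (y t) > 0"
  if ep: "0 < ep" "ep < ep0" and y: "ode (fld4 (ta u) (be u) ep) y" "norm (zp (y 0) - z0 0) <= \<delta>"
   and x0: "\<bar>Xc (y 0)\<bar> <= 1" and H0: "HH u (y 0) >= 0" and t: "0 < t" "t <= T" for ep y t
 proof -
  have nb: "\<bar>Nc (zp (y s))\<bar> <= N" if s: "0 <= s" "s <= T" for s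
  proof -
   have "\<bar>Nc (zp (y s))\<bar> <= norm (zp (y s))" by (rule abs_Nc_le)
   also have "... <= norm (z0 s) + norm (zp (y s) - z0 s)" using norm_triangle_ineq[of "z0 s" "zp (y s) - z0 s"] by simp
   also have "... <= N" using near[OF y s] M(2)[of s] s m(3) by (simp add: N_def)
   finally show ?thesis .
  qed
  have "0 <= a * (1 + N) / be u" using M(1) ab be_pos[of u] by (simp add: N_def)
  hence xb: "\<bar>Xc (y 0)\<bar> <= XB (be u) N" using x0 M(1) by (simp add: XB_def N_def)
  have mv: "\<bar>Xc (y t) - Xc (y 0)\<bar> <= ep * C * t"
   using xi_move[OF y(1) be_pos ep(1) order_refl less_imp_le[OF t(1)] _ xb] nb t by (simp add: C_def)
  have low: "HH u (y t) >= (a + b) * (sg u * (Nc (zp (y t)) - Nc (zp (y 0)))) - b * (ep * C * t)"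
   using HH_lower[OF mv, of u] H0 by linarith
  show ?thesis
  proof (cases "t <= t0")
   case True
   have "D / 2 * t - sg u * Nc (zp (y t)) <= D / 2 * 0 - sg u * Nc (zp (y 0))"
   proof (rule DERIV_nonpos_imp_decreasing_open[of 0 t "%t. D / 2 * t - sg u * Nc (zp (y t))"])
    fix s assume s: "0 < s" "s < t"
    have "((%t. D / 2 * t - sg u * Nc (zp (y t))) has_real_derivative D / 2 * 1 - sg u * Nc (fld (ta u) (zp (y s)))) (at s)"
     by (intro DERIV_diff DERIV_cmult DERIV_ident flow4_deriv(2)[OF y(1)] s)
    moreover have "sg u * Nc (fld (ta u) (zp (y s))) >= D / 2"
    proof (rule rate)
     have "norm (zp (y s) - z0 0) <= norm (zp (y s) - z0 s) + norm (z0 s - z0 0)"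
      using norm_triangle_ineq[of "zp (y s) - z0 s" "z0 s - z0 0"] by simp
     also have "... <= m + \<eta> / 2" by (intro add_mono near[OF y] z0near) (use s t True in auto)
     finally show "norm (zp (y s) - z0 0) <= \<eta>" using m(4) by linarith
    qed
    ultimately show "\<exists>d. ((%t. D / 2 * t - sg u * Nc (zp (y t))) has_real_derivative d) (at s) & d <= 0" by fastforce
   next
    show "continuous_on {0..t} (%t. D / 2 * t - sg u * Nc (zp (y t)))"
     by (intro continuous_intros flow4_cont(3)[OF y(1)]) auto
   qed (use t in auto)
   hence "sg u * (Nc (zp (y t)) - Nc (zp (y 0))) >= D / 2 * t" by (simp add: algebra_simps)
   hence "(a + b) * (sg u * (Nc (zp (y t)) - Nc (zp (y 0)))) >= (a + b) * (D / 2 * t)"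
    using ab by (intro mult_left_mono) auto
   moreover have "b * (ep * C * t) < (a + b) * (D / 2 * t)"
   proof -
    have "ep < (a + b) * D / (2 * (b * C))" using ep(2) by (simp add: ep0_def)
    hence "ep * (2 * (b * C)) < (a + b) * D" using ab C by (simp add: pos_less_divide_eq)
    hence "ep * (2 * (b * C)) * t < (a + b) * D * t" using t by (intro mult_strict_right_mono) auto
    thus ?thesis by (simp add: field_simps)
   qed
   ultimately show ?thesis using low by linarith
  next
   case False
   have n1: "\<bar>Nc (zp (y s)) - Nc (z0 s)\<bar> <= m" if "0 <= s" "s <= T" for s
    using abs_Nc_le[of "zp (y s) - z0 s"] near[OF y that] by simp
   have "\<bar>sg u * (Nc (zp (y t)) - Nc (zp (y 0))) - sg u * (Nc (z0 t) - Nc (z0 0))\<bar>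
     = \<bar>(Nc (zp (y t)) - Nc (z0 t)) - (Nc (zp (y 0)) - Nc (z0 0))\<bar>"
    by (simp add: sg_def abs_minus_commute algebra_simps)
   also have "... <= 2 * m" using n1[of t] n1[of 0] t T by linarith
   finally have "sg u * (Nc (zp (y t)) - Nc (zp (y 0))) >= D / 2 * t0 - 2 * m" using drop[of t] False by linarith
   hence "sg u * (Nc (zp (y t)) - Nc (zp (y 0))) >= D * t0 / 4" using m(5) by linarith
   hence "(a + b) * (sg u * (Nc (zp (y t)) - Nc (zp (y 0)))) >= (a + b) * (D * t0 / 4)"
    using ab by (intro mult_left_mono) auto
   moreover have "b * (ep * C * t) < (a + b) * (D * t0 / 4)"
   proof -
    have "ep < (a + b) * (D * t0 / 4) / (b * C * T)" using ep(2) by (simp add: ep0_def)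
    hence "ep * (b * C * T) < (a + b) * (D * t0 / 4)" using ab C T by (simp add: pos_less_divide_eq)
    moreover have "ep * (b * C * t) <= ep * (b * C * T)" using ep ab C t by (intro mult_left_mono) auto
    ultimately show ?thesis by (simp add: mult_ac)
   qed
   ultimately show ?thesis using low by linarith
  qed
 qed
 show ?thesis
 proof (rule that[OF \<delta>(1) ep0])
  show "HH u (y t) > 0" if "0 < ep" "ep < ep0" "ode (fld4 (ta u) (be u) ep) y" "norm (zp (y 0) - z0 0) <= \<delta>"
   "\<bar>Xc (y 0)\<bar> <= 1" "HH u (y 0) >= 0" "0 < t" "t <= T" for ep y t
   using main that by blast
  show "norm (zp (y t) - z0 t) < \<rho>" if "ode (fld4 (ta u) (be u) ep) y" "norm (zp (y 0) - z0 0) <= \<delta>" "0 <= t" "t <= T" for ep y t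
   using near[OF that] m(2) by linarith
 qed
qed

end

locale climate_nodes = climate +
 fixes Qp Qm :: state3
 assumes Qp: "eqm 0 Qp" "lam Qp < 1" "-1 < Pc Qp" "Nc Qp < 1"
  and Qm: "eqm dl Qm" "lam Qm < 1" "-1 < Pc Qm" "Nc Qm < 1"
begin

definition QQ :: "bool => state3" where "QQ u = (if u then Qp else Qm)"

lemma QQ: "eqm (ta u) (QQ u)" "lam (QQ u) < 1" "-1 < Pc (QQ u)" "Nc (QQ u) < 1"
 using Qp Qm by (auto simp: QQ_def ta_def)

lemma toward_QQ: "toward u (ta (\<not> u))" using dl by (simp add: toward_def ta_def)

lemma Qm_ne_Qp: "Qm \<noteq> Qp"
 using Qp(1) Qm(1) dl by (auto simp: eqm_iff)

lemma Qm_less_Qp: "Wc Qm < Wc Qp" "Pc Qp < Pc Qm" "Nc Qm < Nc Qp"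
 using subeq_below_node[OF eqm_subeq[OF Qm(1)] Qp(1) _ _ Qp(2) Qm_ne_Qp] dl by auto

lemma eqm_le_Qp: "eqm \<tau> z ==> 0 <= \<tau> ==> le3 z Qp"
 by (rule eqm_le_node[OF _ Qp(1) order_refl _ Qp(2)])

text \<open>In phase \<open>True\<close> an equilibrium with slope below 1 is both below and above
  \<open>Qp\<close>, and one with slope at least 1 lies below \<open>Qm\<close>. In phase
  \<open>False\<close> every equilibrium other than \<open>Qm\<close> lies below
  \<open>Qm\<close>.\<close>

lemma upper_eqm_unique:
 assumes e: "eqm (ta u) z" and w: "Wc Qm <= Wc z"
 shows "z = QQ u"
proof (cases u)
 case True
 hence e: "eqm 0 z" using e by (simp add: ta_def)
 show ?thesis
 proof (cases "lam z < 1")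
  case l: True
  have "le3 Qp z" by (rule eqm_le_node[OF Qp(1) e order_refl order_refl l])
  moreover have "le3 z Qp" by (rule eqm_le_Qp[OF e order_refl])
  ultimately show ?thesis using True le3_antisym by (simp add: QQ_def)
 next
  case False
  have "Qm \<noteq> z" using False Qm(2) by auto
  hence "Wc z < Wc Qm"
   using subeq_above_saddle[OF eqm_subeq[OF Qm(1)] e] dl False by simp
  thus ?thesis using w by simp
 qed
next
 case False
 hence e: "eqm dl z" using e by (simp add: ta_def)
 show ?thesis
 proof (rule ccontr)
  assume "z \<noteq> QQ u"
  hence "z \<noteq> Qm" using False by (simp add: QQ_def)
  hence "Wc z < Wc Qm"
   using subeq_below_node(1)[OF eqm_subeq[OF e] Qm(1) _ _ Qm(2)] dl by simp
  thus False using w by simp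
 qed
qed

text \<open>The order interval from \<open>Qm\<close> to \<open>Qp\<close> is invariant in both
  phases. The orbit of one node therefore accumulates at an equilibrium above \<open>Qm\<close>, and
  only the other node qualifies.\<close>

lemma connection:
 assumes z0: "ode (fld (ta u)) z0" and i: "z0 0 = QQ (\<not> u)"
 shows "t >= 0 ==> le3 Qm (z0 t) & le3 (z0 t) Qp"
  and "e > 0 ==> \<exists>t>0. norm (z0 t - QQ u) < e"
proof -
 have le: "le3 Qm Qp" using Qm_less_Qp by (simp add: le3_def)
 have bt: "le3 Qm (z0 t) & le3 (z0 t) Qp" if t: "t >= 0" for t
 proof
  have f1: "le3 0 (fld (ta u) Qm)" using r ta_bounds(2)[of u] by (simp add: fld_at_eqm[OF Qm(1)] le3_def)
  show "le3 Qm (z0 t)" by (rule const_le_flow[OF z0 t f1]) (use i le in \<open>simp add: QQ_def\<close>)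
  have f2: "le3 (fld (ta u) Qp) 0" using r ta_bounds(1)[of u] by (simp add: fld_at_eqm[OF Qp(1)] le3_def)
  show "le3 (z0 t) Qp" by (rule flow_le_const[OF z0 t f2]) (use i le in \<open>simp add: QQ_def\<close>)
 qed
 thus "t >= 0 ==> le3 Qm (z0 t) & le3 (z0 t) Qp" .
 have sg: "Pc Qm < 0" "0 < Nc Qm" using eqm_signs[OF Qm(1)] dl by auto
 have dom: "z0 t \<in> dom3" if "t >= 0" for t
  using bt[OF that] sg Qp(3,4) by (auto simp: le3_def dom3_def)
 obtain z where z: "eqm (ta u) z" "\<And>e. e > 0 ==> \<exists>t\<ge>0. norm (z0 t - z) < e"
  using flow_accumulates[OF z0 dom] by blast
 have "Wc Qm <= Wc z"
 proof (rule field_le_epsilon)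
  fix e :: real assume "e > 0"
  then obtain t where t: "t >= 0" "norm (z0 t - z) < e" using z(2) by blast
  have "\<bar>Wc (z0 t) - Wc z\<bar> < e" using abs_Wc_le[of "z0 t - z"] t(2) by simp
  moreover have "Wc Qm <= Wc (z0 t)" using bt[OF t(1)] by (simp add: le3_def)
  ultimately show "Wc Qm <= Wc z + e" by linarith
 qed
 hence zQ: "z = QQ u" by (rule upper_eqm_unique[OF z(1)])
 assume e: "e > 0"
 have ne: "QQ (\<not> u) \<noteq> QQ u" using Qm_ne_Qp by (auto simp: QQ_def)
 define e' where "e' = min e (norm (QQ (\<not> u) - QQ u))"
 have "e' > 0" using e ne by (simp add: e'_def)
 then obtain t where t: "t >= 0" "norm (z0 t - QQ u) < e'" using z(2) zQ by blast
 hence "t \<noteq> 0" using i by (auto simp: e'_def)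
 thus "\<exists>t>0. norm (z0 t - QQ u) < e" using t by (intro exI[of _ t]) (auto simp: e'_def)
qed

section \<open>Contracting boxes around the two nodes\<close>

definition vR :: "bool => state3 \<times> real" where
 "vR u = (SOME (v, R). Wc v = 1 & Pc v < 0 & 0 < Nc v & R > 0 &
  (\<forall>x. \<bar>Pc x - Pc (QQ u)\<bar> <= R --> -1 < Pc x & Pc x < 0) &
  (\<forall>x. \<bar>Nc x - Nc (QQ u)\<bar> <= R --> 0 < Nc x & Nc x < 1) &
  (\<forall>x \<rho> \<tau>'. \<bar>Pc x - Pc (QQ u)\<bar> <= R --> \<bar>Nc x - Nc (QQ u)\<bar> <= R -->
    \<bar>Pc (x + \<rho> *\<^sub>R v) - Pc (QQ u)\<bar> <= R --> \<bar>Nc (x + \<rho> *\<^sub>R v) - Nc (QQ u)\<bar> <= R --> 0 <= \<rho> -->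
    le3 (fld \<tau>' (x + \<rho> *\<^sub>R v)) (fld \<tau>' x - (R * \<rho>) *\<^sub>R v)))"

definition vv :: "bool => state3" where "vv u = fst (vR u)"
definition RR :: "bool => real" where "RR u = snd (vR u)"

lemma vR:
 "Wc (vv u) = 1" "Pc (vv u) < 0" "0 < Nc (vv u)" "RR u > 0"
 "\<And>x. \<bar>Pc x - Pc (QQ u)\<bar> <= RR u ==> -1 < Pc x & Pc x < 0"
 "\<And>x. \<bar>Nc x - Nc (QQ u)\<bar> <= RR u ==> 0 < Nc x & Nc x < 1"
 "\<And>x \<rho> \<tau>'. \<bar>Pc x - Pc (QQ u)\<bar> <= RR u ==> \<bar>Nc x - Nc (QQ u)\<bar> <= RR u ==>
    \<bar>Pc (x + \<rho> *\<^sub>R vv u) - Pc (QQ u)\<bar> <= RR u ==> \<bar>Nc (x + \<rho> *\<^sub>R vv u) - Nc (QQ u)\<bar> <= RR u ==> 0 <= \<rho> ==>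
    le3 (fld \<tau>' (x + \<rho> *\<^sub>R vv u)) (fld \<tau>' x - (RR u * \<rho>) *\<^sub>R vv u)"
proof -
 obtain v R where *: "Wc v = 1" "Pc v < 0" "0 < Nc v" "R > 0"
  "\<And>x. \<bar>Pc x - Pc (QQ u)\<bar> <= R ==> -1 < Pc x & Pc x < 0"
  "\<And>x. \<bar>Nc x - Nc (QQ u)\<bar> <= R ==> 0 < Nc x & Nc x < 1"
  "\<And>x \<rho> \<tau>'. \<bar>Pc x - Pc (QQ u)\<bar> <= R ==> \<bar>Nc x - Nc (QQ u)\<bar> <= R ==>
    \<bar>Pc (x + \<rho> *\<^sub>R v) - Pc (QQ u)\<bar> <= R ==> \<bar>Nc (x + \<rho> *\<^sub>R v) - Nc (QQ u)\<bar> <= R ==> 0 <= \<rho> ==>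
    le3 (fld \<tau>' (x + \<rho> *\<^sub>R v)) (fld \<tau>' x - (R * \<rho>) *\<^sub>R v)"
  using node_box[OF QQ(1) ta_bounds(1) QQ(2,3,4)] by metis
 have "\<exists>p. case p of (v, R) => Wc v = 1 & Pc v < 0 & 0 < Nc v & R > 0 &
  (\<forall>x. \<bar>Pc x - Pc (QQ u)\<bar> <= R --> -1 < Pc x & Pc x < 0) &
  (\<forall>x. \<bar>Nc x - Nc (QQ u)\<bar> <= R --> 0 < Nc x & Nc x < 1) &
  (\<forall>x \<rho> \<tau>'. \<bar>Pc x - Pc (QQ u)\<bar> <= R --> \<bar>Nc x - Nc (QQ u)\<bar> <= R -->
    \<bar>Pc (x + \<rho> *\<^sub>R v) - Pc (QQ u)\<bar> <= R --> \<bar>Nc (x + \<rho> *\<^sub>R v) - Nc (QQ u)\<bar> <= R --> 0 <= \<rho> -->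
    le3 (fld \<tau>' (x + \<rho> *\<^sub>R v)) (fld \<tau>' x - (R * \<rho>) *\<^sub>R v))"
  by (rule exI[of _ "(v, R)"]) (unfold case_prod_conv, use * in blast)
 from someI_ex[OF this, folded vR_def] have S: "case vR u of (v, R) => Wc v = 1 & Pc v < 0 & 0 < Nc v & R > 0 &
  (\<forall>x. \<bar>Pc x - Pc (QQ u)\<bar> <= R --> -1 < Pc x & Pc x < 0) &
  (\<forall>x. \<bar>Nc x - Nc (QQ u)\<bar> <= R --> 0 < Nc x & Nc x < 1) &
  (\<forall>x \<rho> \<tau>'. \<bar>Pc x - Pc (QQ u)\<bar> <= R --> \<bar>Nc x - Nc (QQ u)\<bar> <= R -->
    \<bar>Pc (x + \<rho> *\<^sub>R v) - Pc (QQ u)\<bar> <= R --> \<bar>Nc (x + \<rho> *\<^sub>R v) - Nc (QQ u)\<bar> <= R --> 0 <= \<rho> -->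
    le3 (fld \<tau>' (x + \<rho> *\<^sub>R v)) (fld \<tau>' x - (R * \<rho>) *\<^sub>R v))" .
 note S' = S[unfolded case_prod_beta, folded vv_def RR_def]
 show "Wc (vv u) = 1" "Pc (vv u) < 0" "0 < Nc (vv u)" "RR u > 0" using S' by blast+
 show "-1 < Pc x & Pc x < 0" if "\<bar>Pc x - Pc (QQ u)\<bar> <= RR u" for x using S' that by blast
 show "0 < Nc x & Nc x < 1" if "\<bar>Nc x - Nc (QQ u)\<bar> <= RR u" for x using S' that by blast
 show "le3 (fld \<tau>' (x + \<rho> *\<^sub>R vv u)) (fld \<tau>' x - (RR u * \<rho>) *\<^sub>R vv u)"
  if "\<bar>Pc x - Pc (QQ u)\<bar> <= RR u" "\<bar>Nc x - Nc (QQ u)\<bar> <= RR u"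
    "\<bar>Pc (x + \<rho> *\<^sub>R vv u) - Pc (QQ u)\<bar> <= RR u" "\<bar>Nc (x + \<rho> *\<^sub>R vv u) - Nc (QQ u)\<bar> <= RR u" "0 <= \<rho>" for x \<rho> \<tau>'
  using S' that by blast
qed

text \<open>A weighted box written as an order interval, so that the comparison principle applies to
  its corners.\<close>

definition nearv :: "bool => real => state3 => state3 => bool" where
 "nearv u d x y \<longleftrightarrow> le3 (y - d *\<^sub>R vv u) x & le3 x (y + d *\<^sub>R vv u)"

definition Vm :: "bool => real" where "Vm u = min 1 (min (- Pc (vv u)) (Nc (vv u)))"
definition VM :: "bool => real" where "VM u = 1 + - Pc (vv u) + Nc (vv u)"
text \<open>A third of the admissible size in the weighted norm: in \<open>box_contract\<close> a
  displacement of up to two units is added to an orbit that stays within one unit of the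
  node.\<close>

definition R1 :: "bool => real" where "R1 u = RR u / (3 * VM u)"

lemma Vm: "Vm u > 0" and VM: "VM u >= 1" and R1: "R1 u > 0"
 using vR(2-4)[of u] by (auto simp: Vm_def VM_def R1_def add_pos_pos intro!: divide_pos_pos)

lemma nearv_iff: "nearv u d x y \<longleftrightarrow> \<bar>Wc x - Wc y\<bar> <= d & \<bar>Pc x - Pc y\<bar> <= d * - Pc (vv u) & \<bar>Nc x - Nc y\<bar> <= d * Nc (vv u)"
 by (auto simp: nearv_def le3_def vR(1) abs_le_iff)

lemma nearv_norm: "nearv u d x y ==> norm (x - y) <= VM u * d"
 using norm3_le[of "x - y"] by (simp add: nearv_iff VM_def algebra_simps)

lemma norm_nearv: "norm (x - y) <= Vm u * d ==> d >= 0 ==> nearv u d x y"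
proof -
 assume n: "norm (x - y) <= Vm u * d" and d: "d >= 0"
 have "Vm u * d <= 1 * d" "Vm u * d <= - Pc (vv u) * d" "Vm u * d <= Nc (vv u) * d"
  by (rule mult_right_mono[OF _ d]; simp add: Vm_def)+
 hence "norm (x - y) <= d" "norm (x - y) <= d * - Pc (vv u)" "norm (x - y) <= d * Nc (vv u)" using n by (simp_all add: mult.commute)
 thus "nearv u d x y"
  unfolding nearv_iff using abs_Wc_le[of "x - y"] abs_Pc_le[of "x - y"] abs_Nc_le[of "x - y"] by simp
qed

lemma nearv_RR:
 assumes n: "nearv u d x (QQ u)" and d: "d <= 3 * R1 u"
 shows "\<bar>Pc x - Pc (QQ u)\<bar> <= RR u" "\<bar>Nc x - Nc (QQ u)\<bar> <= RR u"
proof -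
 have d0: "d >= 0" using n by (auto simp: nearv_iff)
 have v: "- Pc (vv u) <= VM u" "Nc (vv u) <= VM u" "0 < - Pc (vv u)" "0 < Nc (vv u)" using vR(2,3)[of u] by (auto simp: VM_def)
 have "d * VM u <= 3 * R1 u * VM u" using d VM[of u] by (intro mult_right_mono) auto
 also have "... = RR u" using VM[of u] by (simp add: R1_def)
 finally have 1: "d * VM u <= RR u" .
 have "d * - Pc (vv u) <= d * VM u" "d * Nc (vv u) <= d * VM u"
  by (rule mult_left_mono[OF v(1) d0], rule mult_left_mono[OF v(2) d0])
 thus "\<bar>Pc x - Pc (QQ u)\<bar> <= RR u" "\<bar>Nc x - Nc (QQ u)\<bar> <= RR u" using n 1 by (auto simp: nearv_iff)
qed

lemma lips_scaled_exp: "lips {s..t} (%t. (d * exp (- c * t)) *\<^sub>R (v :: state3))"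
proof (rule lips_comp[where F="%s. s *\<^sub>R v"])
 show "(norm v)-lipschitz_on UNIV (%s. s *\<^sub>R v)"
  by (rule lipschitz_onI) (auto simp: dist_norm mult.commute simp flip: scaleR_diff_left)
 show "lips {s..t} (%t. d * exp (- c * t))" by (intro lips_mult lips_const lips_exp)
qed

lemma vd_scaled_exp:
 "((%t. (d * exp (- c * t)) *\<^sub>R (v :: state3)) has_vector_derivative - ((c * (d * exp (- c * t))) *\<^sub>R v)) (at t)"
proof -
 have "((%t. d * exp (- c * t)) has_real_derivative - (c * (d * exp (- c * t)))) (at t)"
  by (auto intro!: derivative_eq_intros)
 from has_vector_derivative_scaleR[OF this has_vector_derivative_const[of v]] show ?thesis by simp
qed

text \<open>\<open>y\<close> shifted up or down by \<open>d * exp (- RR u * t)\<close> times the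
  vector \<open>vv u\<close> is a super- or subsolution, because the field decreases along
  \<open>vv u\<close> at the rate \<open>RR u\<close>. Comparison encloses \<open>x\<close> between
  the two.\<close>

lemma box_contract:
 assumes x: "ode (fld (ta u)) x" and y: "ode (fld (ta u)) y" and t: "t >= 0"
  and d: "0 <= d" "d <= 2 * R1 u" and y0: "\<And>t. t >= 0 ==> nearv u (R1 u) (y t) (QQ u)" and n: "nearv u d (x 0) (y 0)"
 shows "nearv u (d * exp (- RR u * t)) (x t) (y t)"
proof -
 define E where "E t = (d * exp (- RR u * t)) *\<^sub>R vv u" for t
 have e: "0 <= d * exp (- RR u * s)" "d * exp (- RR u * s) <= 2 * R1 u" if "s >= 0" for s
 proof -
  show "0 <= d * exp (- RR u * s)" using d by simp
  have "exp (- RR u * s) <= 1" using vR(4)[of u] that by simp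
  hence "d * exp (- RR u * s) <= d * 1" using d by (intro mult_left_mono) auto
  thus "d * exp (- RR u * s) <= 2 * R1 u" using d by simp
 qed
 have sum: "nearv u (3 * R1 u) (y s + E s) (QQ u)" "nearv u (3 * R1 u) (y s - E s) (QQ u)" "nearv u (3 * R1 u) (y s) (QQ u)" if s: "s >= 0" for s
 proof -
  have yb: "\<bar>Wc (y s) - Wc (QQ u)\<bar> <= R1 u" "\<bar>Pc (y s) - Pc (QQ u)\<bar> <= R1 u * - Pc (vv u)" "\<bar>Nc (y s) - Nc (QQ u)\<bar> <= R1 u * Nc (vv u)"
   using y0[OF s] by (auto simp: nearv_iff)
  define c where "c = d * exp (- RR u * s)"
  have c: "0 <= c" "c <= 2 * R1 u" using e[OF s] by (simp_all add: c_def)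
  have cv: "\<bar>c * Pc (vv u)\<bar> <= 2 * R1 u * - Pc (vv u)" "\<bar>c * Nc (vv u)\<bar> <= 2 * R1 u * Nc (vv u)"
   using c vR(2,3)[of u] by (auto simp: abs_mult intro!: mult_right_mono)
  have Ec: "Wc (E s) = c" "Pc (E s) = c * Pc (vv u)" "Nc (E s) = c * Nc (vv u)" by (simp_all add: E_def c_def vR(1))
  show "nearv u (3 * R1 u) (y s + E s) (QQ u)" "nearv u (3 * R1 u) (y s - E s) (QQ u)" "nearv u (3 * R1 u) (y s) (QQ u)"
   using yb cv c R1[of u] mult_pos_neg[OF R1[of u] vR(2)[of u]] mult_pos_pos[OF R1[of u] vR(3)[of u]]
   unfolding nearv_iff fst_add snd_add fst_diff snd_diff Ec by (intro conjI; linarith)+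
 qed
 have up: "le3 (x t) (y t + E t)"
 proof (rule compare[OF t flow3_lips[OF x] _ negligible_empty])
  show "lips {0..t} (%t. y t + E t)" unfolding E_def by (intro lips_add flow3_lips[OF y] lips_scaled_exp) auto
  fix s assume "s \<in> {0<..<t} - {}"
  hence s: "s > 0" by simp
  have "le3 (fld (ta u) (y s + E s)) (fld (ta u) (y s) - (RR u * (d * exp (- RR u * s))) *\<^sub>R vv u)"
   using vR(7)[of "y s" u "d * exp (- RR u * s)" "ta u"] nearv_RR[OF sum(1)[of s] order_refl] nearv_RR[OF sum(3)[of s] order_refl] e[of s] s
   by (simp add: E_def)
  moreover have "((%t. y t + E t) has_vector_derivative fld (ta u) (y s) - (RR u * (d * exp (- RR u * s))) *\<^sub>R vv u) (at s)"
   using has_vector_derivative_add[OF ode_at[OF y s] vd_scaled_exp[of d "RR u" "vv u" s]] unfolding E_def by simp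
  ultimately show "\<exists>d e. (x has_vector_derivative d) (at s) & ((%t. y t + E t) has_vector_derivative e) (at s) &
    le3 d (fld (ta u) (x s)) & le3 (fld (ta u) (y s + E s)) e"
   using ode_at[OF x s] le3_refl by blast
 qed (use n in \<open>auto simp: nearv_def E_def\<close>)
 have dn: "le3 (y t - E t) (x t)"
 proof (rule compare[OF t _ flow3_lips[OF x] negligible_empty])
  show "lips {0..t} (%t. y t - E t)" unfolding E_def by (intro lips_diff flow3_lips[OF y] lips_scaled_exp) auto
  fix s assume "s \<in> {0<..<t} - {}"
  hence s: "s > 0" by simp
  have "le3 (fld (ta u) (y s - E s + E s)) (fld (ta u) (y s - E s) - (RR u * (d * exp (- RR u * s))) *\<^sub>R vv u)"
   using vR(7)[of "y s - E s" u "d * exp (- RR u * s)" "ta u"] nearv_RR[OF sum(2)[of s] order_refl] nearv_RR[OF sum(3)[of s] order_refl] e[of s] s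
   by (simp add: E_def)
  hence "le3 (fld (ta u) (y s) + (RR u * (d * exp (- RR u * s))) *\<^sub>R vv u) (fld (ta u) (y s - E s))"
   by (simp add: le3_def)
  moreover have "((%t. y t - E t) has_vector_derivative fld (ta u) (y s) + (RR u * (d * exp (- RR u * s))) *\<^sub>R vv u) (at s)"
   using has_vector_derivative_diff[OF ode_at[OF y s] vd_scaled_exp[of d "RR u" "vv u" s]] unfolding E_def by simp
  ultimately show "\<exists>d e. ((%t. y t - E t) has_vector_derivative d) (at s) & (x has_vector_derivative e) (at s) &
    le3 d (fld (ta u) (y s - E s)) & le3 (fld (ta u) (x s)) e"
   using ode_at[OF x s] le3_refl by blast
 qed (use n in \<open>auto simp: nearv_def E_def\<close>)
 show ?thesis using up dn by (simp add: nearv_def E_def)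
qed

lemma ode_const: "f c = 0 ==> ode f (%t. c)" by (simp add: ode_def)

lemma box_attract:
 assumes x: "ode (fld (ta u)) x" and t: "t >= 0" and d: "0 <= d" "d <= 2 * R1 u" and n: "nearv u d (x 0) (QQ u)"
 shows "nearv u (d * exp (- RR u * t)) (x t) (QQ u)"
proof (rule box_contract[OF x ode_const t d _ n])
 show "fld (ta u) (QQ u) = 0" using QQ(1)[of u] by (simp add: eqm_def)
 show "nearv u (R1 u) (QQ u) (QQ u)" using R1[of u] vR(2,3)[of u] by (simp add: nearv_iff mult_nonneg_nonpos)
qed

end

section \<open>Half a cycle\<close>

text \<open>Exponential attraction over a time of order \<open>1 / e\<close> beats every power of
  \<open>e\<close>; one power at a time suffices below.\<close>

lemma exp_small:
 assumes "(k::real) > 0" "c > 0"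
 obtains e0 where "e0 > 0" "\<And>e. 0 < e ==> e < e0 ==> exp (- (k / e)) <= c * e"
proof (rule that[of "c * k\<^sup>2 / 2"])
 show "c * k\<^sup>2 / 2 > 0" using assms by simp
 fix e :: real assume e: "0 < e" "e < c * k\<^sup>2 / 2"
 define x where "x = k / e"
 have x: "x > 0" using assms e by (simp add: x_def)
 have "x\<^sup>2 / 2 <= exp x" using exp_lower_Taylor_quadratic[of x] x by linarith
 hence "exp (- x) <= 2 / x\<^sup>2" using x by (simp add: exp_minus field_simps)
 also have "2 / x\<^sup>2 = e * (e * 2 / k\<^sup>2)" using e assms by (simp add: x_def power_divide power2_eq_square)
 also have "... <= e * c"
 proof (rule mult_left_mono)
  show "e * 2 / k\<^sup>2 <= c" using e assms by (simp add: pos_divide_le_eq)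
 qed (use e in simp)
 finally show "exp (- (k / e)) <= c * e" by (simp add: x_def mult.commute)
qed

lemma first_zero:
 fixes f :: "real => real"
 assumes st: "s <= t" and c: "continuous_on {s..t} f" and f: "f s > 0" "f t <= 0"
 obtains T where "s < T" "T <= t" "f T = 0" "\<And>v. s <= v ==> v < T ==> f v > 0"
proof -
 define A where "A = {v \<in> {s..t}. f v <= 0}"
 have "A = {s..t} \<inter> f -` {..0}" by (auto simp: A_def)
 hence cA: "closed A" using continuous_closed_preimage[OF c] by simp
 have tA: "t \<in> A" using f st by (simp add: A_def)
 have bd: "bdd_below A" by (rule bdd_belowI[of _ s]) (simp add: A_def)
 define T where "T = Inf A"
 have TA: "T \<in> A" unfolding T_def using tA by (intro closed_contains_Inf bd cA) auto
 hence T: "s <= T" "T <= t" "f T <= 0" by (simp_all add: A_def)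
 have "T \<noteq> s" using T f by auto
 hence sT: "s < T" using T by simp
 have pos: "f v > 0" if v: "s <= v" "v < T" for v
 proof (rule ccontr)
  assume "\<not> f v > 0"
  hence "v \<in> A" using v T by (simp add: A_def)
  hence "T <= v" unfolding T_def using bd by (rule cInf_lower)
  thus False using v by simp
 qed
 have "f T >= 0"
 proof -
  have "continuous_on {s..T} f" by (rule continuous_on_subset[OF c]) (use T in simp)
  moreover have "closure {s..<T} = {s..T}" using sT by simp
  ultimately show ?thesis
   using continuous_ge_on_closure[of "{s..<T}" f T 0] pos sT by (simp add: less_imp_le)
 qed
 thus ?thesis using that[of T] sT T pos by simp
qed

context climate begin

text \<open>On the manifold only \<open>a * (\<beta> - b) * (1 - n)\<close> remains. Since
  \<open>bm < b < bp\<close>, its sign drives the slow variable towards the manifold in both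
  phases.\<close>

lemma b_Xi: "b * Xi \<beta> (Nc (zp v)) (Xc v) = \<beta> * hh v + a * (\<beta> - b) * (1 - Nc (zp v))"
 by (simp add: Xi_def hh_def algebra_simps)

lemma sg_be: "sg u * (be u - b) = \<bar>be u - b\<bar>" and be_ne: "\<bar>be u - b\<bar> > 0"
 using bs by (auto simp: sg_def be_def)

lemma sg_b_Xi: "e * (sg u * (b * Xi (be u) (Nc (zp v)) (Xc v))) = e * (be u * HH u v + a * \<bar>be u - b\<bar> * (1 - Nc (zp v)))"
 unfolding b_Xi HH_sg sg_be[symmetric] by (simp add: algebra_simps)

lemma HH_deriv:
 assumes y: "ode (fld4 (ta u) (be u) e) y" and t: "t > 0"
 shows "((%t. HH u (y t)) has_real_derivative sg u * (a + b) * Nc (fld (ta u) (zp (y t)))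
   - e * (be u * HH u (y t) + a * \<bar>be u - b\<bar> * (1 - Nc (zp (y t))))) (at t)"
proof -
 have h: "((%t. hh (y t)) has_real_derivative (a + b) * Nc (fld (ta u) (zp (y t))) - b * (e * Xi (be u) (Nc (zp (y t))) (Xc (y t)))) (at t)"
  using vd_hh[OF ode_at[OF y t]] by (simp add: fld4_def)
 show ?thesis unfolding sg_b_Xi[symmetric] unfolding HH_sg
  by (rule DERIV_cong[OF DERIV_cmult[OF h]]) (simp add: algebra_simps)
qed

text \<open>Within a phase the slow variable moves towards the switching manifold.\<close>

lemma Xc_range:
 assumes y: "ode (fld4 (ta u) (be u) e) y" and e: "e > 0" and t: "t >= 0" and x0: "\<bar>Xc (y 0)\<bar> <= 1"
  and n: "\<And>s. 0 <= s ==> s <= t ==> 0 < Nc (zp (y s)) & Nc (zp (y s)) < 1"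
  and H: "\<And>s. 0 <= s ==> s <= t ==> HH u (y s) >= 0"
 shows "\<bar>Xc (y t)\<bar> <= 1"
proof -
 have c: "continuous_on {0..t} (%t. Xc (y t))" by (rule flow4_cont[OF y]) auto
 have sXi: "sg u * Xi (be u) (Nc (zp (y s))) (Xc (y s)) >= 0" if s: "0 <= s" "s <= t" for s
 proof -
  have "b * (sg u * Xi (be u) (Nc (zp (y s))) (Xc (y s))) = be u * HH u (y s) + a * \<bar>be u - b\<bar> * (1 - Nc (zp (y s)))"
   using sg_b_Xi[of 1 u "y s"] by (simp add: mult.left_commute)
  also have "... >= 0" using H[OF s] n[OF s] ab be_pos[of u] by simp
  finally show ?thesis using ab by (simp add: zero_le_mult_iff)
 qed
 have mono: "sg u * Xc (y 0) <= sg u * Xc (y t)"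
 proof (rule DERIV_nonneg_imp_increasing_open[OF t])
  fix s assume s: "0 < s" "s < t"
  have "((%t. sg u * Xc (y t)) has_real_derivative sg u * (e * Xi (be u) (Nc (zp (y s))) (Xc (y s)))) (at s)"
   by (rule DERIV_cmult[OF flow4_deriv(1)[OF y s(1)]])
  moreover have "sg u * (e * Xi (be u) (Nc (zp (y s))) (Xc (y s))) >= 0"
   using mult_nonneg_nonneg[OF less_imp_le[OF e] sXi[of s]] s by (simp add: mult_ac)
  ultimately show "\<exists>d. ((%t. sg u * Xc (y t)) has_real_derivative d) (at s) & 0 <= d" by blast
 qed (intro continuous_intros c)
 have nt: "0 < Nc (zp (y t))" "Nc (zp (y t)) < 1" using n[OF t order_refl] by auto
 have hx: "b * Xc (y t) = (a + b) * Nc (zp (y t)) - a - hh (y t)" by (simp add: hh_alt)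
 have g: "(a + b) * Nc (zp (y t)) < a + b" "0 < (a + b) * Nc (zp (y t))" using nt ab by simp_all
 show ?thesis
 proof (cases u)
  case True
  hence "b * Xc (y t) < b * 1" using hx g H[OF t order_refl] by (simp add: HH_def)
  hence "Xc (y t) < 1" using ab by simp
  thus ?thesis using mono True x0 by (simp add: sg_def abs_le_iff)
 next
  case False
  hence "b * -1 < b * Xc (y t)" using hx g H[OF t order_refl] ab by (simp add: HH_def)
  hence "-1 < Xc (y t)" by (rule mult_less_cancel_left_pos[THEN iffD1, rotated]) (use ab in simp)
  thus ?thesis using mono False x0 by (simp add: sg_def abs_le_iff)
 qed
qed

text \<open>The critical temperatures separate the two normal speeds by
  \<open>(a + b) * r * dl\<close>, while the slow parts contribute only order
  \<open>e\<close>.\<close>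

lemma hd4_gap:
 assumes e: "0 < e" "e < (a + b) * r * dl / (2 * b * (bp - bm))" and n: "\<bar>Nc (zp v)\<bar> <= 1" "\<bar>Xc v\<bar> <= 1"
 shows "hd4 e 0 v < hd4 e 1 v"
proof -
 have bb: "bp - bm > 0" using bs by simp
 have "e * (2 * b * (bp - bm)) < (a + b) * r * dl" using e bb ab by (simp add: pos_less_divide_eq)
 moreover have "b * (e * ((bp - bm) * (Nc (zp v) - Xc v))) <= b * (e * ((bp - bm) * 2))"
  using n ab e bb by (intro mult_left_mono) auto
 moreover have "hd4 e 1 v - hd4 e 0 v = (a + b) * r * dl - b * (e * ((bp - bm) * (Nc (zp v) - Xc v)))"
  by (simp add: hd4_alt fld_def Xi_def algebra_simps)
 ultimately show ?thesis by (simp add: algebra_simps)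
qed

lemma HH_hd4: "sg u * hd4 e (if u then 1 else 0) v = sg u * (a + b) * Nc (fld (ta u) (zp v))
   - e * (be u * HH u v + a * \<bar>be u - b\<bar> * (1 - Nc (zp v)))"
proof -
 have "hd4 e (if u then 1 else 0) v = (a + b) * Nc (fld (ta u) (zp v)) - b * (e * Xi (be u) (Nc (zp v)) (Xc v))"
  by (simp add: hd4_alt ta_def be_def)
 note eq = this
 show ?thesis unfolding sg_b_Xi[symmetric] eq by (simp add: algebra_simps)
qed

end

context climate_nodes begin

lemma nearv_mono: "nearv u d x y ==> d <= d' ==> nearv u d' x y"
proof -
 assume n: "nearv u d x y" and d: "d <= d'"
 have "d * - Pc (vv u) <= d' * - Pc (vv u)" "d * Nc (vv u) <= d' * Nc (vv u)"
  using d vR(2,3)[of u] by (intro mult_right_mono; simp)+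
 thus ?thesis using n d unfolding nearv_iff by linarith
qed

definition inreg :: "state3 => bool" where "inreg z \<longleftrightarrow> -1 < Pc z & Pc z < 0 & 0 < Nc z & Nc z < 1"

lemma nearv_inreg: "nearv u d x (QQ u) ==> d <= R1 u ==> inreg x"
 using nearv_RR[of u d x] vR(5,6)[of x u] R1[of u] by (simp add: inreg_def)

lemma inreg_phase: "inreg (zp v) ==> \<bar>Xc v\<bar> <= 1 ==> v \<in> phase_space"
 by (auto simp: inreg_def phase_iff abs_le_iff)

text \<open>The orbit first shadows the connecting orbit up to a fixed time \<open>T\<close>, by
  continuous dependence, and has then entered the box of the target node, where the attraction is
  exponential.\<close>

lemma transit:
 obtains \<delta> C where "\<delta> > 0" "C >= 1"
  "\<And>x t. ode (fld (ta u)) x ==> norm (x 0 - QQ (\<not> u)) <= \<delta> ==> t >= 0 ==> inreg (x t) & norm (x t - QQ u) <= C * exp (- RR u * t)"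
  "\<And>x y t. ode (fld (ta u)) x ==> norm (x 0 - QQ (\<not> u)) <= \<delta> ==> ode (fld (ta u)) y ==> norm (y 0 - QQ (\<not> u)) <= \<delta> ==> t >= 0 ==>
    norm (x t - y t) <= C * exp (- RR u * t) * norm (x 0 - y 0)"
proof -
 obtain z0 where z0: "z0 0 = QQ (\<not> u)" "ode (fld (ta u)) z0" using flow3_exists by blast
 note con = connection[OF z0(2,1)]
 define m where "m = Vm u * R1 u / 2"
 have m: "m > 0" using Vm[of u] R1[of u] by (simp add: m_def)
 obtain T where T: "T > 0" "norm (z0 T - QQ u) < m" using con(2)[OF m] by blast
 have sg: "Pc Qm < 0" "0 < Nc Qm" using eqm_signs[OF Qm(1)] dl by auto
 \<comment> \<open>Half the distance from the order interval of the two nodes to the boundary of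
   \<open>inreg\<close>.\<close>
 define \<mu> where "\<mu> = min (min (1 + Pc Qp) (- Pc Qm)) (min (Nc Qm) (1 - Nc Qp)) / 2"
 have \<mu>: "\<mu> > 0" using sg Qp Qm by (auto simp: \<mu>_def)
 define L where "L = exp (Lf * T)"
 have L: "L >= 1" using Lf(1) T by (simp add: L_def)
 define R where "R = RR u"
 have R: "R > 0" using vR(4) by (simp add: R_def)
 define S where "S = \<bar>Wc Qp - Wc Qm\<bar> + \<bar>Pc Qp - Pc Qm\<bar> + \<bar>Nc Qp - Nc Qm\<bar>"
 have S: "S >= 0" by (simp add: S_def)
 define \<delta> where "\<delta> = min 1 (min m \<mu>) / L"
 have \<delta>: "\<delta> > 0" "L * \<delta> <= m" "L * \<delta> <= \<mu>" "L * \<delta> <= 1" using m \<mu> L by (auto simp: \<delta>_def)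
 define ET where "ET = exp (R * T)"
 have ET: "ET >= 1" using R T by (simp add: ET_def)
 \<comment> \<open>One bound for each stage: the factor \<open>ET = exp (R * T)\<close> pays for the
   decay claimed already before \<open>T\<close>, and \<open>VM\<close>, \<open>Vm\<close> convert
   between the norm and the weighted box.\<close>
 define C where "C = max 1 (max ((S + 1) * ET) (max (VM u * R1 u * ET) (max (L * ET) (VM u / Vm u * L * ET))))"
 have eT: "1 <= ET * exp (- R * t)" if "t <= T" for t
 proof -
  have "ET * exp (- R * t) = exp (R * (T - t))" by (simp add: ET_def exp_add[symmetric] algebra_simps)
  thus ?thesis using R that by simp
 qed
 have eT2: "exp (- R * (t - T)) = ET * exp (- R * t)" for t
  by (simp add: ET_def exp_add[symmetric] algebra_simps)
 have C: "C >= 1" "C >= (S + 1) * ET" "C >= VM u * R1 u * ET" "C >= L * ET" "C >= VM u / Vm u * L * ET"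
  by (simp_all add: C_def)
 have near: "norm (x t - z0 t) <= L * \<delta>" if x: "ode (fld (ta u)) x" "norm (x 0 - QQ (\<not> u)) <= \<delta>" and t: "0 <= t" "t <= T" for x t
 proof -
  have "norm (x t - z0 t) <= exp (Lf * t) * norm (x 0 - z0 0)" by (rule flow3_dist[OF x(1) z0(2) t(1)])
  also have "... <= L * \<delta>" unfolding L_def using x(2) t Lf(1) z0(1) by (intro mult_mono) auto
  finally show ?thesis .
 qed
 have arr: "norm (x T - QQ u) <= Vm u * R1 u" "nearv u (R1 u) (x T) (QQ u)" if x: "ode (fld (ta u)) x" "norm (x 0 - QQ (\<not> u)) <= \<delta>" for x
 proof -
  have "norm (x T - QQ u) <= norm (x T - z0 T) + norm (z0 T - QQ u)"
   using norm_triangle_ineq[of "x T - z0 T" "z0 T - QQ u"] by simp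
  also have "... <= m + m" using near[OF x, of T] T \<delta> by simp
  finally show n: "norm (x T - QQ u) <= Vm u * R1 u" by (simp add: m_def mult.commute)
  show "nearv u (R1 u) (x T) (QQ u)" by (rule norm_nearv[OF n]) (use R1[of u] in simp)
 qed
 have late: "nearv u (R1 u * exp (- R * (t - T))) (x t) (QQ u)" if x: "ode (fld (ta u)) x" "norm (x 0 - QQ (\<not> u)) <= \<delta>" and t: "T <= t" for x t
  using box_attract[OF ode_shift[OF x(1) less_imp_le[OF T(1)]], of "t - T" "R1 u"] arr(2)[OF x] R1[of u] t by (simp add: R_def)
 have late1: "nearv u (R1 u) (x t) (QQ u)" if x: "ode (fld (ta u)) x" "norm (x 0 - QQ (\<not> u)) <= \<delta>" and t: "T <= t" for x t
 proof (rule nearv_mono[OF late[OF x t]])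
  have "exp (- R * (t - T)) <= 1" using R t by simp
  thus "R1 u * exp (- R * (t - T)) <= R1 u" using R1[of u] by simp
 qed
 show ?thesis
 proof (rule that[OF \<delta>(1) C(1)])
  fix x t assume x: "ode (fld (ta u)) x" "norm (x 0 - QQ (\<not> u)) <= \<delta>" and t: "(t::real) >= 0"
  show "inreg (x t) & norm (x t - QQ u) <= C * exp (- RR u * t)"
  proof (cases "t <= T")
   case True
   have nz: "norm (x t - z0 t) <= \<mu>" "norm (x t - z0 t) <= 1" using near[OF x t True] \<delta> by auto
   have bt: "le3 Qm (z0 t)" "le3 (z0 t) Qp" using con(1)[OF t] by auto
   have "\<bar>Pc (x t) - Pc (z0 t)\<bar> <= \<mu>" "\<bar>Nc (x t) - Nc (z0 t)\<bar> <= \<mu>"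
    using abs_Pc_le[of "x t - z0 t"] abs_Nc_le[of "x t - z0 t"] nz by simp_all
   moreover have "2 * \<mu> <= 1 + Pc Qp" "2 * \<mu> <= - Pc Qm" "2 * \<mu> <= Nc Qm" "2 * \<mu> <= 1 - Nc Qp" by (simp_all add: \<mu>_def)
   ultimately have "inreg (x t)" using bt \<mu> unfolding inreg_def le3_def by linarith
   moreover have "norm (x t - QQ u) <= C * exp (- RR u * t)"
   proof -
    have "norm (z0 t - QQ u) <= \<bar>Wc (z0 t) - Wc (QQ u)\<bar> + \<bar>Pc (z0 t) - Pc (QQ u)\<bar> + \<bar>Nc (z0 t) - Nc (QQ u)\<bar>"
     using norm3_le[of "z0 t - QQ u"] by simp
    also have "... <= S"
     unfolding S_def using bt by (intro add_mono; cases u) (auto simp: QQ_def le3_def)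
    finally have "norm (z0 t - QQ u) <= S" .
    hence "norm (x t - QQ u) <= 1 + S"
     using norm_triangle_ineq[of "x t - z0 t" "z0 t - QQ u"] nz(2) by simp
    also have "1 + S = (S + 1) * 1" by simp
    also have "... <= (S + 1) * (ET * exp (- R * t))" by (rule mult_left_mono[OF eT[OF True]]) (use S in simp)
    also have "... = ((S + 1) * ET) * exp (- R * t)" by simp
    also have "... <= C * exp (- R * t)" by (rule mult_right_mono[OF C(2)]) simp
    finally show ?thesis by (simp add: R_def)
   qed
   ultimately show ?thesis ..
  next
   case False
   hence tT: "T <= t" by simp
   have "norm (x t - QQ u) <= VM u * (R1 u * exp (- R * (t - T)))" by (rule nearv_norm[OF late[OF x tT]])
   also have "... = (VM u * R1 u * ET) * exp (- R * t)" unfolding eT2 by simp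
   also have "... <= C * exp (- R * t)" by (rule mult_right_mono[OF C(3)]) simp
   finally show ?thesis using nearv_inreg[OF late1[OF x tT] order_refl] by (simp add: R_def)
  qed
 next
  fix x y t assume x: "ode (fld (ta u)) x" "norm (x 0 - QQ (\<not> u)) <= \<delta>" and y: "ode (fld (ta u)) y" "norm (y 0 - QQ (\<not> u)) <= \<delta>" and t: "(t::real) >= 0"
  define D where "D = norm (x 0 - y 0)"
  have D: "D >= 0" by (simp add: D_def)
  have ear: "norm (x s - y s) <= L * D" if s: "0 <= s" "s <= T" for s
  proof -
   have "norm (x s - y s) <= exp (Lf * s) * D" unfolding D_def by (rule flow3_dist[OF x(1) y(1) s(1)])
   also have "... <= L * D" unfolding L_def using s Lf(1) D by (intro mult_right_mono) auto
   finally show ?thesis .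
  qed
  show "norm (x t - y t) <= C * exp (- RR u * t) * norm (x 0 - y 0)"
  proof (cases "t <= T")
   case True
   have "norm (x t - y t) <= L * D * 1" using ear[OF t True] by simp
   also have "... <= L * D * (ET * exp (- R * t))" using eT[OF True] L D by (intro mult_left_mono) auto
   also have "... = L * ET * (exp (- R * t) * D)" by simp
   also have "... <= C * (exp (- R * t) * D)" using C(4) D by (intro mult_right_mono) auto
   finally show ?thesis by (simp add: D_def R_def mult.assoc)
  next
   case False
   hence tT: "T <= t" by simp
   define d where "d = norm (x T - y T) / Vm u"
   have "norm (x T - y T) <= norm (x T - QQ u) + norm (y T - QQ u)"
    using norm_triangle_ineq4[of "x T - QQ u" "y T - QQ u"] by simp
   hence "norm (x T - y T) <= Vm u * R1 u + Vm u * R1 u" using arr(1)[OF x] arr(1)[OF y] by linarith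
   hence "norm (x T - y T) <= 2 * R1 u * Vm u" by (simp add: algebra_simps)
   hence d: "0 <= d" "d <= 2 * R1 u" using Vm[of u] by (simp_all add: d_def pos_divide_le_eq)
   have "nearv u d (x T) (y T)" by (rule norm_nearv) (use d Vm[of u] in \<open>simp_all add: d_def\<close>)
   moreover have "nearv u (R1 u) (y (T + s)) (QQ u)" if "s >= 0" for s by (rule late1[OF y]) (use that in simp)
   ultimately have "nearv u (d * exp (- RR u * (t - T))) (x (T + (t - T))) (y (T + (t - T)))"
    using box_contract[OF ode_shift[OF x(1) less_imp_le[OF T(1)]] ode_shift[OF y(1) less_imp_le[OF T(1)]], of "t - T" d] d tT by simp
   hence "norm (x t - y t) <= VM u * (d * exp (- R * (t - T)))" using nearv_norm by (simp add: R_def)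
   also have "... = (VM u / Vm u * ET * exp (- R * t)) * norm (x T - y T)" unfolding eT2 by (simp add: d_def)
   also have "... <= (VM u / Vm u * ET * exp (- R * t)) * (L * D)"
    using ear[of T] T VM[of u] Vm[of u] ET by (intro mult_left_mono mult_nonneg_nonneg divide_nonneg_pos) auto
   also have "... = (VM u / Vm u * L * ET) * (exp (- R * t) * D)" by simp
   also have "... <= C * (exp (- R * t) * D)" using C(5) D by (intro mult_right_mono) auto
   finally show ?thesis by (simp add: D_def R_def mult.assoc)
  qed
 qed
qed

lemma QQ_one_minus: "1 - Nc (QQ u) > 0" using QQ(4)[of u] by simp

text \<open>Close to its node a phase is left transversally.\<close>

lemma exit_rate:
 obtains \<mu> c where "\<mu> > 0" "c > 0"
  "\<And>e v. 0 < e ==> e <= 1 ==> norm (zp v - QQ u) <= \<mu> * e ==> HH u v >= 0 ==>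
   sg u * (a + b) * Nc (fld (ta u) (zp v)) - e * (be u * HH u v + a * \<bar>be u - b\<bar> * (1 - Nc (zp v))) <= - c * e"
proof -
 define K where "K = a * \<bar>be u - b\<bar>"
 have K: "K > 0" using ab be_ne[of u] by (simp add: K_def)
 \<comment> \<open>Close to the node the slow term is at least \<open>2 * c * e\<close>; the fast
   term will take at most \<open>c * e\<close> of it.\<close>
 define c where "c = K * (1 - Nc (QQ u)) / 4"
 have c: "c > 0" using K QQ_one_minus by (simp add: c_def)
 \<comment> \<open>The first bound keeps the northern line away from 1. The second makes the fast
   speed at distance \<open>\<mu> * e\<close> contribute at most \<open>c * e\<close>.\<close>
 define \<mu> where "\<mu> = min ((1 - Nc (QQ u)) / 2) (c / ((a + b) * Lf))"
 have \<mu>: "\<mu> <= (1 - Nc (QQ u)) / 2" "\<mu> <= c / ((a + b) * Lf)" by (simp_all only: \<mu>_def min.cobounded1 min.cobounded2)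
 have \<mu>0: "\<mu> > 0" using QQ_one_minus[of u] c ab Lf(1) by (simp add: \<mu>_def)
 show ?thesis
 proof (rule that[OF \<mu>0 c])
  fix e v assume e: "0 < e" "e <= (1::real)" and n: "norm (zp v - QQ u) <= \<mu> * e" and H: "HH u v >= 0"
  have "\<mu> * e <= \<mu>" using e \<mu>0 by simp
  hence nn: "norm (zp v - QQ u) <= (1 - Nc (QQ u)) / 2" using n \<mu>(1) by linarith
  have "\<bar>Nc (zp v) - Nc (QQ u)\<bar> <= norm (zp v - QQ u)" using abs_Nc_le[of "zp v - QQ u"] by simp
  from order_trans[OF this nn] have "\<bar>Nc (zp v) - Nc (QQ u)\<bar> <= (1 - Nc (QQ u)) / 2" .
  from abs_le_D1[OF this] have "1 - Nc (zp v) >= (1 - Nc (QQ u)) / 2" by (simp add: field_simps)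
  hence "K * (1 - Nc (zp v)) >= K * ((1 - Nc (QQ u)) / 2)" using K by (intro mult_left_mono) auto
  hence 1: "K * (1 - Nc (zp v)) >= 2 * c" by (simp add: c_def)
  have "be u * HH u v >= 0" using H be_pos[of u] by simp
  hence 2: "e * (be u * HH u v + K * (1 - Nc (zp v))) >= e * (2 * c)" using 1 e by (intro mult_left_mono) auto
  have f0: "fld (ta u) (QQ u) = 0" using QQ(1) by (simp add: eqm_def)
  have "\<bar>Nc (fld (ta u) (zp v))\<bar> <= norm (fld (ta u) (zp v) - fld (ta u) (QQ u))" using abs_Nc_le f0 by simp
  also have "... <= Lf * norm (zp v - QQ u)" using lipschitz_onD[OF Lf(2)[of "ta u"], of "zp v" "QQ u"] by (simp add: dist_norm)
  also have "... <= Lf * (\<mu> * e)" using n Lf(1) by simp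
  also have "... <= Lf * (c / ((a + b) * Lf) * e)" using \<mu>(2) e Lf(1) by (intro mult_left_mono mult_right_mono) auto
  also have "... = c * e / (a + b)" using Lf(1) by simp
  finally have "(a + b) * \<bar>Nc (fld (ta u) (zp v))\<bar> <= c * e" using ab by (simp add: pos_le_divide_eq mult.commute)
  moreover have "sg u * (a + b) * Nc (fld (ta u) (zp v)) <= (a + b) * \<bar>Nc (fld (ta u) (zp v))\<bar>"
  proof -
   have "sg u * Nc (fld (ta u) (zp v)) <= \<bar>Nc (fld (ta u) (zp v))\<bar>" by (auto simp: sg_def)
   hence "(a + b) * (sg u * Nc (fld (ta u) (zp v))) <= (a + b) * \<bar>Nc (fld (ta u) (zp v))\<bar>" using ab by (intro mult_left_mono) auto
   thus ?thesis by (simp add: mult_ac)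
  qed
  ultimately show "sg u * (a + b) * Nc (fld (ta u) (zp v)) - e * (be u * HH u v + a * \<bar>be u - b\<bar> * (1 - Nc (zp v))) <= - c * e"
   using 2 unfolding K_def[symmetric] by (simp add: mult_ac)
 qed
qed

definition mu :: "bool => real" where
 "mu u = (SOME \<mu>. \<mu> > 0 & (\<exists>c>0. \<forall>e v. 0 < e --> e <= 1 --> norm (zp v - QQ u) <= \<mu> * e --> HH u v >= 0 -->
   sg u * (a + b) * Nc (fld (ta u) (zp v)) - e * (be u * HH u v + a * \<bar>be u - b\<bar> * (1 - Nc (zp v))) <= - c * e))"

lemma mu_ex: "mu u > 0 & (\<exists>c>0. \<forall>e v. 0 < e --> e <= 1 --> norm (zp v - QQ u) <= mu u * e --> HH u v >= 0 -->
   sg u * (a + b) * Nc (fld (ta u) (zp v)) - e * (be u * HH u v + a * \<bar>be u - b\<bar> * (1 - Nc (zp v))) <= - c * e)"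
 unfolding mu_def by (rule someI_ex) (rule exit_rate[of u], blast)

definition cr :: "bool => real" where
 "cr u = (SOME c. c > 0 & (\<forall>e v. 0 < e --> e <= 1 --> norm (zp v - QQ u) <= mu u * e --> HH u v >= 0 -->
   sg u * (a + b) * Nc (fld (ta u) (zp v)) - e * (be u * HH u v + a * \<bar>be u - b\<bar> * (1 - Nc (zp v))) <= - c * e))"

lemma mu: "mu u > 0" and cr: "cr u > 0"
 and exit: "0 < e ==> e <= 1 ==> norm (zp v - QQ u) <= mu u * e ==> HH u v >= 0 ==>
   sg u * (a + b) * Nc (fld (ta u) (zp v)) - e * (be u * HH u v + a * \<bar>be u - b\<bar> * (1 - Nc (zp v))) <= - cr u * e"
proof -
 show "mu u > 0" using mu_ex by blast
 have "\<exists>c. c > 0 & (\<forall>e v. 0 < e --> e <= 1 --> norm (zp v - QQ u) <= mu u * e --> HH u v >= 0 -->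
   sg u * (a + b) * Nc (fld (ta u) (zp v)) - e * (be u * HH u v + a * \<bar>be u - b\<bar> * (1 - Nc (zp v))) <= - c * e)"
  using mu_ex by blast
 from someI_ex[OF this, folded cr_def] show "cr u > 0"
  "0 < e ==> e <= 1 ==> norm (zp v - QQ u) <= mu u * e ==> HH u v >= 0 ==>
   sg u * (a + b) * Nc (fld (ta u) (zp v)) - e * (be u * HH u v + a * \<bar>be u - b\<bar> * (1 - Nc (zp v))) <= - cr u * e"
  by blast+
qed

definition egap :: real where "egap = min 1 ((a + b) * r * dl / (2 * b * (bp - bm)))"

lemma egap_pos: "egap > 0" using ab r dl bs by (simp add: egap_def)

text \<open>By \<open>exit\<close> the field of phase \<open>u\<close> leaves its region here; the
  order of the two normal speeds in \<open>hd4_gap\<close> then forces the same sign on the other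
  field.\<close>

lemma strict_near_node:
 assumes e: "0 < e" "e < egap" and n: "norm (zp v - QQ u) <= mu u * e" and h: "hh v = 0" and g: "\<bar>Nc (zp v)\<bar> <= 1" "\<bar>Xc v\<bar> <= 1"
 shows "strict e v"
proof -
 have e1: "e <= 1" "e < (a + b) * r * dl / (2 * b * (bp - bm))" using e by (auto simp: egap_def)
 have H0: "HH u v = 0" using h by (simp add: HH_def)
 have "sg u * hd4 e (if u then 1 else 0) v <= - cr u * e"
  unfolding HH_hd4 by (rule exit[OF e(1) e1(1) n]) (simp add: H0)
 moreover have "cr u * e > 0" using cr[of u] e by simp
 ultimately have "sg u * hd4 e (if u then 1 else 0) v < 0" by simp
 thus ?thesis using hd4_gap[OF e(1) e1(2) g] h by (cases u) (auto simp: strict_def sg_def)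
qed

text \<open>While the fast variables stay within order \<open>e\<close> of the node,
  \<open>HH u\<close> falls at least at the rate \<open>cr u * e\<close>, so it vanishes within the
  time \<open>HH u (y s) / (cr u * e)\<close>.\<close>

lemma phase_ends:
 assumes y: "ode (fld4 (ta u) (be u) e) y" and e: "0 < e" "e <= 1" and s: "s >= 0"
  and near: "\<And>t. t >= s ==> norm (zp (y t) - QQ u) <= mu u * e" and H: "HH u (y s) > 0"
 obtains T where "T > s" "HH u (y T) = 0" "\<And>t. s <= t ==> t < T ==> HH u (y t) > 0"
proof -
 have cH: "continuous_on {s..t} (%t. HH u (y t))" for t
  unfolding HH_sg by (intro continuous_intros flow4_cont(4)[OF y]) (use s in auto)
 define t where "t = s + HH u (y s) / (cr u * e)"
 have st: "s < t" using H cr[of u] e by (simp add: t_def)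
 have ce: "cr u * e * (t - s) = HH u (y s)" using cr[of u] e by (simp add: t_def)
 have "\<exists>v\<in>{s..t}. HH u (y v) <= 0"
 proof (rule ccontr)
  assume "\<not> ?thesis"
  hence pos: "HH u (y v) > 0" if "s <= v" "v <= t" for v using that by force
  have "HH u (y t) + cr u * e * t <= HH u (y s) + cr u * e * s"
  proof (rule DERIV_nonpos_imp_decreasing_open[OF less_imp_le[OF st]])
   fix v assume v: "s < v" "v < t"
   hence v0: "v > 0" using s by simp
   have "((%t. HH u (y t) + cr u * e * t) has_real_derivative (sg u * (a + b) * Nc (fld (ta u) (zp (y v)))
     - e * (be u * HH u (y v) + a * \<bar>be u - b\<bar> * (1 - Nc (zp (y v))))) + cr u * e * 1) (at v)"
    by (intro DERIV_add HH_deriv[OF y v0] DERIV_cmult DERIV_ident)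
   moreover have "sg u * (a + b) * Nc (fld (ta u) (zp (y v)))
     - e * (be u * HH u (y v) + a * \<bar>be u - b\<bar> * (1 - Nc (zp (y v)))) <= - cr u * e"
    by (rule exit[OF e near]) (use v pos[of v] in auto)
   ultimately show "\<exists>d. ((%t. HH u (y t) + cr u * e * t) has_real_derivative d) (at v) & d <= 0" by fastforce
  qed (intro continuous_intros cH)
  hence "HH u (y t) <= HH u (y s) - cr u * e * (t - s)" by (simp add: algebra_simps)
  thus False using pos[of t] st ce by simp
 qed
 then obtain v where v: "s <= v" "HH u (y v) <= 0" by auto
 obtain T where "s < T" "HH u (y T) = 0" "\<And>w. s <= w ==> w < T ==> HH u (y w) > 0"
  using first_zero[OF v(1) cH H v(2)] by metis
 thus ?thesis using that by blast
qed

text \<open>For a start anywhere in a box whose size may be independent of \<open>e\<close>: either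
  the phase ends early, or the attraction of the box brings the fast variables within order
  \<open>e\<close> of the node.\<close>

lemma phase_ends_late:
 assumes y: "ode (fld4 (ta u) (be u) e) y" and e: "0 < e" "e <= 1" and d: "0 <= d" "d <= R1 u"
  and n: "nearv u d (zp (y 0)) (QQ u)" and H: "HH u (y 0) > 0"
 obtains T where "T > 0" "HH u (y T) = 0" "\<And>t. 0 <= t ==> t < T ==> HH u (y t) > 0"
  "\<And>t. 0 <= t ==> nearv u d (zp (y t)) (QQ u)"
proof -
 have at: "nearv u (d * exp (- RR u * t)) (zp (y t)) (QQ u)" if "t >= 0" for t
  by (rule box_attract[OF flow4_zp[OF y] that d(1) _ n]) (use d R1[of u] in simp)
 have nd: "nearv u d (zp (y t)) (QQ u)" if t: "t >= 0" for t
 proof (rule nearv_mono[OF at[OF t]])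
  have "exp (- RR u * t) <= 1" using vR(4)[of u] t by simp
  thus "d * exp (- RR u * t) <= d" using d by (simp add: mult_left_le)
 qed
 have "((%t. VM u * (d * exp (- RR u * t))) \<longlongrightarrow> VM u * (d * 0)) at_top"
 proof (intro tendsto_intros)
  have "filterlim (%t. - RR u * t) at_bot at_top"
   by (rule filterlim_tendsto_neg_mult_at_bot[OF tendsto_const _ filterlim_ident]) (use vR(4) in simp)
  thus "((%t. exp (- RR u * t)) \<longlongrightarrow> 0) at_top" by (rule filterlim_compose[OF exp_at_bot])
 qed
 hence "\<forall>\<^sub>F t in at_top. VM u * (d * exp (- RR u * t)) < mu u * e"
  using order_tendstoD(2)[of _ 0 at_top "mu u * e"] mu[of u] e by simp
 then obtain s where s: "\<And>t. t >= s ==> VM u * (d * exp (- RR u * t)) < mu u * e"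
  unfolding eventually_at_top_linorder by blast
 define s' where "s' = max 0 s"
 have near: "norm (zp (y t) - QQ u) <= mu u * e" if "t >= s'" for t
  using nearv_norm[OF at[of t]] s[of t] that by (simp add: s'_def)
 have cH: "continuous_on {0..s'} (%t. HH u (y t))"
  unfolding HH_sg by (intro continuous_intros flow4_cont(4)[OF y]) auto
 have s0: "0 <= s'" by (simp add: s'_def)
 show ?thesis
 proof (cases "\<exists>v\<in>{0..s'}. HH u (y v) <= 0")
  case True
  then obtain v where v: "0 <= v" "v <= s'" "HH u (y v) <= 0" by auto
  have "continuous_on {0..v} (%t. HH u (y t))" by (rule continuous_on_subset[OF cH]) (use v in auto)
  from first_zero[OF v(1) this H v(3)] obtain T where "0 < T" "HH u (y T) = 0" "\<And>w. 0 <= w ==> w < T ==> HH u (y w) > 0" by metis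
  thus ?thesis using that nd by blast
 next
  case False
  hence pos: "HH u (y v) > 0" if "0 <= v" "v <= s'" for v using that by force
  obtain T where T: "T > s'" "HH u (y T) = 0" "\<And>t. s' <= t ==> t < T ==> HH u (y t) > 0"
   using phase_ends[OF y e s0 near pos[OF s0 order_refl]] by blast
  have "HH u (y t) > 0" if "0 <= t" "t < T" for t using pos[of t] T(3)[of t] that by (cases "t <= s'") auto
  thus ?thesis using that[of T] T nd s0 by auto
 qed
qed

definition start :: "bool => real => real => (real => state4) => bool" where
 "start u \<delta> e y \<longleftrightarrow> ode (fld4 (ta u) (be u) e) y & norm (zp (y 0) - QQ (\<not> u)) <= \<delta> & \<bar>Xc (y 0)\<bar> <= 1 & HH u (y 0) >= 0"

text \<open>Between the nodes the northern line moves by \<open>dn\<close>, which carries the state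
  deep into the region of the phase, while the slow variable moves only with speed of order
  \<open>e\<close>. So a time \<open>c / e\<close> passes before the manifold can be met, and by
  then the fast variables have been attracted exponentially.\<close>

lemma half_cycle:
 obtains \<delta> c C e0 where "\<delta> > 0" "c > 0" "C >= 1" "e0 > 0" "e0 <= 1"
  "\<And>e y t. 0 < e ==> e < e0 ==> start u \<delta> e y ==> 0 < t ==> t <= c / e ==> HH u (y t) > 0"
  "\<And>e y t. 0 < e ==> e < e0 ==> start u \<delta> e y ==> t >= c / e ==> C * norm (zp (y t) - QQ u) <= mu u * e * e"
  "\<And>e y t. start u \<delta> e y ==> t >= 0 ==> inreg (zp (y t))"
  "\<And>e y y' t. start u \<delta> e y ==> start u \<delta> e y' ==> t >= 0 ==> norm (zp (y t) - zp (y' t)) <= C * norm (zp (y 0) - zp (y' 0))"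
  "\<And>e y y' t. 0 < e ==> e < e0 ==> start u \<delta> e y ==> start u \<delta> e y' ==> t >= c / e ==> norm (zp (y t) - zp (y' t)) <= norm (zp (y 0) - zp (y' 0)) / 4"
  "\<And>e y t. start u \<delta> e y ==> t >= 0 ==> norm (zp (y t) - QQ u) <= C"
proof -
 obtain \<delta>1 C where tr: "\<delta>1 > 0" "C >= 1"
  "\<And>x t. ode (fld (ta u)) x ==> norm (x 0 - QQ (\<not> u)) <= \<delta>1 ==> t >= 0 ==> inreg (x t) & norm (x t - QQ u) <= C * exp (- RR u * t)"
  "\<And>x y t. ode (fld (ta u)) x ==> norm (x 0 - QQ (\<not> u)) <= \<delta>1 ==> ode (fld (ta u)) y ==> norm (y 0 - QQ (\<not> u)) <= \<delta>1 ==> t >= 0 ==>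
    norm (x t - y t) <= C * exp (- RR u * t) * norm (x 0 - y 0)"
  by (rule transit[of u]) blast
 have R: "RR u > 0" by (rule vR(4))
 define dn where "dn = Nc Qp - Nc Qm"
 have dn: "dn > 0" using Qm_less_Qp by (simp add: dn_def)
 have sdn: "sg u * (Nc (QQ u) - Nc (QQ (\<not> u))) = dn" by (simp add: sg_def QQ_def dn_def)
 \<comment> \<open>From this time on the northern line is within \<open>dn / 4\<close> of its
   target; earlier times are handled by \<open>escape\<close>.\<close>
 define T where "T = 1 + \<bar>ln (4 * C / dn)\<bar> / RR u"
 have T: "T > 0" using R by (simp add: T_def add_pos_nonneg)
 have CT: "C * exp (- RR u * t) <= dn / 4" if "t >= T" for t
 proof -
  have "RR u * T >= ln (4 * C / dn)" using R by (simp add: T_def distrib_left)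
  hence "RR u * t >= ln (4 * C / dn)" using mult_left_mono[OF that, of "RR u"] R by linarith
  hence "exp (- RR u * t) <= exp (- ln (4 * C / dn))" by simp
  also have "... = dn / (4 * C)" using tr(2) dn by (simp add: exp_minus)
  finally have "C * exp (- RR u * t) <= C * (dn / (4 * C))" using tr(2) by (intro mult_left_mono) auto
  thus ?thesis using tr(2) by simp
 qed
 obtain z0 where z0: "z0 0 = QQ (\<not> u)" "ode (fld (ta u)) z0" using flow3_exists by blast
 have ez: "eqm (ta (\<not> u)) (z0 0)" using QQ(1) z0 by simp
 obtain \<delta>2 e2 where es: "\<delta>2 > 0" "e2 > 0"
  "\<And>e y t. 0 < e ==> e < e2 ==> ode (fld4 (ta u) (be u) e) y ==> norm (zp (y 0) - z0 0) <= \<delta>2 ==> \<bar>Xc (y 0)\<bar> <= 1 ==>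
    HH u (y 0) >= 0 ==> 0 < t ==> t <= T ==> HH u (y t) > 0"
  by (rule escape[OF z0(2) ez toward_QQ T zero_less_one]) blast
 define \<delta> where "\<delta> = min (min \<delta>1 \<delta>2) (dn / 4)"
 have \<delta>: "\<delta> > 0" "\<delta> <= \<delta>1" "\<delta> <= \<delta>2" "\<delta> <= dn / 4" using tr(1) es(1) dn by (auto simp: \<delta>_def)
 define X where "X = CX (be u) 1"
 have X: "X > 0"
 proof -
  have "XB (be u) 1 > 0" using ab be_pos[of u] by (simp add: XB_def add_pos_pos)
  thus ?thesis unfolding X_def CX_def using ab be_pos[of u] by (simp add: add_pos_pos)
 qed
 \<comment> \<open>Within the time \<open>c / e\<close> the slow drift uses at most
   \<open>dn / 4\<close> of the gain, of which at least \<open>dn / 2\<close> is available.\<close>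
 define c where "c = (a + b) * (dn / 4) / (b * X)"
 have c: "c > 0" using ab dn X by (simp add: c_def)
 define k where "k = RR u * c"
 have k: "k > 0" using R c by (simp add: k_def)
 obtain e3 where e3: "e3 > 0" "\<And>e. 0 < e ==> e < e3 ==> exp (- (k / e)) <= (1 / (4 * C)) * e"
  using exp_small[OF k, of "1 / (4 * C)"] tr(2) by auto
 obtain e4 where e4: "e4 > 0" "\<And>e. 0 < e ==> e < e4 ==> exp (- (k / 2 / e)) <= (mu u / (C * C)) * e"
  using exp_small[of "k / 2" "mu u / (C * C)"] k mu[of u] tr(2) by auto
 obtain e5 where e5: "e5 > 0" "\<And>e. 0 < e ==> e < e5 ==> exp (- (k / 2 / e)) <= 1 * e"
  using exp_small[of "k / 2" 1] k by auto
 define e0 where "e0 = min (min 1 e2) (min e3 (min e4 e5))"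
 have e0: "e0 > 0" "e0 <= 1" "e0 <= e2" "e0 <= e3" "e0 <= e4" "e0 <= e5" using es(2) e3 e4 e5 by (auto simp: e0_def)
 have S: "ode (fld4 (ta u) (be u) e) y" "ode (fld (ta u)) (%t. zp (y t))" "norm (zp (y 0) - QQ (\<not> u)) <= \<delta>1" "norm (zp (y 0) - QQ (\<not> u)) <= \<delta>2"
   "norm (zp (y 0) - QQ (\<not> u)) <= dn / 4" "\<bar>Xc (y 0)\<bar> <= 1" "HH u (y 0) >= 0" if "start u \<delta> e y" for e y
  using that \<delta> flow4_zp by (auto simp: start_def)
 have expc: "exp (- RR u * t) <= exp (- (k / e))" if "e > 0" "t >= c / e" for e t
 proof -
  have "RR u * (c / e) <= RR u * t" using that R by (intro mult_left_mono) auto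
  thus ?thesis by (simp add: k_def)
 qed
 have pos: "HH u (y t) > 0" if e: "0 < e" "e < e0" and y: "start u \<delta> e y" and t: "0 < t" "t <= c / e" for e y t
 proof (cases "t <= T")
  case True
  show ?thesis using es(3)[OF e(1) _ S(1)[OF y] _ S(6,7)[OF y] t(1) True] e e0 S(4)[OF y] z0(1) by simp
 next
  case False
  have nb: "\<bar>Nc (zp (y s))\<bar> <= 1" if "0 <= s" for s using tr(3)[OF S(2,3)[OF y] that] by (simp add: inreg_def)
  have "0 <= a * (1 + 1) / be u" using ab be_pos[of u] by simp
  hence xb: "\<bar>Xc (y 0)\<bar> <= XB (be u) 1" using S(6)[OF y] by (simp add: XB_def)
  have mv: "\<bar>Xc (y t) - Xc (y 0)\<bar> <= e * X * t"
   using xi_move[OF S(1)[OF y] be_pos e(1) order_refl less_imp_le[OF t(1)] _ xb] nb by (simp add: X_def)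
  have n1: "\<bar>Nc (zp (y t)) - Nc (QQ u)\<bar> <= dn / 4"
   using abs_Nc_le[of "zp (y t) - QQ u"] tr(3)[OF S(2,3)[OF y], of t] CT[of t] False t by simp
  have n0: "\<bar>Nc (zp (y 0)) - Nc (QQ (\<not> u))\<bar> <= dn / 4"
   using abs_Nc_le[of "zp (y 0) - QQ (\<not> u)"] S(5)[OF y] by simp
  have "sg u * (Nc (zp (y t)) - Nc (zp (y 0))) >= dn / 2"
   using n1[unfolded abs_le_iff] n0[unfolded abs_le_iff] sdn unfolding sg_def by (cases u; simp; linarith)
  hence "(a + b) * (sg u * (Nc (zp (y t)) - Nc (zp (y 0)))) >= (a + b) * (dn / 2)" using ab by (intro mult_left_mono) auto
  moreover have "b * (e * X * t) <= (a + b) * (dn / 4)"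
  proof -
   have "e * t <= c" using t(2) e by (simp add: pos_le_divide_eq mult.commute)
   hence "b * X * (e * t) <= b * X * c" using ab X by (intro mult_left_mono) auto
   also have "... = (a + b) * (dn / 4)" using ab X by (simp add: c_def)
   finally show ?thesis by (simp add: mult_ac)
  qed
  moreover have "(a + b) * (dn / 4) < (a + b) * (dn / 2)" using ab dn by simp
  ultimately show ?thesis using HH_lower[OF mv, of u] S(7)[OF y] by linarith
 qed
 have near: "C * norm (zp (y t) - QQ u) <= mu u * e * e" if e: "0 < e" "e < e0" and y: "start u \<delta> e y" and t: "t >= c / e" for e y t
 proof -
  have t0: "t >= 0" using t c e by (meson divide_nonneg_pos less_imp_le order_trans)
  have "norm (zp (y t) - QQ u) <= C * exp (- RR u * t)" using tr(3)[OF S(2,3)[OF y] t0] by simp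
  also have "... <= C * exp (- (k / e))" using expc[OF e(1) t] tr(2) by (intro mult_left_mono) auto
  \<comment> \<open>Each of the two equal factors supplies one power of \<open>e\<close>; together
    they give the distance of order \<open>e * e\<close>.\<close>
  also have "exp (- (k / e)) = exp (- (k / 2 / e)) * exp (- (k / 2 / e))" by (simp add: exp_add[symmetric])
  also have "C * (exp (- (k / 2 / e)) * exp (- (k / 2 / e))) <= C * ((mu u / (C * C)) * e * (1 * e))"
   using e4(2)[of e] e5(2)[of e] e e0 tr(2) mu[of u] by (intro mult_left_mono mult_mono) auto
  finally have "C * norm (zp (y t) - QQ u) <= C * (C * ((mu u / (C * C)) * e * (1 * e)))" using tr(2) by (intro mult_left_mono) auto
  also have "... = mu u * e * e" using tr(2) by simp
  finally show ?thesis .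
 qed
 have e1: "exp (- RR u * t) <= 1" if "t >= 0" for t using R that by simp
 show ?thesis
 proof (rule that[of \<delta> c C e0])
  show "HH u (y t) > 0" if "0 < e" "e < e0" "start u \<delta> e y" "0 < t" "t <= c / e" for e y t using pos that by blast
  show "C * norm (zp (y t) - QQ u) <= mu u * e * e" if "0 < e" "e < e0" "start u \<delta> e y" "t >= c / e" for e y t using near that by blast
  show "inreg (zp (y t))" if "start u \<delta> e y" "t >= 0" for e y t using tr(3)[OF S(2,3)[OF that(1)] that(2)] by simp
  show "norm (zp (y t) - zp (y' t)) <= C * norm (zp (y 0) - zp (y' 0))" if "start u \<delta> e y" "start u \<delta> e y'" "t >= 0" for e y y' t
  proof -
   have "norm (zp (y t) - zp (y' t)) <= C * exp (- RR u * t) * norm (zp (y 0) - zp (y' 0))"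
    by (rule tr(4)[OF S(2,3)[OF that(1)] S(2,3)[OF that(2)] that(3)])
   also have "... <= C * 1 * norm (zp (y 0) - zp (y' 0))" using e1[OF that(3)] tr(2) by (intro mult_right_mono mult_left_mono) auto
   finally show ?thesis by simp
  qed
  show "norm (zp (y t) - zp (y' t)) <= norm (zp (y 0) - zp (y' 0)) / 4"
   if e: "0 < e" "e < e0" and y: "start u \<delta> e y" "start u \<delta> e y'" and t: "t >= c / e" for e y y' t
  proof -
   have t0: "t >= 0" using t c e by (meson divide_nonneg_pos less_imp_le order_trans)
   have "C * exp (- RR u * t) <= C * ((1 / (4 * C)) * e)"
    using order_trans[OF expc[OF e(1) t] e3(2)[of e]] e e0 tr(2) by (intro mult_left_mono) auto
   also have "... = e / 4" using tr(2) by simp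
   also have "... <= 1 / 4" using e e0 by simp
   finally have "C * exp (- RR u * t) * norm (zp (y 0) - zp (y' 0)) <= 1 / 4 * norm (zp (y 0) - zp (y' 0))" by (rule mult_right_mono) simp
   thus ?thesis using tr(4)[OF S(2,3)[OF y(1)] S(2,3)[OF y(2)] t0] by simp
  qed
  show "norm (zp (y t) - QQ u) <= C" if "start u \<delta> e y" "t >= 0" for e y t
  proof -
   have "norm (zp (y t) - QQ u) <= C * exp (- RR u * t)" using tr(3)[OF S(2,3)[OF that(1)] that(2)] by simp
   also have "... <= C * 1" using e1[OF that(2)] tr(2) by (intro mult_left_mono) auto
   finally show ?thesis by simp
  qed
 qed (use \<delta>(1) c tr(2) e0 in simp_all)
qed

end

section \<open>The return map\<close>

lemma vd_bound:
 fixes x :: "real => 'a::real_normed_vector"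
 assumes st: "s <= t" and d: "\<And>v. s <= v ==> v <= t ==> (x has_vector_derivative f v) (at v within {s..t})"
  and M: "\<And>v. s <= v ==> v <= t ==> norm (f v) <= M"
 shows "norm (x t - x s) <= M * (t - s)"
proof -
 have "norm (x t - x s) <= M * norm (t - s)"
 proof (rule differentiable_bound[of "{s..t}" x "%v h. h *\<^sub>R f v"])
  fix v assume v: "v \<in> {s..t}"
  show "(x has_derivative (%h. h *\<^sub>R f v)) (at v within {s..t})"
   using d[of v] v by (simp add: has_vector_derivative_def)
  show "onorm (%h. h *\<^sub>R f v) <= M"
   using M[of v] v by (intro onorm_le) (simp add: mult.commute[of M] mult_left_mono)
 qed (use st in auto)
 thus ?thesis using st by simp
qed

text \<open>One fixed small \<open>e\<close>. The \<open>hc\<close> assumptions are the conclusions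
  of \<open>half_cycle\<close>. By \<open>esm\<close> the landing points lie inside the
  neighbourhoods that \<open>good_near\<close> will show to be attracted, and by \<open>esc\<close>
  the variation of the exit time costs at most a quarter in the contraction of the return
  map.\<close>

locale climate_cycle = climate_nodes +
 fixes e dd :: real and cc CC :: "bool => real"
 assumes e: "0 < e" "e < 1" "e < egap"
  and dd: "0 < dd" "\<And>u. dd <= Vm u * R1 u"
  and cc: "\<And>u. cc u > 0" and CC: "\<And>u. CC u >= 1"
  and esm: "\<And>u. mu u * e * e < Vm u * min (R1 u) (min (mu u * e / VM u) (dd / VM u))"
  and esc: "\<And>u. Lf * mu u * e * ((a + b) * CC u + b * (1 + (a + b) / b + (be u + a) / be u * CC u)) * (1 + (a + b) / b) <= cr u / 4"
  and hc1: "\<And>u y t. start u dd e y ==> 0 < t ==> t <= cc u / e ==> HH u (y t) > 0"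
  and hc2: "\<And>u y t. start u dd e y ==> t >= cc u / e ==> norm (zp (y t) - QQ u) <= mu u * e * e"
  and hc3: "\<And>u y t. start u dd e y ==> t >= 0 ==> inreg (zp (y t))"
  and hc4: "\<And>u y y' t. start u dd e y ==> start u dd e y' ==> t >= 0 ==> norm (zp (y t) - zp (y' t)) <= CC u * norm (zp (y 0) - zp (y' 0))"
  and hc5: "\<And>u y y' t. start u dd e y ==> start u dd e y' ==> t >= cc u / e ==> norm (zp (y t) - zp (y' t)) <= norm (zp (y 0) - zp (y' 0)) / 4"
begin

text \<open>Small enough for the box contraction, for a transversal exit at scale \<open>e\<close>,
  and for the end of the phase to be an admissible start of the next.\<close>

definition rr :: "bool => real" where "rr u = min (R1 u) (min (mu u * e / VM u) (dd / VM u))"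

lemma rr: "rr u > 0" "rr u <= R1 u" "VM u * rr u <= mu u * e" "VM u * rr u <= dd" "mu u * e * e < Vm u * rr u" "Vm u * rr u <= dd" "Vm u * rr u <= mu u * e"
proof -
 show p: "rr u > 0" using R1[of u] mu[of u] e dd VM[of u] by (simp add: rr_def)
 show "rr u <= R1 u" by (simp add: rr_def)
 have "rr u <= mu u * e / VM u" "rr u <= dd / VM u" by (simp_all add: rr_def)
 thus q: "VM u * rr u <= mu u * e" "VM u * rr u <= dd" using VM[of u] by (simp_all add: pos_le_divide_eq mult.commute)
 show "mu u * e * e < Vm u * rr u" using esm by (simp add: rr_def)
 have "Vm u * rr u <= VM u * rr u" using p VM[of u] by (intro mult_right_mono) (auto simp: Vm_def)
 thus "Vm u * rr u <= dd" "Vm u * rr u <= mu u * e" using q by linarith+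
qed

lemma mee: "mu u * e * e <= dd" "mu u * e * e <= mu u * e" using rr(5,6,7)[of u] by linarith+

section \<open>Arcs of one phase and their end points\<close>

definition st :: "bool => state4 => bool" where
 "st u v \<longleftrightarrow> norm (zp v - QQ (\<not> u)) <= dd & \<bar>Xc v\<bar> <= 1 & HH u v >= 0"

definition fl :: "bool => state4 => real => state4" where
 "fl u v = (SOME y. y 0 = v & ode (fld4 (ta u) (be u) e) y)"

lemma fl: "fl u v 0 = v" "ode (fld4 (ta u) (be u) e) (fl u v)"
proof -
 have "\<exists>y. y 0 = v & ode (fld4 (ta u) (be u) e) y" by (rule flow4_exists)
 from someI_ex[OF this, folded fl_def] show "fl u v 0 = v" "ode (fld4 (ta u) (be u) e) (fl u v)" by auto
qed

lemma fl_start: "st u v ==> start u dd e (fl u v)"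
 using fl[of u v] by (simp add: start_def st_def)

lemma cce: "cc u / e > 0" using cc e by simp

lemma e1: "e <= 1" using e by simp

lemma TT_ex:
 assumes s: "st u v"
 shows "\<exists>T. T > cc u / e & HH u (fl u v T) = 0 & (\<forall>t. 0 < t --> t < T --> HH u (fl u v t) > 0)"
proof -
 note S = fl_start[OF s]
 have n: "norm (zp (fl u v t) - QQ u) <= mu u * e" if "t >= cc u / e" for t
  using order_trans[OF hc2[OF S that] mee(2)] .
 obtain T where T: "T > cc u / e" "HH u (fl u v T) = 0" "\<And>t. cc u / e <= t ==> t < T ==> HH u (fl u v t) > 0"
  using phase_ends[OF fl(2) e(1) e1 less_imp_le[OF cce] n hc1[OF S cce order_refl]] by blast
 have "HH u (fl u v t) > 0" if "0 < t" "t < T" for t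
  using hc1[OF S, of t] T(3)[of t] that by (cases "t <= cc u / e") auto
 thus ?thesis using T by blast
qed

definition TT :: "bool => state4 => real" where
 "TT u v = (SOME T. T > cc u / e & HH u (fl u v T) = 0 & (\<forall>t. 0 < t --> t < T --> HH u (fl u v t) > 0))"

lemma TT: assumes "st u v"
 shows "TT u v > cc u / e" "TT u v > 0" "HH u (fl u v (TT u v)) = 0" "\<And>t. 0 < t ==> t < TT u v ==> HH u (fl u v t) > 0"
 using someI_ex[OF TT_ex[OF assms], folded TT_def] cce[of u] by auto

lemma HH_nonneg: "st u v ==> 0 <= t ==> t <= TT u v ==> HH u (fl u v t) >= 0"
proof -
 assume s: "st u v" and t: "0 <= t" "t <= TT u v"
 consider "t = 0" | "t = TT u v" | "0 < t" "t < TT u v" using t by linarith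
 thus ?thesis using TT(3,4)[OF s] s fl(1) by cases (auto simp: st_def less_imp_le)
qed

lemma inreg_bounds: "inreg z ==> 0 < Nc z & Nc z < 1" by (simp add: inreg_def)

lemma Xc_arc: "st u v ==> 0 <= t ==> t <= TT u v ==> \<bar>Xc (fl u v t)\<bar> <= 1"
proof -
 assume s: "st u v" and t: "0 <= t" "t <= TT u v"
 show ?thesis
 proof (rule Xc_range[OF fl(2) e(1) t(1)])
  show "\<bar>Xc (fl u v 0)\<bar> <= 1" using s fl(1) by (simp add: st_def)
  show "0 < Nc (zp (fl u v w)) & Nc (zp (fl u v w)) < 1" if "0 <= w" for w
   by (rule inreg_bounds[OF hc3[OF fl_start[OF s] that]])
  show "HH u (fl u v w) >= 0" if "0 <= w" "w <= t" for w using HH_nonneg[OF s that(1)] that t by simp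
 qed
qed

lemma arc_phase: "st u v ==> 0 <= t ==> t <= TT u v ==> fl u v t \<in> phase_space"
 by (rule inreg_phase[OF hc3[OF fl_start] Xc_arc]) auto

lemma arc_gsol: "st u v ==> gsol e {0..TT u v} (fl u v)"
 by (rule flow_gsol[OF fl(2)]) (use HH_nonneg in auto)

definition PI :: "bool => state4 => state4" where "PI u v = fl u v (TT u v)"

lemma strict_node:
 assumes n: "norm (zp v - QQ u) <= mu u * e" "norm (zp v - QQ u) <= dd" and h: "hh v = 0" and x: "\<bar>Xc v\<bar> <= 1"
 shows "strict e v"
proof -
 have "nearv u (R1 u) (zp v) (QQ u)" by (rule norm_nearv) (use n(2) dd(2)[of u] R1[of u] in auto)
 hence "inreg (zp v)" by (rule nearv_inreg) simp
 thus ?thesis using strict_near_node[OF e(1,3) n(1) h _ x] inreg_bounds[of "zp v"] by simp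
qed

lemma PI: assumes s: "st u v"
 shows "norm (zp (PI u v) - QQ u) <= mu u * e * e" "hh (PI u v) = 0" "st (\<not> u) (PI u v)" "strict e (PI u v)" "PI u v \<in> phase_space"
proof -
 show n: "norm (zp (PI u v) - QQ u) <= mu u * e * e"
  unfolding PI_def by (rule hc2[OF fl_start[OF s]]) (use TT(1)[OF s] in simp)
 show h: "hh (PI u v) = 0" using TT(3)[OF s] by (auto simp: PI_def HH_def split: if_splits)
 have x: "\<bar>Xc (PI u v)\<bar> <= 1" unfolding PI_def by (rule Xc_arc[OF s]) (use TT(2)[OF s] in auto)
 show "st (\<not> u) (PI u v)" unfolding st_def using order_trans[OF n mee(1)] x h by (cases u) (simp_all add: HH_def)
 show "strict e (PI u v)" by (rule strict_node[OF order_trans[OF n mee(2)] order_trans[OF n mee(1)] h x])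
 show "PI u v \<in> phase_space" unfolding PI_def by (rule arc_phase[OF s]) (use TT(2)[OF s] in auto)
qed

text \<open>Inside an arc \<open>HH\<close> is positive and its end is transversal, so only the
  initial point can fail.\<close>

lemma arc_strict: "st u v ==> 0 <= t ==> t <= TT u v ==> 0 < t \<or> strict e v ==> strict e (fl u v t)"
proof -
 assume s: "st u v" and t: "0 <= t" "t <= TT u v" and d: "0 < t \<or> strict e v"
 consider "t = 0" | "t = TT u v" | "0 < t" "t < TT u v" using t by linarith
 thus ?thesis
 proof cases
  case 1 thus ?thesis using d fl(1) by simp
 next
  case 2 thus ?thesis using PI(4)[OF s] by (simp add: PI_def)
 next
  case 3 thus ?thesis using TT(4)[OF s 3] by (auto simp: strict_def HH_def split: if_splits)
 qed
qed

definition phs :: "bool => nat => bool" where "phs u n = (if even n then u else \<not> u)"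

primrec vq :: "bool => state4 => nat => state4" where
 "vq u v 0 = v"
| "vq u v (Suc n) = PI (phs u n) (vq u v n)"

definition tq :: "bool => state4 => nat => real" where "tq u v n = TT (phs u n) (vq u v n)"

lemma phs_Suc: "phs u (Suc n) = (\<not> phs u n)" by (simp add: phs_def)

lemma vq_st: "st u v ==> st (phs u n) (vq u v n)"
proof (induction n)
 case (Suc n) thus ?case using PI(3)[of "phs u n" "vq u v n"] by (simp add: phs_Suc)
qed (simp add: phs_def)

text \<open>Arcs of alternating phases are glued; each lasts longer than \<open>cc u / e\<close>, so
  they fill the half-line.\<close>

lemma cycle_solution:
 assumes s: "st u v"
 obtains y where "gsol e {0..} y" "y 0 = v" "\<And>t. t >= 0 ==> y t \<in> phase_space"
  "\<And>t. t >= 0 ==> 0 < t \<or> strict e v ==> strict e (y t)"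
  "\<And>n t. 0 <= t ==> t <= tq u v n ==> y ((\<Sum>i<n. tq u v i) + t) = fl (phs u n) (vq u v n) t"
  "\<And>t. t >= 0 ==> \<exists>n s. t = (\<Sum>i<n. tq u v i) + s & 0 <= s & s <= tq u v n"
proof -
 define d0 where "d0 = min (cc True / e) (cc False / e)"
 have d0: "d0 > 0" using cce by (simp add: d0_def)
 have tqp: "tq u v n > 0" for n using TT(2)[OF vq_st[OF s]] by (simp add: tq_def)
 have tq0: "tq u v n >= d0" for n
  using TT(1)[OF vq_st[OF s, of n]] by (cases "phs u n") (auto simp: d0_def tq_def)
 obtain y where y: "gsol e {0..} y" "\<And>n t. 0 <= t ==> t <= tq u v n ==> y ((\<Sum>i<n. tq u v i) + t) = fl (phs u n) (vq u v n) t"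
  "\<And>t. t >= 0 ==> \<exists>n s. t = (\<Sum>i<n. tq u v i) + s & 0 <= s & s <= tq u v n"
 proof (rule gsol_concat[of e "tq u v" "%n. fl (phs u n) (vq u v n)" d0])
  show "gsol e {0..tq u v n} (fl (phs u n) (vq u v n))" for n unfolding tq_def by (rule arc_gsol[OF vq_st[OF s]])
  show "fl (phs u n) (vq u v n) (tq u v n) = fl (phs u (Suc n)) (vq u v (Suc n)) 0" for n
   by (simp add: fl(1) PI_def tq_def)
 qed (use d0 tq0 in auto)
 show ?thesis
 proof (rule that[OF y(1) _ _ _ y(2,3)])
  show "y 0 = v" using y(2)[of 0 0] tqp[of 0] fl(1) by simp
  fix t :: real assume t: "t >= 0"
  then obtain n w where w: "t = (\<Sum>i<n. tq u v i) + w" "0 <= w" "w <= tq u v n" using y(3) by blast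
  have yt: "y t = fl (phs u n) (vq u v n) w" using y(2)[OF w(2,3)] w(1) by simp
  show "y t \<in> phase_space" unfolding yt by (rule arc_phase[OF vq_st[OF s]]) (use w in \<open>auto simp: tq_def\<close>)
  assume d: "0 < t \<or> strict e v"
  show "strict e (y t)" unfolding yt
  proof (rule arc_strict[OF vq_st[OF s]])
   show "0 < w \<or> strict e (vq u v n)"
   proof (cases n)
    case 0 thus ?thesis using d w by simp
   next
    case (Suc m) thus ?thesis using PI(4)[OF vq_st[OF s, of m]] by simp
   qed
  qed (use w in \<open>auto simp: tq_def\<close>)
 qed
qed

section \<open>Dependence of arcs and exit times on the starting point\<close>

definition KX :: "bool => real" where "KX u = 1 + (a + b) / b + (be u + a) / be u * CC u"
definition KH :: "bool => real" where "KH u = (a + b) * CC u + b * KX u"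

lemma KX: "KX u >= 1" "(be u + a) * CC u <= be u * KX u" and KH: "KH u >= 0"
proof -
 have 1: "(be u + a) / be u * CC u >= 0" "(a + b) / b >= 0" using be_pos[of u] ab CC[of u] by simp_all
 thus k: "KX u >= 1" unfolding KX_def by linarith
 have "be u * ((be u + a) / be u * CC u) = (be u + a) * CC u" using be_pos[of u] by simp
 moreover have "be u * KX u >= be u * ((be u + a) / be u * CC u)" unfolding KX_def using 1 be_pos[of u] by (intro mult_left_mono) auto
 ultimately show "(be u + a) * CC u <= be u * KX u" by simp
 show "KH u >= 0" unfolding KH_def using k ab CC[of u] by simp
qed

lemma zp_diff: "zp v - zp v' = zp (v - v')" and Xc_diff: "Xc v - Xc v' = Xc (v - v')"
 by (simp_all add: zp_def Xc_def)

lemma norm4_le: "norm (v - v') <= norm (zp v - zp v') + \<bar>Xc v - Xc v'\<bar>"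
 using norm_mk_le[of "zp (v - v')" "Xc (v - v')"] by (simp add: zp_diff Xc_diff)

lemma zp_cmp:
 assumes s: "st u v" "st u v'" and t: "t >= 0"
 shows "norm (zp (fl u v t) - zp (fl u v' t)) <= CC u * norm (v - v')"
proof -
 have "norm (zp (fl u v t) - zp (fl u v' t)) <= CC u * norm (zp v - zp v')"
  using hc4[OF fl_start[OF s(1)] fl_start[OF s(2)] t] by (simp add: fl(1))
 also have "... <= CC u * norm (v - v')" unfolding zp_diff using norm_zp_le CC[of u] by (intro mult_left_mono) auto
 finally show ?thesis .
qed

text \<open>The slow equation pulls the two slow variables together at rate \<open>e * be u\<close>,
  and the fast difference pushes with at most \<open>e * (be u + a) * CC u\<close> times the initial
  distance. So the level \<open>KX u\<close> times that distance is a barrier, uniformly in time and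
  in \<open>e\<close>.\<close>

lemma Xc_cmp1:
 assumes s: "st u v" "st u v'" and t: "t >= 0"
 shows "Xc (fl u v t) - Xc (fl u v' t) <= KX u * norm (v - v')"
proof -
 define D where "D = norm (v - v')"
 have D: "D >= 0" by (simp add: D_def)
 have c: "continuous_on {0..t} (%t. Xc (fl u w t))" for w by (rule flow4_cont[OF fl(2)]) auto
 have "Xc (fl u v t) - Xc (fl u v' t) - KX u * D <= 0"
 proof (rule barrier_nonpos[OF t, where f="%t. Xc (fl u v t) - Xc (fl u v' t) - KX u * D"])
  have "\<bar>Xc v - Xc v'\<bar> <= D" unfolding D_def Xc_diff by (rule norm_Xc_le)
  moreover have "1 * D <= KX u * D" using KX(1) D by (intro mult_right_mono) auto
  ultimately show "Xc (fl u v 0) - Xc (fl u v' 0) - KX u * D <= 0" by (simp add: fl(1))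
  fix w assume w: "0 < w" "w < t" "Xc (fl u v w) - Xc (fl u v' w) - KX u * D > 0"
  let ?X = "%v. Xi (be u) (Nc (zp (fl u v w))) (Xc (fl u v w))"
  have "\<bar>Nc (zp (fl u v w)) - Nc (zp (fl u v' w))\<bar> <= norm (zp (fl u v w) - zp (fl u v' w))"
   using abs_Nc_le[of "zp (fl u v w) - zp (fl u v' w)"] by simp
  also have "... <= CC u * D" unfolding D_def by (rule zp_cmp[OF s]) (use w in simp)
  finally have "(be u + a) * (Nc (zp (fl u v w)) - Nc (zp (fl u v' w))) <= (be u + a) * (CC u * D)"
   using be_pos[of u] ab by (intro mult_left_mono) (auto simp: abs_le_iff)
  also have "... = (be u + a) * CC u * D" by simp
  also have "... <= be u * KX u * D" using KX(2)[of u] D by (intro mult_right_mono) auto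
  also have "... <= be u * (Xc (fl u v w) - Xc (fl u v' w))" using w(3) be_pos[of u] by (simp add: mult.assoc)
  finally have "?X v - ?X v' <= 0" by (simp add: Xi_def algebra_simps)
  hence "e * ?X v - e * ?X v' - 0 <= 0" using e by (simp add: mult_le_0_iff flip: right_diff_distrib)
  moreover have "((%t. Xc (fl u v t) - Xc (fl u v' t) - KX u * D) has_real_derivative e * ?X v - e * ?X v' - 0) (at w)"
   by (intro DERIV_diff flow4_deriv(1)[OF fl(2) w(1)] DERIV_const)
  ultimately show "\<exists>d. ((%t. Xc (fl u v t) - Xc (fl u v' t) - KX u * D) has_real_derivative d) (at w) & d <= 0" by blast
 qed (intro continuous_intros c)
 thus ?thesis by (simp add: D_def)
qed

lemma Xc_cmp:
 assumes s: "st u v" "st u v'" and t: "t >= 0"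
 shows "\<bar>Xc (fl u v t) - Xc (fl u v' t)\<bar> <= KX u * norm (v - v')"
 using Xc_cmp1[OF s t] Xc_cmp1[OF s(2,1) t] by (simp add: abs_le_iff norm_minus_commute)

lemma HH_cmp:
 assumes s: "st u v" "st u v'" and t: "t >= 0"
 shows "HH u (fl u v t) <= HH u (fl u v' t) + KH u * norm (v - v')"
proof -
 define D where "D = norm (v - v')"
 have "\<bar>Nc (zp (fl u v t)) - Nc (zp (fl u v' t))\<bar> <= norm (zp (fl u v t) - zp (fl u v' t))"
  using abs_Nc_le[of "zp (fl u v t) - zp (fl u v' t)"] by simp
 also have "... <= CC u * D" unfolding D_def by (rule zp_cmp[OF s t])
 finally have "(a + b) * \<bar>Nc (zp (fl u v t)) - Nc (zp (fl u v' t))\<bar> <= (a + b) * (CC u * D)"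
  using ab by (intro mult_left_mono) auto
 moreover have "b * \<bar>Xc (fl u v t) - Xc (fl u v' t)\<bar> <= b * (KX u * D)"
  unfolding D_def using Xc_cmp[OF s t] ab by (intro mult_left_mono) auto
 moreover have "sg u * c * x <= c * \<bar>x\<bar>" "- (sg u * c * x) <= c * \<bar>x\<bar>" if "c >= 0" for c x
  using mult_left_mono[OF abs_ge_self[of x] that] mult_left_mono[OF abs_ge_minus_self[of x] that] by (auto simp: sg_def)
 note this(1)[of "a + b" "Nc (zp (fl u v t)) - Nc (zp (fl u v' t))"] this(2)[of b "Xc (fl u v t) - Xc (fl u v' t)"]
 moreover have "a + b >= 0" "b >= 0" using ab by simp_all
 moreover have "KH u * D = (a + b) * (CC u * D) + b * (KX u * D)" by (simp add: KH_def algebra_simps)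
 ultimately show ?thesis using HH_diff[of u "fl u v t" "fl u v' t"] unfolding D_def by linarith
qed

text \<open>When the first solution leaves, the second has at most \<open>KH u\<close> times the
  initial distance left in \<open>HH\<close>, and it loses at least \<open>cr u * e\<close> per unit
  of time.\<close>

lemma TT_cmp:
 assumes s: "st u v" "st u v'"
 shows "TT u v' - TT u v <= KH u * norm (v - v') / (cr u * e)"
proof (cases "TT u v <= TT u v'")
 case le: True
 have "HH u (fl u v' (TT u v')) + cr u * e * TT u v' <= HH u (fl u v' (TT u v)) + cr u * e * TT u v"
 proof (rule DERIV_nonpos_imp_decreasing_open[OF le, where f="%t. HH u (fl u v' t) + cr u * e * t"])
  fix w assume w: "TT u v < w" "w < TT u v'"
  have w0: "w > 0" "w >= cc u / e" using w TT(1,2)[OF s(1)] by linarith+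
  have "((%t. HH u (fl u v' t) + cr u * e * t) has_real_derivative (sg u * (a + b) * Nc (fld (ta u) (zp (fl u v' w)))
    - e * (be u * HH u (fl u v' w) + a * \<bar>be u - b\<bar> * (1 - Nc (zp (fl u v' w))))) + cr u * e * 1) (at w)"
   by (intro DERIV_add HH_deriv[OF fl(2) w0(1)] DERIV_cmult DERIV_ident)
  moreover have "sg u * (a + b) * Nc (fld (ta u) (zp (fl u v' w)))
    - e * (be u * HH u (fl u v' w) + a * \<bar>be u - b\<bar> * (1 - Nc (zp (fl u v' w)))) <= - cr u * e"
   by (rule exit[OF e(1) e1 order_trans[OF hc2[OF fl_start[OF s(2)] w0(2)] mee(2)] HH_nonneg[OF s(2)]]) (use w w0 in auto)
  ultimately show "\<exists>d. ((%t. HH u (fl u v' t) + cr u * e * t) has_real_derivative d) (at w) & d <= 0" by fastforce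
 next
  show "continuous_on {TT u v..TT u v'} (%t. HH u (fl u v' t) + cr u * e * t)"
   unfolding HH_sg by (intro continuous_intros flow4_cont(4)[OF fl(2)]) (use TT(2)[OF s(1)] in auto)
 qed
 moreover have "HH u (fl u v' (TT u v)) <= KH u * norm (v - v')"
  using HH_cmp[OF s(2,1), of "TT u v"] TT(2,3)[OF s(1)] by (simp add: norm_minus_commute)
 ultimately have "cr u * e * (TT u v' - TT u v) <= KH u * norm (v - v')" using TT(3)[OF s(2)] by (simp add: algebra_simps)
 thus ?thesis using cr[of u] e by (simp add: pos_le_divide_eq mult.commute)
next
 case False
 have "0 <= KH u * norm (v - v') / (cr u * e)" using KH cr[of u] e by simp
 thus ?thesis using False by linarith
qed

lemma move:
 assumes s: "st u v" and t: "cc u / e <= w" "w <= t"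
 shows "norm (zp (fl u v t) - zp (fl u v w)) <= Lf * (mu u * e * e) * (t - w)"
  and "\<bar>Xc (fl u v t) - Xc (fl u v w)\<bar> <= e * CX (be u) 1 * (t - w)"
proof -
 have w0: "w > 0" using cce[of u] t by linarith
 show "norm (zp (fl u v t) - zp (fl u v w)) <= Lf * (mu u * e * e) * (t - w)"
 proof (rule vd_bound[OF t(2)])
  fix x assume x: "w <= x" "x <= t"
  show "((%t. zp (fl u v t)) has_vector_derivative fld (ta u) (zp (fl u v x))) (at x within {w..t})"
   by (rule has_vector_derivative_at_within[OF ode_at[OF flow4_zp[OF fl(2)]]]) (use w0 x in simp)
  have f0: "fld (ta u) (QQ u) = 0" using QQ(1) by (simp add: eqm_def)
  have "norm (fld (ta u) (zp (fl u v x)) - fld (ta u) (QQ u)) <= Lf * norm (zp (fl u v x) - QQ u)"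
   using lipschitz_onD[OF Lf(2)[of "ta u"], of "zp (fl u v x)" "QQ u"] by (simp add: dist_norm)
  also have "... <= Lf * (mu u * e * e)" using hc2[OF fl_start[OF s], of x] x t Lf(1) by (intro mult_left_mono) auto
  finally show "norm (fld (ta u) (zp (fl u v x))) <= Lf * (mu u * e * e)" by (simp add: f0)
 qed
 have "0 <= a * (1 + 1) / be u" using ab be_pos[of u] by simp
 hence xb: "\<bar>Xc (fl u v 0)\<bar> <= XB (be u) 1" using s by (simp add: XB_def fl(1) st_def)
 have nb: "\<bar>Nc (zp (fl u v x))\<bar> <= 1" if "0 <= x" for x using hc3[OF fl_start[OF s] that] by (simp add: inreg_def)
 show "\<bar>Xc (fl u v t) - Xc (fl u v w)\<bar> <= e * CX (be u) 1 * (t - w)"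
  by (rule xi_move[OF fl(2) be_pos e(1) _ t(2) nb xb]) (use w0 in auto)
qed

text \<open>Up to the earlier exit the fast difference shrinks to a quarter. The later solution then
  moves with speed of order \<open>e * e\<close> for a time of order \<open>1 / e\<close> times the
  distance, which contributes order \<open>e\<close>.\<close>

lemma PI_cmp1:
 assumes s: "st u v" "st u v'" and le: "TT u v <= TT u v'"
 shows "norm (zp (PI u v) - zp (PI u v')) <= norm (zp v - zp v') / 4 + Lf * mu u * e * KH u / cr u * norm (v - v')"
proof -
 have c: "cc u / e <= TT u v" using TT(1)[OF s(1)] by simp
 have "norm (zp (fl u v (TT u v)) - zp (fl u v' (TT u v))) <= norm (zp v - zp v') / 4"
  using hc5[OF fl_start[OF s(1)] fl_start[OF s(2)] c] by (simp add: fl(1))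
 moreover have "norm (zp (fl u v' (TT u v')) - zp (fl u v' (TT u v))) <= Lf * mu u * e * KH u / cr u * norm (v - v')"
 proof -
  have "norm (zp (fl u v' (TT u v')) - zp (fl u v' (TT u v))) <= Lf * (mu u * e * e) * (TT u v' - TT u v)"
   by (rule move(1)[OF s(2) c le])
  also have "... <= Lf * (mu u * e * e) * (KH u * norm (v - v') / (cr u * e))"
   using TT_cmp[OF s] Lf(1) mu[of u] e by (intro mult_left_mono) auto
  also have "... = Lf * mu u * e * KH u / cr u * norm (v - v')" using e by simp
  finally show ?thesis .
 qed
 moreover have "norm (zp (PI u v) - zp (PI u v')) <= norm (zp (fl u v (TT u v)) - zp (fl u v' (TT u v))) + norm (zp (fl u v' (TT u v')) - zp (fl u v' (TT u v)))"
  unfolding PI_def using norm_triangle_ineq4[of "zp (fl u v (TT u v)) - zp (fl u v' (TT u v))" "zp (fl u v' (TT u v')) - zp (fl u v' (TT u v))"] by simp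
 ultimately show ?thesis by linarith
qed

lemma PI_cmp:
 assumes s: "st u v" "st u v'"
 shows "norm (zp (PI u v) - zp (PI u v')) <= norm (zp v - zp v') / 4 + Lf * mu u * e * KH u / cr u * norm (v - v')"
 using PI_cmp1[OF s] PI_cmp1[OF s(2,1)] by (cases "TT u v <= TT u v'") (auto simp: norm_minus_commute)

definition KD :: "bool => real" where
 "KD u = CC u + KX u + (Lf * (mu u * e * e) + e * CX (be u) 1) * (KH u / (cr u * e))"

text \<open>Points are matched at equal times and, beyond the end of the other arc, with its end
  point. This turns convergence of the return points into convergence of whole arcs.\<close>

lemma arc_cmp:
 assumes s: "st u v" "st u v'" and t: "0 <= t" "t <= TT u v"
 shows "\<exists>w. 0 <= w & w <= TT u v' & norm (fl u v t - fl u v' w) <= KD u * norm (v - v')"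
proof -
 define D where "D = norm (v - v')"
 have D: "D >= 0" by (simp add: D_def)
 define Q where "Q = Lf * (mu u * e * e) + e * CX (be u) 1"
 have "XB (be u) 1 >= 0" using ab be_pos[of u] by (simp add: XB_def)
 hence "CX (be u) 1 >= 0" using ab be_pos[of u] by (simp add: CX_def)
 hence Q: "Q >= 0" unfolding Q_def using Lf(1) mu[of u] e by simp
 have 1: "norm (fl u v x - fl u v' x) <= (CC u + KX u) * D" if "x >= 0" for x
  using norm4_le[of "fl u v x" "fl u v' x"] zp_cmp[OF s that] Xc_cmp[OF s that] unfolding D_def distrib_right by linarith
 have k: "Q * (KH u / (cr u * e)) * D >= 0" using Q KH cr[of u] e D by simp
 have KDe: "KD u * D = (CC u + KX u) * D + Q * (KH u / (cr u * e)) * D" by (simp add: KD_def Q_def algebra_simps)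
 show ?thesis
 proof (cases "t <= TT u v'")
  case True
  thus ?thesis using 1[OF t(1)] k t KDe unfolding D_def by (intro exI[of _ t]) linarith
 next
  case False
  have c: "cc u / e <= TT u v'" "0 <= TT u v'" using TT(1,2)[OF s(2)] by auto
  have "norm (fl u v t - fl u v (TT u v')) <= Q * (t - TT u v')"
   using norm4_le[of "fl u v t" "fl u v (TT u v')"] move[OF s(1) c(1), of t] False unfolding Q_def distrib_right by linarith
  also have "... <= Q * (KH u * D / (cr u * e))"
   using TT_cmp[OF s(2,1)] t Q by (intro mult_left_mono) (auto simp: D_def norm_minus_commute)
  also have "... = Q * (KH u / (cr u * e)) * D" by simp
  finally have "norm (fl u v t - fl u v' (TT u v')) <= KD u * D"
   using 1[OF c(2)] KDe norm_triangle_ineq[of "fl u v t - fl u v (TT u v')" "fl u v (TT u v') - fl u v' (TT u v')"] by simp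
  thus ?thesis using c unfolding D_def by (intro exI[of _ "TT u v'"]) simp
 qed
qed

end

section \<open>The limit cycle\<close>

context climate_cycle begin

definition Ks :: real where "Ks = 1 + (a + b) / b"

lemma Ks: "Ks >= 1" using ab by (simp add: Ks_def)

text \<open>Inverse of \<open>zp\<close> on the switching manifold, which is a graph over the fast
  variables; it makes the return map a map of fast variables only.\<close>

definition sw :: "state3 => state4" where "sw z = mk z (((a + b) * Nc z - a) / b)"

lemma zp_sw [simp]: "zp (sw z) = z" by (simp add: sw_def)

lemma hh_sw: "hh (sw z) = 0" using ab by (simp add: sw_def hh_alt)

lemma sw_zp: "hh v = 0 ==> sw (zp v) = v"
proof -
 assume "hh v = 0"
 hence "((a + b) * Nc (zp v) - a) / b = Xc v" using ab by (simp add: hh_alt field_simps)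
 thus ?thesis by (simp add: sw_def)
qed

lemma sw_norm: "norm (sw z - sw z') <= Ks * norm (z - z')"
proof -
 have "Xc (sw z) - Xc (sw z') = (a + b) / b * (Nc z - Nc z')" using ab by (simp add: sw_def field_simps)
 hence "\<bar>Xc (sw z) - Xc (sw z')\<bar> = (a + b) / b * \<bar>Nc z - Nc z'\<bar>" using ab by (simp add: abs_mult)
 also have "... <= (a + b) / b * norm (z - z')" using abs_Nc_le[of "z - z'"] ab by (intro mult_left_mono) auto
 finally show ?thesis using norm4_le[of "sw z" "sw z'"] by (simp add: Ks_def distrib_right)
qed

lemma st_sw: "norm (z - QQ (\<not> u)) <= dd ==> st u (sw z)"
proof -
 assume n: "norm (z - QQ (\<not> u)) <= dd"
 have "nearv (\<not> u) (R1 (\<not> u)) z (QQ (\<not> u))" by (rule norm_nearv) (use n dd(2)[of "\<not> u"] R1[of "\<not> u"] in auto)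
 hence z: "0 < Nc z" "Nc z < 1" using nearv_inreg[of "\<not> u" _ z] inreg_bounds[of z] by auto
 have "(a + b) * Nc z < (a + b) * 1" "0 < (a + b) * Nc z" using z ab by (intro mult_strict_left_mono, auto)
 moreover have "\<bar>m - a\<bar> <= b" if "m < (a + b) * 1" "0 < m" for m using that ab by (simp add: abs_le_iff)
 ultimately have "\<bar>(a + b) * Nc z - a\<bar> <= b" by blast
 hence "\<bar>((a + b) * Nc z - a) / b\<bar> <= 1" using ab by (simp add: abs_divide)
 thus ?thesis using n hh_sw by (simp add: st_def HH_def sw_def)
qed

definition PIz :: "bool => state3 => state3" where "PIz u z = zp (PI u (sw z))"

lemma PIz_ball: "norm (z - QQ (\<not> u)) <= dd ==> norm (PIz u z - QQ u) <= dd"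
 using order_trans[OF PI(1)[OF st_sw] mee(1)] by (simp add: PIz_def)

text \<open>A quarter from the attraction in the phase and a quarter from the exit times by
  \<open>esc\<close>, with \<open>Ks\<close> the Lipschitz constant of the lift to the
  manifold.\<close>

lemma PIz_contract:
 assumes "norm (z - QQ (\<not> u)) <= dd" "norm (z' - QQ (\<not> u)) <= dd"
 shows "norm (PIz u z - PIz u z') <= norm (z - z') / 2"
proof -
 have "KH u = (a + b) * CC u + b * (1 + (a + b) / b + (be u + a) / be u * CC u)" by (simp add: KH_def KX_def)
 hence "Lf * mu u * e * KH u * Ks <= cr u / 4" using esc[of u] by (simp add: Ks_def)
 hence k: "Lf * mu u * e * KH u * Ks / cr u <= 1 / 4" using cr[of u] by (simp add: pos_divide_le_eq)
 have "norm (PIz u z - PIz u z') <= norm (z - z') / 4 + Lf * mu u * e * KH u / cr u * norm (sw z - sw z')"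
  using PI_cmp[OF st_sw[OF assms(1)] st_sw[OF assms(2)]] by (simp add: PIz_def)
 also have "Lf * mu u * e * KH u / cr u * norm (sw z - sw z') <= Lf * mu u * e * KH u / cr u * (Ks * norm (z - z'))"
  using sw_norm Lf(1) mu[of u] e KH cr[of u] by (intro mult_left_mono) auto
 also have "... = Lf * mu u * e * KH u * Ks / cr u * norm (z - z')" by simp
 also have "... <= 1 / 4 * norm (z - z')" by (rule mult_right_mono[OF k]) simp
 finally show ?thesis by simp
qed

lemma cycle_fix: "\<exists>z. norm (z - QQ False) <= dd & PIz False (PIz True z) = z"
proof -
 have cb: "z \<in> cball (QQ False) dd \<longleftrightarrow> norm (z - QQ (\<not> True)) <= dd" for z by (simp add: dist_norm norm_minus_commute)
 have "\<exists>!z\<in>cball (QQ False) dd. PIz False (PIz True z) = z"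
 proof (rule Banach_fix[of _ "1/4" "%z. PIz False (PIz True z)"])
  show "(%z. PIz False (PIz True z)) ` cball (QQ False) dd \<subseteq> cball (QQ False) dd"
   using PIz_ball[of _ True] PIz_ball[of _ False] cb by (metis (no_types, lifting) image_subsetI)
  fix z z' assume z: "z \<in> cball (QQ False) dd" "z' \<in> cball (QQ False) dd"
  have "norm (PIz True z - PIz True z') <= norm (z - z') / 2" by (rule PIz_contract) (use z cb in auto)
  moreover have "norm (PIz False (PIz True z) - PIz False (PIz True z')) <= norm (PIz True z - PIz True z') / 2"
   by (rule PIz_contract) (use z cb PIz_ball[of _ True] in auto)
  ultimately show "dist (PIz False (PIz True z)) (PIz False (PIz True z')) <= 1/4 * dist z z'" by (simp add: dist_norm)
 qed (use dd in \<open>auto intro: compact_imp_complete\<close>)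
 thus ?thesis using cb by auto
qed

definition zst :: state3 where "zst = (SOME z. norm (z - QQ False) <= dd & PIz False (PIz True z) = z)"

definition vs :: "bool => state4" where "vs u = (if u then sw zst else PI True (sw zst))"

lemma vs: "st u (vs u)" "hh (vs u) = 0" "PI u (vs u) = vs (\<not> u)" "norm (zp (vs u) - QQ (\<not> u)) <= mu (\<not> u) * e * e" "strict e (vs u)"
proof -
 have z: "norm (zst - QQ (\<not> True)) <= dd" "PIz False (PIz True zst) = zst"
  using someI_ex[OF cycle_fix, folded zst_def] by auto
 have s1: "st True (vs True)" using st_sw[OF z(1)] by (simp add: vs_def)
 have s2: "st False (vs False)" using PI(3)[OF s1] by (simp add: vs_def)
 show "st u (vs u)" using s1 s2 by (cases u) auto
 show "hh (vs u) = 0" using hh_sw PI(2)[OF s1] by (simp add: vs_def)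
 have "PI True (sw zst) = sw (PIz True zst)" using sw_zp[OF PI(2)[OF s1]] by (simp add: PIz_def vs_def)
 hence "zp (PI False (PI True (sw zst))) = zst" using z(2) by (simp add: PIz_def)
 hence p: "PI False (PI True (sw zst)) = sw zst" using sw_zp[OF PI(2)[OF s2]] by (simp add: vs_def)
 thus pp: "PI u (vs u) = vs (\<not> u)" by (cases u) (simp_all add: vs_def)
 have q: "vs u = PI (\<not> u) (vs (\<not> u))" using p by (cases u) (simp_all add: vs_def)
 have s: "st (\<not> u) (vs (\<not> u))" using s1 s2 by (cases u) auto
 show "norm (zp (vs u) - QQ (\<not> u)) <= mu (\<not> u) * e * e" "strict e (vs u)"
  unfolding q by (rule PI(1)[OF s], rule PI(4)[OF s])
qed

definition Gam :: "state4 set" where "Gam = (\<Union>u. fl u (vs u) ` {0..TT u (vs u)})"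

lemma Gam_in: "0 <= t ==> t <= TT u (vs u) ==> fl u (vs u) t \<in> Gam" unfolding Gam_def by (intro UN_I[of u] imageI) auto

lemma vq_vs: "vq u (vs u) n = vs (phs u n)"
 by (induction n) (simp_all add: vs(3) phs_Suc, simp add: phs_def)

lemma Gam_periodic:
 obtains x where "gsol e UNIV x" "\<And>t. x t \<in> phase_space" "\<exists>T>0. \<forall>t. x (t + T) = x t" "\<exists>t. x t \<noteq> x 0" "range x = Gam"
proof -
 define d where "d = tq True (vs True)"
 define P where "P = TT True (vs True) + TT False (vs False)"
 have dn: "d n = TT (phs True n) (vs (phs True n))" for n by (simp add: d_def tq_def vq_vs)
 have P: "P > 0" using TT(2)[OF vs(1), of True] TT(2)[OF vs(1), of False] by (simp add: P_def)
 obtain y where y: "gsol e {0..} y" "y 0 = vs True" "\<And>t. t >= 0 ==> y t \<in> phase_space"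
  "\<And>n t. 0 <= t ==> t <= d n ==> y ((\<Sum>i<n. d i) + t) = fl (phs True n) (vs (phs True n)) t"
  "\<And>t. t >= 0 ==> \<exists>n s. t = (\<Sum>i<n. d i) + s & 0 <= s & s <= d n"
  using cycle_solution[OF vs(1)[of True]] unfolding d_def vq_vs by metis
 have dP: "d n + d (Suc n) = P" for n by (cases "even n") (simp_all add: dn P_def phs_def)
 have per: "y (t + P) = y t" if t: "t >= 0" for t
 proof -
  obtain n s where s: "t = (\<Sum>i<n. d i) + s" "0 <= s" "s <= d n" using y(5)[OF t] by blast
  have eq: "t + P = (\<Sum>i<Suc (Suc n). d i) + s" using s(1) dP[of n] by simp
  have p: "d (Suc (Suc n)) = d n" "phs True (Suc (Suc n)) = phs True n" by (simp_all add: dn phs_def)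
  have "y (t + P) = fl (phs True n) (vs (phs True n)) s"
   unfolding eq using y(4)[of s "Suc (Suc n)"] s p by (simp only:)
  thus ?thesis using y(4)[of s n] s by simp
 qed
 obtain x where x: "gsol e UNIV x" "\<And>t. t >= 0 ==> x t = y t" "\<And>t. x (t + P) = x t" "range x = y ` {0..P}"
  using gsol_periodic[OF y(1) P per] by blast
 have seg: "y t = fl True (vs True) t" if "0 <= t" "t <= TT True (vs True)" for t
  using y(4)[of t 0] that by (simp add: dn phs_def)
 have seg2: "y (TT True (vs True) + t) = fl False (vs False) t" if "0 <= t" "t <= TT False (vs False)" for t
  using y(4)[of t 1] that by (simp add: dn phs_def)
 have im: "y ` {0..P} = Gam"
 proof
  show "y ` {0..P} \<subseteq> Gam"
  proof
   fix v assume "v \<in> y ` {0..P}"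
   then obtain t where t: "v = y t" "0 <= t" "t <= P" by auto
   show "v \<in> Gam"
   proof (cases "t <= TT True (vs True)")
    case True
    thus ?thesis using seg[of t] t Gam_in[of t True] by simp
   next
    case False
    thus ?thesis using seg2[of "t - TT True (vs True)"] t Gam_in[of "t - TT True (vs True)" False] by (simp add: P_def)
   qed
  qed
  show "Gam \<subseteq> y ` {0..P}"
  proof
   fix v assume "v \<in> Gam"
   then obtain u t where t: "v = fl u (vs u) t" "0 <= t" "t <= TT u (vs u)" by (auto simp: Gam_def)
   show "v \<in> y ` {0..P}"
   proof (cases u)
    case True
    thus ?thesis using t seg[of t] TT(2)[OF vs(1), of False] by (intro image_eqI[of _ _ t]) (auto simp: P_def)
   next
    case False
    thus ?thesis using t seg2[of t] TT(2)[OF vs(1), of True] by (intro image_eqI[of _ _ "TT True (vs True) + t"]) (auto simp: P_def)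
   qed
  qed
 qed
 have "x t \<in> phase_space" for t
 proof -
  have "x t \<in> y ` {0..P}" using x(4) by blast
  thus ?thesis using y(3) by auto
 qed
 \<comment> \<open>The solution is not constant: it starts on the manifold and is strictly inside a
   region at this time.\<close>
 moreover have "x (cc True / e) \<noteq> x 0"
 proof
  assume eq: "x (cc True / e) = x 0"
  have "HH True (y (cc True / e)) > 0"
   using seg[of "cc True / e"] TT(1)[OF vs(1), of True] TT(4)[OF vs(1), of "cc True / e" True] cce[of True] by simp
  moreover have "HH True (y 0) = 0" using y(2) vs(2)[of True] by (simp add: HH_def)
  ultimately show False using eq x(2)[of 0] x(2)[of "cc True / e"] cce[of True] by simp
 qed
 ultimately show ?thesis using that[OF x(1)] x(3,4) P im by blast
qed

text \<open>With the flag \<open>sb\<close> the solution is also strict, hence unique, as attraction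
  requires. Without it the notion covers starts in boxes of a size independent of \<open>e\<close>,
  where the exit may be too far from the node for transversality to be known.\<close>

definition good :: "bool => state4 => bool" where
 "good sb v \<longleftrightarrow> (\<exists>y. y 0 = v & gsol e {0..} y & (\<forall>t\<ge>0. y t \<in> phase_space & (sb --> strict e (y t))) &
   ((%t. infdist (y t) Gam) \<longlongrightarrow> 0) at_top)"

text \<open>From the first return on, the states lie on the manifold and approach those of the cycle
  geometrically by \<open>PIz_contract\<close>; \<open>arc_cmp\<close> carries this to the arcs
  between them.\<close>

lemma good_start:
 assumes s: "st u v" and sb: "sb ==> strict e v"
 shows "good sb v"
proof -
 define d where "d = tq u v"
 define w where "w n = vq u v n" for n
 obtain y where y: "gsol e {0..} y" "y 0 = v" "\<And>t. t >= 0 ==> y t \<in> phase_space"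
  "\<And>t. t >= 0 ==> 0 < t \<or> strict e v ==> strict e (y t)"
  "\<And>n t. 0 <= t ==> t <= d n ==> y ((\<Sum>i<n. d i) + t) = fl (phs u n) (w n) t"
  "\<And>t. t >= 0 ==> \<exists>n s. t = (\<Sum>i<n. d i) + s & 0 <= s & s <= d n"
  using cycle_solution[OF s] unfolding d_def w_def by metis
 have ws: "st (phs u n) (w n)" for n unfolding w_def by (rule vq_st[OF s])
 have dp: "d n > 0" for n using TT(2)[OF ws] by (simp add: d_def tq_def w_def)
 have wh: "hh (w (Suc n)) = 0" for n using PI(2)[OF ws[of n]] by (simp add: w_def)
 \<comment> \<open>Counting starts with the first return, since \<open>v\<close> itself may lie off
   the manifold.\<close>
 define D where "D n = norm (zp (w (Suc n)) - zp (vs (phs u (Suc n))))" for n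
 have Dn: "D n <= (1/2)^n * D 0" for n
 proof (induction n)
  case (Suc n)
  have "w (Suc (Suc n)) = PI (phs u (Suc n)) (sw (zp (w (Suc n))))" using sw_zp[OF wh[of n]] by (simp add: w_def)
  hence 1: "zp (w (Suc (Suc n))) = PIz (phs u (Suc n)) (zp (w (Suc n)))" by (simp add: PIz_def)
  have "vs (phs u (Suc (Suc n))) = PI (phs u (Suc n)) (sw (zp (vs (phs u (Suc n)))))"
   using sw_zp[OF vs(2)] vs(3)[of "phs u (Suc n)"] phs_Suc[of u "Suc n"] by simp
  hence 2: "zp (vs (phs u (Suc (Suc n)))) = PIz (phs u (Suc n)) (zp (vs (phs u (Suc n))))" by (simp add: PIz_def)
  have "D (Suc n) <= D n / 2" unfolding D_def 1 2
   by (rule PIz_contract) (use ws[of "Suc n"] vs(1)[of "phs u (Suc n)"] in \<open>simp_all add: st_def\<close>)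
  thus ?case using Suc by simp
 qed simp
 define K where "K = max (KD True) (KD False) * Ks"
 have close: "infdist (y ((\<Sum>i<Suc n. d i) + t)) Gam <= \<bar>K\<bar> * ((1/2)^n * D 0)" if t: "0 <= t" "t <= d (Suc n)" for n t
 proof -
  obtain x where x: "0 <= x" "x <= TT (phs u (Suc n)) (vs (phs u (Suc n)))"
    "norm (fl (phs u (Suc n)) (w (Suc n)) t - fl (phs u (Suc n)) (vs (phs u (Suc n))) x) <= KD (phs u (Suc n)) * norm (w (Suc n) - vs (phs u (Suc n)))"
   using arc_cmp[OF ws[of "Suc n"] vs(1)[of "phs u (Suc n)"], of t] t by (auto simp: d_def tq_def w_def)
  have "infdist (y ((\<Sum>i<Suc n. d i) + t)) Gam <= dist (y ((\<Sum>i<Suc n. d i) + t)) (fl (phs u (Suc n)) (vs (phs u (Suc n))) x)"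
   by (rule infdist_le[OF Gam_in[OF x(1,2)]])
  also have "... <= KD (phs u (Suc n)) * norm (w (Suc n) - vs (phs u (Suc n)))" using x(3) y(5)[OF t] by (simp add: dist_norm)
  also have "... <= max (KD True) (KD False) * norm (w (Suc n) - vs (phs u (Suc n)))"
   by (intro mult_right_mono) (cases "phs u (Suc n)"; simp)+
  also have "... <= \<bar>max (KD True) (KD False)\<bar> * (Ks * D n)"
  proof (rule mult_mono)
   show "norm (w (Suc n) - vs (phs u (Suc n))) <= Ks * D n"
    using sw_norm[of "zp (w (Suc n))" "zp (vs (phs u (Suc n)))"] sw_zp[OF wh[of n]] sw_zp[OF vs(2)] by (simp add: D_def)
  qed auto
  also have "... = \<bar>K\<bar> * D n" using Ks by (simp add: K_def abs_mult)
  also have "... <= \<bar>K\<bar> * ((1/2)^n * D 0)" by (rule mult_left_mono[OF Dn]) simp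
  finally show ?thesis .
 qed
 have "((%t. infdist (y t) Gam) \<longlongrightarrow> 0) at_top"
  unfolding tendsto_iff eventually_at_top_linorder
 proof (intro allI impI)
  fix r :: real assume r: "r > 0"
  have "(%n. \<bar>K\<bar> * ((1/2)^n * D 0)) \<longlonglongrightarrow> \<bar>K\<bar> * (0 * D 0)" by (intro tendsto_intros LIMSEQ_power_zero) auto
  hence "\<forall>\<^sub>F n in sequentially. \<bar>K\<bar> * ((1/2)^n * D 0) < r" using order_tendstoD(2)[of _ "\<bar>K\<bar> * (0 * D 0)" sequentially r] r by simp
  then obtain N where N: "\<And>n. n >= N ==> \<bar>K\<bar> * ((1/2)^n * D 0) < r" unfolding eventually_sequentially by blast
  have "dist (infdist (y t) Gam) 0 < r" if t: "t >= (\<Sum>i<Suc (Suc N). d i)" for t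
  proof -
   have S0: "(\<Sum>i<m. d i) >= 0" for m by (intro sum_nonneg) (use dp less_imp_le in blast)
   have "t >= 0" using S0[of "Suc (Suc N)"] t by linarith
   then obtain n x where x: "t = (\<Sum>i<n. d i) + x" "0 <= x" "x <= d n" using y(6) by blast
   have "n >= Suc N"
   proof (rule ccontr)
    assume "\<not> n >= Suc N"
    hence "(\<Sum>i<Suc n. d i) <= (\<Sum>i<Suc N. d i)" using dp by (intro sum_mono2) (auto simp: less_imp_le)
    moreover have "t <= (\<Sum>i<Suc n. d i)" using x by simp
    ultimately show False using t dp[of "Suc N"] by simp
   qed
   then obtain m where m: "n = Suc m" "m >= N" by (cases n) auto
   have "infdist (y t) Gam <= \<bar>K\<bar> * ((1/2)^m * D 0)" using close[of x m] x m(1) by (simp del: sum.lessThan_Suc)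
   thus ?thesis using N[OF m(2)] infdist_nonneg[of "y t" Gam] by (simp add: dist_real_def)
  qed
  thus "\<exists>M. \<forall>t\<ge>M. dist (infdist (y t) Gam) 0 < r" by blast
 qed
 thus ?thesis unfolding good_def using y(1-4) sb by blast
qed

lemma good_flow:
 assumes y: "ode (fld4 (ta u) (be u) e) y" and T: "T >= 0"
  and pos: "\<And>t. 0 <= t ==> t < T ==> HH u (y t) > 0" and en: "HH u (y T) >= 0"
  and ps: "\<And>t. 0 <= t ==> t < T ==> y t \<in> phase_space" and g: "good sb (y T)"
 shows "good sb (y 0)"
proof -
 obtain z where z: "z 0 = y T" "gsol e {0..} z" "\<And>t. t >= 0 ==> z t \<in> phase_space & (sb --> strict e (z t))"
   "((%t. infdist (z t) Gam) \<longlongrightarrow> 0) at_top"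
  using g unfolding good_def by blast
 define x where "x t = (if t <= T then y t else z (t - T))" for t
 have xT: "x t = z (t - T)" if "t >= T" for t using that z(1) by (auto simp: x_def)
 have "gsol e {0..T} y"
 proof (rule flow_gsol[OF y])
  show "HH u (y t) >= 0" if "t \<in> {0..T}" for t using pos[of t] en that by (cases "t = T") (auto simp: less_imp_le)
 qed auto
 hence g1: "gsol e {0..T} x" by (rule gsol_cong) (auto simp: x_def)
 have "gsol e {T..} (%t. z (t + (- T)))" by (rule gsol_shift[OF z(2)]) auto
 hence g2: "gsol e {T..} x" by (rule gsol_cong) (auto simp: xT)
 have "gsol e ({0..T} \<union> {T..}) x" by (rule gsol_Un[OF g1 g2]) (use T in auto)
 hence gx: "gsol e {0..} x" by (rule gsol_subset) auto
 have px: "x t \<in> phase_space & (sb --> strict e (x t))" if t: "t >= 0" for t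
 proof (cases "t < T")
  case True
  hence "HH u (y t) > 0" using pos t by simp
  hence "strict e (y t)" by (auto simp: strict_def HH_def split: if_splits)
  thus ?thesis using True ps t by (simp add: x_def)
 next
  case False
  thus ?thesis using xT[of t] z(3)[of "t - T"] by simp
 qed
 have "((%t. infdist (z (t - T)) Gam) \<longlongrightarrow> 0) at_top"
 proof (rule filterlim_compose[OF z(4)])
  have "filterlim (%t. - T + t) at_top at_top" by (rule filterlim_tendsto_add_at_top[OF tendsto_const filterlim_ident])
  thus "filterlim (%t. t - T) at_top at_top" by simp
 qed
 moreover have "\<forall>\<^sub>F t in at_top. infdist (z (t - T)) Gam = infdist (x t) Gam"
  unfolding eventually_at_top_linorder using xT by (intro exI[of _ T]) auto
 ultimately have "((%t. infdist (x t) Gam) \<longlongrightarrow> 0) at_top" by (rule Lim_transform_eventually)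
 moreover have "x 0 = y 0" using T by (simp add: x_def)
 ultimately show ?thesis unfolding good_def using gx px by blast
qed

text \<open>The phase ends inside the box of its node, and the end point is an admissible start of
  the next phase. Strictness there needs the finer scale \<open>mu u * e\<close>.\<close>

lemma good_late:
 assumes n: "nearv u d (zp v) (QQ u)" and d: "0 <= d" "d <= R1 u" "VM u * d <= dd" and H: "HH u v > 0" and p: "v \<in> phase_space"
  and sb: "sb ==> VM u * d <= mu u * e"
 shows "good sb v"
proof -
 obtain T where T: "T > 0" "HH u (fl u v T) = 0" "\<And>t. 0 <= t ==> t < T ==> HH u (fl u v t) > 0"
  "\<And>t. 0 <= t ==> nearv u d (zp (fl u v t)) (QQ u)"
  using phase_ends_late[OF fl(2)[of u v] e(1) e1 d(1,2)] n H by (auto simp: fl(1))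
 have inr: "inreg (zp (fl u v t))" if "t >= 0" for t by (rule nearv_inreg[OF T(4)[OF that] d(2)])
 have H0: "HH u (fl u v t) >= 0" if "0 <= t" "t <= T" for t using T(2) T(3)[of t] that by (cases "t = T") (auto simp: less_imp_le)
 have x: "\<bar>Xc (fl u v t)\<bar> <= 1" if t: "0 <= t" "t <= T" for t
 proof (rule Xc_range[OF fl(2) e(1) t(1)])
  show "\<bar>Xc (fl u v 0)\<bar> <= 1" using p by (auto simp: fl(1) phase_iff)
  show "0 < Nc (zp (fl u v s)) & Nc (zp (fl u v s)) < 1" if "0 <= s" for s using inreg_bounds[OF inr[OF that]] .
  show "HH u (fl u v s) >= 0" if "0 <= s" "s <= t" for s using H0 that t by simp
 qed
 define v' where "v' = fl u v T"
 have h: "hh v' = 0" using T(2) by (auto simp: v'_def HH_def split: if_splits)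
 have nn: "norm (zp v' - QQ u) <= VM u * d" unfolding v'_def by (rule nearv_norm[OF T(4)]) (use T in simp)
 have xv: "\<bar>Xc v'\<bar> <= 1" using x[of T] T(1) by (simp add: v'_def)
 have g: "good sb v'"
 proof (rule good_start)
  show "st (\<not> u) v'" using nn d(3) xv h by (simp add: st_def HH_def)
  show "strict e v'" if sb using that by (intro strict_node[OF order_trans[OF nn sb] order_trans[OF nn d(3)] h xv])
 qed
 have "good sb (fl u v 0)"
  by (rule good_flow[OF fl(2) less_imp_le[OF T(1)] T(3) _ _ g[unfolded v'_def]])
   (use T(2) inreg_phase inr x in auto)
 thus ?thesis by (simp add: fl(1))
qed

text \<open>Either the state belongs to the closed region of the other phase and starts it, or the
  present phase is about to end near its node.\<close>

lemma good_near:
 assumes n: "norm (zp v - QQ u) < Vm u * rr u" and p: "v \<in> phase_space"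
 shows "good True v"
proof (cases "HH (\<not> u) v >= 0")
 case True
 have x: "\<bar>Xc v\<bar> <= 1" using p by (auto simp: phase_iff)
 show ?thesis
 proof (rule good_start)
  show "st (\<not> u) v" using True x n rr(6)[of u] by (simp add: st_def)
  show "strict e v"
  proof (cases "hh v = 0")
   case True
   show ?thesis by (rule strict_node[of v u, OF _ _ True x]) (use n rr(6,7)[of u] in auto)
  qed (simp add: strict_def)
 qed
next
 case False
 hence H: "HH u v > 0" by (auto simp: HH_def split: if_splits)
 have "nearv u (rr u) (zp v) (QQ u)" by (rule norm_nearv) (use n rr(1)[of u] in auto)
 from good_late[OF this _ _ _ H p] show ?thesis using rr(1-4)[of u] by auto
qed

text \<open>At both ends of the arc the fast variables are near a node. In between, a compact piece
  of the arc has an open tube inside the region of the phase, and nearby orbits follow it into the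
  neighbourhood of the far end.\<close>

lemma arc_good:
 assumes t: "0 <= t" "t <= TT u (vs u)"
 shows "\<exists>\<rho>>0. \<forall>v\<in>phase_space. norm (v - fl u (vs u) t) < \<rho> --> good True v"
proof -
 have at: "\<exists>\<rho>>0. \<forall>v\<in>phase_space. norm (v - g) < \<rho> --> good True v" if g: "norm (zp g - QQ u) <= mu u * e * e" for g u
 proof (intro exI[of _ "Vm u * rr u - mu u * e * e"] conjI ballI impI)
  show "Vm u * rr u - mu u * e * e > 0" using rr(5)[of u] by simp
  fix v assume v: "v \<in> phase_space" "norm (v - g) < Vm u * rr u - mu u * e * e"
  have "norm (zp v - QQ u) <= norm (zp v - zp g) + norm (zp g - QQ u)"
   using norm_triangle_ineq[of "zp v - zp g" "zp g - QQ u"] by simp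
  moreover have "norm (zp v - zp g) <= norm (v - g)" unfolding zp_diff by (rule norm_zp_le)
  ultimately show "good True v" by (intro good_near[of v u, OF _ v(1)]) (use v(2) g in linarith)
 qed
 note S = fl_start[OF vs(1)[of u]]
 consider "t = 0" | "t >= cc u / e" | "0 < t" "t < cc u / e" using t by linarith
 thus ?thesis
 proof cases
  case 1
  show ?thesis unfolding 1 fl(1) by (rule at[OF vs(4)])
 next
  case 2
  show ?thesis by (rule at[OF hc2[OF S 2]])
 next
  case 3
  define s where "s = cc u / e"
  have s: "t < s" "s < TT u (vs u)" using 3 TT(1)[OF vs(1)] by (simp_all add: s_def)
  define A where "A = fl u (vs u) ` {t..s}"
  define O' where "O' = {v. HH u v > 0 & inreg (zp v)}"
  have cz: "continuous_on UNIV zp" by (rule linear_continuous_on[OF bounded_linear_zp])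
  have oO: "open O'" unfolding O'_def inreg_def HH_sg
   by (intro open_Collect_conj open_Collect_less continuous_intros cz hh_continuous)
  have cA: "compact A" unfolding A_def
   by (intro compact_continuous_image continuous_on_subset[OF ode_continuous[OF fl(2)]]) (use 3 in auto)
  have "fl u (vs u) x \<in> O'" if "t <= x" "x <= s" for x
   unfolding O'_def using TT(4)[OF vs(1), of x u] hc3[OF S, of x] that s 3 by simp
  hence "A \<subseteq> O'" by (auto simp: A_def)
  then obtain r0 where r0: "r0 > 0" "(\<Union>x\<in>A. ball x r0) \<subseteq> O'"
   using compact_subset_open_imp_ball_epsilon_subset[OF cA oO] by metis
  obtain r1 where r1: "r1 > 0" "\<forall>v\<in>phase_space. norm (v - fl u (vs u) s) < r1 --> good True v"
   using at[OF hc2[OF S, of s]] by (auto simp: s_def)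
  obtain L where L: "L > 0" "L-lipschitz_on UNIV (fld4 (ta u) (be u) e)" using fld4_lipschitz by blast
  \<comment> \<open>Orbits separate at most by the factor \<open>exp (L * s)\<close> up to the time
    \<open>s\<close>, so they stay in the tube and end within \<open>r1\<close> of the arc.\<close>
  define \<rho> where "\<rho> = min r0 r1 / exp (L * s)"
  have \<rho>: "\<rho> > 0" "exp (L * s) * \<rho> = min r0 r1" using r0 r1 by (simp_all add: \<rho>_def)
  have "good True v" if v: "v \<in> phase_space" "norm (v - fl u (vs u) t) < \<rho>" for v
  proof -
   have dist: "norm (fl u v x - fl u (vs u) (t + x)) < min r0 r1" if x: "0 <= x" "x <= s - t" for x
   proof -
    have "norm (fl u v x - fl u (vs u) (t + x)) <= exp (L * x) * norm (v - fl u (vs u) t)"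
     using ode_dist_le[OF L(2) fl(2)[of u v] ode_shift[OF fl(2)[of u "vs u"] t(1)] x(1)] by (simp add: fl(1))
    also have "... <= exp (L * s) * norm (v - fl u (vs u) t)" using x L 3 by (intro mult_right_mono) auto
    also have "... < exp (L * s) * \<rho>" using v(2) by simp
    finally show ?thesis using \<rho> by simp
   qed
   have inO: "fl u v x \<in> O'" if x: "0 <= x" "x <= s - t" for x
   proof -
    have "fl u (vs u) (t + x) \<in> A" unfolding A_def using x by auto
    moreover have "fl u v x \<in> ball (fl u (vs u) (t + x)) r0" using dist[OF x] by (simp add: dist_norm norm_minus_commute)
    ultimately show ?thesis using r0(2) by blast
   qed
   have ps: "fl u v x \<in> phase_space" if x: "0 <= x" "x <= s - t" for x
   proof (rule inreg_phase)
    show "inreg (zp (fl u v x))" using inO[OF x] by (simp add: O'_def)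
    show "\<bar>Xc (fl u v x)\<bar> <= 1"
    proof (rule Xc_range[OF fl(2) e(1) x(1)])
     show "\<bar>Xc (fl u v 0)\<bar> <= 1" using v(1) by (auto simp: fl(1) phase_iff)
     show "0 < Nc (zp (fl u v w)) & Nc (zp (fl u v w)) < 1" "HH u (fl u v w) >= 0" if "0 <= w" "w <= x" for w
      using inO[of w] that x inreg_bounds by (auto simp: O'_def)
    qed
   qed
   have "good True (fl u v 0)"
   proof (rule good_flow[OF fl(2)])
    show "0 <= s - t" using s by simp
    show "good True (fl u v (s - t))" using r1(2) ps[of "s - t"] dist[of "s - t"] s by simp
    show "HH u (fl u v x) > 0" if "0 <= x" "x < s - t" for x using inO[of x] that by (simp add: O'_def)
    show "HH u (fl u v (s - t)) >= 0" using inO[of "s - t"] s by (simp add: O'_def)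
   qed (use ps in auto)
   thus ?thesis by (simp add: fl(1))
  qed
  thus ?thesis using \<rho>(1) by blast
 qed
qed

text \<open>A strict solution from each nearby point converges to \<open>Gam\<close>. Strictness
  makes it unique, so every given solution from that point is a piece of it.\<close>

theorem Gam_attracting: "attracting_limit_cycle (incl e) phase_space Gam"
 unfolding attracting_limit_cycle_def
proof
 show "\<exists>x. filippov_solution (incl e) phase_space UNIV x & (\<exists>T>0. \<forall>t. x (t + T) = x t) & (\<exists>t. x t \<noteq> x 0) & Gam = range x"
  by (rule Gam_periodic) (unfold filippov_gsol, blast)
 define U where "U = \<Union>{ball g \<rho> | g \<rho>. g \<in> Gam & \<rho> > 0 & (\<forall>v\<in>phase_space. norm (v - g) < \<rho> --> good True v)}"
 have "open U" unfolding U_def by auto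
 moreover have "Gam \<subseteq> U"
 proof
  fix g assume g: "g \<in> Gam"
  then obtain u t where "g = fl u (vs u) t" "0 <= t" "t <= TT u (vs u)" by (auto simp: Gam_def)
  then obtain \<rho> where "\<rho> > 0" "\<forall>v\<in>phase_space. norm (v - g) < \<rho> --> good True v" using arc_good by blast
  thus "g \<in> U" unfolding U_def using g by (intro UnionI[of "ball g \<rho>"]) auto
 qed
 moreover have "\<exists>y. filippov_solution (incl e) phase_space {0..} y & (\<forall>t\<in>J. y t = x t) & ((%t. infdist (y t) Gam) \<longlongrightarrow> 0) at_top"
  if J: "is_interval J & 0 \<in> J & J \<subseteq> {0..} & filippov_solution (incl e) phase_space J x & x 0 \<in> U" for J x
 proof -
  have x: "gsol e J x" "\<And>t. t \<in> J ==> x t \<in> phase_space" using J unfolding filippov_gsol by auto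
  have "x 0 \<in> U" "x 0 \<in> phase_space" using J x(2) by auto
  hence "good True (x 0)" unfolding U_def by (auto simp: dist_norm norm_minus_commute)
  then obtain y where y: "y 0 = x 0" "gsol e {0..} y" "\<And>t. t >= 0 ==> y t \<in> phase_space" "\<And>t. t >= 0 ==> strict e (y t)"
   "((%t. infdist (y t) Gam) \<longlongrightarrow> 0) at_top" unfolding good_def by blast
  have "y t = x t" if t: "t \<in> J" for t
  proof -
   have t0: "t >= 0" using J t by auto
   have sub: "{0..t} \<subseteq> J" using J t unfolding is_interval_1 by fastforce
   show ?thesis
    by (rule gsol_unique[OF gsol_subset[OF x(1) sub] gsol_subset[OF y(2)], symmetric, of t]) (use y(1,4) t0 in auto)
  qed
  moreover have "filippov_solution (incl e) phase_space {0..} y" unfolding filippov_gsol using y(2,3) by auto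
  ultimately show ?thesis using y(5) by blast
 qed
 ultimately show "attracts (incl e) phase_space Gam" unfolding attracts_def by blast
qed

end

section \<open>Competing cycles\<close>

lemma periodic_range:
 fixes f :: "real => 'a"
 assumes P: "P > 0" "\<And>t. f (t + P) = f t"
 shows "range f = (%t. f (c + t)) ` {0..P}"
proof
 have 1: "f (t + P * of_nat n) = f t" for t n
 proof (induction n)
  case (Suc n)
  have "f (t + P * of_nat (Suc n)) = f ((t + P * of_nat n) + P)" by (simp add: algebra_simps)
  thus ?case using P(2) Suc by simp
 qed simp
 have 2: "f (t + P * of_int n) = f t" for t n
 proof (cases "n >= 0")
  case True
  thus ?thesis using 1[of t "nat n"] by simp
 next
  case False
  thus ?thesis using 1[of "t + P * of_int n" "nat (- n)"] by (simp add: algebra_simps)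
 qed
 show "range f \<subseteq> (%t. f (c + t)) ` {0..P}"
 proof
  fix v assume "v \<in> range f"
  then obtain t where t: "v = f t" by auto
  define m where "m = \<lfloor>(t - c) / P\<rfloor>"
  have "of_int m <= (t - c) / P" "(t - c) / P < of_int m + 1" unfolding m_def by linarith+
  hence "P * of_int m <= t - c" "t - c < P * of_int m + P" using P(1) by (simp_all add: field_simps)
  moreover have "f (c + (t - c - P * of_int m)) = v" using 2[of t "- m"] t by simp
  ultimately show "v \<in> (%t. f (c + t)) ` {0..P}" by (intro image_eqI[of _ _ "t - c - P * of_int m"]) auto
 qed
qed auto

lemma compact_limit_common:
 fixes A C :: "'a::heine_borel set"
 assumes A: "compact A" "A \<noteq> {}" and C: "compact C" "C \<noteq> {}"
  and l: "((%t. infdist (w t) A) \<longlongrightarrow> 0) at_top" "((%t. infdist (w t) C) \<longlongrightarrow> 0) (at_top :: real filter)"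
 shows "A \<inter> C \<noteq> {}"
proof
 assume "A \<inter> C = {}"
 then obtain m where m: "m > 0" "\<forall>x\<in>A. \<forall>y\<in>C. m <= dist x y"
  using separate_compact_closed[OF A(1) compact_imp_closed[OF C(1)]] by blast
 have "\<forall>\<^sub>F t in at_top. infdist (w t) A < m / 2 & infdist (w t) C < m / 2"
  using order_tendstoD(2)[OF l(1), of "m / 2"] order_tendstoD(2)[OF l(2), of "m / 2"] m(1) by (intro eventually_conj) auto
 then obtain t where t: "infdist (w t) A < m / 2" "infdist (w t) C < m / 2" unfolding eventually_at_top_linorder by blast
 obtain x where x: "x \<in> A" "infdist (w t) A = dist (w t) x" using infdist_attains_inf[OF compact_imp_closed[OF A(1)] A(2)] by metis
 obtain y where y: "y \<in> C" "infdist (w t) C = dist (w t) y" using infdist_attains_inf[OF compact_imp_closed[OF C(1)] C(2)] by metis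
 have "dist x y < m" using dist_triangle2[of x y "w t"] x y t by (simp add: dist_commute)
 thus False using m(2) x y by force
qed

context climate_nodes begin

definition per :: "real => (real => state4) => bool" where
 "per e x \<longleftrightarrow> gsol e UNIV x & (\<forall>t. x t \<in> phase_space) & (\<exists>P>0. \<forall>t. x (t + P) = x t)"

definition bas :: "(bool => real) => state4 => bool" where
 "bas d v \<longleftrightarrow> v \<in> phase_space & (\<exists>u. nearv u (d u) (zp v) (QQ u) & HH u v > 0)"

text \<open>What is known about a limit cycle different from the one constructed above: no solution
 starting near it reaches the set \<open>bas d\<close>, whose points are attracted by the latter.\<close>

definition trap :: "(bool => real) => real => (real => state4) => bool" where
 "trap d e x \<longleftrightarrow> per e x & (\<exists>U. open U & range x \<subseteq> U &
   (\<forall>v\<in>U \<inter> phase_space. \<exists>y. y 0 = v & gsol e {0..} y & (\<forall>t\<ge>0. y t \<in> phase_space)) &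
   (\<forall>y T. T >= 0 --> gsol e {0..T} y --> (\<forall>t\<in>{0..T}. y t \<in> phase_space) --> y 0 \<in> U --> \<not> bas d (y T)))"

text \<open>The constants are chosen before \<open>e\<close>. In particular \<open>dd\<close> fixes
  the sizes of the boxes in \<open>bas\<close> independently of \<open>e\<close>, as the exclusion
  of other cycles requires.\<close>

lemma cycle_params:
 obtains dd cc CC where "dd > 0" "\<forall>\<^sub>F e in at_right 0. climate_cycle B r \<kappa> k q F0 G0 a b bm bp dl Qp Qm e dd cc CC"
proof -
 define HP where "HP u \<delta> c C e0 \<longleftrightarrow> \<delta> > 0 & c > 0 & C >= 1 & e0 > 0 &
  (\<forall>e y t. 0 < e --> e < e0 --> start u \<delta> e y --> 0 < t --> t <= c / e --> HH u (y t) > 0) &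
  (\<forall>e y t. 0 < e --> e < e0 --> start u \<delta> e y --> t >= c / e --> C * norm (zp (y t) - QQ u) <= mu u * e * e) &
  (\<forall>e y t. start u \<delta> e y --> t >= 0 --> inreg (zp (y t))) &
  (\<forall>e y y' t. start u \<delta> e y --> start u \<delta> e y' --> t >= 0 --> norm (zp (y t) - zp (y' t)) <= C * norm (zp (y 0) - zp (y' 0))) &
  (\<forall>e y y' t. 0 < e --> e < e0 --> start u \<delta> e y --> start u \<delta> e y' --> t >= c / e --> norm (zp (y t) - zp (y' t)) <= norm (zp (y 0) - zp (y' 0)) / 4)"
  for u \<delta> c C e0
 have "\<exists>\<delta> c C e0. HP u \<delta> c C e0" for u unfolding HP_def by (rule half_cycle[of u]) blast
 then obtain \<delta> c C e0 where hp: "\<And>u. HP u (\<delta> u) (c u) (C u) (e0 u)" by metis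
 note h0 = hp[unfolded HP_def]
 note h = h0[THEN conjunct1] h0[THEN conjunct2, THEN conjunct1] h0[THEN conjunct2, THEN conjunct2, THEN conjunct1]
  h0[THEN conjunct2, THEN conjunct2, THEN conjunct2, THEN conjunct1]
 note H = h0[THEN conjunct2, THEN conjunct2, THEN conjunct2, THEN conjunct2]
 note H1 = H[THEN conjunct1, rule_format] and H2 = H[THEN conjunct2, THEN conjunct1, rule_format]
  and H3 = H[THEN conjunct2, THEN conjunct2, THEN conjunct1, rule_format]
  and H4 = H[THEN conjunct2, THEN conjunct2, THEN conjunct2, THEN conjunct1, rule_format]
  and H5 = H[THEN conjunct2, THEN conjunct2, THEN conjunct2, THEN conjunct2, rule_format]
 define dd where "dd = min (min (\<delta> True) (\<delta> False)) (min (Vm True * R1 True) (Vm False * R1 False))"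
 have dd: "dd > 0" "dd <= \<delta> u" "dd <= Vm u * R1 u" for u
  using h(1)[of True] h(1)[of False] Vm[of True] Vm[of False] R1[of True] R1[of False] by (cases u; simp add: dd_def)+
 have st: "start u dd e y ==> start u (\<delta> u) e y" for u e y using dd(2)[of u] by (auto simp: start_def)
 define Kc where "Kc u = Lf * mu u * ((a + b) * C u + b * (1 + (a + b) / b + (be u + a) / be u * C u)) * (1 + (a + b) / b)" for u
 have small: "\<forall>\<^sub>F e in at_right 0. f e < m" if "(f \<longlongrightarrow> 0) (at_right 0)" "m > 0" for f :: "real => real" and m
  using order_tendstoD(2)[OF that] .
 have t0: "((%e. K * e) \<longlongrightarrow> 0) (at_right 0)" "((%e. K * e * e) \<longlongrightarrow> 0) (at_right 0)" for K :: real
 proof -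
  have "((%e. K * e) \<longlongrightarrow> K * 0) (at_right 0)" "((%e. K * e * e) \<longlongrightarrow> K * 0 * 0) (at_right 0)" by (intro tendsto_intros)+
  thus "((%e. K * e) \<longlongrightarrow> 0) (at_right 0)" "((%e. K * e * e) \<longlongrightarrow> 0) (at_right 0)" by simp_all
 qed
 have ev: "\<forall>\<^sub>F e in at_right 0. 0 < e & e < 1 & e < egap & e < e0 u & mu u * e * e < Vm u * R1 u & 1 * e < Vm u / VM u &
   mu u * e * e < Vm u * dd / VM u & Kc u * e < cr u / 4" for u
 proof (intro eventually_conj)
  have t1: "((%e. e) \<longlongrightarrow> 0) (at_right (0::real))" "((%e. 1 * e) \<longlongrightarrow> 0) (at_right (0::real))" using t0(1)[of 1] by simp_all
  show "\<forall>\<^sub>F e in at_right 0. 0 < (e::real)" by (rule eventually_at_right_less)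
  show "\<forall>\<^sub>F e in at_right 0. e < (1::real)" by (rule small[OF t1(1)]) simp
  show "\<forall>\<^sub>F e in at_right 0. e < egap" by (rule small[OF t1(1) egap_pos])
  show "\<forall>\<^sub>F e in at_right 0. e < e0 u" by (rule small[OF t1(1)]) (use h(4) in blast)
  show "\<forall>\<^sub>F e in at_right 0. mu u * e * e < Vm u * R1 u" by (rule small[OF t0(2)]) (use Vm R1 in simp)
  show "\<forall>\<^sub>F e in at_right 0. 1 * e < Vm u / VM u" by (rule small[OF t1(2)]) (use Vm[of u] VM[of u] in simp)
  show "\<forall>\<^sub>F e in at_right 0. mu u * e * e < Vm u * dd / VM u" by (rule small[OF t0(2)]) (use Vm[of u] VM[of u] dd(1) in simp)
  show "\<forall>\<^sub>F e in at_right 0. Kc u * e < cr u / 4" by (rule small[OF t0(1)]) (use cr in simp)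
 qed
 have "\<forall>\<^sub>F e in at_right 0. climate_cycle B r \<kappa> k q F0 G0 a b bm bp dl Qp Qm e dd c C"
  using ev[of True] ev[of False]
 proof eventually_elim
  case (elim e)
  have E: "0 < e" "e < 1" "e < egap" "e < e0 u" "mu u * e * e < Vm u * R1 u" "e < Vm u / VM u"
   "mu u * e * e < Vm u * dd / VM u" "Kc u * e < cr u / 4" for u
   using elim by (cases u; simp)+
  show ?case
  proof unfold_locales
   show "mu u * e * e < Vm u * min (R1 u) (min (mu u * e / VM u) (dd / VM u))" for u
   proof -
    have "mu u * e * e < mu u * e * (Vm u / VM u)" using E(1) E(6)[of u] mu[of u] by (intro mult_strict_left_mono) auto
    hence "mu u * e * e < Vm u * (mu u * e / VM u)" by (simp add: mult_ac)
    moreover have "mu u * e * e < Vm u * (dd / VM u)" using E(7)[of u] by simp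
    ultimately show ?thesis using E(5)[of u] by (simp add: min_def)
   qed
   show "Lf * mu u * e * ((a + b) * C u + b * (1 + (a + b) / b + (be u + a) / be u * C u)) * (1 + (a + b) / b) <= cr u / 4" for u
    using E(8)[of u] unfolding Kc_def by (simp add: mult_ac)
   show "norm (zp (y t) - QQ u) <= mu u * e * e" if "start u dd e y" "c u / e <= t" for u y t
   proof -
    have "1 * norm (zp (y t) - QQ u) <= C u * norm (zp (y t) - QQ u)" using h(3)[of u] by (intro mult_right_mono) auto
    also have "... <= mu u * e * e" by (rule H2[OF E(1,4) st[OF that(1)] that(2)])
    finally show ?thesis by simp
   qed
   show "0 < HH u (y t)" if "start u dd e y" "0 < t" "t <= c u / e" for u y t
    by (rule H1[OF E(1,4) st[OF that(1)] that(2,3)])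
   show "inreg (zp (y t))" if "start u dd e y" "0 <= t" for u y t
    by (rule H3[OF st[OF that(1)] that(2)])
   show "norm (zp (y t) - zp (y' t)) <= C u * norm (zp (y 0) - zp (y' 0))" if "start u dd e y" "start u dd e y'" "0 <= t" for u y y' t
    by (rule H4[OF st[OF that(1)] st[OF that(2)] that(3)])
   show "norm (zp (y t) - zp (y' t)) <= norm (zp (y 0) - zp (y' 0)) / 4" if "start u dd e y" "start u dd e y'" "c u / e <= t" for u y y' t
    by (rule H5[OF E(1,4) st[OF that(1)] st[OF that(2)] that(3)])
  qed (rule E(1) E(2) E(3) dd(1) dd(3) h(2) h(3))+
 qed
 thus ?thesis by (rule that[OF dd(1)])
qed

end

context climate_cycle begin

text \<open>The single time is itself a null set, so any state will do; fed into the definition of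
  attraction, this yields existence of global solutions.\<close>

lemma gsol_point: "gsol e {0} (%_. v)"
 unfolding gsol_def by (auto intro: exI[of _ "{0}"])

text \<open>A solution from near \<open>G\<close> that reached \<open>bas\<close> could be continued
  towards \<open>Gam\<close>, hence approach both compact cycles, which therefore meet. Solutions on
  \<open>Gam\<close> are unique forwards, so the two cycles would coincide.\<close>

lemma trap_if_other:
 assumes lc: "attracting_limit_cycle (incl e) phase_space G" and ne: "G \<noteq> Gam"
 shows "\<exists>x. trap (%u. min (R1 u) (dd / VM u)) e x"
proof -
 obtain x P where x: "filippov_solution (incl e) phase_space UNIV x" "P > 0" "\<And>t. x (t + P) = x t" "G = range x"
  using lc unfolding attracting_limit_cycle_def by blast
 have gx: "gsol e UNIV x" "\<And>t. x t \<in> phase_space" using x(1) unfolding filippov_gsol by auto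
 have "attracts (incl e) phase_space G" using lc by (simp add: attracting_limit_cycle_def)
 then obtain U where U0: "open U & G \<subseteq> U & (\<forall>J x. is_interval J & 0 \<in> J & J \<subseteq> {0..} & filippov_solution (incl e) phase_space J x & x 0 \<in> U -->
     (\<exists>y. filippov_solution (incl e) phase_space {0..} y & (\<forall>t\<in>J. y t = x t) & ((%t. infdist (y t) G) \<longlongrightarrow> 0) at_top))"
  unfolding attracts_def by (rule exE)
 have U: "open U" "G \<subseteq> U" using U0 by simp_all
 have U3: "\<exists>y. gsol e {0..} y & (\<forall>t\<in>{0..}. y t \<in> phase_space) & (\<forall>t\<in>J. y t = x t) & ((%t. infdist (y t) G) \<longlongrightarrow> 0) at_top"
  if "is_interval J" "0 \<in> J" "J \<subseteq> {0..}" "gsol e J x" "\<forall>t\<in>J. x t \<in> phase_space" "x 0 \<in> U" for J x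
 proof -
  have "filippov_solution (incl e) phase_space J x" using that(4,5) unfolding filippov_gsol by (rule conjI)
  from U0[THEN conjunct2, THEN conjunct2, rule_format, of J x] that(1-3,6) this
  show ?thesis unfolding filippov_gsol by simp
 qed
 have ex: "\<exists>y. y 0 = v & gsol e {0..} y & (\<forall>t\<ge>0. y t \<in> phase_space)" if v: "v \<in> U \<inter> phase_space" for v
  using U3[of "{0}" "%_. v"] gsol_point v by (auto simp: is_interval_1)
 have no: "\<not> bas (%u. min (R1 u) (dd / VM u)) (y T)"
  if T: "T >= 0" and y: "gsol e {0..T} y" "\<forall>t\<in>{0..T}. y t \<in> phase_space" "y 0 \<in> U" for y T
 proof
  assume "bas (%u. min (R1 u) (dd / VM u)) (y T)"
  then obtain u where u: "nearv u (min (R1 u) (dd / VM u)) (zp (y T)) (QQ u)" "HH u (y T) > 0" "y T \<in> phase_space"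
   by (auto simp: bas_def)
  have v1: "VM u \<noteq> 0" "VM u >= 0" using VM[of u] by auto
  have "VM u * min (R1 u) (dd / VM u) <= VM u * (dd / VM u)" by (rule mult_left_mono[OF min.cobounded2 v1(2)])
  also have "... = dd" using v1 by simp
  finally have vd: "VM u * min (R1 u) (dd / VM u) <= dd" .
  have "0 <= min (R1 u) (dd / VM u)" using R1[of u] dd(1) v1 by simp
  hence "good False (y T)" by (rule good_late[OF u(1) _ min.cobounded1 vd u(2,3)]) simp
  then obtain z where z: "z 0 = y T" "gsol e {0..} z" "\<And>t. t >= 0 ==> z t \<in> phase_space" "((%t. infdist (z t) Gam) \<longlongrightarrow> 0) at_top"
   unfolding good_def by blast
  \<comment> \<open>The given solution up to \<open>T\<close>, followed by one that approaches
    \<open>Gam\<close>; as it starts in \<open>U\<close>, it must also approach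
    \<open>G\<close>.\<close>
  define w where "w t = (if t <= T then y t else z (t - T))" for t
  have wT: "w t = z (t - T)" if "t >= T" for t using that z(1) by (auto simp: w_def)
  have g1: "gsol e {0..T} w" by (rule gsol_cong[OF y(1)]) (auto simp: w_def is_interval_1)
  have "gsol e {T..} (%t. z (t + (- T)))" by (rule gsol_shift[OF z(2)]) auto
  hence g2: "gsol e {T..} w" by (rule gsol_cong) (auto simp: wT is_interval_1)
  have "gsol e ({0..T} \<union> {T..}) w" by (rule gsol_Un[OF g1 g2]) (use T in \<open>auto simp: is_interval_1\<close>)
  hence gw: "gsol e {0..} w" by (rule gsol_subset) auto
  have pw: "\<forall>t\<in>{0..}. w t \<in> phase_space" using y(2) z(3) by (auto simp: w_def)
  have "w 0 \<in> U" using y(3) T by (simp add: w_def)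
  then obtain y' where y': "\<forall>t\<in>{0..}. y' t = w t" "((%t. infdist (y' t) G) \<longlongrightarrow> 0) at_top"
   using U3[OF _ _ _ gw pw] by (auto simp: is_interval_1)
  have lim1: "((%t. infdist (w t) G) \<longlongrightarrow> 0) at_top"
   by (rule Lim_transform_eventually[OF y'(2)]) (use y'(1) in \<open>auto simp: eventually_at_top_linorder intro!: exI[of _ 0]\<close>)
  have lim2: "((%t. infdist (w t) Gam) \<longlongrightarrow> 0) at_top"
  proof (rule Lim_transform_eventually)
   have "filterlim (%t. - T + t) at_top at_top" by (rule filterlim_tendsto_add_at_top[OF tendsto_const filterlim_ident])
   hence "filterlim (%t. t - T) at_top at_top" by simp
   thus "((%t. infdist (z (t - T)) Gam) \<longlongrightarrow> 0) at_top" by (rule filterlim_compose[OF z(4)])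
   show "\<forall>\<^sub>F t in at_top. infdist (z (t - T)) Gam = infdist (w t) Gam"
    unfolding eventually_at_top_linorder using wT by (intro exI[of _ T]) auto
  qed
  note lim = lim1 lim2
  obtain xG where xG: "gsol e UNIV xG" "\<And>t. xG t \<in> phase_space" "\<exists>T>0. \<forall>t. xG (t + T) = xG t" "range xG = Gam"
   by (rule Gam_periodic) blast
  have cpt: "compact (range f) & range f \<noteq> {}" if f: "gsol e UNIV f" "\<exists>T>0. \<forall>t. f (t + T) = f t" for f
  proof -
   obtain T where T: "T > 0" "\<And>t. f (t + T) = f t" using f(2) by blast
   have "range f = f ` {0..T}" by (rule periodic_range[of T f 0, simplified]) (rule T)+
   moreover have "compact (f ` {0..T})" by (rule compact_continuous_image[OF gsol_continuous[OF f(1) subset_UNIV] compact_Icc])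
   ultimately show ?thesis using T(1) by simp
  qed
  have "\<exists>T>0. \<forall>t. x (t + T) = x t" using x(2,3) by blast
  from cpt[OF gx(1) this] cpt[OF xG(1,3)] have "G \<inter> Gam \<noteq> {}"
   unfolding x(4) xG(4) by (intro compact_limit_common[OF _ _ _ _ lim[unfolded x(4)]]) auto
  then obtain t0 s0 where ts: "x t0 = xG s0" using x(4) xG(4) by blast
  obtain PG where PG: "PG > 0" "\<And>t. xG (t + PG) = xG t" using xG(3) by blast
  have sG: "strict e (xG t)" for t
  proof -
   have "xG t \<in> Gam" using xG(4) by blast
   then obtain u' s where "xG t = fl u' (vs u') s" "0 <= s" "s <= TT u' (vs u')" by (auto simp: Gam_def)
   thus ?thesis using arc_strict[OF vs(1) _ _ disjI2[OF vs(5)]] by simp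
  qed
  \<comment> \<open>Every point of \<open>Gam\<close> is strict, so there is only one forward
    solution from the common point.\<close>
  have eq: "x (t0 + t) = xG (s0 + t)" if t: "t >= 0" for t
  proof -
   have "gsol e {0..t} (%t. x (t + t0))" "gsol e {0..t} (%t. xG (t + s0))"
    using gsol_shift[OF gx(1)] gsol_shift[OF xG(1)] by simp_all
   from gsol_unique[OF this, of t] show ?thesis using ts sG t by (simp add: add.commute)
  qed
  have fwd: "range f = (%t. f (c + t)) ` {0..}" if "T > 0" "\<forall>t. f (t + T) = f t" for f :: "real => state4" and c T
  proof
   have "range f = (%t. f (c + t)) ` {0..T}" by (rule periodic_range) (use that in auto)
   also have "... \<subseteq> (%t. f (c + t)) ` {0..}" by (intro image_mono) auto
   finally show "range f \<subseteq> (%t. f (c + t)) ` {0..}" .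
  qed auto
  have "range x = (%t. x (t0 + t)) ` {0..}" by (rule fwd[of P]) (use x(2,3) in auto)
  also have "... = (%t. xG (s0 + t)) ` {0..}" by (intro image_cong eq) auto
  also have "... = range xG" by (rule fwd[of PG, symmetric]) (use PG in auto)
  finally show False using ne x(4) xG(4) by simp
 qed
 have "per e x" unfolding per_def using gx x(2,3) by blast
 moreover have "range x \<subseteq> U" using U(2) x(4) by simp
 ultimately show ?thesis unfolding trap_def
  by (rule_tac exI[of _ x], intro conjI exI[of _ U] ballI allI impI) (assumption | rule U(1) ex no)+
qed

end

section \<open>Periodic solutions come close to equilibria\<close>

text \<open>When \<open>g\<close> vanishes together with its derivative, the kink of the minimum is
  invisible; this is the situation of sliding along the manifold.\<close>

lemma min_zero_deriv:
 fixes g :: "real => real"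
 assumes g: "(g has_real_derivative 0) (at t)" "g t = 0"
 shows "((%s. min 0 (g s)) has_real_derivative 0) (at t)"
proof -
 have "((%y. (g y - g t) / (y - t)) \<longlongrightarrow> 0) (at t)" using g(1) by (simp add: has_field_derivative_iff)
 hence "((%y. (min 0 (g y) - min 0 (g t)) / (y - t)) \<longlongrightarrow> 0) (at t)"
 proof (rule tendsto_0_le[where K=1], intro always_eventually allI)
  fix y show "norm ((min 0 (g y) - min 0 (g t)) / (y - t)) <= norm ((g y - g t) / (y - t)) * 1"
   unfolding norm_divide mult_1_right by (rule divide_right_mono) (use g(2) in auto)
 qed
 thus ?thesis by (simp add: has_field_derivative_iff)
qed

context climate_nodes begin

lemma mix_comps: "zp (mix s e v) = fld ((1 - s) * dl) (zp v)" "Xc (mix s e v) = e * Xi ((1 - s) * bm + s * bp) (Nc (zp v)) (Xc v)"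
 by (simp_all add: mix_def fld4_def)

lemma phase_bounds: "v \<in> phase_space ==> \<bar>Nc (zp v)\<bar> <= 1 & \<bar>Pc (zp v)\<bar> <= 1 & \<bar>Xc v\<bar> <= 1 & zp v \<in> dom3"
 by (auto simp: phase_iff dom3_def)

text \<open>Over one period the excess of \<open>Wc\<close>, or of its negative, over
  \<open>Fb\<close> is multiplied by at most \<open>exp (- B * P)\<close>, yet it returns to itself,
  so it cannot be positive.\<close>

lemma per_W:
 assumes "per e x"
 shows "\<bar>Wc (zp (x t))\<bar> <= Fb"
proof -
 obtain P where g: "gsol e UNIV x" and P: "P > 0" "\<And>t. x (t + P) = x t" using assms by (auto simp: per_def)
 obtain Z where Z: "negligible Z" "\<forall>t\<in>UNIV - Z. \<exists>y\<in>incl e (x t). (x has_vector_derivative y) (at t)"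
  using g unfolding gsol_def by blast
 have "sgn * Wc (zp (x t)) - Fb <= 0" if sgn: "sgn = 1 \<or> sgn = -1" for sgn
 proof -
  have "sgn * Wc (zp (x (t + P))) - Fb <= exp (- B * (t + P - t)) * (sgn * Wc (zp (x t)) - Fb)"
  proof (rule gronwall_ae[OF _ _ Z(1)])
   have "lips {t..t+P} (%t. sgn * Wc (zp (x t)))"
    by (intro lips_mult lips_const lips_comps lips_zp gsol_lips[OF g]) simp
   thus "lips {t..t+P} (%t. sgn * Wc (zp (x t)) - Fb)" by (intro lips_diff lips_const)
   fix s assume "s \<in> {t<..<t+P} - Z"
   then obtain y where y: "y \<in> incl e (x s)" "(x has_vector_derivative y) (at s)" using Z(2) by blast
   have wy: "Wc (zp y) = B * (F0 + \<kappa> * (ph (Nc (zp (x s))) - ph (Pc (zp (x s)))) - Wc (zp (x s)))"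
    using y(1) by (auto simp: incl_def mix_comps fld_def)
   have "((%t. sgn * Wc (zp (x t)) - Fb) has_real_derivative sgn * Wc (zp y) - 0) (at s)"
    by (intro DERIV_diff DERIV_cmult vd_comps(1)[OF vd_zp[OF y(2)]] DERIV_const)
   moreover have "sgn * Wc (zp y) - 0 <= - B * (sgn * Wc (zp (x s)) - Fb)"
   proof -
    define F where "F = F0 + \<kappa> * (ph (Nc (zp (x s))) - ph (Pc (zp (x s))))"
    have "\<bar>F\<bar> <= Fb" unfolding F_def by (rule F_bound)
    hence "sgn * F <= Fb" using sgn by (auto simp: abs_le_iff)
    hence "B * (sgn * F) <= B * Fb" using B by simp
    thus ?thesis unfolding wy F_def[symmetric] by (simp add: algebra_simps)
   qed
   ultimately show "\<exists>d. ((%t. sgn * Wc (zp (x t)) - Fb) has_real_derivative d) (at s) & d <= - B * (sgn * Wc (zp (x s)) - Fb)" by blast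
  qed (use P in simp)
  hence 1: "sgn * Wc (zp (x t)) - Fb <= exp (- (B * P)) * (sgn * Wc (zp (x t)) - Fb)" using P(2) by simp
  have "exp (- (B * P)) < 1" using B P by simp
  show ?thesis
  proof (rule ccontr)
   assume "\<not> ?thesis"
   hence "exp (- (B * P)) * (sgn * Wc (zp (x t)) - Fb) < 1 * (sgn * Wc (zp (x t)) - Fb)"
    using \<open>exp (- (B * P)) < 1\<close> by (intro mult_strict_right_mono) auto
   thus False using 1 by simp
  qed
 qed
 from this[of 1] this[of "-1"] show ?thesis by (simp add: abs_le_iff)
qed

definition CXb :: real where "CXb = 2 * bp + 2 * a"
definition C1 :: real where "C1 = 2 * \<kappa> * dl * (b / (a + b) * CXb)"

lemma mix_beta: "0 <= s ==> s <= 1 ==> 0 < (1 - s) * bm + s * bp & (1 - s) * bm + s * bp <= bp & 0 <= (1 - s) * dl & (1 - s) * dl <= dl"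
proof -
 assume s: "0 <= s" "s <= 1"
 have bb: "0 < bm" "bm <= bp" using bs by auto
 have "(1 - s) * bm + s * bm <= (1 - s) * bm + s * bp" using s bb by (intro add_left_mono mult_left_mono) auto
 moreover have "(1 - s) * bm + s * bp <= (1 - s) * bp + s * bp" using s bb by (intro add_right_mono mult_left_mono) auto
 ultimately have "bm <= (1 - s) * bm + s * bp" "(1 - s) * bm + s * bp <= bp" by (simp_all add: algebra_simps)
 moreover have "0 <= (1 - s) * dl" "(1 - s) * dl <= 1 * dl" using s dl by (simp, intro mult_right_mono, auto)
 ultimately show ?thesis using bb by simp
qed

lemma Xi_bound: "0 <= \<beta> ==> \<beta> <= bp ==> \<bar>n\<bar> <= 1 ==> \<bar>x\<bar> <= 1 ==> \<bar>Xi \<beta> n x\<bar> <= CXb"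
proof -
 assume h: "0 <= \<beta>" "\<beta> <= bp" "\<bar>n\<bar> <= 1" "\<bar>x\<bar> <= 1"
 have "\<bar>\<beta> * (n - x)\<bar> <= bp * 2" unfolding abs_mult using h by (intro mult_mono) auto
 moreover have "\<bar>a * (1 - n)\<bar> <= a * 2" unfolding abs_mult using h ab by (intro mult_mono) auto
 ultimately show ?thesis unfolding Xi_def CXb_def by (simp add: abs_le_iff)
qed

text \<open>The position of the northern ice line on the switching manifold for the given slow
  variable.\<close>

definition ns :: "state4 => real" where "ns v = (b * Xc v + a) / (a + b)"

lemma hh_ns: "hh v = (a + b) * (Nc (zp v) - ns v)"
 using ab by (simp add: hh_alt ns_def field_simps)

lemma ns_bounds: "\<bar>Xc v\<bar> <= 1 ==> -1 <= ns v & ns v <= 1"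
proof -
 assume "\<bar>Xc v\<bar> <= 1"
 hence "b * Xc v <= b * 1" "b * -1 <= b * Xc v" using ab by (intro mult_left_mono; simp add: abs_le_iff)+
 thus ?thesis using ab by (simp add: ns_def pos_le_divide_eq pos_divide_le_eq)
qed

text \<open>The energy of the equilibria for the critical temperature of the phase \<open>True\<close>, corrected so
 that it also decreases, up to order \<open>e\<close>, in the other phase.\<close>

definition Eh :: "state4 => real" where
 "Eh v = En 0 (zp v) + \<kappa> * dl * min 0 (Phi (Nc (zp v)) - Phi (ns v))"

text \<open>In phase \<open>False\<close> the energy for \<tau> = 0 has the extra rate
  \<open>- \<kappa> * dl * sd n * n'\<close>. There the corrector equals
  \<open>\<kappa> * dl * (Phi n - Phi (ns v))\<close>, which cancels it up to the motion of
  \<open>ns\<close>, of order \<open>e\<close>. In phase \<open>True\<close> the corrector is 0. The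
  hypothesis \<open>tv\<close> excludes transversal crossing times, where the corrector may have a
  kink.\<close>

lemma energy_step:
 assumes x: "(x has_vector_derivative d) (at t)" and d: "d = mix s e (x t)" and s: "0 <= s" "s <= 1" "hh (x t) > 0 --> s = 1" "hh (x t) < 0 --> s = 0"
  and ps: "\<And>u. x u \<in> phase_space" and e: "e > 0"
  and tv: "hh (x t) = 0 ==> (a + b) * Nc (zp d) = b * Xc d"
 shows "\<exists>D. ((%t. Eh (x t)) has_real_derivative D) (at t) & D <= - (md * (norm (zp d))\<^sup>2) + C1 * e"
proof -
 let ?z = "zp (x t)"
 define n where "n = Nc ?z"
 define \<tau> where "\<tau> = (1 - s) * dl"
 have pb: "\<bar>n\<bar> <= 1" "\<bar>Xc (x t)\<bar> <= 1" "?z \<in> dom3" using phase_bounds[OF ps[of t]] by (auto simp: n_def)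
 have zd: "zp d = fld \<tau> ?z" unfolding d \<tau>_def by (rule mix_comps)
 have mb: "0 <= \<tau>" "\<tau> <= dl" using mix_beta[OF s(1,2)] by (auto simp: \<tau>_def)
 define n' where "n' = Nc (zp d)"
 define ms where "ms = b / (a + b) * Xc d"
 have "\<bar>Xc d\<bar> <= e * CXb"
  unfolding d mix_comps abs_mult using Xi_bound[of "(1 - s) * bm + s * bp" n "Xc (x t)"] mix_beta[OF s(1,2)] pb e by (simp add: n_def)
 hence "b / (a + b) * \<bar>Xc d\<bar> <= b / (a + b) * (e * CXb)" using ab by (intro mult_left_mono) auto
 hence ms: "\<bar>ms\<bar> <= b / (a + b) * CXb * e" using ab by (simp add: ms_def abs_mult mult_ac)
 have small: "\<bar>\<kappa> * dl * (sd y * ms)\<bar> <= C1 * e" if y: "-1 <= y" "y <= 1" for y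
 proof -
  have "\<bar>sd y\<bar> <= 2" using sd_bounds(1)[OF y] sd_bounds(2)[of y] q by (simp add: abs_le_iff)
  hence "\<bar>sd y * ms\<bar> <= 2 * (b / (a + b) * CXb * e)" unfolding abs_mult using ms by (intro mult_mono) auto
  hence "\<kappa> * dl * \<bar>sd y * ms\<bar> <= \<kappa> * dl * (2 * (b / (a + b) * CXb * e))" using \<kappa> dl by (intro mult_left_mono) auto
  thus ?thesis using \<kappa> dl by (simp add: C1_def abs_mult mult_ac)
 qed
 define Q where "Q = (Wc (zp d))\<^sup>2 / B + \<kappa> * sd (Pc ?z) * (Pc (zp d))\<^sup>2 / r + \<kappa> * sd n * n'\<^sup>2 / r"
 have Q: "Q >= md * (norm (zp d))\<^sup>2" unfolding Q_def n_def n'_def by (rule dissipation[OF pb(3)])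
 have fd: "Wc (zp d) = B * (F0 + \<kappa> * (Phi (Nc ?z) - Phi (Pc ?z)) - Wc ?z)" "Pc (zp d) = - r * (Wc ?z - (G0 + k * (Pc ?z)\<^sup>2))"
  "n' = r * (Wc ?z - (G0 + k * n\<^sup>2) - \<tau>)" unfolding n'_def zd fld_dom[OF pb(3)] by (simp_all add: n_def)
 have "((%t. En 0 (zp (x t))) has_real_derivative - (Wc (zp d))\<^sup>2 / B - \<kappa> * sd (Pc ?z) * (Pc (zp d))\<^sup>2 / r
   - \<kappa> * sd n * (Wc ?z - (G0 + k * n\<^sup>2) - 0) * n') (at t)"
  unfolding n_def n'_def by (rule En_deriv[OF vd_zp[OF x] fd(1,2)])
 moreover have "- (Wc (zp d))\<^sup>2 / B - \<kappa> * sd (Pc ?z) * (Pc (zp d))\<^sup>2 / r - \<kappa> * sd n * (Wc ?z - (G0 + k * n\<^sup>2) - 0) * n' = - Q - \<kappa> * \<tau> * (sd n * n')"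
 proof -
  have w: "Wc ?z - (G0 + k * n\<^sup>2) - 0 = n' / r + \<tau>" using fd(3) r by (simp add: field_simps)
  show ?thesis unfolding w Q_def by (simp add: algebra_simps power2_eq_square)
 qed
 ultimately have dE: "((%t. En 0 (zp (x t))) has_real_derivative - Q - \<kappa> * \<tau> * (sd n * n')) (at t)" by simp
 define g where "g t = Phi (Nc (zp (x t))) - Phi (ns (x t))" for t
 have dn: "((%t. Nc (zp (x t))) has_real_derivative n') (at t)" unfolding n'_def by (rule vd_comps(3)[OF vd_zp[OF x]])
 have dns: "((%t. ns (x t)) has_real_derivative ms) (at t)"
  unfolding ns_def ms_def using DERIV_cdivide[OF DERIV_add[OF DERIV_cmult[OF vd_Xc[OF x], of b] DERIV_const[of a]], of "a + b"] by simp
 have dg: "(g has_real_derivative sd n * n' - sd (ns (x t)) * ms) (at t)"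
  unfolding g_def[abs_def] n_def by (intro DERIV_diff DERIV_chain2[OF Phi_deriv] dn dns)
 have "isCont (%t. hh (x t)) t" using vd_hh[OF x] by (rule DERIV_isCont)
 hence ch: "((%t. hh (x t)) \<longlongrightarrow> hh (x t)) (nhds t)" unfolding isCont_def by (rule tendsto_at_iff_tendsto_nhds[THEN iffD1])
 have Pm: "Phi y <= Phi w" if "-1 <= y" "y <= w" "w <= 1" for y w using Phi_mono_lip(1)[OF that] by simp
 have rng: "-1 <= Nc (zp (x u))" "Nc (zp (x u)) <= 1" "-1 <= ns (x u)" "ns (x u) <= 1" for u
  using phase_bounds[OF ps[of u]] ns_bounds[of "x u"] by (auto simp: abs_le_iff)
 have gneg: "g u <= 0" if "hh (x u) < 0" for u
 proof -
  have "Nc (zp (x u)) <= ns (x u)" using that ab by (simp add: hh_ns mult_less_0_iff)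
  thus ?thesis using Pm[of "Nc (zp (x u))" "ns (x u)"] rng[of u] by (simp add: g_def)
 qed
 have gpos: "g u >= 0" if "hh (x u) > 0" for u
 proof -
  have "ns (x u) <= Nc (zp (x u))" using that ab by (simp add: hh_ns zero_less_mult_iff)
  thus ?thesis using Pm[of "ns (x u)" "Nc (zp (x u))"] rng[of u] by (simp add: g_def)
 qed
 have fin: ?thesis if m: "((%t. min 0 (g t)) has_real_derivative m) (at t)" and le: "- (\<kappa> * \<tau> * (sd n * n')) + \<kappa> * dl * m <= C1 * e" for m
 proof -
  have "((%t. Eh (x t)) has_real_derivative (- Q - \<kappa> * \<tau> * (sd n * n')) + \<kappa> * dl * m) (at t)"
   using DERIV_add[OF dE DERIV_cmult[OF m, of "\<kappa> * dl"]] by (simp add: Eh_def g_def)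
  thus ?thesis using Q le by (intro exI conjI) (assumption, linarith)
 qed
 consider "hh (x t) < 0" | "hh (x t) > 0" | "hh (x t) = 0" by linarith
 thus ?thesis
 proof cases
  case 1
  have "\<forall>\<^sub>F u in nhds t. hh (x u) < 0" using order_tendstoD(2)[OF ch 1] .
  hence "\<forall>\<^sub>F u in nhds t. min 0 (g u) = g u" by eventually_elim (use gneg in simp)
  hence "((%t. min 0 (g t)) has_real_derivative sd n * n' - sd (ns (x t)) * ms) (at t)"
   using dg by (subst DERIV_cong_ev[OF refl _ refl]) auto
  moreover have "\<tau> = dl" using s(4) 1 by (simp add: \<tau>_def)
  ultimately show ?thesis using small[OF rng(3,4)[of t]] by (intro fin) (auto simp: algebra_simps abs_le_iff)
 next
  case 2
  have "\<forall>\<^sub>F u in nhds t. hh (x u) > 0" using order_tendstoD(1)[OF ch 2] .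
  hence "\<forall>\<^sub>F u in nhds t. min 0 (g u) = 0" by eventually_elim (use gpos in simp)
  hence "((%t. min 0 (g t)) has_real_derivative 0) (at t)"
   by (subst DERIV_cong_ev[OF refl _ refl]) auto
  moreover have "\<tau> = 0" using s(3) 2 by (simp add: \<tau>_def)
  moreover have "0 <= C1 * e" using small[of 0] by (simp add: abs_le_iff)
  ultimately show ?thesis by (intro fin) auto
 next
  case 3
  have nn: "ns (x t) = n" using 3 ab by (simp add: hh_ns n_def)
  have n'm: "n' = ms" using tv[OF 3] ab by (simp add: n'_def ms_def field_simps)
  \<comment> \<open>On the manifold \<open>tv\<close> gives \<open>n' = ms\<close>: the derivative
    of \<open>g\<close> vanishes, and the velocity of the northern line is itself of order
    \<open>e\<close>.\<close>
  have "((%t. min 0 (g t)) has_real_derivative 0) (at t)"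
  proof (rule min_zero_deriv)
   show "(g has_real_derivative 0) (at t)" using dg nn n'm by simp
   show "g t = 0" using nn by (simp add: g_def n_def)
  qed
  moreover have "- (\<kappa> * \<tau> * (sd n * n')) <= C1 * e"
  proof -
   have "- (\<kappa> * \<tau> * (sd n * n')) <= \<kappa> * \<tau> * \<bar>sd n * ms\<bar>"
    using mult_left_mono[OF abs_ge_minus_self[of "sd n * ms"], of "\<kappa> * \<tau>"] \<kappa> mb n'm by simp
   also have "... <= \<kappa> * dl * \<bar>sd n * ms\<bar>" using \<kappa> mb by (intro mult_right_mono mult_left_mono) auto
   also have "... <= C1 * e" using small[of n] pb(1) \<kappa> dl by (simp add: abs_mult abs_le_iff)
   finally show ?thesis .
  qed
  ultimately show ?thesis by (intro fin) auto
 qed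
qed

lemma Eh_lips:
 assumes x: "lips {s..t} x"
 shows "lips {s..t} (%t. Eh (x t))"
proof -
 have c: "lips {s..t} (%t. Wc (zp (x t)))" "lips {s..t} (%t. Pc (zp (x t)))" "lips {s..t} (%t. Nc (zp (x t)))"
  by (rule lips_comps[OF lips_zp[OF x]])+
 have P: "lips {s..t} (%t. Phi (f t))" and I: "lips {s..t} (%t. Ip (f t))" if "lips {s..t} f" for f
  unfolding Phi_def Ip_def divide_inverse by (intro lips_add lips_diff lips_mult lips_const lips_power that)+
 have n: "lips {s..t} (%t. ns (x t))"
  unfolding ns_def divide_inverse by (intro lips_mult lips_add lips_const lips_Xc x)
 show ?thesis unfolding Eh_def En_def divide_inverse
  by (intro lips_add lips_diff lips_mult lips_const lips_power lips_min c P[OF c(2)] P[OF c(3)] P[OF n] I[OF c(2)] I[OF c(3)])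
qed

section \<open>Times at which the fast field is small\<close>

definition cons :: "real => state4 => bool" where
 "cons s v \<longleftrightarrow> 0 <= s & s <= 1 & (hh v > 0 --> s = 1) & (hh v < 0 --> s = 0)"

text \<open>Otherwise the function \<open>V\<close> below would decrease at least at the rate
  \<open>e\<close> almost everywhere, which is impossible over a period. Dividing the slow variable
  by \<open>e\<close> puts its motion on the same footing as the dissipation.\<close>

lemma slow_time:
 assumes p: "per e x" and e: "e > 0" and M: "M > 0"
 shows "\<exists>t s. cons s (x t) & M * (md * (norm (fld ((1 - s) * dl) (zp (x t))))\<^sup>2) < Xi ((1 - s) * bm + s * bp) (Nc (zp (x t))) (Xc (x t)) + (M * C1 + 1) * e"
proof (rule ccontr)
 assume no: "\<not> ?thesis"
 obtain P where g: "gsol e UNIV x" and ps: "\<And>t. x t \<in> phase_space" and P: "P > 0" "\<And>t. x (t + P) = x t" using p by (auto simp: per_def)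
 obtain Z where Z: "negligible Z" "\<forall>t\<in>UNIV - Z. \<exists>y\<in>incl e (x t). (x has_vector_derivative y) (at t)"
  using g unfolding gsol_def by blast
 define Y where "Y = {t. hh (x t) = 0 & (\<exists>d. d \<noteq> 0 & ((%t. hh (x t)) has_real_derivative d) (at t))}"
 have "negligible Y"
  unfolding Y_def negligible_iff_null_sets
  by (intro null_sets_completionI countable_imp_null_set_lborel countable_transversal_zeros)
 hence nZ: "negligible (Z \<union> Y)" using Z(1) by simp
 define V where "V t = Xc (x t) / e + M * Eh (x t)" for t
 have "V P - V 0 <= - e * (P - 0)"
 proof (rule lips_increment_le[OF _ less_imp_le[OF P(1)] nZ])
  have lx: "lips {0..P} x" by (rule gsol_lips[OF g]) simp
  show "lips {0..P} V" unfolding V_def[abs_def] divide_inverse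
   by (intro lips_add lips_mult lips_const lips_Xc lx Eh_lips)
  fix t assume t: "t \<in> {0<..<P} - (Z \<union> Y)"
  then obtain d where "d \<in> incl e (x t)" and dx: "(x has_vector_derivative d) (at t)" using Z(2) by blast
  then obtain s where d: "d = mix s e (x t)" and c: "cons s (x t)" by (auto simp: incl_def cons_def)
  have tv: "(a + b) * Nc (zp d) = b * Xc d" if "hh (x t) = 0"
  proof -
   have "\<not> (a + b) * Nc (zp d) - b * Xc d \<noteq> 0" using t that vd_hh[OF dx] unfolding Y_def by blast
   thus ?thesis by simp
  qed
  obtain D where D: "((%t. Eh (x t)) has_real_derivative D) (at t)" "D <= - (md * (norm (zp d))\<^sup>2) + C1 * e"
   using energy_step[OF dx d _ _ _ _ ps e tv] c unfolding cons_def by blast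
  define X where "X = Xi ((1 - s) * bm + s * bp) (Nc (zp (x t))) (Xc (x t))"
  have "(V has_real_derivative Xc d / e + M * D) (at t)"
   unfolding V_def[abs_def] by (intro DERIV_add DERIV_cdivide DERIV_cmult D(1) vd_Xc[OF dx])
  moreover have "Xc d / e + M * D <= - e"
  proof -
   have "Xc d / e = X" using e by (simp add: d mix_comps X_def)
   moreover have "M * D <= M * (- (md * (norm (zp d))\<^sup>2) + C1 * e)" using D(2) M by (intro mult_left_mono) auto
   moreover have "M * (md * (norm (zp d))\<^sup>2) >= X + (M * C1 + 1) * e" using no c unfolding X_def d mix_comps(1) not_ex by (metis linorder_not_less)
   ultimately show ?thesis by (simp add: algebra_simps)
  qed
  ultimately show "\<exists>d. (V has_real_derivative d) (at t) & d <= - e" by blast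
 qed
 moreover have "V P = V 0" using P(2)[of 0] by (simp add: V_def)
 ultimately show False using mult_pos_pos[OF e P(1)] by simp
qed

text \<open>The inequality of \<open>slow_time\<close> is used twice: the dissipation is bounded
  because \<open>Xi\<close> is, and \<open>Xi\<close> is almost nonnegative because the dissipation
  is nonnegative. The sign of \<open>Xi\<close> will rule out equilibria of phase
  \<open>False\<close>.\<close>

lemma slow_times:
 assumes th: "\<theta> > 0"
 shows "\<exists>e0>0. \<forall>e x. 0 < e --> e < e0 --> per e x --> (\<exists>t s. cons s (x t) &
  norm (fld ((1 - s) * dl) (zp (x t))) < \<theta> & - \<theta> <= Xi ((1 - s) * bm + s * bp) (Nc (zp (x t))) (Xc (x t)))"
proof -
 have cx: "CXb > 0" using bs ab by (simp add: CXb_def)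
 \<comment> \<open>A squared speed of \<theta> squared would cost \<open>2 * CXb\<close>, but
   \<open>Xi\<close> and the error of order \<open>e\<close> supply less than \<open>CXb\<close>
   each.\<close>
 define M where "M = 2 * CXb / (md * \<theta>\<^sup>2)"
 have M: "M > 0" "M * (md * \<theta>\<^sup>2) = 2 * CXb" using cx md_pos th by (simp_all add: M_def)
 have "C1 >= 0" using \<kappa> dl ab cx by (simp add: C1_def)
 hence K: "M * C1 + 1 > 0" using M(1) by (simp add: add_nonneg_pos)
 define e0 where "e0 = min \<theta> CXb / (M * C1 + 1)"
 show ?thesis
 proof (rule exI[of _ e0], intro conjI allI impI)
  show "e0 > 0" using th cx K by (simp add: e0_def)
  fix e x assume e: "0 < e" "e < e0" and p: "per e x"
  have "(M * C1 + 1) * e < min \<theta> CXb" using e(2) K by (simp add: e0_def pos_less_divide_eq mult.commute)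
  hence s: "(M * C1 + 1) * e < \<theta>" "(M * C1 + 1) * e < CXb" by simp_all
  obtain t w where c: "cons w (x t)" and i: "M * (md * (norm (fld ((1 - w) * dl) (zp (x t))))\<^sup>2) < Xi ((1 - w) * bm + w * bp) (Nc (zp (x t))) (Xc (x t)) + (M * C1 + 1) * e"
   using slow_time[OF p e(1) M(1)] by blast
  have ps: "x t \<in> phase_space" using p by (simp add: per_def)
  have "Xi ((1 - w) * bm + w * bp) (Nc (zp (x t))) (Xc (x t)) <= CXb"
   using Xi_bound[of "(1 - w) * bm + w * bp" "Nc (zp (x t))" "Xc (x t)"] mix_beta[of w] c phase_bounds[OF ps] by (simp add: cons_def abs_le_iff)
  hence "M * (md * (norm (fld ((1 - w) * dl) (zp (x t))))\<^sup>2) < M * (md * \<theta>\<^sup>2)" using i s(2) M(2) by linarith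
  hence "(norm (fld ((1 - w) * dl) (zp (x t))))\<^sup>2 < \<theta>\<^sup>2" using M(1) md_pos by simp
  hence "norm (fld ((1 - w) * dl) (zp (x t))) < \<theta>" using th by (simp add: power2_less_imp_less)
  moreover have "0 <= M * (md * (norm (fld ((1 - w) * dl) (zp (x t))))\<^sup>2)" using M(1) md_pos by simp
  ultimately show "\<exists>t s. cons s (x t) & norm (fld ((1 - s) * dl) (zp (x t))) < \<theta> &
    - \<theta> <= Xi ((1 - s) * bm + s * bp) (Nc (zp (x t))) (Xc (x t))"
   using c i s(1) by (intro exI[of _ t] exI[of _ w] conjI) (assumption | linarith)+
 qed
qed

end

section \<open>Exclusion of other cycles\<close>

text \<open>Bad points at the scales \<open>1 / (n + 1)\<close> would accumulate at a point of
  \<open>K\<close>, whose local scale excludes them.\<close>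

lemma compact_uniform:
 fixes K :: "'a::metric_space set" and R :: "real => 'a => bool"
 assumes K: "compact K" and mono: "\<And>\<eta> \<eta>' z. R \<eta> z ==> \<eta>' <= \<eta> ==> R \<eta>' z"
  and loc: "\<And>z. z \<in> K ==> \<exists>\<delta>>0. \<forall>z'\<in>K. dist z' z < \<delta> --> R \<delta> z'"
 shows "\<exists>\<eta>>0. \<forall>z\<in>K. R \<eta> z"
proof (rule ccontr)
 assume no: "\<not> ?thesis"
 have "\<exists>z\<in>K. \<not> R (inverse (real (Suc n))) z" for n
 proof -
  have "inverse (real (Suc n)) > 0" by simp
  thus ?thesis using no by blast
 qed
 then obtain f where f: "\<And>n. f n \<in> K" "\<And>n. \<not> R (inverse (real (Suc n))) (f n)" by metis
 obtain l s where l: "l \<in> K" "strict_mono s" "(f \<circ> s) \<longlonglongrightarrow> l"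
  using K f(1) unfolding compact_def by metis
 obtain \<delta> where \<delta>: "\<delta> > 0" "\<And>z. z \<in> K ==> dist z l < \<delta> ==> R \<delta> z" using loc[OF l(1)] by blast
 have "\<forall>\<^sub>F n in sequentially. dist ((f \<circ> s) n) l < \<delta>" using l(3) \<delta>(1) by (rule tendstoD)
 moreover have "\<forall>\<^sub>F n in sequentially. inverse (real (Suc n)) < \<delta>"
  using LIMSEQ_inverse_real_of_nat \<delta>(1) by (rule order_tendstoD)
 ultimately have "\<forall>\<^sub>F n in sequentially. dist ((f \<circ> s) n) l < \<delta> & inverse (real (Suc n)) < \<delta>" by (rule eventually_conj)
 then obtain n where n: "dist (f (s n)) l < \<delta>" "inverse (real (Suc n)) < \<delta>"
  unfolding eventually_sequentially by (metis comp_apply order_refl)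
 have "n <= s n" by (rule seq_suble[OF l(2)])
 hence "inverse (real (Suc (s n))) <= inverse (real (Suc n))" by (simp add: le_imp_inverse_le)
 hence "R (inverse (real (Suc (s n)))) (f (s n))"
  by (rule mono[OF \<delta>(2)[OF f(1) n(1)] order_trans[OF _ less_imp_le[OF n(2)]]])
 thus False using f(2) by blast
qed

context climate_nodes begin

text \<open>As long as the flow of a phase stays strictly inside its region, the inclusion leaves no
  choice.\<close>

lemma follow:
 assumes y: "gsol e {0..T} y" and f: "ode (fld4 (ta u) (be u) e) f" "f 0 = y 0"
  and H: "\<And>s. 0 <= s ==> s < T ==> HH u (f s) > 0" and s: "0 <= s" "s <= T"
 shows "y s = f s"
proof (cases "T > 0")
 case True
 have c: "continuous_on {0..T} (%s. HH u (f s))"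
  unfolding HH_sg by (intro continuous_intros flow4_cont(4)[OF f(1)]) auto
 have "HH u (f T) >= 0"
  using continuous_ge_on_closure[of "{0..<T}" "%s. HH u (f s)" T 0] c H True by (simp add: less_imp_le)
 hence "gsol e {0..T} f"
  by (intro flow_gsol[OF f(1)]) (use H in \<open>auto simp: le_less\<close>)
 from gsol_unique[OF y this f(2)[symmetric] _ s] show ?thesis
  using H by (force simp: strict_def HH_def split: if_splits)
next
 case False
 hence "s = 0" using s by linarith
 thus ?thesis using f(2) by simp
qed

lemma trap_phase: "trap d e x ==> x t \<in> phase_space"
 by (simp add: trap_def per_def)

lemma trap_gsol: "trap d e x ==> gsol e {0..T} (%s. x (t + s))"
 using gsol_shift[of e UNIV x "{0..T}" t] by (simp add: trap_def per_def add.commute)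

lemma trap_not_bas: "trap d e x ==> \<not> bas d (x t)"
proof -
 assume tr: "trap d e x"
 then obtain U where U: "range x \<subseteq> U" "\<forall>y T. T >= 0 --> gsol e {0..T} y --> (\<forall>t\<in>{0..T}. y t \<in> phase_space) --> y 0 \<in> U --> \<not> bas d (y T)"
  unfolding trap_def by blast
 have "x t \<in> U" using U(1) by blast
 thus ?thesis using U(2)[rule_format, of 0 "%s. x (t + s)"] trap_gsol[OF tr, of 0 t] trap_phase[OF tr] by auto
qed

text \<open>If the orbit leaves \<open>dom3\<close>, a small ball around \<open>z0 T\<close> misses
  \<open>dom3\<close> and the conclusion is vacuous. Otherwise the orbit accumulates at an
  equilibrium, which \<open>lim\<close> identifies as the node.\<close>

lemma ends:
 assumes z0: "ode (fld (ta u)) z0" "z0 0 \<in> dom3" "z0 0 \<noteq> QQ u" and d: "d > 0"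
  and lim: "\<And>z. eqm (ta u) z ==> (\<And>e. e > 0 ==> \<exists>t\<ge>0. norm (z0 t - z) < e) ==> z = QQ u"
 obtains T \<rho> where "T > 0" "\<rho> > 0" "\<And>z. norm (z - z0 T) < \<rho> ==> z \<in> dom3 ==> nearv u d z (QQ u)"
proof (cases "\<exists>T\<ge>0. z0 T \<notin> dom3")
 case True
 then obtain T where T: "T >= 0" "z0 T \<notin> dom3" by blast
 hence "T > 0" using z0(2) by (cases "T = 0") auto
 have "open (- dom3)" using closed_dom3 by (simp add: open_Compl)
 then obtain \<rho> where "\<rho> > 0" "ball (z0 T) \<rho> \<subseteq> - dom3" using T(2) open_contains_ball by (metis ComplI)
 thus ?thesis using that[OF \<open>T > 0\<close>, of \<rho>] by (auto simp: dist_norm norm_minus_commute subset_iff)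
next
 case False
 obtain z where z: "eqm (ta u) z" "\<And>e. e > 0 ==> \<exists>t\<ge>0. norm (z0 t - z) < e"
  using flow_accumulates[OF z0(1)] False by blast
 have zQ: "z = QQ u" by (rule lim[OF z])
 define m where "m = min (Vm u * d / 2) (norm (z0 0 - QQ u))"
 have m: "m > 0" using Vm[of u] d z0(3) by (simp add: m_def)
 obtain T where T: "T >= 0" "norm (z0 T - QQ u) < m" using z(2)[OF m] zQ by blast
 have "T \<noteq> 0" using T(2) by (auto simp: m_def)
 hence "T > 0" using T(1) by simp
 show ?thesis
 proof (rule that[OF \<open>T > 0\<close>])
  show "Vm u * d / 2 > 0" using Vm[of u] d by simp
  fix w assume w: "norm (w - z0 T) < Vm u * d / 2"
  have "norm (w - QQ u) <= norm (w - z0 T) + norm (z0 T - QQ u)" using norm_triangle_ineq[of "w - z0 T" "z0 T - QQ u"] by simp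
  also have "... <= Vm u * d" using w T(2) by (simp add: m_def)
  finally show "nearv u d w (QQ u)" using d by (intro norm_nearv) auto
 qed
qed

lemma accum_le:
 assumes acc: "\<And>e. e > 0 ==> \<exists>t\<ge>0. norm (z0 t - z) < e"
 shows "(\<And>t. t >= 0 ==> Wc (z0 t) <= c) ==> Wc z <= c" and "(\<And>t. t >= 0 ==> c <= Wc (z0 t)) ==> c <= Wc z"
proof -
 have *: "\<exists>t\<ge>0. \<bar>Wc (z0 t) - Wc z\<bar> < e" if "e > 0" for e
  using acc[OF that] abs_Wc_le[of "z0 _ - z"] by (metis fst_diff order_le_less_trans)
 show "Wc z <= c" if h: "\<And>t. t >= 0 ==> Wc (z0 t) <= c"
 proof (rule field_le_epsilon)
  fix e :: real assume "e > 0"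
  then obtain t where "t >= 0" "\<bar>Wc (z0 t) - Wc z\<bar> < e" using * by blast
  thus "Wc z <= c + e" using h[of t] by linarith
 qed
 show "c <= Wc z" if h: "\<And>t. t >= 0 ==> c <= Wc (z0 t)"
 proof (rule field_le_epsilon)
  fix e :: real assume "e > 0"
  then obtain t where "t >= 0" "\<bar>Wc (z0 t) - Wc z\<bar> < e" using * by blast
  thus "c <= Wc z + e" using h[of t] by linarith
 qed
qed

text \<open>Otherwise raising the slow variable slightly would put the solution into the phase \<open>False\<close>,
 whose flow escapes from the equilibrium.\<close>

lemma no_sigma_near:
 assumes d: "d False > 0" and q: "eqm \<tau> z" "0 <= \<tau>" "\<tau> < dl"
 obtains \<rho> where "\<rho> > 0" "\<And>e x t. 0 < e ==> e < \<rho> ==> trap d e x ==> hh (x t) = 0 ==> norm (zp (x t) - z) >= \<rho>"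
proof -
 obtain z0 where z0: "z0 0 = z" "ode (fld (ta False)) z0" using flow3_exists by blast
 have ta: "ta False = dl" by (simp add: ta_def)
 have ez: "eqm \<tau> (z0 0)" using q z0 by simp
 have tw: "toward False \<tau>" using q by (simp add: toward_def ta)
 have ne: "w \<noteq> z" if "eqm dl w" for w using that q unfolding eqm_iff by auto
 have nQ: "z0 0 \<noteq> QQ False" using ne[of "QQ False"] QQ(1)[of False] z0(1) ta by auto
 \<comment> \<open>The orbit descends, so its limit is not above \<open>z\<close>. Slope
   \<open>lam z >= 1\<close> would place every equilibrium for \<open>dl\<close> above
   \<open>z\<close>; hence \<open>z\<close> has slope below 1, lies above \<open>Qm\<close>, and the
   orbit stays above \<open>Qm\<close>.\<close>
 have lim: "w = QQ False" if w: "eqm (ta False) w" "\<And>e. e > 0 ==> \<exists>t\<ge>0. norm (z0 t - w) < e" for w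
 proof -
  have "Wc (z0 t) <= Wc z" if "t >= 0" for t
   using escape_monotone[OF z0(2) ez tw order_refl that] z0(1) by (simp add: le3_def)
  hence Wle: "Wc w <= Wc z" using accum_le(1)[OF w(2)] by blast
  have wdl: "eqm dl w" using w(1) ta by simp
  have l: "lam z < 1"
  proof (rule ccontr)
   assume "\<not> lam z < 1"
   hence "Wc z < Wc w" using subeq_above_saddle[OF eqm_subeq[OF wdl] q(1,2)] q dl ne[OF wdl] by simp
   thus False using Wle by simp
  qed
  have "le3 Qm z" by (rule eqm_le_node[OF Qm(1) q(1,2) less_imp_le[OF q(3)] l])
  hence "le3 Qm (z0 t)" if "t >= 0" for t
   using const_le_flow[OF z0(2) that, of Qm] Qm(1) z0(1) ta by (simp add: eqm_def)
  hence "Wc Qm <= Wc w" using accum_le(2)[OF w(2)] by (auto simp: le3_def)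
  thus ?thesis by (rule upper_eqm_unique[OF w(1)])
 qed
 have zd: "z0 0 \<in> dom3" using ez by (simp add: eqm_def)
 obtain T \<rho> where T: "T > 0" "\<rho> > 0" "\<And>w. norm (w - z0 T) < \<rho> ==> w \<in> dom3 ==> nearv False (d False) w (QQ False)"
  using ends[OF z0(2) zd nQ d lim] by blast
 obtain \<delta> e0 where es: "\<delta> > 0" "e0 > 0"
  "\<And>e y t. 0 < e ==> e < e0 ==> ode (fld4 (ta False) (be False) e) y ==> norm (zp (y 0) - z0 0) <= \<delta> ==> \<bar>Xc (y 0)\<bar> <= 1 ==>
    HH False (y 0) >= 0 ==> 0 < t ==> t <= T ==> HH False (y t) > 0"
  "\<And>e y t. ode (fld4 (ta False) (be False) e) y ==> norm (zp (y 0) - z0 0) <= \<delta> ==> 0 <= t ==> t <= T ==>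
    norm (zp (y t) - z0 t) < \<rho>"
  by (rule escape[OF z0(2) ez tw T(1,2)]) blast
 show ?thesis
 proof (rule that[of "min \<delta> e0"])
  show "min \<delta> e0 > 0" using es by simp
  fix e x t assume e: "0 < e" "e < min \<delta> e0" and tr: "trap d e x" and h: "hh (x t) = 0"
  show "norm (zp (x t) - z) >= min \<delta> e0"
  proof (rule ccontr)
   assume "\<not> ?thesis"
   hence nz: "norm (zp (x t) - z0 0) <= \<delta>" using z0(1) by simp
   obtain U where U: "open U" "range x \<subseteq> U" "\<forall>v\<in>U \<inter> phase_space. \<exists>y. y 0 = v & gsol e {0..} y & (\<forall>t\<ge>0. y t \<in> phase_space)"
    "\<forall>y T. T >= 0 --> gsol e {0..T} y --> (\<forall>t\<in>{0..T}. y t \<in> phase_space) --> y 0 \<in> U --> \<not> bas d (y T)"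
    using tr unfolding trap_def by blast
   have "x t \<in> U" using U(2) by blast
   then obtain m where m: "m > 0" "ball (x t) m \<subseteq> U" using U(1) open_contains_ball by blast
   have xp: "x t \<in> phase_space" by (rule trap_phase[OF tr])
   have "(a + b) * Nc (zp (x t)) < (a + b) * 1" using xp ab by (intro mult_strict_left_mono) (auto simp: phase_iff)
   hence "b * Xc (x t) < b * 1" using h by (simp add: hh_alt)
   hence X1: "Xc (x t) < 1" using ab by simp
   \<comment> \<open>Small enough for the raised state to remain in \<open>U\<close> and in the
     phase space, and positive because the slow variable is below 1 on the manifold.\<close>
   define g where "g = min (m / 2) (1 - Xc (x t))"
   have "g <= m / 2" "g <= 1 - Xc (x t)" unfolding g_def by (rule min.cobounded1, rule min.cobounded2)
   moreover have "g > 0" using m X1 by (simp add: g_def)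
   ultimately have g: "g > 0" "g <= m / 2" "Xc (x t) + g <= 1" by linarith+
   define v where "v = mk (zp (x t)) (Xc (x t) + g)"
   have "v - x t = mk 0 g" using mk_diff[of "zp (x t)" "Xc (x t) + g" "zp (x t)" "Xc (x t)"] by (simp add: v_def)
   hence "norm (v - x t) <= g" using norm_mk_le[of 0 g] g(1) by simp
   hence vU: "v \<in> U" using m g by (intro subsetD[OF m(2)]) (simp add: dist_norm norm_minus_commute)
   have vp: "v \<in> phase_space" using xp g by (auto simp: phase_iff v_def)
   have "0 < b * g" using g(1) ab by simp
   hence hv: "HH False v > 0" using h by (simp add: HH_def hh_alt v_def distrib_left)
   obtain y where y: "y 0 = v" "gsol e {0..} y" "\<And>t. t >= 0 ==> y t \<in> phase_space" using U(3) vU vp by blast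
   obtain f where f: "f 0 = v" "ode (fld4 (ta False) (be False) e) f" using flow4_exists by blast
   have f0: "norm (zp (f 0) - z0 0) <= \<delta>" "\<bar>Xc (f 0)\<bar> <= 1" using nz phase_bounds[OF vp] by (simp_all add: f(1) v_def)
   have Hf: "HH False (f s) > 0" if s: "0 <= s" "s <= T" for s
    using es(3)[OF e(1) _ f(2) f0, of s] e hv s f(1) by (cases "s = 0") auto
   have yT: "y T = f T"
    by (rule follow[OF gsol_subset[OF y(2)] f(2)]) (use f(1) y(1) Hf T in auto)
   have "nearv False (d False) (zp (y T)) (QQ False)"
    by (rule T(3)) (use es(4)[OF f(2) f0(1), of T] yT T phase_bounds[OF y(3)[of T]] in auto)
   hence "bas d (y T)" unfolding bas_def using y(3)[of T] Hf[of T] yT T by (intro conjI exI[of _ False]) auto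
   moreover have "\<not> bas d (y T)"
    using U(4)[rule_format, of T y] T y vU gsol_subset[OF y(2), of "{0..T}"] by auto
   ultimately show False by simp
  qed
 qed
qed

end

section \<open>Passing the unstable equilibrium\<close>

lemma exp_barrier:
 fixes f :: "real => real"
 assumes st: "0 <= s" and c: "continuous_on {0..s} f" and f0: "f 0 <= K"
  and der: "\<And>t. 0 < t ==> t < s ==> f t > K * exp (- c * t) ==> \<exists>d. (f has_real_derivative d) (at t) & d <= - c * (K * exp (- c * t))"
 shows "f s <= K * exp (- c * s)"
proof -
 have "f s - K * exp (- c * s) <= 0"
 proof (rule barrier_nonpos[OF st, where f="%s. f s - K * exp (- c * s)"])
  show "continuous_on {0..s} (%s. f s - K * exp (- c * s))" by (intro continuous_intros c)
  show "f 0 - K * exp (- c * 0) <= 0" using f0 by simp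
  fix t assume t: "0 < t" "t < s" "f t - K * exp (- c * t) > 0"
  obtain d where d: "(f has_real_derivative d) (at t)" "d <= - c * (K * exp (- c * t))" using der[of t] t by auto
  have "((%s. f s - K * exp (- c * s)) has_real_derivative d - K * (exp (- c * t) * (- c))) (at t)"
   by (auto intro!: derivative_eq_intros d(1))
  moreover have "d - K * (exp (- c * t) * (- c)) <= 0" using d(2) by (simp add: algebra_simps)
  ultimately show "\<exists>d. ((%s. f s - K * exp (- c * s)) has_real_derivative d) (at t) & d <= 0" by blast
 qed
 thus ?thesis by simp
qed

lemma exp_integral_bound:
 fixes f :: "real => real"
 assumes st: "0 <= s" and c: "continuous_on {0..s} f" "c > 0" and K: "K >= 0"
  and der: "\<And>t. 0 < t ==> t < s ==> \<exists>d. (f has_real_derivative d) (at t) & \<bar>d\<bar> <= K * exp (- c * t)"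
 shows "\<bar>f s - f 0\<bar> <= K / c"
proof -
 have "g * f s <= g * f 0 + K / c" if g: "g = 1 \<or> g = -1" for g
 proof -
  have "g * f s + K / c * exp (- c * s) <= g * f 0 + K / c * exp (- c * 0)"
  proof (rule DERIV_nonpos_imp_decreasing_open[OF st, where f="%t. g * f t + K / c * exp (- c * t)"])
   fix t assume t: "0 < t" "t < s"
   obtain d where d: "(f has_real_derivative d) (at t)" "\<bar>d\<bar> <= K * exp (- c * t)" using der[OF t] by blast
   have "((%t. g * f t + K / c * exp (- c * t)) has_real_derivative g * d + K / c * (exp (- c * t) * (- c))) (at t)"
    by (auto intro!: derivative_eq_intros d(1))
   moreover have "g * d + K / c * (exp (- c * t) * (- c)) <= 0" using d(2) g c(2) by (auto simp: abs_le_iff)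
   ultimately show "\<exists>d. ((%t. g * f t + K / c * exp (- c * t)) has_real_derivative d) (at t) & d <= 0" by blast
  qed (intro continuous_intros c(1))
  moreover have "K / c * exp (- c * s) >= 0" using K c(2) by simp
  ultimately show ?thesis by simp
 qed
 from this[of 1] this[of "-1"] show ?thesis by (simp add: abs_le_iff)
qed

context climate begin

lemma Phi_inj: "\<bar>x\<bar> <= 1 ==> \<bar>y\<bar> <= 1 ==> Phi x = Phi y ==> x = y"
proof -
 assume xy: "\<bar>x\<bar> <= 1" "\<bar>y\<bar> <= 1" and e: "Phi x = Phi y"
 have "x\<^sup>2 <= 1" "y\<^sup>2 <= 1" using xy by (simp_all add: abs_square_le_1)
 moreover have "\<bar>x * y\<bar> <= 1 * 1" unfolding abs_mult using xy by (intro mult_mono) auto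
 ultimately have "x\<^sup>2 + x * y + y\<^sup>2 <= 3" by (simp add: abs_le_iff)
 hence "q / 2 * (x\<^sup>2 + x * y + y\<^sup>2) <= q / 2 * 3" using q by (intro mult_left_mono) auto
 moreover have "q / 2 * 3 < 1 + q / 2" using q by simp
 ultimately have "1 + q / 2 - q / 2 * (x\<^sup>2 + x * y + y\<^sup>2) > 0" by linarith
 thus ?thesis using Phi_diff[of x y] e by simp
qed

lemma const_deriv_zero:
 fixes f :: "real => real"
 assumes "\<And>s. 0 < s ==> s < t ==> f s = c" "(f has_real_derivative D) (at s)" "0 < s" "s < t"
 shows "D = 0"
proof (rule DERIV_local_const[OF assms(2)])
 show "0 < min s (t - s)" using assms by simp
 show "\<forall>y. \<bar>s - y\<bar> < min s (t - s) --> f s = f y"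
 proof (intro allI impI)
  fix y assume "\<bar>s - y\<bar> < min s (t - s)"
  hence "0 < y" "y < t" by (auto simp: abs_less_iff)
  thus "f s = f y" using assms(1)[of y] assms(1)[of s] assms(3,4) by simp
 qed
qed

text \<open>If the northern line stalled, its equation would freeze the temperature, the heat
  balance would freeze \<open>Phi\<close> of the southern line and so the southern line: the whole
  field would vanish initially.\<close>

lemma increasing_N_strict:
 assumes x: "ode (fld 0) x" and P: "-1 < Pc (x 0)" "Pc (x 0) < 0" and f: "le3 0 (fld 0 (x 0))" "fld 0 (x 0) \<noteq> 0" and t: "t > 0"
 shows "Nc (x 0) < Nc (x t)"
proof (rule ccontr)
 assume "\<not> ?thesis"
 hence nt: "Nc (x t) <= Nc (x 0)" by simp
 have inc: "le3 (x s) (x u)" if "0 <= s" "s <= u" for s u by (rule flow_increasing[OF x f(1) that])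
 have N: "Nc (x s) = Nc (x 0)" if "0 < s" "s < t" for s using inc[of 0 s] inc[of s t] nt that by (simp add: le3_def)
 have cx: "continuous_on {0..} x" by (rule ode_continuous[OF x])
 obtain d where d: "d > 0" "\<And>s. s \<in> {0..} ==> dist s 0 < d ==> dist (x s) (x 0) < 1 + Pc (x 0)"
  using cx P unfolding continuous_on_iff by (metis atLeast_iff diff_gt_0_iff_gt diff_minus_eq_add add.commute order_refl)
 define t' where "t' = min t d"
 have t': "t' > 0" "t' <= t" "t' <= d" using t d(1) by (auto simp: t'_def)
 have Pr: "\<bar>Pc (x s)\<bar> <= 1" if s: "0 <= s" "s < t'" for s
 proof -
  have "\<bar>Pc (x s) - Pc (x 0)\<bar> <= norm (x s - x 0)" using abs_Pc_le[of "x s - x 0"] by simp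
  moreover have "norm (x s - x 0) < 1 + Pc (x 0)" using d(2)[of s] s t' by (simp add: dist_norm)
  moreover have "Pc (x s) <= Pc (x 0)" using inc[of 0 s] s by (simp add: le3_def)
  ultimately show ?thesis using P by (simp add: abs_le_iff)
 qed
 have dx: "((%t. Wc (x t)) has_real_derivative Wc (fld 0 (x s))) (at s)" "((%t. Pc (x t)) has_real_derivative Pc (fld 0 (x s))) (at s)"
   "((%t. Nc (x t)) has_real_derivative Nc (fld 0 (x s))) (at s)" if "s > 0" for s
  using vd_comps[OF ode_at[OF x that]] .
 have N0: "Nc (fld 0 (x s)) = 0" if s: "0 < s" "s < t'" for s
  by (rule const_deriv_zero[OF N dx(3)]) (use s t' in auto)
 have W: "Wc (x s) = gg (Nc (x 0))" if s: "0 < s" "s < t'" for s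
  using N0[OF s] N[of s] s t' r by (simp add: fld_def)
 have W0: "Wc (fld 0 (x s)) = 0" if s: "0 < s" "s < t'" for s
  by (rule const_deriv_zero[OF W dx(1)]) (use s in auto)
 have ph: "ph (Pc (x s)) = ph (Pc (x (t' / 2)))" if s: "0 < s" "s < t'" for s
 proof -
  have h: "\<kappa> * ph (Pc (x v)) = F0 + \<kappa> * ph (Nc (x 0)) - gg (Nc (x 0))" if v: "0 < v" "v < t'" for v
  proof -
   have "B * (F0 + \<kappa> * (ph (Nc (x 0)) - ph (Pc (x v))) - gg (Nc (x 0))) = 0"
    using W0[OF v] W[OF v] N[of v] v t' unfolding fld_def by simp
   hence "F0 + \<kappa> * (ph (Nc (x 0)) - ph (Pc (x v))) - gg (Nc (x 0)) = 0" using B by (metis less_irrefl mult_eq_0_iff)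
   thus ?thesis by (simp add: right_diff_distrib)
  qed
  have "\<kappa> * ph (Pc (x s)) = \<kappa> * ph (Pc (x (t' / 2)))" by (rule trans[OF h[OF s] h[symmetric]]) (use t' in auto)
  thus ?thesis using \<kappa> by simp
 qed
 have PP: "Pc (x s) = Pc (x (t' / 2))" if s: "0 < s" "s < t'" for s
 proof -
  have p: "\<bar>Pc (x s)\<bar> <= 1" "\<bar>Pc (x (t' / 2))\<bar> <= 1" using Pr[of s] Pr[of "t' / 2"] s t' by simp_all
  hence "cl (Pc (x s)) = Pc (x s)" "cl (Pc (x (t' / 2))) = Pc (x (t' / 2))" by (simp_all add: cl_id abs_le_iff)
  thus ?thesis using Phi_inj[OF p] ph[OF s] unfolding ph_def by simp
 qed
 have P0: "Pc (fld 0 (x s)) = 0" if s: "0 < s" "s < t'" for s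
  by (rule const_deriv_zero[OF PP dx(2)]) (use s in auto)
 have z: "fld 0 (x s) = 0" if "s \<in> {0<..<t'}" for s using N0[of s] W0[of s] P0[of s] that by (simp add: prod_eq_iff)
 have "continuous_on (closure {0<..<t'}) (%s. fld 0 (x s))"
  using t' by (intro continuous_on_compose2[OF fld_continuous[of UNIV] continuous_on_subset[OF cx]]) auto
 from continuous_constant_on_closure[OF this z, of 0] show False using f(2) t' by simp
qed

text \<open>Replaces the stable manifold. If the velocity is never ordered, its components cannot
  support each other's growth, so each decays exponentially from a size proportional to the initial
  distance, and the total displacement is a multiple of that distance.\<close>

lemma saddle_decay:
 assumes zq: "eqm 0 zq" and c0: "c0 > 0" and ball: "\<And>z. norm (z - zq) <= r0 ==> -1 <= Pc z & Pc z <= - c0 & c0 <= Nc z & Nc z <= 1"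
 obtains K where "K > 0" "\<And>Z s. ode (fld 0) Z ==> s >= 0 ==> (\<And>v. 0 <= v ==> v <= s ==> norm (Z v - zq) <= r0) ==>
  (\<And>v. 0 <= v ==> v <= s ==> \<not> le3 0 (fld 0 (Z v)) & \<not> le3 (fld 0 (Z v)) 0) ==> norm (Z s - zq) <= K * norm (Z 0 - zq)"
proof -
 define c where "c = min (B / 2) (2 * r * k * c0)"
 have c: "c > 0" "c <= B / 2" "c <= 2 * r * k * c0" using B r k c0 by (auto simp: c_def)
 define M where "M = 4 * r * k"
 \<comment> \<open>The part \<open>8 * \<kappa> * M\<close> lets half of the damping
   \<open>B\<close> absorb the ice line terms, which are at most
   \<open>4 * \<kappa> * M * E\<close>; the other half yields the rate \<open>c\<close>.\<close>
 define K1 where "K1 = Lf + 8 * \<kappa> * M"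
 define K3 where "K3 = Lf + M"
 have M: "M > 0" using r k by (simp add: M_def)
 have K: "K1 > 0" "K3 > 0" "K1 >= Lf" "K3 >= Lf" using Lf(1) M \<kappa> by (simp_all add: K1_def K3_def add_pos_pos)
 show ?thesis
 proof (rule that[of "1 + (K1 + (K3 + M) + K3) / c"])
  show "1 + (K1 + (K3 + M) + K3) / c > 0" using K M c by (simp add: add_pos_pos)
  fix Z s assume Z: "ode (fld 0) Z" and s: "(s::real) >= 0" and inb: "\<And>v. 0 <= v ==> v <= s ==> norm (Z v - zq) <= r0"
   and mixd: "\<And>v. 0 <= v ==> v <= s ==> \<not> le3 0 (fld 0 (Z v)) & \<not> le3 (fld 0 (Z v)) 0"
  define \<rho> where "\<rho> = norm (Z 0 - zq)"
  have \<rho>: "\<rho> >= 0" by (simp add: \<rho>_def)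
  define W where "W t = Wc (Z t)" for t
  define P where "P t = Pc (Z t)" for t
  define N where "N t = Nc (Z t)" for t
  define w1 where "w1 t = B * (F0 + \<kappa> * (Phi (N t) - Phi (P t)) - W t)" for t
  \<comment> \<open>The velocity of the southern line is taken with reversed sign, so that an
    ordered velocity means three components of one sign.\<close>
  define w2 where "w2 t = r * (W t - (G0 + k * (P t)\<^sup>2))" for t
  define w3 where "w3 t = r * (W t - (G0 + k * (N t)\<^sup>2))" for t
  have rg: "-1 <= P v" "P v <= - c0" "c0 <= N v" "N v <= 1" if "0 <= v" "v <= s" for v
   using ball[OF inb[OF that]] by (simp_all add: P_def N_def)
  have fz: "fld 0 (Z v) = (w1 v, - w2 v, w3 v)" if "0 <= v" "v <= s" for v
  proof -
   have "Z v \<in> dom3" using rg[OF that] c0 by (simp add: dom3_def P_def N_def)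
   thus ?thesis by (simp add: fld_dom w1_def w2_def w3_def W_def P_def N_def)
  qed
  have cZ: "continuous_on {0..t} Z" for t by (rule continuous_on_subset[OF ode_continuous[OF Z]]) auto
  have cts: "continuous_on {0..t} W" "continuous_on {0..t} P" "continuous_on {0..t} N" for t
   unfolding W_def[abs_def] P_def[abs_def] N_def[abs_def] by (intro continuous_intros cZ)+
  have cPhi: "continuous_on {0..t} (%t. Phi (f t))" if "continuous_on {0..t} f" for f t
   unfolding Phi_def by (intro continuous_intros that)
  have cw: "continuous_on {0..t} w1" "continuous_on {0..t} w3" for t
   unfolding w1_def[abs_def] w3_def[abs_def] by (intro continuous_intros cts cPhi)+
  have dW: "(W has_real_derivative w1 v) (at v)" "(P has_real_derivative - w2 v) (at v)" "(N has_real_derivative w3 v) (at v)"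
   if v: "0 < v" "v <= s" for v
   using vd_comps[OF ode_at[OF Z v(1)]] fz[of v] v unfolding W_def[abs_def] P_def[abs_def] N_def[abs_def] by simp_all
  have fq: "fld 0 zq = 0" using zq by (simp add: eqm_def)
  have "norm (fld 0 (Z 0) - fld 0 zq) <= Lf * norm (Z 0 - zq)"
   using lipschitz_onD[OF Lf(2)[of 0], of "Z 0" zq] by (simp add: dist_norm)
  hence f0: "norm (fld 0 (Z 0)) <= Lf * \<rho>" by (simp add: fq \<rho>_def)
  have "\<bar>w1 0\<bar> <= Lf * \<rho>" "\<bar>w3 0\<bar> <= Lf * \<rho>"
   using order_trans[OF abs_Wc_le f0] order_trans[OF abs_Nc_le f0] fz[of 0] s by simp_all
  moreover have "Lf * \<rho> <= K1 * \<rho>" "Lf * \<rho> <= K3 * \<rho>" using K \<rho> by (simp_all add: mult_right_mono)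
  ultimately have w0: "\<bar>w1 0\<bar> <= K1 * \<rho>" "\<bar>w3 0\<bar> <= K3 * \<rho>" by linarith+
  \<comment> \<open>With equal critical temperatures both ice lines obey the same law, so their
    asymmetry decays exponentially whatever the temperature does. Hence \<open>w2\<close> and
    \<open>w3\<close> differ little.\<close>
  define D where "D t = - P t - N t" for t
  have sym: "Pc zq = - Nc zq"
  proof -
   have "Wc zq = G0 + k * (Pc zq)\<^sup>2" "Wc zq = G0 + k * (Nc zq)\<^sup>2" using zq unfolding eqm_iff by auto
   hence "k * (Pc zq)\<^sup>2 = k * (Nc zq)\<^sup>2" by linarith
   hence "(Pc zq)\<^sup>2 = (Nc zq)\<^sup>2" using k by simp
   thus ?thesis using eqm_signs[OF zq] by (auto simp: power2_eq_iff)
  qed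
  have D0: "\<bar>D 0\<bar> <= 2 * \<rho>"
   using abs_Pc_le[of "Z 0 - zq"] abs_Nc_le[of "Z 0 - zq"] sym by (simp add: D_def P_def N_def \<rho>_def)
  have D_eq: "w2 v - w3 v = - (r * k * (N v - P v)) * D v" for v
   by (simp add: w2_def w3_def D_def power2_eq_square algebra_simps)
  have sgD: "g * D t <= 2 * \<rho> * exp (- c * t)" if g: "g = 1 \<or> g = -1" and t: "0 <= t" "t <= s" for g t
  proof (rule exp_barrier[OF t(1)])
   show "continuous_on {0..t} (%t. g * D t)" unfolding D_def by (intro continuous_intros cts)
   show "g * D 0 <= 2 * \<rho>" using D0 g by (auto simp: abs_le_iff)
   fix v assume v: "0 < v" "v < t" and big: "g * D v > 2 * \<rho> * exp (- c * v)"
   have vs: "0 <= v" "v <= s" using v t by auto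
   have "2 * \<rho> * exp (- c * v) >= 0" using \<rho> by simp
   hence pos: "g * D v >= 0" using big by linarith
   have "((%t. g * D t) has_real_derivative g * (- (- w2 v) - w3 v)) (at v)"
    unfolding D_def by (intro DERIV_cmult DERIV_diff DERIV_minus dW) (use v vs in auto)
   moreover have "g * (- (- w2 v) - w3 v) <= - c * (2 * \<rho> * exp (- c * v))"
   proof -
    have "r * k * (2 * c0) <= r * k * (N v - P v)" using rg[OF vs] r k by (intro mult_left_mono) auto
    hence "c <= r * k * (N v - P v)" using c(3) by simp
    hence "c * (g * D v) <= r * k * (N v - P v) * (g * D v)" using pos by (rule mult_right_mono)
    moreover have "c * (2 * \<rho> * exp (- c * v)) <= c * (g * D v)" using big c(1) by simp
    ultimately have "- (r * k * (N v - P v)) * (g * D v) <= - c * (2 * \<rho> * exp (- c * v))" by simp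
    thus ?thesis using D_eq[of v] by (simp add: mult.left_commute mult.assoc)
   qed
   ultimately show "\<exists>d. ((%t. g * D t) has_real_derivative d) (at v) & d <= - c * (2 * \<rho> * exp (- c * v))" by blast
  qed
  define E where "E t = \<rho> * exp (- c * t)" for t
  have E0: "E t >= 0" for t using \<rho> by (simp add: E_def)
  have gap: "\<bar>w2 t - w3 t\<bar> <= M * E t" if t: "0 <= t" "t <= s" for t
  proof -
   have "\<bar>D t\<bar> <= 2 * E t" using sgD[of 1 t] sgD[of "-1" t] t by (simp add: abs_le_iff E_def)
   moreover have "0 <= N t - P t" "N t - P t <= 2" using rg[OF t] c0 by auto
   ultimately have "\<bar>N t - P t\<bar> * \<bar>D t\<bar> <= 2 * (2 * E t)" by (intro mult_mono) auto
   hence "r * k * (\<bar>N t - P t\<bar> * \<bar>D t\<bar>) <= r * k * (2 * (2 * E t))" using r k by (intro mult_left_mono) auto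
   thus ?thesis unfolding D_eq M_def abs_mult abs_minus_cancel using r k by (simp add: mult_ac)
  qed
  have mx: "\<not> (0 <= g * w1 v & 0 <= g * w2 v & 0 <= g * w3 v)" if g: "g = 1 \<or> g = -1" and v: "0 <= v" "v <= s" for g v
   using mixd[OF v] g unfolding fz[OF v] le3_def by auto
  have sgg: "\<bar>g * y\<bar> = \<bar>y\<bar>" if "g = 1 \<or> g = -1" for g y :: real using that by auto
  \<comment> \<open>Above the barrier \<open>g * w1\<close> is positive, so one of
    \<open>g * w2\<close>, \<open>g * w3\<close> is negative; by \<open>gap\<close> both are at most
    \<open>M * E\<close>, and the heat balance damps \<open>w1\<close>.\<close>
  have b1: "g * w1 t <= K1 * \<rho> * exp (- c * t)" if g: "g = 1 \<or> g = -1" and t: "0 <= t" "t <= s" for g t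
  proof (rule exp_barrier[OF t(1)])
   show "continuous_on {0..t} (%t. g * w1 t)" by (intro continuous_intros cw)
   show "g * w1 0 <= K1 * \<rho>" using w0 g by (auto simp: abs_le_iff)
   fix v assume v: "0 < v" "v < t" and big: "g * w1 v > K1 * \<rho> * exp (- c * v)"
   have vs: "0 <= v" "v <= s" using v t by auto
   have big': "g * w1 v > K1 * E v" using big by (simp add: E_def mult.assoc)
   have "K1 * E v >= 0" using K E0[of v] by simp
   hence "\<not> (0 <= g * w2 v & 0 <= g * w3 v)" using mx[OF g vs] big' by linarith
   moreover have "\<bar>g * w2 v - g * w3 v\<bar> <= M * E v" using gap[OF vs] sgg[OF g, of "w2 v - w3 v"] by (simp add: right_diff_distrib)
   moreover have me: "M * E v >= 0" using M E0[of v] by simp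
   ultimately have sm: "g * w2 v <= M * E v" "g * w3 v <= M * E v" by (auto simp: abs_le_iff)
   have sdb: "0 <= sd y & sd y <= 2" if "-1 <= y" "y <= 1" for y
    using sd_pos[OF that] sd_bounds(2)[of y] q by simp
   have s2: "sd y * (g * z) <= 2 * (M * E v)" if "-1 <= y" "y <= 1" "g * z <= M * E v" for y z
   proof -
    have "sd y * (g * z) <= sd y * (M * E v)" using sdb[OF that(1,2)] that(3) by (intro mult_left_mono) auto
    also have "... <= 2 * (M * E v)" using sdb[OF that(1,2)] me by (intro mult_right_mono) auto
    finally show ?thesis .
   qed
   have "((%t. g * w1 t) has_real_derivative g * (B * (0 + \<kappa> * (sd (N v) * w3 v - sd (P v) * (- w2 v)) - w1 v))) (at v)"
   proof -
    have "((%t. g * (B * (F0 + \<kappa> * (Phi (N t) - Phi (P t)) - W t))) has_real_derivative g * (B * (0 + \<kappa> * (sd (N v) * w3 v - sd (P v) * (- w2 v)) - w1 v))) (at v)"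
     by (intro DERIV_cmult DERIV_diff DERIV_add DERIV_const DERIV_chain2[OF Phi_deriv] dW v(1) vs(2))
    thus ?thesis by (simp only: w1_def[symmetric])
   qed
   moreover have "g * (B * (0 + \<kappa> * (sd (N v) * w3 v - sd (P v) * (- w2 v)) - w1 v)) <= - c * (K1 * \<rho> * exp (- c * v))"
   proof -
    have eq: "g * (B * (0 + \<kappa> * (sd (N v) * w3 v - sd (P v) * (- w2 v)) - w1 v)) = B * \<kappa> * (sd (N v) * (g * w3 v) + sd (P v) * (g * w2 v)) - B * (g * w1 v)"
     by (simp add: algebra_simps)
    have "sd (N v) * (g * w3 v) + sd (P v) * (g * w2 v) <= 4 * (M * E v)"
     using s2[of "N v" "w3 v"] s2[of "P v" "w2 v"] rg[OF vs] sm c0 by simp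
    hence 1: "B * \<kappa> * (sd (N v) * (g * w3 v) + sd (P v) * (g * w2 v)) <= B * \<kappa> * (4 * (M * E v))" using B \<kappa> by (intro mult_left_mono) auto
    have 2: "B * (K1 * E v) <= B * (g * w1 v)" using big' B by simp
    have "8 * \<kappa> * M * E v <= K1 * E v" using E0[of v] Lf(1) by (intro mult_right_mono) (auto simp: K1_def)
    hence 3: "B / 2 * (8 * \<kappa> * M * E v) <= B / 2 * (K1 * E v)" using B by (intro mult_left_mono) auto
    have 4: "c * (K1 * E v) <= B / 2 * (K1 * E v)" using c(2) K E0[of v] by (intro mult_right_mono) auto
    have "B * \<kappa> * (4 * (M * E v)) - B * (K1 * E v) <= - (c * (K1 * E v))" using 3 4 by (simp add: algebra_simps)
    hence "g * (B * (0 + \<kappa> * (sd (N v) * w3 v - sd (P v) * (- w2 v)) - w1 v)) <= - (c * (K1 * E v))" unfolding eq using 1 2 by linarith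
    thus ?thesis by (simp add: E_def mult.assoc)
   qed
   ultimately show "\<exists>d. ((%t. g * w1 t) has_real_derivative d) (at v) & d <= - c * (K1 * \<rho> * exp (- c * v))" by blast
  qed
  \<comment> \<open>Here \<open>gap\<close> makes \<open>g * w2\<close> nonnegative together with
    \<open>g * w3\<close>, so \<open>g * w1\<close> must be negative, and the ice line equation
    damps \<open>w3\<close>.\<close>
  have b3: "g * w3 t <= K3 * \<rho> * exp (- c * t)" if g: "g = 1 \<or> g = -1" and t: "0 <= t" "t <= s" for g t
  proof (rule exp_barrier[OF t(1)])
   show "continuous_on {0..t} (%t. g * w3 t)" by (intro continuous_intros cw)
   show "g * w3 0 <= K3 * \<rho>" using w0 g by (auto simp: abs_le_iff)
   fix v assume v: "0 < v" "v < t" and big: "g * w3 v > K3 * \<rho> * exp (- c * v)"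
   have vs: "0 <= v" "v <= s" using v t by auto
   have "K3 * E v >= M * E v" using Lf(1) E0[of v] by (intro mult_right_mono) (auto simp: K3_def)
   hence big': "g * w3 v > K3 * E v" "g * w3 v > M * E v" using big by (simp_all add: E_def mult.assoc)
   have me: "M * E v >= 0" using M E0[of v] by simp
   have "\<bar>g * w2 v - g * w3 v\<bar> <= M * E v" using gap[OF vs] sgg[OF g, of "w2 v - w3 v"] by (simp add: right_diff_distrib)
   hence "g * w2 v >= 0" using big'(2) by (simp add: abs_le_iff)
   hence neg: "g * w1 v < 0" using mx[OF g vs] big'(2) me by linarith
   have "((%t. g * w3 t) has_real_derivative g * (r * (w1 v - (0 + k * (2 * N v * w3 v))))) (at v)"
   proof -
    have "((%t. g * (r * (W t - (G0 + k * (N t)\<^sup>2)))) has_real_derivative g * (r * (w1 v - (0 + k * (of_nat 2 * (w3 v * N v ^ (2 - Suc 0))))))) (at v)"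
     by (intro DERIV_cmult DERIV_diff DERIV_add DERIV_const DERIV_power dW v(1) vs(2))
    hence "((%t. g * w3 t) has_real_derivative g * (r * (w1 v - (0 + k * (of_nat 2 * (w3 v * N v ^ (2 - Suc 0))))))) (at v)"
     by (simp only: w3_def[symmetric])
    thus ?thesis by (simp add: mult_ac)
   qed
   moreover have "g * (r * (w1 v - (0 + k * (2 * N v * w3 v)))) <= - c * (K3 * \<rho> * exp (- c * v))"
   proof -
    have eq: "g * (r * (w1 v - (0 + k * (2 * N v * w3 v)))) = r * (g * w1 v) - 2 * r * k * N v * (g * w3 v)" by (simp add: algebra_simps)
    have "r * (g * w1 v) <= 0" by (rule mult_nonneg_nonpos) (use r neg in auto)
    moreover have "2 * r * k * c0 * (g * w3 v) <= 2 * r * k * N v * (g * w3 v)"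
     using rg(3)[OF vs] r k big'(2) me by (intro mult_right_mono mult_left_mono) auto
    moreover have "c * (g * w3 v) <= 2 * r * k * c0 * (g * w3 v)" using c(3) big'(2) me by (intro mult_right_mono) auto
    moreover have "c * (K3 * E v) <= c * (g * w3 v)" using c(1) big'(1) by simp
    ultimately have "g * (r * (w1 v - (0 + k * (2 * N v * w3 v)))) <= - (c * (K3 * E v))" unfolding eq by linarith
    thus ?thesis by (simp add: E_def mult.assoc)
   qed
   ultimately show "\<exists>d. ((%t. g * w3 t) has_real_derivative d) (at v) & d <= - c * (K3 * \<rho> * exp (- c * v))" by blast
  qed
  have W1: "\<bar>w1 t\<bar> <= K1 * \<rho> * exp (- c * t)" and W3: "\<bar>w3 t\<bar> <= K3 * \<rho> * exp (- c * t)"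
   and W2: "\<bar>- w2 t\<bar> <= (K3 + M) * \<rho> * exp (- c * t)" if t: "0 <= t" "t <= s" for t
  proof -
   show "\<bar>w1 t\<bar> <= K1 * \<rho> * exp (- c * t)" using b1[of 1 t] b1[of "-1" t] t by (simp add: abs_le_iff)
   show 3: "\<bar>w3 t\<bar> <= K3 * \<rho> * exp (- c * t)" using b3[of 1 t] b3[of "-1" t] t by (simp add: abs_le_iff)
   have "(K3 + M) * \<rho> * exp (- c * t) = K3 * \<rho> * exp (- c * t) + M * E t" by (simp add: E_def algebra_simps)
   thus "\<bar>- w2 t\<bar> <= (K3 + M) * \<rho> * exp (- c * t)" using 3 gap[OF t] by linarith
  qed
  have i1: "\<bar>W s - W 0\<bar> <= K1 * \<rho> / c"
  proof (rule exp_integral_bound[OF s cts(1) c(1)])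
   show "\<exists>d. (W has_real_derivative d) (at t) & \<bar>d\<bar> <= K1 * \<rho> * exp (- c * t)" if "0 < t" "t < s" for t
    using dW(1)[of t] W1[of t] that by (intro exI conjI) auto
  qed (use K \<rho> in simp)
  have i2: "\<bar>P s - P 0\<bar> <= (K3 + M) * \<rho> / c"
  proof (rule exp_integral_bound[OF s cts(2) c(1)])
   show "\<exists>d. (P has_real_derivative d) (at t) & \<bar>d\<bar> <= (K3 + M) * \<rho> * exp (- c * t)" if "0 < t" "t < s" for t
    using dW(2)[of t] W2[of t] that by (intro exI[of _ "- w2 t"] conjI) auto
  qed (use K M \<rho> in simp)
  have i3: "\<bar>N s - N 0\<bar> <= K3 * \<rho> / c"
  proof (rule exp_integral_bound[OF s cts(3) c(1)])
   show "\<exists>d. (N has_real_derivative d) (at t) & \<bar>d\<bar> <= K3 * \<rho> * exp (- c * t)" if "0 < t" "t < s" for t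
    using dW(3)[of t] W3[of t] that by (intro exI conjI) auto
  qed (use K \<rho> in simp)
  have "norm (Z s - Z 0) <= K1 * \<rho> / c + (K3 + M) * \<rho> / c + K3 * \<rho> / c"
   using norm3_le[of "Z s - Z 0"] i1 i2 i3 by (simp add: W_def P_def N_def)
  also have "... = (K1 + (K3 + M) + K3) / c * \<rho>" by (simp add: add_divide_distrib algebra_simps)
  finally show "norm (Z s - zq) <= (1 + (K1 + (K3 + M) + K3) / c) * norm (Z 0 - zq)"
   using norm_triangle_ineq[of "Z s - Z 0" "Z 0 - zq"] by (simp add: \<rho>_def distrib_right)
 qed
qed

end

context climate_nodes begin

text \<open>The rising orbit starts at a sub-equilibrium other than \<open>z\<close>, hence above
  \<open>z\<close> in \<open>w\<close>. Two distinct equilibria of slope at least 1 would each lie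
  above the other, so the limit has slope below 1 and is \<open>Qp\<close>.\<close>

lemma saddle_limit:
 assumes q: "eqm 0 z" "lam z >= 1" and z0: "ode (fld (ta True)) z0" "le3 0 (fld 0 (z0 0))"
  and i: "z0 0 \<in> dom3" "Pc (z0 0) < 0" "0 < Nc (z0 0)" "z0 0 \<noteq> z"
  and w: "eqm (ta True) w" "\<And>e. e > 0 ==> \<exists>t\<ge>0. norm (z0 t - w) < e"
 shows "w = QQ True"
proof -
 have ta: "ta True = 0" by (simp add: ta_def)
 have w0: "eqm 0 w" using w(1) ta by simp
 have "Wc z < Wc (z0 0)"
  using subeq_above_saddle[of 0 "z0 0" 0 z] q i z0(2) by (simp add: subeq_def)
 moreover have "Wc (z0 0) <= Wc (z0 t)" if "t >= 0" for t
  using flow_increasing[OF z0(1)[unfolded ta] z0(2) order_refl that] by (simp add: le3_def)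
 hence "Wc (z0 0) <= Wc w" using accum_le(2)[OF w(2)] by blast
 ultimately have lt: "Wc z < Wc w" by simp
 have l: "lam w < 1"
 proof (rule ccontr)
  assume "\<not> lam w < 1"
  hence "Wc w < Wc z" using subeq_above_saddle[OF eqm_subeq[OF q(1)] w0] lt by auto
  thus False using lt by simp
 qed
 have "le3 Qp w" by (rule eqm_le_node[OF Qp(1) w0 _ _ l]) simp_all
 moreover have "le3 w Qp" by (rule eqm_le_Qp[OF w0]) simp
 ultimately show ?thesis using le3_antisym by (simp add: QQ_def)
qed

text \<open>Once it leaves an unstable equilibrium upwards, a solution in the phase \<open>True\<close> either
 meets the switching manifold nearby, which is excluded, or continues up to the node.\<close>

lemma no_leave:
 assumes d: "d True > 0" and q: "eqm 0 z" "lam z >= 1"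
  and sig: "\<rho>1 > 0" "\<And>e x t. 0 < e ==> e < \<rho>1 ==> trap d e x ==> hh (x t) = 0 ==> norm (zp (x t) - z) >= \<rho>1"
  and w: "w \<noteq> z" "norm (w - z) < \<rho>1" "inreg w" "le3 0 (fld 0 w)" "fld 0 w \<noteq> 0"
 shows "\<exists>\<delta>>0. \<forall>e x t. 0 < e --> e < \<delta> --> trap d e x --> hh (x t) > 0 --> norm (zp (x t) - w) >= \<delta>"
proof -
 have ta: "ta True = 0" by (simp add: ta_def)
 obtain z0 where z0: "z0 0 = w" "ode (fld (ta True)) z0" using flow3_exists by blast
 have wi: "-1 < Pc w" "Pc w < 0" "0 < Nc w" "Nc w < 1" using w(3) by (auto simp: inreg_def)
 have wd: "z0 0 \<in> dom3" using wi z0 by (simp add: dom3_def)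
 have lim: "v = QQ True" if "eqm (ta True) v" "\<And>e. e > 0 ==> \<exists>t\<ge>0. norm (z0 t - v) < e" for v
  by (rule saddle_limit[OF q z0(2) _ wd _ _ _ that]) (use w wi z0 in auto)
 have nQ: "z0 0 \<noteq> QQ True" using QQ(1)[of True] w(5) z0(1) ta by (auto simp: eqm_def)
 obtain T \<rho> where T: "T > 0" "\<rho> > 0" "\<And>v. norm (v - z0 T) < \<rho> ==> v \<in> dom3 ==> nearv True (d True) v (QQ True)"
  using ends[OF z0(2) wd nQ d lim] by blast
 have z00: "ode (fld 0) z0" using z0(2) ta by simp
 define \<mu> where "\<mu> = (\<rho>1 - norm (w - z)) / 2"
 have \<mu>: "\<mu> > 0" "norm (w - z) + \<mu> + \<mu> = \<rho>1" using w(2) by (simp_all add: \<mu>_def)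
 have cz: "continuous_on {0..} z0" by (rule ode_continuous[OF z00])
 obtain tc where tc: "tc > 0" "\<And>s. s \<in> {0..} ==> dist s 0 < tc ==> dist (z0 s) (z0 0) < \<mu>"
  using cz \<mu>(1) unfolding continuous_on_iff by (metis atLeast_iff order_refl)
 \<comment> \<open>Up to \<open>tm\<close> the exact orbit is close enough to \<open>z\<close> that
   a meeting with the manifold is excluded by \<open>sig\<close>; afterwards the gain of the
   northern line prevents it.\<close>
 define tm where "tm = tc / 2"
 have tm: "tm > 0" using tc by (simp add: tm_def)
 have early: "norm (z0 s - z) < \<rho>1 - \<mu>" if s: "0 <= s" "s <= tm" for s
 proof -
  have "norm (z0 s - w) < \<mu>" using tc(2)[of s] s tc(1) z0(1) by (simp add: tm_def dist_norm)
  thus ?thesis using norm_triangle_ineq[of "z0 s - w" "w - z"] \<mu>(2) by simp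
 qed
 define g where "g = Nc (z0 tm) - Nc w"
 \<comment> \<open>Strict growth of the northern line gives a gain by the time \<open>tm\<close>,
   and monotonicity keeps it.\<close>
 have g: "g > 0" using increasing_N_strict[OF z00 _ _ _ _ tm] z0(1) wi w(4,5) by (simp add: g_def)
 have lateN: "Nc (z0 s) >= Nc w + g" if "tm <= s" for s
  using flow_increasing[OF z00 _ less_imp_le[OF tm] that] z0(1) w(4) by (simp add: g_def le3_def)
 define E where "E = exp (Lf * T)"
 have E: "E >= 1" using Lf(1) T by (simp add: E_def)
 define m where "m = min \<rho> (min \<mu> (g / 4)) / 2"
 have m: "m > 0" "m < \<rho>" "m < \<mu>" "m <= g / 4" using T(2) \<mu>(1) g by (auto simp: m_def)
 define X where "X = CX (be True) 1"
 define e0 where "e0 = min \<rho>1 ((a + b) * (g / 2) / (b * (\<bar>X\<bar> + 1) * T))"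
 have e0: "e0 > 0" using sig(1) ab g T by (simp add: e0_def)
 show ?thesis
 proof (rule exI[of _ "min e0 (m / E)"], intro conjI allI impI)
  show "min e0 (m / E) > 0" using e0 m E by simp
  fix e x t assume e: "0 < e" "e < min e0 (m / E)" and tr: "trap d e x" and h: "hh (x t) > 0"
  show "norm (zp (x t) - w) >= min e0 (m / E)"
  proof (rule ccontr)
   assume "\<not> ?thesis"
   hence "norm (zp (x t) - w) < m / E" by simp
   hence n0: "E * norm (zp (x t) - w) < m" using E by (simp add: pos_less_divide_eq mult.commute)
   obtain f where f: "f 0 = x t" "ode (fld4 (ta True) (be True) e) f" using flow4_exists by blast
   have near: "norm (zp (f s) - z0 s) < m" if s: "0 <= s" "s <= T" for s
   proof -
    have "norm (zp (f s) - z0 s) <= exp (Lf * s) * norm (zp (x t) - w)"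
     using flow3_dist[OF flow4_zp[OF f(2)] z0(2) s(1)] by (simp add: f(1) z0(1))
    also have "... <= E * norm (zp (x t) - w)" unfolding E_def using s Lf(1) by (intro mult_right_mono) auto
    finally show ?thesis using n0 by simp
   qed
   have xf: "x (t + s) = f s" if "0 <= s" "s <= S" "\<And>v. 0 <= v ==> v < S ==> HH True (f v) > 0" for s S
    using follow[OF trap_gsol[OF tr] f(2) _ that(3) that(1,2)] f(1) by simp
   have pos: "HH True (f s) > 0" if s: "0 <= s" "s <= T" for s
   proof (rule ccontr)
    assume n: "\<not> HH True (f s) > 0"
    have c: "continuous_on {0..s} (%s. HH True (f s))"
     unfolding HH_sg by (intro continuous_intros flow4_cont(4)[OF f(2)]) auto
    have h0: "HH True (f 0) > 0" using h f(1) by (simp add: HH_def)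
    obtain S where S: "0 < S" "S <= s" "HH True (f S) = 0" "\<And>v. 0 <= v ==> v < S ==> HH True (f v) > 0"
     by (rule first_zero[OF s(1) c h0]) (use n in auto)
    have ST: "0 <= S" "S <= T" using S s by auto
    have xS: "x (t + v) = f v" if "0 <= v" "v <= S" for v by (rule xf[OF that S(4)])
    show False
    proof (cases "S <= tm")
     case True
     have "hh (x (t + S)) = 0" using S(3) xS[of S] S(1) by (simp add: HH_def)
     hence "norm (zp (x (t + S)) - z) >= \<rho>1" using e by (intro sig(2)[OF e(1) _ tr]) (auto simp: e0_def)
     moreover have "norm (zp (f S) - z) < m + (\<rho>1 - \<mu>)"
      using norm_triangle_ineq[of "zp (f S) - z0 S" "z0 S - z"] near[OF ST] early[OF ST(1) True] by simp
     ultimately show False using xS[of S] S(1) m(3) by simp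
    next
     case False
     have nb: "\<bar>Nc (zp (f v))\<bar> <= 1" if "0 <= v" "v <= S" for v
      using phase_bounds[OF trap_phase[OF tr, of "t + v"]] xS[OF that] by simp
     have "0 <= a * (1 + 1) / be True" using ab be_pos[of True] by simp
     hence xb: "\<bar>Xc (f 0)\<bar> <= XB (be True) 1" using phase_bounds[OF trap_phase[OF tr, of t]] f(1) by (simp add: XB_def)
     have mv: "\<bar>Xc (f S) - Xc (f 0)\<bar> <= e * X * (S - 0)"
      unfolding X_def by (rule xi_move[OF f(2) be_pos e(1) order_refl ST(1) nb xb])
     have "\<bar>Nc (zp (f S)) - Nc (z0 S)\<bar> <= m" "\<bar>Nc (zp (f 0)) - Nc w\<bar> <= m"
      using order_trans[OF abs_Nc_le less_imp_le[OF near[OF ST]]] order_trans[OF abs_Nc_le less_imp_le[OF near[of 0]]] T z0(1) by simp_all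
     hence "Nc (zp (f S)) - Nc (zp (f 0)) >= g / 2" using lateN[of S] False m(4) by (auto simp: abs_le_iff)
     hence 1: "(a + b) * (sg True * (Nc (zp (f S)) - Nc (zp (f 0)))) >= (a + b) * (g / 2)"
      using ab by (intro mult_left_mono) (auto simp: sg_def)
     have "e < (a + b) * (g / 2) / (b * (\<bar>X\<bar> + 1) * T)" using e(2) by (simp add: e0_def)
     hence 2: "e * (b * (\<bar>X\<bar> + 1) * T) < (a + b) * (g / 2)" using ab T by (simp add: pos_less_divide_eq)
     have "X * S <= (\<bar>X\<bar> + 1) * T" using ST by (intro mult_mono) auto
     hence "b * e * (X * S) <= b * e * ((\<bar>X\<bar> + 1) * T)" using ab e by (intro mult_left_mono) auto
     hence 3: "b * (e * X * (S - 0)) <= e * (b * (\<bar>X\<bar> + 1) * T)" by (simp add: mult_ac)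
     show False using HH_lower[OF mv, of True] 1 2 3 S(3) h0 by linarith
    qed
   qed
   have xT: "x (t + T) = f T" by (rule xf[of T T]) (use T pos in auto)
   have "nearv True (d True) (zp (x (t + T))) (QQ True)"
   proof (rule T(3))
    show "norm (zp (x (t + T)) - z0 T) < \<rho>" using near[of T] T m(2) xT by simp
    show "zp (x (t + T)) \<in> dom3" using phase_bounds[OF trap_phase[OF tr, of "t + T"]] by simp
   qed
   hence "bas d (x (t + T))" unfolding bas_def
    using trap_phase[OF tr, of "t + T"] pos[of T] xT T by (intro conjI exI[of _ True]) auto
   thus False using trap_not_bas[OF tr] by blast
  qed
 qed
qed

text \<open>Every mixed field lies below \<open>fld 0\<close>, so the periodic solution stays below
  the orbit \<open>z0\<close>, which descends from the same point. After one period the solution is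
  back, so \<open>z0\<close> cannot have moved.\<close>

lemma no_maximum:
 assumes p: "per e x" and f: "le3 (fld 0 (zp (x t))) 0"
 shows "fld 0 (zp (x t)) = 0"
proof -
 obtain P where g: "gsol e UNIV x" and ps: "\<And>t. x t \<in> phase_space" and P: "P > 0" "\<And>t. x (t + P) = x t" using p by (auto simp: per_def)
 obtain Z where Z: "negligible Z" "\<forall>t\<in>UNIV - Z. \<exists>y\<in>incl e (x t). (x has_vector_derivative y) (at t)"
  using g unfolding gsol_def by blast
 obtain z0 where z0: "z0 0 = zp (x t)" "ode (fld 0) z0" using flow3_exists by blast
 have f0: "le3 (fld 0 (z0 0)) 0" using f z0 by simp
 define X where "X s = zp (x (t + s))" for s
 have "negligible ((+) (- t) ` Z)" by (rule negligible_translation[OF Z(1)])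
 have le: "le3 (X P) (z0 P)"
 proof (rule compare[OF less_imp_le[OF P(1)] _ flow3_lips[OF z0(2) order_refl] \<open>negligible ((+) (- t) ` Z)\<close>])
  have "gsol e UNIV (%s. x (s + t))" by (rule gsol_shift[OF g]) simp
  hence "lips {0..P} (%s. x (s + t))" by (rule gsol_lips) simp
  thus "lips {0..P} X" unfolding X_def[abs_def] by (intro lips_zp) (simp add: add.commute)
  show "le3 (X 0) (z0 0)" by (simp add: X_def z0(1))
  fix s assume s: "s \<in> {0<..<P} - (+) (- t) ` Z"
  have "t + s \<notin> Z" using s by (auto simp: image_iff)
  then obtain y where y: "y \<in> incl e (x (t + s))" "(x has_vector_derivative y) (at (t + s))" using Z(2) by blast
  then obtain v where v: "y = mix v e (x (t + s))" "0 <= v" "v <= 1" by (auto simp: incl_def)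
  have "((%s. t + s) has_vector_derivative 1) (at s)" by (auto intro!: derivative_eq_intros)
  from vector_diff_chain_at[OF this y(2)] have "((%s. x (t + s)) has_vector_derivative y) (at s)" by (simp add: o_def)
  hence "(X has_vector_derivative zp y) (at s)" unfolding X_def[abs_def] by (rule vd_zp)
  moreover have "le3 (zp y) (fld 0 (X s))"
   using mix_beta[OF v(2,3)] r unfolding v(1) mix_comps X_def by (subst fld_tau) (simp add: le3_def)
  moreover have "s > 0" using s by simp
  ultimately show "\<exists>d e. (X has_vector_derivative d) (at s) & (z0 has_vector_derivative e) (at s) & le3 d (fld 0 (X s)) & le3 (fld 0 (z0 s)) e"
   using ode_at[OF z0(2)] le3_refl by blast
 qed
 have "X P = z0 0" using P(2)[of t] z0(1) by (simp add: X_def)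
 have const: "z0 s = z0 0" if s: "0 < s" "s < P" for s
 proof (rule le3_antisym)
  show "le3 (z0 s) (z0 0)" by (rule flow_decreasing[OF z0(2) f0]) (use s in auto)
  have "le3 (z0 P) (z0 s)" by (rule flow_decreasing[OF z0(2) f0]) (use s in auto)
  thus "le3 (z0 0) (z0 s)" using le \<open>X P = z0 0\<close> le3_trans by metis
 qed
 have h: "0 < P / 2" "P / 2 < P" using P(1) by auto
 note dv = vd_comps[OF ode_at[OF z0(2) h(1)]]
 have "Wc (fld 0 (z0 (P / 2))) = 0" by (rule const_deriv_zero[OF _ dv(1) h]) (simp add: const)
 moreover have "Pc (fld 0 (z0 (P / 2))) = 0" by (rule const_deriv_zero[OF _ dv(2) h]) (simp add: const)
 moreover have "Nc (fld 0 (z0 (P / 2))) = 0" by (rule const_deriv_zero[OF _ dv(3) h]) (simp add: const)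
 ultimately show ?thesis using const[OF h] z0(1) by (simp add: prod_eq_iff)
qed

end

context climate_nodes begin

lemma no_node_near:
 assumes d: "d True > 0"
 shows "\<exists>\<delta>>0. \<forall>e x t. 0 < e --> e < \<delta> --> trap d e x --> hh (x t) > 0 --> norm (zp (x t) - Qp) >= \<delta>"
proof (intro exI[of _ "Vm True * d True"] conjI allI impI)
 show "Vm True * d True > 0" using Vm d by simp
 fix e x t assume tr: "trap d e x" and h: "hh (x t) > 0"
 show "norm (zp (x t) - Qp) >= Vm True * d True"
 proof (rule ccontr)
  assume "\<not> ?thesis"
  hence "nearv True (d True) (zp (x t)) (QQ True)" using d by (intro norm_nearv) (auto simp: QQ_def)
  hence "bas d (x t)" unfolding bas_def using trap_phase[OF tr] h by (intro conjI exI[of _ True]) (auto simp: HH_def)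
  thus False using trap_not_bas[OF tr] by blast
 qed
qed

text \<open>The solution has to leave a ball around the saddle, and not through the manifold. Its
  velocity cannot point up when it reaches the sphere, by \<open>no_leave\<close>, and cannot point
  down at any time, by \<open>no_maximum\<close>; a velocity that is never ordered does not carry it
  to the sphere, by \<open>saddle_decay\<close>.\<close>

lemma no_saddle_near:
 assumes d: "\<And>u. d u > 0" and q: "eqm 0 z" "lam z >= 1"
 shows "\<exists>\<delta>>0. \<forall>e x t. 0 < e --> e < \<delta> --> trap d e x --> hh (x t) > 0 --> norm (zp (x t) - z) >= \<delta>"
proof -
 have ta: "ta True = 0" by (simp add: ta_def)
 obtain \<rho>1 where sig: "\<rho>1 > 0" "\<And>e x t. 0 < e ==> e < \<rho>1 ==> trap d e x ==> hh (x t) = 0 ==> norm (zp (x t) - z) >= \<rho>1"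
  by (rule no_sigma_near[where d=d, OF d q(1) order_refl dl]) (rule that)
 have zQ: "z \<noteq> Qp" using q(2) Qp(2) by auto
 have sg: "Pc z < 0" "0 < Nc z" using eqm_signs[OF q(1)] by simp_all
 have "le3 z Qp" by (rule eqm_le_Qp[OF q(1)]) simp
 hence bd: "-1 < Pc z" "Nc z < 1" using Qp(3,4) by (auto simp: le3_def)
 define c0 where "c0 = min (min (- Pc z) (Nc z)) (min (1 + Pc z) (1 - Nc z)) / 2"
 have c0: "c0 > 0" "2 * c0 <= - Pc z" "2 * c0 <= Nc z" "2 * c0 <= 1 + Pc z" "2 * c0 <= 1 - Nc z" using sg bd by (auto simp: c0_def)
 define r0 where "r0 = min c0 (min (\<rho>1 / 2) (norm (Qp - z) / 2))"
 have r0: "r0 > 0" "r0 <= c0" "r0 < \<rho>1" using c0(1) sig(1) zQ by (auto simp: r0_def)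
 have "r0 <= norm (Qp - z) / 2" unfolding r0_def by (simp only: min.coboundedI2 min.cobounded2)
 moreover have "0 < norm (Qp - z)" using zQ by simp
 ultimately have r0Q: "r0 < norm (Qp - z)" by linarith
 have ball: "-1 < Pc v & Pc v <= - c0 & c0 <= Nc v & Nc v <= 1 - c0" if "norm (v - z) <= r0" for v
 proof -
  have "\<bar>Pc v - Pc z\<bar> <= c0" "\<bar>Nc v - Nc z\<bar> <= c0" using abs_Pc_le[of "v - z"] abs_Nc_le[of "v - z"] that r0(2) by simp_all
  thus ?thesis using c0 by (auto simp: abs_le_iff)
 qed
 have binr: "inreg v" if "norm (v - z) <= r0" for v using ball[OF that] c0(1) by (simp add: inreg_def)
 \<comment> \<open>The points of the sphere at which a solution could leave upwards; compactness
   makes the bounds of \<open>no_leave\<close> uniform over them.\<close>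
 define S where "S = {v. norm (v - z) = r0} \<inter> {v. le3 0 (fld 0 v)}"
 have cS: "compact S"
 proof -
  have "{v. norm (v - z) = r0} = sphere z r0" by (auto simp: sphere_def dist_norm norm_minus_commute)
  moreover have "closed {v. le3 0 (fld 0 v)}"
   using closed_vimage[OF closed_le3(2)[of 0] fld_continuous[of UNIV 0]] by (simp add: vimage_def)
  ultimately show ?thesis unfolding S_def by (simp add: compact_Int_closed)
 qed
 have nz: "fld 0 w \<noteq> 0" if w: "norm (w - z) = r0" for w
 proof
  assume f: "fld 0 w = 0"
  have "w \<in> dom3" using ball[of w] w c0(1) by (simp add: dom3_def)
  hence e: "eqm 0 w" using f by (simp add: eqm_def)
  have "w \<noteq> z" using w r0(1) by auto
  hence "Wc z < Wc w" using subeq_above_saddle[OF eqm_subeq[OF e] q(1)] q(2) by simp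
  moreover have "Wc w < Wc z" if "lam w >= 1" using subeq_above_saddle[OF eqm_subeq[OF q(1)] e] that \<open>w \<noteq> z\<close> by simp
  ultimately have l: "lam w < 1" by fastforce
  have "le3 Qp w" by (rule eqm_le_node[OF Qp(1) e _ _ l]) simp_all
  moreover have "le3 w Qp" by (rule eqm_le_Qp[OF e]) simp
  ultimately have "w = Qp" using le3_antisym by blast
  thus False using w r0Q by simp
 qed
 have "\<exists>\<eta>>0. \<forall>w\<in>S. \<forall>e x t. 0 < e --> e < \<eta> --> trap d e x --> hh (x t) > 0 --> zp (x t) \<noteq> w"
 proof (rule compact_uniform[OF cS, where R="%\<eta> w. \<forall>e x t. 0 < e --> e < \<eta> --> trap d e x --> hh (x t) > 0 --> zp (x t) \<noteq> w"])
  fix w assume "w \<in> S"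
  hence w: "norm (w - z) = r0" "le3 0 (fld 0 w)" by (auto simp: S_def)
  have "w \<noteq> z" using w(1) r0(1) by auto
  have "\<exists>\<delta>>0. \<forall>e x t. 0 < e --> e < \<delta> --> trap d e x --> hh (x t) > 0 --> norm (zp (x t) - w) >= \<delta>"
  proof (rule no_leave[of d z \<rho>1 w])
   show "norm (w - z) < \<rho>1" using w(1) r0(3) by simp
   show "inreg w" by (rule binr) (use w(1) in simp)
   show "norm (zp (x t) - z) >= \<rho>1" if "0 < e" "e < \<rho>1" "trap d e x" "hh (x t) = 0" for e x t by (rule sig(2)[OF that])
  qed (rule d q sig(1) \<open>w \<noteq> z\<close> w(2) nz[OF w(1)])+
  then obtain \<delta> where \<delta>: "\<delta> > 0"
    "\<And>e x t. 0 < e ==> e < \<delta> ==> trap d e x ==> hh (x t) > 0 ==> norm (zp (x t) - w) >= \<delta>"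
   by blast
  show "\<exists>\<delta>>0. \<forall>z'\<in>S. dist z' w < \<delta> --> (\<forall>e x t. 0 < e --> e < \<delta> --> trap d e x --> hh (x t) > 0 --> zp (x t) \<noteq> z')"
  proof (intro exI[of _ \<delta>] conjI \<delta>(1) ballI impI allI)
   fix z' e x t assume h: "dist z' w < \<delta>" "0 < e" "e < \<delta>" "trap d e x" "hh (x t) > 0"
   show "zp (x t) \<noteq> z'" using \<delta>(2)[OF h(2-5)] h(1) by (auto simp: dist_norm)
  qed
 qed (rule allI impI | drule spec | drule mp | assumption | erule order_less_le_trans)+
 then obtain \<eta> where \<eta>: "\<eta> > 0" "\<And>e x t. zp (x t) \<in> S ==> 0 < e ==> e < \<eta> ==> trap d e x ==> hh (x t) > 0 ==> False"
  by blast
 have ball1: "-1 <= Pc v & Pc v <= - c0 & c0 <= Nc v & Nc v <= 1" if "norm (v - z) <= r0" for v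
  using ball[OF that] c0(1) by linarith
 obtain K where K: "K > 0" "\<And>Z s. ode (fld 0) Z ==> s >= 0 ==> (\<And>v. 0 <= v ==> v <= s ==> norm (Z v - z) <= r0) ==>
  (\<And>v. 0 <= v ==> v <= s ==> \<not> le3 0 (fld 0 (Z v)) & \<not> le3 (fld 0 (Z v)) 0) ==> norm (Z s - z) <= K * norm (Z 0 - z)"
 proof (rule saddle_decay[OF q(1) c0(1) ball1])
  fix K assume "K > 0" "\<And>Z s. ode (fld 0) Z ==> s >= 0 ==> (\<And>v. 0 <= v ==> v <= s ==> norm (Z v - z) <= r0) ==>
  (\<And>v. 0 <= v ==> v <= s ==> \<not> le3 0 (fld 0 (Z v)) & \<not> le3 (fld 0 (Z v)) 0) ==> norm (Z s - z) <= K * norm (Z 0 - z)"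
  thus thesis by (rule that)
 qed
 define \<delta> where "\<delta> = min (min \<rho>1 \<eta>) (min r0 (r0 / K))"
 have \<delta>: "\<delta> > 0" "\<delta> <= \<rho>1" "\<delta> <= \<eta>" "\<delta> <= r0" "\<delta> <= r0 / K" using sig(1) \<eta>(1) r0(1) K(1) by (auto simp: \<delta>_def)
 show ?thesis
 proof (rule exI[of _ \<delta>], intro conjI \<delta>(1) allI impI)
  fix e x t assume e: "0 < e" "e < \<delta>" and tr: "trap d e x" and h: "hh (x t) > 0"
  show "norm (zp (x t) - z) >= \<delta>"
  proof (rule ccontr)
   assume "\<not> ?thesis"
   hence n0: "norm (zp (x t) - z) < r0" "norm (zp (x t) - z) < r0 / K" using \<delta> by simp_all
   obtain f where f: "f 0 = x t" "ode (fld4 (ta True) (be True) e) f" using flow4_exists by blast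
   define g where "g s = min (HH True (f s)) (r0 - norm (zp (f s) - z))" for s
   have cg: "continuous_on {0..s} g" for s
    unfolding g_def[abs_def] HH_sg by (intro continuous_intros flow4_cont[OF f(2)]) auto
   have g0: "g 0 > 0" using h n0 f(1) by (simp add: g_def HH_def)
   have xf: "x (t + s) = f s" if "0 <= s" "s <= S" "\<And>v. 0 <= v ==> v < S ==> g v > 0" for s S
    using follow[OF trap_gsol[OF tr] f(2) _ _ that(1,2)] f(1) that(3) by (simp add: g_def)
   have "\<exists>s\<ge>0. g s <= 0"
   proof (rule ccontr)
    assume "\<not> ?thesis"
    hence gp: "g s > 0" if "s >= 0" for s using that by force
    \<comment> \<open>Lower bound for \<open>Xi\<close> in the ball: there the northern line is at
      most \<open>1 - c0\<close>, and \<open>bp > b\<close>.\<close>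
    define c where "c = a * (bp - b) * c0 / b"
    have c: "c > 0" using ab bs c0 by (simp add: c_def)
    \<comment> \<open>By this time the slow variable would have grown by 3, more than the length 2
      of its range.\<close>
    define s where "s = 3 / (e * c)"
    have s: "s > 0" using e c by (simp add: s_def)
    have "Xc (f 0) - e * c * 0 <= Xc (f s) - e * c * s"
    proof (rule DERIV_nonneg_imp_increasing_open[OF less_imp_le[OF s], where f="%s. Xc (f s) - e * c * s"])
     fix v assume v: "0 < v" "v < s"
     have gv: "HH True (f v) > 0" "norm (zp (f v) - z) < r0" using gp[of v] v by (auto simp: g_def)
     have "a * (bp - b) * c0 <= a * (bp - b) * (1 - Nc (zp (f v)))"
      using ball[of "zp (f v)"] gv(2) ab bs by (intro mult_left_mono) auto
     moreover have "bp * hh (f v) > 0" using gv(1) bs ab by (simp add: HH_def)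
     ultimately have "a * (bp - b) * c0 <= b * Xi bp (Nc (zp (f v))) (Xc (f v))" unfolding b_Xi by simp
     hence "c <= Xi bp (Nc (zp (f v))) (Xc (f v))" using ab by (simp add: c_def pos_divide_le_eq mult.commute)
     hence "e * c <= e * Xi bp (Nc (zp (f v))) (Xc (f v))" using e by simp
     moreover have "((%s. Xc (f s) - e * c * s) has_real_derivative e * Xi (be True) (Nc (zp (f v))) (Xc (f v)) - e * c * 1) (at v)"
      by (intro DERIV_diff flow4_deriv(1)[OF f(2) v(1)] DERIV_cmult DERIV_ident)
     ultimately show "\<exists>d. ((%s. Xc (f s) - e * c * s) has_real_derivative d) (at v) & 0 <= d"
      by (intro exI conjI) (assumption, simp add: be_def)
    qed (intro continuous_intros flow4_cont(2)[OF f(2)], auto)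
    moreover have "e * c * s = 3" using e c by (simp add: s_def)
    moreover have "x (t + s) = f s" by (rule xf[OF less_imp_le[OF s] order_refl gp])
    ultimately show False
     using phase_bounds[OF trap_phase[OF tr, of t]] phase_bounds[OF trap_phase[OF tr, of "t + s"]] f(1) by (simp add: abs_le_iff)
   qed
   then obtain s0 where s0: "s0 >= 0" "g s0 <= 0" by blast
   obtain s where s: "0 < s" "s <= s0" "g s = 0" "\<And>v. 0 <= v ==> v < s ==> g v > 0"
    by (rule first_zero[OF s0(1) cg g0 s0(2)]) blast
   have xs: "x (t + v) = f v" if "0 <= v" "v <= s" for v by (rule xf[OF that s(4)])
   have gv: "HH True (f v) >= 0" "norm (zp (f v) - z) <= r0" if "0 <= v" "v <= s" for v
    using s(3) s(4)[of v] that by (cases "v = s"; auto simp: g_def min_def split: if_splits)+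
   have sT: "0 <= s" "s <= s" using s(1) by simp_all
   have hs: "HH True (f s) > 0"
   proof (rule ccontr)
    assume "\<not> HH True (f s) > 0"
    hence "hh (x (t + s)) = 0" using gv(1)[OF sT] xs[OF sT] by (simp add: HH_def)
    hence "norm (zp (x (t + s)) - z) >= \<rho>1" using e \<delta>(2) by (intro sig(2)[OF e(1) _ tr]) auto
    thus False using gv(2)[OF sT] xs[OF sT] r0(3) by simp
   qed
   hence rs: "norm (zp (f s) - z) = r0" using s(3) by (auto simp: g_def min_def split: if_splits)
   define Z where "Z v = zp (f v)" for v
   have Z: "ode (fld 0) Z" unfolding Z_def[abs_def] using flow4_zp[OF f(2)] ta by simp
   \<comment> \<open>An upward velocity persists along a monotone flow, so it would still be upward
     when the sphere is reached.\<close>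
   have up: False if v: "0 <= v" "v <= s" "le3 0 (fld 0 (Z v))" for v
   proof -
    have Zv: "ode (fld 0) (%w. Z (v + w))" by (rule ode_shift[OF Z v(1)])
    define y where "y w = Z (v + w)" for w
    have y: "ode (fld 0) y" "le3 0 (fld 0 (y 0))" using Zv v(3) by (simp_all add: y_def[abs_def])
    have "le3 0 (fld 0 (y w))" if w: "w > 0" for w
    proof -
     have mono: "le3 (y w) (y w')" if "w <= w'" for w' by (rule flow_increasing[OF y]) (use w that in auto)
     have mono': "le3 (y w') (y w)" if "0 <= w'" "w' <= w" for w' by (rule flow_increasing[OF y that])
     note dv = vd_comps[OF ode_at[OF y(1) w]]
     have inc: "0 <= D" if D: "(h has_real_derivative D) (at w)" and m: "\<And>w'. w <= w' ==> h w <= h w'" for h :: "real => real" and D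
     proof (rule ccontr)
      assume "\<not> 0 <= D"
      then obtain dd where "dd > 0" "\<forall>hh>0. hh < dd --> h (w + hh) < h w" using DERIV_neg_dec_right[OF D] by auto
      hence "h (w + dd / 2) < h w" by simp
      thus False using m[of "w + dd / 2"] \<open>dd > 0\<close> by simp
     qed
     have "0 <= Wc (fld 0 (y w))" by (rule inc[OF dv(1)]) (use mono in \<open>auto simp: le3_def\<close>)
     moreover have "0 <= - Pc (fld 0 (y w))" by (rule inc[OF DERIV_minus[OF dv(2)]]) (use mono in \<open>auto simp: le3_def\<close>)
     moreover have "0 <= Nc (fld 0 (y w))" by (rule inc[OF dv(3)]) (use mono in \<open>auto simp: le3_def\<close>)
     ultimately show ?thesis by (simp add: le3_def)
    qed
    hence "le3 0 (fld 0 (y (s - v)))" using y(2) v by (cases "v = s") auto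
    hence "Z s \<in> S" using rs by (simp add: S_def Z_def y_def)
    hence "zp (x (t + s)) \<in> S" using xs[OF sT] by (simp add: Z_def)
    moreover have "hh (x (t + s)) > 0" using hs xs[OF sT] by (simp add: HH_def)
    ultimately show False using \<eta>(2)[OF _ e(1) _ tr] e(2) \<delta>(3) by simp
   qed
   have down: False if v: "0 <= v" "v <= s" "le3 (fld 0 (Z v)) 0" for v
   proof -
    have p: "per e x" using tr by (simp add: trap_def)
    have "fld 0 (Z v) = 0" using no_maximum[OF p, of "t + v"] v xs[of v] by (simp add: Z_def)
    thus False using up[OF v(1,2)] by simp
   qed
   have "norm (Z s - z) <= K * norm (Z 0 - z)"
    by (rule K(2)[OF Z sT(1)]) (use gv(2) up down in \<open>auto simp: Z_def\<close>)
   moreover have "K * norm (Z 0 - z) < r0" using n0(2) K(1) f(1) by (simp add: Z_def pos_less_divide_eq mult.commute)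
   ultimately show False using rs by (simp add: Z_def)
  qed
 qed
qed

text \<open>By \<open>slow_times\<close> a trapped solution comes near a state where the fast field
  of some mixture vanishes and \<open>Xi\<close> is nonnegative. Each such limit state is excluded
  locally, and compactness makes the exclusion uniform.\<close>

lemma no_trap:
 assumes d: "\<And>u. d u > 0"
 shows "\<exists>e0>0. \<forall>e x. 0 < e --> e < e0 --> \<not> trap d e x"
proof -
 define K where "K = (dom3 \<inter> {z. \<bar>Wc z\<bar> <= Fb}) \<times> {-1..1::real} \<times> {0..1::real}"
 define FF where "FF p = norm (fld ((1 - snd (snd p)) * dl) (fst p))" for p :: "state3 \<times> real \<times> real"
 define XX where "XX p = Xi ((1 - snd (snd p)) * bm + snd (snd p) * bp) (Nc (fst p)) (fst (snd p))" for p :: "state3 \<times> real \<times> real"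
 define hv where "hv p = hh (mk (fst p) (fst (snd p)))" for p :: "state3 \<times> real \<times> real"
 \<comment> \<open>The mixture parameter is a coordinate of its own, since on the manifold it is not
   determined by the state.\<close>
 define R where "R \<eta> p \<longleftrightarrow> (\<forall>e x t. 0 < e --> e < \<eta> --> trap d e x --> x t = mk (fst p) (fst (snd p)) --> cons (snd (snd p)) (x t) -->
   FF p < \<eta> --> - \<eta> <= XX p --> False)" for \<eta> p
 have cF: "continuous_on UNIV FF"
  unfolding FF_def[abs_def] by (subst fld_tau) (intro continuous_intros continuous_on_compose2[OF fld_continuous[of UNIV]], auto)
 have cX: "continuous_on UNIV XX" unfolding XX_def[abs_def] Xi_def by (intro continuous_intros)
 have ch: "continuous_on UNIV hv" unfolding hv_def[abs_def] hh_alt zp_mk Xc_mk by (intro continuous_intros)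
 have near: "\<exists>\<delta>>0. \<forall>p'. dist p' p < \<delta> --> \<bar>f p' - f p\<bar> < m" if "continuous_on UNIV f" "m > 0" for f :: "state3 \<times> real \<times> real => real" and m p
  using that unfolding continuous_on_iff dist_real_def by blast
 have dz: "norm (fst p' - fst p) <= dist p' p" "\<bar>snd (snd p') - snd (snd p)\<bar> <= dist p' p" for p p' :: "state3 \<times> real \<times> real"
  using dist_fst_le[of p' p] order_trans[OF dist_snd_le[of "snd p'" "snd p"] dist_snd_le[of p' p]] by (simp_all add: dist_norm)
 have "\<exists>\<eta>>0. \<forall>p\<in>K. R \<eta> p"
 proof (rule compact_uniform)
  show "compact K" unfolding K_def by (intro compact_Times compact_dom3_slab compact_Icc)
  show "R \<eta>' p" if "R \<eta> p" "\<eta>' <= \<eta>" for \<eta> \<eta>' p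
   unfolding R_def
  proof (intro allI impI)
   fix e x t assume "0 < e" "e < \<eta>'" "trap d e x" "x t = mk (fst p) (fst (snd p))" "cons (snd (snd p)) (x t)" "FF p < \<eta>'" "- \<eta>' <= XX p"
   thus False using that(1)[unfolded R_def, rule_format, of e x t] that(2) by simp
  qed
  fix p assume "p \<in> K"
  obtain z \<xi> s where p: "p = (z, \<xi>, s)" by (cases p) auto
  have zs: "z \<in> dom3" "0 <= s" "s <= 1" using \<open>p \<in> K\<close> by (auto simp: K_def p)
  consider "FF p > 0" | "XX p < 0" | "FF p = 0" "XX p >= 0" using norm_ge_zero unfolding FF_def by fastforce
  thus "\<exists>\<delta>>0. \<forall>p'\<in>K. dist p' p < \<delta> --> R \<delta> p'"
  proof cases
   case 1
   then obtain \<delta> where \<delta>: "\<delta> > 0" "\<And>p'. dist p' p < \<delta> ==> \<bar>FF p' - FF p\<bar> < FF p / 2" using near[OF cF, of "FF p / 2" p] by auto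
   show ?thesis
   proof (intro exI[of _ "min \<delta> (FF p / 2)"] conjI ballI impI)
    show "min \<delta> (FF p / 2) > 0" using \<delta> 1 by simp
    fix p' assume "dist p' p < min \<delta> (FF p / 2)"
    hence "\<bar>FF p' - FF p\<bar> < FF p / 2" using \<delta>(2)[of p'] by simp
    from le_less_trans[OF abs_ge_minus_self this] have "FF p / 2 <= FF p'" by (simp add: field_simps)
    hence "FF p' >= min \<delta> (FF p / 2)" by (rule order_trans[OF min.cobounded2])
    from leD[OF this] show "R (min \<delta> (FF p / 2)) p'" unfolding R_def by blast
   qed
  next
   case 2
   then obtain \<delta> where \<delta>: "\<delta> > 0" "\<And>p'. dist p' p < \<delta> ==> \<bar>XX p' - XX p\<bar> < - XX p / 2" using near[OF cX, of "- XX p / 2" p] by auto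
   show ?thesis
   proof (intro exI[of _ "min \<delta> (- XX p / 2)"] conjI ballI impI)
    show "min \<delta> (- XX p / 2) > 0" using \<delta> 2 by simp
    fix p' assume "dist p' p < min \<delta> (- XX p / 2)"
    hence "\<bar>XX p' - XX p\<bar> < - XX p / 2" using \<delta>(2)[of p'] by simp
    from le_less_trans[OF abs_ge_self this] have "XX p' < XX p / 2" by (simp add: field_simps)
    moreover have "XX p / 2 <= - min \<delta> (- XX p / 2)" using min.cobounded2[of \<delta> "- XX p / 2"] by (simp add: field_simps)
    ultimately have "\<not> - min \<delta> (- XX p / 2) <= XX p'" by linarith
    thus "R (min \<delta> (- XX p / 2)) p'" unfolding R_def by blast
   qed
  next
   case 3
   define \<tau> where "\<tau> = (1 - s) * dl"
   have \<tau>: "0 <= \<tau>" "s > 0 ==> \<tau> < dl" using zs dl by (simp_all add: \<tau>_def)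
   have ez: "eqm \<tau> z" using 3(1) zs(1) by (simp add: FF_def p eqm_def \<tau>_def)
   have "le3 z Qp" by (rule eqm_le_Qp[OF ez \<tau>(1)])
   hence n1: "Nc z < 1" using Qp(4) by (simp add: le3_def)
   show ?thesis
   proof (cases "s = 0")
    case True
    have "b * XX p = bm * hv p + a * (bm - b) * (1 - Nc z)"
     using b_Xi[of bm "mk z \<xi>"] True by (simp add: XX_def hv_def p)
    moreover have "b * XX p >= 0" using 3(2) ab by simp
    moreover have "a * (bm - b) * (1 - Nc z) < 0" using ab bs n1 by (simp add: mult_pos_neg mult_neg_pos)
    ultimately have "bm * hv p > 0" by linarith
    hence hp: "hv p > 0" using bs by (simp add: zero_less_mult_iff)
    then obtain \<delta> where \<delta>: "\<delta> > 0" "\<And>p'. dist p' p < \<delta> ==> \<bar>hv p' - hv p\<bar> < hv p" using near[OF ch hp, of p] by auto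
    show ?thesis
    proof (intro exI[of _ "min \<delta> 1"] conjI ballI impI)
     show "min \<delta> 1 > 0" using \<delta> by simp
     fix p' assume n: "dist p' p < min \<delta> 1"
     have "hv p' > 0" using \<delta>(2)[of p'] n by (auto simp: abs_less_iff)
     moreover have "snd (snd p') < 1" using dz(2)[of p' p] n True by (simp add: p abs_le_iff)
     ultimately show "R (min \<delta> 1) p'" unfolding R_def cons_def hv_def by auto
    qed
   next
    case False
    hence s0: "s > 0" using zs by simp
    obtain \<delta>1 where \<delta>1: "\<delta>1 > 0" "\<And>e x t. 0 < e ==> e < \<delta>1 ==> trap d e x ==> hh (x t) = 0 ==> norm (zp (x t) - z) >= \<delta>1"
     by (rule no_sigma_near[where d=d, OF d ez \<tau>(1) \<tau>(2)[OF s0]]) (rule that)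
    have "\<exists>\<delta>>0. s = 1 --> (\<forall>e x t. 0 < e --> e < \<delta> --> trap d e x --> hh (x t) > 0 --> norm (zp (x t) - z) >= \<delta>)"
    proof (cases "s = 1")
     case True
     hence e0: "eqm 0 z" using ez by (simp add: \<tau>_def)
     show ?thesis
     proof (cases "lam z < 1")
      case l: True
      have "le3 Qp z" by (rule eqm_le_node[OF Qp(1) e0 _ _ l]) simp_all
      hence "z = Qp" using \<open>le3 z Qp\<close> le3_antisym by blast
      thus ?thesis using no_node_near[of d] d by auto
     next
      case False
      thus ?thesis using no_saddle_near[where d=d, OF d e0] by auto
     qed
    next
     case False
     thus ?thesis by (intro exI[of _ 1]) simp
    qed
    then obtain \<delta>2 where \<delta>2: "\<delta>2 > 0" "\<And>e x t. s = 1 ==> 0 < e ==> e < \<delta>2 ==> trap d e x ==> hh (x t) > 0 ==> norm (zp (x t) - z) >= \<delta>2"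
     by blast
    \<comment> \<open>Keeps nearby mixture parameters away from 0 and, unless \<open>s = 1\<close>,
      away from 1. By \<open>cons\<close> only the manifold remains, or the region
      \<open>h > 0\<close> when \<open>s = 1\<close>.\<close>
    define m where "m = (if s = 1 then s else min s (1 - s))"
    have m: "m > 0" "m <= s" "s = 1 \<or> m <= 1 - s" using s0 zs by (auto simp: m_def)
    define \<delta> where "\<delta> = min (min \<delta>1 \<delta>2) m"
    have \<delta>: "\<delta> > 0" "\<delta> <= \<delta>1" "\<delta> <= \<delta>2" "\<delta> <= m" using \<delta>1(1) \<delta>2(1) m(1) by (auto simp: \<delta>_def)
    show ?thesis
    proof (intro exI[of _ \<delta>] conjI ballI impI \<delta>(1))
     fix p' assume n: "dist p' p < \<delta>"
     show "R \<delta> p'" unfolding R_def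
     proof (intro allI impI)
      fix e x t assume e: "0 < e" "e < \<delta>" and tr: "trap d e x" and x: "x t = mk (fst p') (fst (snd p'))" and c: "cons (snd (snd p')) (x t)"
      have nz: "norm (zp (x t) - z) < \<delta>" using dz(1)[of p' p] n x by (simp add: p)
      have ns: "\<bar>snd (snd p') - s\<bar> < \<delta>" using dz(2)[of p' p] n by (simp add: p)
      have "hh (x t) \<noteq> 0" using \<delta>1(2)[OF e(1) _ tr, of t] e(2) \<delta>(2) nz by auto
      moreover have "\<not> hh (x t) < 0" using c ns m \<delta>(4) by (auto simp: cons_def abs_less_iff)
      moreover have "\<not> hh (x t) > 0"
      proof
       assume h: "hh (x t) > 0"
       hence "snd (snd p') = 1" using c by (simp add: cons_def)
       hence "s = 1" using ns m(3) \<delta>(4) by (auto simp: abs_less_iff)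
       thus False using \<delta>2(2)[OF _ e(1) _ tr h] e(2) \<delta>(3) nz by auto
      qed
      ultimately show False by linarith
     qed
    qed
   qed
  qed
 qed
 then obtain \<eta> where \<eta>: "\<eta> > 0" "\<And>p. p \<in> K ==> R \<eta> p" by blast
 obtain e0 where e0: "e0 > 0" "\<And>e x. 0 < e ==> e < e0 ==> per e x ==> \<exists>t s. cons s (x t) &
  norm (fld ((1 - s) * dl) (zp (x t))) < \<eta> & - \<eta> <= Xi ((1 - s) * bm + s * bp) (Nc (zp (x t))) (Xc (x t))"
  using slow_times[OF \<eta>(1)] by blast
 show ?thesis
 proof (rule exI[of _ "min e0 \<eta>"], intro conjI allI impI notI)
  show "min e0 \<eta> > 0" using e0 \<eta> by simp
  fix e x assume e: "0 < e" "e < min e0 \<eta>" and tr: "trap d e x"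
  have p: "per e x" using tr by (simp add: trap_def)
  have el: "e < e0" "e < \<eta>" using e(2) by simp_all
  obtain t s where ts: "cons s (x t)" "norm (fld ((1 - s) * dl) (zp (x t))) < \<eta>"
    "- \<eta> <= Xi ((1 - s) * bm + s * bp) (Nc (zp (x t))) (Xc (x t))"
   using e0(2)[OF e(1) el(1) p] by blast
  have "(zp (x t), Xc (x t), s) \<in> K"
   using phase_bounds[OF trap_phase[OF tr, of t]] per_W[OF p, of t] ts(1) by (auto simp: K_def cons_def abs_le_iff)
  hence "R \<eta> (zp (x t), Xc (x t), s)" by (rule \<eta>(2))
  from this[unfolded R_def, rule_format, OF e(1) el(2) tr, of t] show False using ts by (simp add: FF_def XX_def)
 qed
qed

lemma unique_cycle: "\<forall>\<^sub>F e in at_right 0. \<exists>!G. attracting_limit_cycle (incl e) phase_space G"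
proof -
 obtain dd cc CC where dd: "dd > 0" and ev: "\<forall>\<^sub>F e in at_right 0. climate_cycle B r \<kappa> k q F0 G0 a b bm bp dl Qp Qm e dd cc CC"
  by (rule cycle_params) (rule that)
 define d where "d u = min (R1 u) (dd / VM u)" for u
 have "d u > 0" for u using R1[of u] dd VM[of u] by (simp add: d_def)
 from no_trap[of d, OF this] obtain e0 where e0: "e0 > 0" "\<And>e x. 0 < e ==> e < e0 ==> \<not> trap d e x" by blast
 have "\<forall>\<^sub>F e in at_right 0. 0 < e & e < e0" using eventually_at_right_real[OF e0(1)] by simp
 thus ?thesis using ev
 proof eventually_elim
  case (elim e)
  interpret climate_cycle B r \<kappa> k q F0 G0 a b bm bp dl Qp Qm e dd cc CC by (rule elim(2))
  have "G = Gam" if "attracting_limit_cycle (incl e) phase_space G" for G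
  proof (rule ccontr)
   assume "G \<noteq> Gam"
   from trap_if_other[OF that this] show False using e0(2) elim(1) unfolding d_def[abs_def] by blast
  qed
  thus ?case using Gam_attracting by blast
 qed
qed

end

section \<open>The model\<close>

lemma attracting_limit_cycle_cong:
 assumes eq: "\<And>v. v \<in> D ==> X v = Y v"
 shows "attracting_limit_cycle X D G \<longleftrightarrow> attracting_limit_cycle Y D G"
proof -
 have "filippov_solution X D J x \<longleftrightarrow> filippov_solution Y D J x" for J x
  unfolding filippov_solution_def using eq by (auto elim!: eventually_mono)
 thus ?thesis unfolding attracting_limit_cycle_def attracts_def by simp
qed

context climate begin

definition Lin :: "state3 => state3 => state3" where
 "Lin z v = (B * (\<kappa> * (sd (Nc z) * Nc v - sd (Pc z) * Pc v) - Wc v), - r * (Wc v - 2 * k * Pc z * Pc v), r * (Wc v - 2 * k * Nc z * Nc v))"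

text \<open>The physical field and \<open>fld\<close> need to agree on \<open>dom3\<close> only;
  \<open>z\<close> has an open neighbourhood inside it, which is all that the derivative
  sees.\<close>

lemma Lin_deriv:
 assumes z: "-1 < Pc z" "Pc z < Nc z" "Nc z < 1" and Y: "\<And>v. v \<in> dom3 ==> Y v = fld \<tau> v"
 shows "frechet_derivative Y (at z) = Lin z"
proof -
 define U where "U = {v :: state3. -1 < Pc v & Pc v < Nc v & Nc v < 1}"
 have U: "open U" unfolding U_def
  by (intro open_Collect_conj open_Collect_less continuous_intros)
 have Ph: "((%v. Phi (f v)) has_derivative (%h. sd (f z) * f' h)) (at z)" if "(f has_derivative f') (at z)" for f :: "state3 => real" and f'
  using has_derivative_compose[OF that Phi_deriv[unfolded has_field_derivative_def]] by simp
 have d: "((%z. (B * (F0 + \<kappa> * (Phi (Nc z) - Phi (Pc z)) - Wc z), - r * (Wc z - (G0 + k * (Pc z)\<^sup>2)), r * (Wc z - (G0 + k * (Nc z)\<^sup>2) - \<tau>)))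
   has_derivative Lin z) (at z)"
  unfolding Lin_def by ((rule Ph derivative_eq_intros refl | simp)+, simp add: mult_ac)
 have Yv: "Y v = (B * (F0 + \<kappa> * (Phi (Nc v) - Phi (Pc v)) - Wc v), - r * (Wc v - (G0 + k * (Pc v)\<^sup>2)), r * (Wc v - (G0 + k * (Nc v)\<^sup>2) - \<tau>))" if "v \<in> U" for v
 proof -
  have "v \<in> dom3" using that by (simp add: U_def dom3_def)
  thus ?thesis using Y fld_dom by simp
 qed
 have "z \<in> U" using z by (simp add: U_def)
 have "(Y has_derivative Lin z) (at z)"
  by (rule has_derivative_transform_within_open[OF d U \<open>z \<in> U\<close>]) (rule Yv[symmetric])
 thus ?thesis by (rule frechet_derivative_at[symmetric])
qed

text \<open>For \<open>lam z >= 1\<close> the characteristic polynomial has a nonnegative root, by the intermediate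
 value theorem.\<close>

lemma stable_node_lam:
 assumes e: "eqm \<tau> z" "\<tau> >= 0" and z: "-1 < Pc z" "Nc z < 1" and Y: "\<And>v. v \<in> dom3 ==> Y v = fld \<tau> v"
  and s: "stable_node Y z"
 shows "lam z < 1"
proof (rule ccontr)
 assume "\<not> lam z < 1"
 hence l: "lam z >= 1" by simp
 have sg: "Pc z < 0" "0 < Nc z" using eqm_signs[OF e] .
 define m where "m = 2 * r * k * - Pc z"
 define n where "n = 2 * r * k * Nc z"
 have mn: "m > 0" "n > 0" using sg r k by (simp_all add: m_def n_def mult_pos_neg)
 define cm where "cm = \<kappa> * r * sd (Pc z)"
 define cn where "cn = \<kappa> * r * sd (Nc z)"
 have c: "cm > 0" "cn > 0" using sd_pos[of "Pc z"] sd_pos[of "Nc z"] sg z \<kappa> r by (simp_all add: cm_def cn_def)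
 \<comment> \<open>The eigenvalue equation after elimination of the ice line components. It is
   nonnegative at 0, where its value is \<open>lam z - 1\<close>, and nonpositive at
   \<open>B * lam z\<close>.\<close>
 define f where "f x = cm / (x + m) + cn / (x + n) - 1 - x / B" for x
 have lm: "lam z = cm / m + cn / n"
  using r k sg by (simp add: lam_def cm_def cn_def m_def n_def field_simps)
 have "\<exists>x\<ge>0. x <= B * lam z & f x = 0"
 proof (rule IVT2)
  have B0: "B * lam z >= 0" using B l by simp
  have "cm / (B * lam z + m) <= cm / m" "cn / (B * lam z + n) <= cn / n"
   using c mn B0 by (auto intro!: divide_left_mono)
  hence "f (B * lam z) <= lam z - 1 - B * lam z / B" unfolding f_def lm by linarith
  thus "f (B * lam z) <= 0" using B by simp
  show "0 <= f 0" using l by (simp add: f_def lm)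
  show "0 <= B * lam z" by (rule B0)
  show "\<forall>x. 0 <= x & x <= B * lam z --> isCont f x"
   unfolding f_def using mn B by (auto intro!: continuous_intros)
 qed
 then obtain x where x: "x >= 0" "f x = 0" by blast
 have xm: "x + m \<noteq> 0" "x + n \<noteq> 0" using x mn by auto
 \<comment> \<open>The eigenvector for the root \<open>x\<close>: the ice line rows determine the
   last two components from the first.\<close>
 define v :: state3 where "v = (1, - r / (x + m), r / (x + n))"
 have "Lin z v = x *\<^sub>R v"
 proof -
  have "\<kappa> * (sd (Nc z) * (r / (x + n)) - sd (Pc z) * (- r / (x + m))) = cm / (x + m) + cn / (x + n)"
   by (simp add: cm_def cn_def algebra_simps)
  also have "... = 1 + x / B" using x(2) by (simp add: f_def)
  finally have 1: "B * (\<kappa> * (sd (Nc z) * (r / (x + n)) - sd (Pc z) * (- r / (x + m))) - 1) = x" using B by simp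
  have 2: "- r * (1 - 2 * k * Pc z * (- r / (x + m))) = x * (- r / (x + m))"
   using xm by (simp add: m_def field_simps)
  have 3: "r * (1 - 2 * k * Nc z * (r / (x + n))) = x * (r / (x + n))"
   using xm by (simp add: n_def field_simps)
  show ?thesis unfolding Lin_def v_def using 1 2 3 by simp
 qed
 moreover have "Lin z 0 = 0" by (simp add: Lin_def zero_prod_def)
 ultimately have "complex_eigenvalue (Lin z) (complex_of_real x)"
  unfolding complex_eigenvalue_def by (intro exI[of _ v] exI[of _ 0]) (simp add: v_def zero_prod_def)
 moreover have "frechet_derivative Y (at z) = Lin z" by (rule Lin_deriv[OF z(1) _ z(2) Y]) (use sg in auto)
 ultimately have "Re (complex_of_real x) < 0" using s unfolding stable_node_def by auto
 thus False using x(1) by simp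
qed

lemma mix_affine: "(1 - s) *\<^sub>R fld4 dl bm e v + s *\<^sub>R fld4 0 bp e v = mix s e v"
 unfolding mix_def fld4_def mk_scaleR mk_add mk_eq_iff
 by (subst fld_tau, subst (3) fld_tau) (simp add: Xi_def prod_eq_iff algebra_simps)

end

section \<open>The physical parameters\<close>

definition par_q :: real where "par_q = - par_s2"
definition par_k :: real where "par_k = 3 / 2 * par_L * (1 - alpha0) * par_q"
definition par_kappa :: real where "par_kappa = par_C * par_L * (alpha2 - alpha1) / (2 * par_B)"
definition par_F0 :: real where "par_F0 = (par_Q * (1 - alpha0) - par_A) / par_B - par_kappa"
definition par_G0 :: real where "par_G0 = -10 - par_k / 3"

text \<open>Doubling the angle turns 23.5 into 47 degrees, whose cosine lies between those of 60 and
  45 degrees.\<close>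

lemma par_q_bounds: "39/100 <= par_q" "par_q <= 49/100"
proof -
 define c where "c = cos obliquity"
 have "cos (47 * pi / 180) <= cos (pi / 4)" "cos (pi / 3) <= cos (47 * pi / 180)"
  by (rule cos_monotone_0_pi_le; simp)+
 moreover have "cos (47 * pi / 180) = 2 * c\<^sup>2 - 1"
  using cos_double_cos[of obliquity] by (simp add: obliquity_def c_def)
 ultimately have b: "1 / 2 <= 2 * c\<^sup>2 - 1" "2 * c\<^sup>2 - 1 <= sqrt 2 / 2" by (simp_all add: cos_45 cos_60)
 have "sqrt 2 <= 1415 / 1000" by (rule real_le_lsqrt) (simp_all add: power2_eq_square)
 thus "39/100 <= par_q" "par_q <= 49/100"
  using b by (simp_all add: par_q_def par_s2_def legendre2_def c_def[symmetric])
qed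

text \<open>Only \<open>disc\<close> needs numbers, and its two sides are far enough apart for the
  crude bounds on \<open>par_q\<close>.\<close>

lemma climate_model:
 assumes "T_cN_plus < Tm" "0 < bm" "bm < par_b" "par_b < bp"
 shows "climate par_B par_rho par_kappa par_k par_q par_F0 par_G0 par_a par_b bm bp (Tm - T_cN_plus)"
proof
 have kap: "par_kappa <= 16.67" "par_kappa > 0"
  by (simp_all add: par_kappa_def par_C_def par_L_def par_Q_def par_B_def alpha1_def alpha2_def)
 show "par_B > 0" "par_rho > 0" "0 < par_a" "par_a < par_b" by (simp_all add: par_B_def par_rho_def par_a_def par_b_def)
 show "0 < par_q" "par_q < 1" using par_q_bounds by simp_all
 show "par_kappa > 0" by (rule kap)
 define K where "K = 3 / 2 * par_L * (1 - alpha0)"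
 have K: "55.1 <= K" "K <= 55.3" by (simp_all add: K_def par_L_def par_Q_def par_B_def par_C_def alpha0_def alpha1_def alpha2_def)
 have pk: "par_k = K * par_q" by (simp add: par_k_def K_def)
 have k1: "55.1 * 0.39 <= par_k" unfolding pk by (intro mult_mono) (use K par_q_bounds in auto)
 have k2: "par_k <= 55.3 * 0.49" unfolding pk by (intro mult_mono) (use K par_q_bounds in auto)
 show "par_k > 0" using k1 by simp
 have f0: "par_F0 <= -27.29"
  by (simp add: par_F0_def par_kappa_def par_Q_def par_A_def par_B_def par_C_def par_L_def alpha0_def alpha1_def alpha2_def)
 have gf: "par_G0 - par_F0 >= 8.25" using k2 f0 by (simp add: par_G0_def)
 have "par_kappa * (1 + par_q / 2) <= 16.67 * (1 + 0.49 / 2)" using kap par_q_bounds by (intro mult_mono) auto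
 hence "(par_kappa * (1 + par_q / 2))\<^sup>2 <= (16.67 * (1 + 0.49 / 2))\<^sup>2" using kap par_q_bounds by (intro power_mono) auto
 also have "... < 4 * (55.1 * 0.39) * 8.25" by (simp add: power2_eq_square)
 also have "... <= 4 * par_k * (par_G0 - par_F0)" using k1 gf by (intro mult_mono) auto
 finally show "(par_kappa * (1 + par_q / 2))\<^sup>2 < 4 * par_k * (par_G0 - par_F0)" .
qed (use assms in auto)

theorem theorem5p3:
  fixes Tm bm bp :: real and Qp Qm :: state3
  assumes Tm: "T_cN_plus < Tm"
    and b: "0 < bm" "bm < par_b" "par_b < bp"
    and Qp: "Qp \<in> space3" "stable_node (Y_field T_cN_plus) Qp"
    and Qm: "Qm \<in> interior space3" "stable_node (Y_field Tm) Qm"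
      "continues_equilibrium T_cN_plus Tm Qp Qm"
    and saddle_minus: "\<exists>q \<in> interior space3. saddle (Y_field Tm) q"
    and i: "\<And>\<epsilon>. \<epsilon> > 0 \<Longrightarrow>
        P_point bm Qm \<in> stable_set (X_field T_cN_plus bp \<epsilon>) phase_space (P_point bp Qp) \<and>
        P_point bp Qp \<in> stable_set (X_field Tm bm \<epsilon>) phase_space (P_point bm Qm)"
    and ii: "\<And>\<epsilon>. \<epsilon> > 0 \<Longrightarrow>
        {R_point Qp, R_point Qm} \<subseteq>
          stable_set (X_field Tm bm \<epsilon>) phase_space (P_point bm Qm) \<inter>
          stable_set (X_field T_cN_plus bp \<epsilon>) phase_space (P_point bp Qp)"
  shows "\<forall>\<^sub>F \<epsilon> in at_right 0. \<exists>!\<Gamma>.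
           attracting_limit_cycle (X_incl Tm bm bp \<epsilon>) phase_space \<Gamma>"
proof -
 interpret climate par_B par_rho par_kappa par_k par_q par_F0 par_G0 par_a par_b bm bp "Tm - T_cN_plus"
  by (rule climate_model[OF Tm b])
 have insol: "insol y = sd y" for y
  unfolding sd_def by (simp add: insol_def par_s0_def par_q_def legendre2_def field_simps)
 have int: "integral {p..n} insol = Phi n - Phi p" if "p <= n" for p n
 proof (rule integral_unique, rule fundamental_theorem_of_calculus[OF that])
  show "(Phi has_vector_derivative insol y) (at y within {p..n})" for y
   using Phi_deriv[of y] by (simp add: insol has_real_derivative_iff_has_vector_derivative)
 qed
 have F: "F_eq p n = par_F0 + par_kappa * (Phi n - Phi p)" if "p <= n" for p n
  unfolding F_eq_def int[OF that] by (simp add: par_s0_def par_F0_def par_kappa_def par_B_def field_simps)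
 have GH: "G_eq y = par_G0 + par_k * y\<^sup>2" "H_eq T y = par_G0 + par_k * y\<^sup>2 + (T - T_cN_plus)" for T y
  by (simp_all add: G_eq_def H_eq_def insol sd_def par_G0_def par_k_def T_cS_def T_cN_plus_def field_simps)
 have Y: "Y_field T v = fld (T - T_cN_plus) v" if v: "v \<in> dom3" for T v
 proof -
  have "Pc v <= Nc v" using v by (simp add: dom3_def)
  thus ?thesis unfolding fld_dom[OF v] by (cases v) (simp add: Y_field_def F GH par_R_def algebra_simps)
 qed
 have X: "X_field T bb e v = fld4 (T - T_cN_plus) bb e v" if v: "v \<in> phase_space" for T bb e v
 proof -
  have "zp v \<in> dom3" using v by (auto simp: phase_iff dom3_def)
  hence "X_field T bb e v = mk (Y_field T (zp v)) (e * Xi bb (Nc (zp v)) (Xc v))"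
   by (cases v) (simp add: X_field_def Y_field_def mk_def zp_def Xc_def Xi_def)
  thus ?thesis using Y[OF \<open>zp v \<in> dom3\<close>] by (simp add: fld4_def)
 qed
 have sw: "switch_h v = hh v" for v by (cases v) (simp add: switch_h_def hh_def zp_def Xc_def)
 have incl_eq: "X_incl Tm bm bp e v = incl e v" if v: "v \<in> phase_space" for e v
 proof -
  have v4: "v \<in> space4" using v by (auto simp: phase_space_def)
  have m: "(1 - p) *\<^sub>R X_field Tm bm e v + p *\<^sub>R X_field T_cN_plus bp e v = mix p e v" for p
   using mix_affine[of p e v] X[OF v] by simp
  have m0: "X_field Tm bm e v = mix 0 e v" "X_field T_cN_plus bp e v = mix 1 e v" using m[of 0] m[of 1] by simp_all
  consider "hh v < 0" | "hh v = 0" | "hh v > 0" by linarith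
  thus ?thesis
  proof cases
   case 2 thus ?thesis by (simp add: X_incl_def S_minus_def Sigma_sw_def v4 sw incl_def m)
  qed (auto simp: X_incl_def S_minus_def S_plus_def Sigma_sw_def v4 sw incl_def m0)
 qed
 have sp: "space3 = dom3" by (auto simp: space3_def dom3_def)
 have P0: "v \<in> phase_space" if "v \<in> stable_set f phase_space w" for v w and f :: "state4 => state4"
  using that unfolding stable_set_def by force
 have inner: "-1 < Pc z & Nc z < 1" if "P_point c z \<in> phase_space" for c z
  using that by (cases z) (auto simp: P_point_def phase_space_def)
 \<comment> \<open>Membership in a stable set, read at time 0 and for one value of the small
   parameter, puts both nodes into the phase space, hence off the boundary of the domain.\<close>
 have in0: "-1 < Pc Qm & Nc Qm < 1" "-1 < Pc Qp & Nc Qp < 1"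
  using i[OF zero_less_one] P0 inner by blast+
 have dm: "Qp \<in> dom3" "Qm \<in> dom3" using Qp(1) Qm(1) interior_subset sp by auto
 have ep: "eqm 0 Qp" using Qp(2) Y[OF dm(1), of T_cN_plus] dm by (simp add: eqm_def stable_node_def)
 have em: "eqm (Tm - T_cN_plus) Qm" using Qm(2) Y[OF dm(2), of Tm] dm by (simp add: eqm_def stable_node_def)
 have "lam Qp < 1"
  by (rule stable_node_lam[OF ep _ _ _ _ Qp(2)]) (use in0 Y[of _ T_cN_plus] in auto)
 moreover have "lam Qm < 1"
  by (rule stable_node_lam[OF em _ _ _ _ Qm(2)]) (use in0 Tm Y[of _ Tm] in auto)
 ultimately interpret climate_nodes par_B par_rho par_kappa par_k par_q par_F0 par_G0 par_a par_b bm bp "Tm - T_cN_plus" Qp Qm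
  using ep em in0 by unfold_locales auto
 show ?thesis
  using unique_cycle by (simp add: attracting_limit_cycle_cong[OF incl_eq])
qed

end
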